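(* Let $M\in\{1,2\}$ and let $F:\mathbb R^2\to\mathbb R^2$, $G=(G_1,\dots,G_M):\mathbb R^2\to\mathbb M_{2\times M}$ satisfy: (1) $F,G$ are of class $\mathcal C^{1,1}$ with all partial derivatives Lipschitz with constant $L$; (2) $F(0)=0$; (3) $\mathrm{rank}[G_i(0),DF(0)G_i(0)]=2$ for $i=1,\dots,M$; (4) $DG(0)=0$. Let $T$ be the minimum time function to reach the origin for $\dot x=F(x)+G(x)u$, $u\in[-1,1]^M$. Then there exists $\mathcal T>0$ depending only on $G(0)$, $DF(0)$ and $L$ such that $T\in SBV_{\mathrm{loc}}(\mathrm{int}(\mathcal R_{\mathcal T}))$.
   Context: $\mathcal R_t=\{x: T(x)\le t\}$. $SBV_{\mathrm{loc}}(\Omega)$ denotes the functions of locally bounded variation on $\Omega$ whose distributional derivative has vanishing Cantor part. *)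

theory Defs
  imports "HOL-Analysis.Analysis"
begin

definition admissible_control :: "(real \<Rightarrow> real^'m) \<Rightarrow> bool" where
  "admissible_control u \<longleftrightarrow>
     u \<in> borel_measurable lebesgue \<and> (\<forall>s. \<forall>k. u s $ k \<in> {-1..1})"

definition steers_to_origin ::
  "(real^2 \<Rightarrow> real^2) \<Rightarrow> (real^2 \<Rightarrow> real^'m^2) \<Rightarrow> real^2 \<Rightarrow> real \<Rightarrow> bool" where
  "steers_to_origin F G x0 t \<longleftrightarrow> 0 \<le> t \<and>
     (\<exists>(u :: real \<Rightarrow> real^'m) (y :: real \<Rightarrow> real^2).
        admissible_control u \<and> continuous_on {0..t} y \<and> y 0 = x0 \<and> y t = 0 \<and>
        (\<forall>s\<in>{0..t}. ((\<lambda>\<tau>. F (y \<tau>) + G (y \<tau>) *v u \<tau>) has_integral (y s - x0)) {0..s}))"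

text \<open>Minimum time function (value \<infinity> if the origin cannot be reached).\<close>
definition min_time ::
  "(real^2 \<Rightarrow> real^2) \<Rightarrow> (real^2 \<Rightarrow> real^'m^2) \<Rightarrow> real^2 \<Rightarrow> ereal" where
  "min_time F G x0 = Inf {ereal t | t. steers_to_origin F G x0 t}"

definition reach_set ::
  "(real^2 \<Rightarrow> real^2) \<Rightarrow> (real^2 \<Rightarrow> real^'m^2) \<Rightarrow> real \<Rightarrow> (real^2) set" where
  "reach_set F G t = {x. min_time F G x \<le> ereal t}"

definition test_C1 :: "'a::euclidean_space set \<Rightarrow> ('a \<Rightarrow> real) \<Rightarrow> bool" where
  "test_C1 U \<phi> \<longleftrightarrow>
     (\<exists>\<phi>'. (\<forall>x. (\<phi> has_derivative \<phi>' x) (at x)) \<and>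
           (\<forall>i\<in>Basis. continuous_on UNIV (\<lambda>x. \<phi>' x i))) \<and>
     compact (closure {x. \<phi> x \<noteq> 0}) \<and> closure {x. \<phi> x \<noteq> 0} \<subseteq> U"

text \<open>A finite signed Borel measure on the ambient space, concentrated on U,
  represented as a difference P - N of two finite Borel measures.\<close>
definition finite_signed_on :: "'a::euclidean_space set \<Rightarrow> 'a measure \<Rightarrow> 'a measure \<Rightarrow> bool" where
  "finite_signed_on U P N \<longleftrightarrow>
     sets P = sets borel \<and> sets N = sets borel \<and> finite_measure P \<and> finite_measure N \<and>
     emeasure P (- U) = 0 \<and> emeasure N (- U) = 0"

definition is_distr_gradient ::
  "'a::euclidean_space set \<Rightarrow> ('a \<Rightarrow> real) \<Rightarrow> ('a \<Rightarrow> 'a measure) \<Rightarrow> ('a \<Rightarrow> 'a measure) \<Rightarrow> bool" where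
  "is_distr_gradient U u P N \<longleftrightarrow>
     (\<forall>i\<in>Basis. finite_signed_on U (P i) (N i)) \<and>
     (\<forall>\<phi>. test_C1 U \<phi> \<longrightarrow> (\<forall>i\<in>Basis.
        (\<integral>x. indicator U x * u x * frechet_derivative \<phi> (at x) i \<partial>lebesgue)
          = - ((\<integral>x. \<phi> x \<partial>(P i)) - (\<integral>x. \<phi> x \<partial>(N i)))))"

definition BV_on :: "'a::euclidean_space set \<Rightarrow> ('a \<Rightarrow> real) \<Rightarrow> bool" where
  "BV_on U u \<longleftrightarrow> open U \<and> set_integrable lebesgue U u \<and> (\<exists>P N. is_distr_gradient U u P N)"

definition half_ball_plus :: "'a::euclidean_space \<Rightarrow> real \<Rightarrow> 'a \<Rightarrow> 'a set" where
  "half_ball_plus x r \<nu> = {y \<in> ball x r. (y - x) \<bullet> \<nu> > 0}"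

definition half_ball_minus :: "'a::euclidean_space \<Rightarrow> real \<Rightarrow> 'a \<Rightarrow> 'a set" where
  "half_ball_minus x r \<nu> = {y \<in> ball x r. (y - x) \<bullet> \<nu> < 0}"

definition avg_dev :: "('a::euclidean_space \<Rightarrow> real) \<Rightarrow> 'a set \<Rightarrow> real \<Rightarrow> real" where
  "avg_dev u A a = (\<integral>y. indicator A y * \<bar>u y - a\<bar> \<partial>lebesgue) / measure lebesgue A"

text \<open>Approximate jump set J_u (Ambrosio--Fusco--Pallara, Def. 3.67).\<close>
definition jump_set :: "'a::euclidean_space set \<Rightarrow> ('a \<Rightarrow> real) \<Rightarrow> 'a set" where
  "jump_set U u = {x \<in> U. \<exists>a b \<nu>. a \<noteq> b \<and> norm \<nu> = 1 \<and>
      ((\<lambda>r. avg_dev u (half_ball_plus x r \<nu>) a) \<longlongrightarrow> 0) (at_right 0) \<and>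
      ((\<lambda>r. avg_dev u (half_ball_minus x r \<nu>) b) \<longlongrightarrow> 0) (at_right 0)}"

text \<open>SBV(U): u \<in> BV(U) and the Cantor part D^c u = D^s u - D^j u vanishes, where
  D^s u = Du restricted to a Lebesgue null Borel set Z carrying the singular part
  (Du restricted to the complement of Z is absolutely continuous w.r.t. Lebesgue measure),
  and D^j u = D^s u restricted to J_u.  Hence D^c u = Du restricted to Z - J_u.\<close>
definition SBV_on :: "'a::euclidean_space set \<Rightarrow> ('a \<Rightarrow> real) \<Rightarrow> bool" where
  "SBV_on U u \<longleftrightarrow> open U \<and> set_integrable lebesgue U u \<and>
     (\<exists>P N Z. is_distr_gradient U u P N \<and> Z \<in> sets borel \<and> emeasure lborel Z = 0 \<and>
        (\<forall>i\<in>Basis. \<forall>B\<in>sets borel.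
           (B \<inter> Z = {} \<and> emeasure lborel B = 0 \<longrightarrow> measure (P i) B = measure (N i) B) \<and>
           (B \<subseteq> Z - jump_set U u \<longrightarrow> measure (P i) B = measure (N i) B)))"

definition SBV_loc :: "'a::euclidean_space set \<Rightarrow> ('a \<Rightarrow> real) \<Rightarrow> bool" where
  "SBV_loc \<Omega> u \<longleftrightarrow> (\<forall>V. open V \<and> compact (closure V) \<and> closure V \<subseteq> \<Omega> \<longrightarrow> SBV_on V u)"

definition C11_vec :: "(real^2 \<Rightarrow> real^'k) \<Rightarrow> (real^2 \<Rightarrow> real^2 \<Rightarrow> real^'k) \<Rightarrow> real \<Rightarrow> bool" where
  "C11_vec F F' L \<longleftrightarrow> (\<forall>x. (F has_derivative F' x) (at x)) \<and>
     (\<forall>x y j i. \<bar>F' x (axis j 1) $ i - F' y (axis j 1) $ i\<bar> \<le> L * dist x y)"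

definition C11_mat :: "(real^2 \<Rightarrow> real^'m^2) \<Rightarrow> (real^2 \<Rightarrow> real^2 \<Rightarrow> real^'m^2) \<Rightarrow> real \<Rightarrow> bool" where
  "C11_mat G G' L \<longleftrightarrow> (\<forall>x. (G has_derivative G' x) (at x)) \<and>
     (\<forall>x y j i k. \<bar>G' x (axis j 1) $ i $ k - G' y (axis j 1) $ i $ k\<bar> \<le> L * dist x y)"

definition bracket_matrix :: "real^'m^2 \<Rightarrow> real^2^2 \<Rightarrow> 'm \<Rightarrow> real^2^2" where
  "bracket_matrix G0 A k =
     (\<chi> r c. if c = 1 then column k G0 $ r else (A *v column k G0) $ r)"

end

theory Submission
  imports Defs
begin

text \<open>
  The minimum time turns out to be continuous and weakly differentiable near the origin, so its
  derivative is absolutely continuous and has no Cantor part.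

  If two columns of \<open>G 0\<close> are independent, every small velocity is available near the
  origin; steering along segments shows that the minimum time is Lipschitz.

  If all columns of \<open>G 0\<close> are multiples of one vector \<open>g\<close>, then \<open>g\<close> and \<open>DF(0) g\<close> span
  the plane, and anisotropic scaling (\<open>e\<^sup>2\<close> in one direction, \<open>e\<close> in the other) turns the
  system into a small perturbation of the double integrator. The condition \<open>DG(0) = 0\<close> makes the
  perturbation depend on the control only to higher order. Extremal trajectories into the origin form
  a switching curve which no trajectory crosses against its orientation. Along lines in two
  oblique directions the minimum time therefore decreases, up to a linear term, towards the curve and
  increases beyond it, and it is locally Lipschitz off the curve. A continuous function of this kind is
  absolutely continuous on each line, hence weakly differentiable.
\<close>

section \<open>Integral estimates and integral equations\<close>

text \<open>The obstacle: at horizontal offset a from the switching curve the available bound for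
  the slope of the minimum time is of order 1/a, and this is not integrable up to the curve.
  Differentiability therefore comes from signs, not sizes. One-sided inequalities make the function
  monotone on either side of the crossing, up to a linear term. Lipschitz bounds away from the
  single crossing point give Lusin's condition (N), and the two together give absolute continuity.
  No optimal trajectory is constructed and no maximum principle is used: each estimate alters a
  given trajectory and counts the extra time. The directions are (2,1) and (2,-1) because a change
  of height by h can be bought with a horizontal drift of at most 6/5 h, which a horizontal
  displacement of 2h absorbs. Both directions cross the curve transversally and together they span
  the plane. The decimal constants are slack. Perturbations of Lipschitz size 1/100, acting for
  times at most 1/5, leave room in every inequality.\<close>

lemma has_integral_le_const:
  fixes f :: "real \<Rightarrow> real"
  assumes "(f has_integral I) {a..b}" "a \<le> b" "\<And>x. x \<in> {a..b} \<Longrightarrow> f x \<le> c"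
  shows "I \<le> c * (b - a)"
proof -
  have "((\<lambda>x. c) has_integral (b - a) * c) {a..b}"
    using has_integral_const_real[of c a b] assms(2) by simp
  from has_integral_le[OF assms(1) this] assms(3) show ?thesis by (simp add: mult.commute)
qed

lemma has_integral_ge_const:
  fixes f :: "real \<Rightarrow> real"
  assumes "(f has_integral I) {a..b}" "a \<le> b" "\<And>x. x \<in> {a..b} \<Longrightarrow> c \<le> f x"
  shows "c * (b - a) \<le> I"
proof -
  have "((\<lambda>x. c) has_integral (b - a) * c) {a..b}"
    using has_integral_const_real[of c a b] assms(2) by simp
  from has_integral_le[OF this assms(1)] assms(3) show ?thesis by (simp add: mult.commute)
qed

lemma has_integral_abs_le_const:
  fixes f :: "real \<Rightarrow> real"
  assumes "(f has_integral I) {a..b}" "a \<le> b" "\<And>x. x \<in> {a..b} \<Longrightarrow> \<bar>f x\<bar> \<le> c"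
  shows "\<bar>I\<bar> \<le> c * (b - a)"
proof -
  have "I \<le> c * (b - a)" by (rule has_integral_le_const[OF assms(1,2)]) (use assms(3) in force)
  moreover have "(-c) * (b - a) \<le> I" 
    by (rule has_integral_ge_const[OF assms(1,2)]) (use assms(3) in force)
  ultimately show ?thesis by linarith
qed

text \<open>The least element of the compact level set; an earlier dip below \<open>c\<close> would
  produce a smaller element by the intermediate value theorem. Trajectories are cut at such times so
  that a sign or size bound holds on a whole piece.\<close>

lemma first_hit:
  fixes f :: "real \<Rightarrow> real"
  assumes "continuous_on {a..b} f" "a \<le> b" "c \<le> f a" "f b \<le> c"
  obtains s where "a \<le> s" "s \<le> b" "f s = c" "\<And>r. a \<le> r \<Longrightarrow> r \<le> s \<Longrightarrow> c \<le> f r"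
proof -
  define K where "K = {s \<in> {a..b}. f s = c}"
  obtain x where "a \<le> x" "x \<le> b" "f x = c" using IVT2'[of f b c a] assms by auto
  then have "K \<noteq> {}" by (auto simp: K_def)
  moreover have "closed K" unfolding K_def
    using continuous_closed_preimage_constant[OF assms(1)] by simp
  then have "compact K" unfolding K_def
    by (metis (no_types, lifting) bounded_closed_interval bounded_subset compact_eq_bounded_closed mem_Collect_eq subsetI)
  ultimately obtain s where s: "s \<in> K" "\<And>t. t \<in> K \<Longrightarrow> s \<le> t" using compact_attains_inf[of K] by blast
  have "c \<le> f r" if "a \<le> r" "r \<le> s" for r
  proof (rule ccontr)
    assume "\<not> c \<le> f r"
    then have "f r \<le> c" by simp
    moreover have "continuous_on {a..r} f" using that s by (intro continuous_on_subset[OF assms(1)]) (auto simp: K_def)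
    ultimately obtain x where "a \<le> x" "x \<le> r" "f x = c" using IVT2'[of f r c a, OF _ assms(3) \<open>a \<le> r\<close>] by blast
    then have "x \<in> K" using that s(1) by (auto simp: K_def)
    then have "s \<le> x" by (rule s(2))
    then have "x = r" using \<open>x \<le> r\<close> that by simp
    then show False using \<open>\<not> c \<le> f r\<close> \<open>f x = c\<close> by simp
  qed
  with s that show thesis by (auto simp: K_def)
qed

lemma last_hit:
  fixes f :: "real \<Rightarrow> real"
  assumes "continuous_on {a..b} f" "a \<le> b" "c \<le> f a" "f b \<le> c"
  obtains s where "a \<le> s" "s \<le> b" "f s = c" "\<And>r. s \<le> r \<Longrightarrow> r \<le> b \<Longrightarrow> f r \<le> c"
proof -
  \<comment> \<open>Time reversal combined with a sign change turns the last hit into a first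
    hit.\<close>
  have "continuous_on {-b..-a} (\<lambda>x. - f (-x))"
    by (intro continuous_intros continuous_on_compose2[OF assms(1)]) auto
  from first_hit[OF this, of "-c"] assms
  obtain s where s: "-b \<le> s" "s \<le> -a" "f (-s) = c" "\<And>r. -b \<le> r \<Longrightarrow> r \<le> s \<Longrightarrow> f (-r) \<le> c" by auto
  show thesis
  proof (rule that[of "-s"])
    fix r assume "-s \<le> r" "r \<le> b"
    then show "f r \<le> c" using s(4)[of "-r"] by simp
  qed (use s in auto)
qed

text \<open>Quadratic errors disappear when an interval is subdivided, so increments may be
  estimated with frozen coefficients.\<close>
lemma increment_lower_bound:
  fixes \<phi> :: "real \<Rightarrow> real"
  assumes "a \<le> b"
    and inc: "\<And>s s'. a \<le> s \<Longrightarrow> s \<le> s' \<Longrightarrow> s' \<le> b \<Longrightarrow> - c * (s' - s) - C * (s' - s)\<^sup>2 \<le> \<phi> s' - \<phi> s"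
  shows "- c * (b - a) \<le> \<phi> b - \<phi> a"
proof -
  have "- c * (b - a) - C * (b - a)\<^sup>2 * inverse (real (Suc n)) \<le> \<phi> b - \<phi> a" for n
  proof -
    define h where "h = (b - a) / Suc n"
    have h0: "0 \<le> h" using assms(1) by (simp add: h_def)
    have hn: "real (Suc n) * h = b - a" by (simp add: h_def)
    have "- c * (real k * h) - C * real k * h\<^sup>2 \<le> \<phi> (a + real k * h) - \<phi> a" if "k \<le> Suc n" for k
      using that
    proof (induction k)
      case (Suc k)
      have 1: "real (Suc k) * h \<le> real (Suc n) * h" using Suc.prems h0 by (intro mult_right_mono) auto
      have "- c * (a + real (Suc k) * h - (a + real k * h)) - C * (a + real (Suc k) * h - (a + real k * h))\<^sup>2
          \<le> \<phi> (a + real (Suc k) * h) - \<phi> (a + real k * h)"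
        by (rule inc) (use 1 hn h0 in \<open>auto simp: algebra_simps\<close>)
      moreover have "a + real (Suc k) * h - (a + real k * h) = h" by (simp add: algebra_simps)
      moreover have "- c * (real k * h) - C * real k * h\<^sup>2 \<le> \<phi> (a + real k * h) - \<phi> a"
        using Suc by simp
      ultimately show ?case by (simp add: algebra_simps)
    qed simp
    from this[of "Suc n"] have "- c * (b - a) - C * (real (Suc n) * h\<^sup>2) \<le> \<phi> b - \<phi> a"
      using hn by (simp add: mult.assoc)
    moreover have "real (Suc n) * h\<^sup>2 = (b - a)\<^sup>2 * inverse (real (Suc n))"
      proof -
      have "N * ((b - a) / N)\<^sup>2 = (b - a)\<^sup>2 * inverse N" if "N \<noteq> 0" for N :: real
        using that unfolding power_divide power2_eq_square[of N] by (simp add: field_simps)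
      then show ?thesis unfolding h_def by (metis nat.simps(3) of_nat_eq_0_iff)
    qed
    ultimately show ?thesis by (simp add: mult.assoc)
  qed
  moreover have "(\<lambda>n. - c * (b - a) - C * (b - a)\<^sup>2 * inverse (real (Suc n))) \<longlonglongrightarrow> - c * (b - a) - C * (b - a)\<^sup>2 * 0"
    by (intro tendsto_intros LIMSEQ_inverse_real_of_nat)
  ultimately show ?thesis using LIMSEQ_le_const2 by fastforce
qed

text \<open>Picard iteration in a single contraction, which is why \<open>K * t < 1\<close> is
  asked. The field is only measurable in time, because the control is, so integrability along
  continuous paths is a hypothesis and the solution is given in integral form.\<close>

lemma ode_exists:
  fixes g :: "real \<Rightarrow> 'a::euclidean_space \<Rightarrow> 'a"
  assumes t: "0 \<le> t" and K: "0 \<le> K" "K * t < 1"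
    and lip: "\<And>s x x'. s \<in> {0..t} \<Longrightarrow> norm (g s x - g s x') \<le> K * norm (x - x')"
    and int: "\<And>y. continuous_on UNIV y \<Longrightarrow> (\<lambda>s. g s (y s)) integrable_on {0..t}"
  obtains y where "continuous_on UNIV y" "y 0 = y0"
    "\<And>a b. 0 \<le> a \<Longrightarrow> a \<le> b \<Longrightarrow> b \<le> t \<Longrightarrow> ((\<lambda>s. g s (y s)) has_integral (y b - y a)) {a..b}"
proof -
  \<comment> \<open>Clamping the upper limit to [0,t] makes every iterate bounded and continuous on
    the whole line, so the fixed point theorem applies in the complete type of bounded continuous
    functions.\<close>
  define J where "J y s = y0 + integral {0..max 0 (min t s)} (\<lambda>\<tau>. g \<tau> (y \<tau>))" for y :: "real \<Rightarrow> 'a" and s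
  have cont: "continuous_on UNIV (J y)" if y: "continuous_on UNIV y" for y
  proof -
    have "continuous_on UNIV (\<lambda>s. integral {0..max 0 (min t s)} (\<lambda>\<tau>. g \<tau> (y \<tau>)))"
      using t by (intro continuous_on_compose2[OF indefinite_integral_continuous_1[OF int[OF y]]] continuous_intros) auto
    then show ?thesis unfolding J_def by (intro continuous_intros)
  qed
  have bnd: "J y \<in> bcontfun" if y: "continuous_on UNIV y" for y
  proof -
    have "J y s = J y (max 0 (min t s))" for s using t by (simp add: J_def)
    then have "range (J y) \<subseteq> J y ` {0..t}" using t by (auto simp: image_iff) (metis atLeastAtMost_iff max.cobounded1 max_def min.cobounded1)
    moreover have "compact (J y ` {0..t})"
      by (intro compact_continuous_image continuous_on_subset[OF cont[OF y]]) auto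
    ultimately show ?thesis using cont[OF y] bounded_subset compact_imp_bounded by (auto simp: bcontfun_def)
  qed
  define \<Phi> where "\<Phi> y = Bcontfun (J (apply_bcontfun y))" for y :: "real \<Rightarrow>\<^sub>C 'a"
  have app: "apply_bcontfun (\<Phi> y) = J (apply_bcontfun y)" for y
    unfolding \<Phi>_def by (rule Bcontfun_inverse) (simp add: bnd)
  have "dist (\<Phi> y) (\<Phi> z) \<le> (K * t) * dist y z" for y z
  proof (rule dist_bound)
    fix s
    define s' where "s' = max 0 (min t s)"
    have s': "0 \<le> s'" "s' \<le> t" using t by (auto simp: s'_def)
    have i: "(\<lambda>\<tau>. g \<tau> (x \<tau>)) integrable_on {0..s'}" if "continuous_on UNIV x" for x
      by (rule integrable_on_subinterval[OF int[OF that]]) (use s' in auto)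
    have "dist (\<Phi> y s) (\<Phi> z s) = norm (integral {0..s'} (\<lambda>\<tau>. g \<tau> (y \<tau>)) - integral {0..s'} (\<lambda>\<tau>. g \<tau> (z \<tau>)))"
      by (simp add: app J_def dist_norm s'_def)
    also have "\<dots> = norm (integral {0..s'} (\<lambda>\<tau>. g \<tau> (y \<tau>) - g \<tau> (z \<tau>)))"
      by (subst integral_diff) (auto intro: i)
    also have "\<dots> \<le> integral {0..s'} (\<lambda>\<tau>. K * dist y z)"
    proof (rule integral_norm_bound_integral)
      fix x assume "x \<in> {0..s'}"
      then have "norm (g x (y x) - g x (z x)) \<le> K * norm (y x - z x)" using s' by (intro lip) auto
      also have "\<dots> \<le> K * dist y z" using K dist_bounded[of y x z] by (intro mult_left_mono) (auto simp: dist_norm)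
      finally show "norm (g x (y x) - g x (z x)) \<le> K * dist y z" .
    qed (auto intro!: integrable_diff i)
    also have "\<dots> = s' * (K * dist y z)" using s' by simp
    also have "\<dots> \<le> t * (K * dist y z)" using s' K by (intro mult_right_mono) auto
    finally show "dist (\<Phi> y s) (\<Phi> z s) \<le> (K * t) * dist y z" by (simp add: algebra_simps)
  qed
  then obtain y where y: "\<Phi> y = y" using banach_fix_type[of "K * t" \<Phi>] K t by auto
  then have yJ: "apply_bcontfun y = J (apply_bcontfun y)" using app by metis
  show thesis
  proof (rule that[of "apply_bcontfun y"])
    show "y 0 = y0" using t by (subst yJ) (simp add: J_def)
    fix a b :: real assume ab: "0 \<le> a" "a \<le> b" "b \<le> t"
    have i: "(\<lambda>\<tau>. g \<tau> (y \<tau>)) integrable_on {0..t}" by (rule int) simp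
    have 1: "y s = y0 + integral {0..s} (\<lambda>\<tau>. g \<tau> (y \<tau>))" if "0 \<le> s" "s \<le> t" for s
      using that by (subst yJ) (simp add: J_def)
    have "integral {0..a} (\<lambda>\<tau>. g \<tau> (y \<tau>)) + integral {a..b} (\<lambda>\<tau>. g \<tau> (y \<tau>)) = integral {0..b} (\<lambda>\<tau>. g \<tau> (y \<tau>))"
      by (rule Henstock_Kurzweil_Integration.integral_combine) (use ab i integrable_on_subinterval in \<open>fastforce+\<close>)
    then have "integral {a..b} (\<lambda>\<tau>. g \<tau> (y \<tau>)) = y b - y a" using 1[of a] 1[of b] ab by (simp add: algebra_simps)
    moreover have "(\<lambda>\<tau>. g \<tau> (y \<tau>)) integrable_on {a..b}" by (rule integrable_on_subinterval[OF i]) (use ab in auto)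
    ultimately show "((\<lambda>s. g s (y s)) has_integral (y b - y a)) {a..b}" using integrable_integral by metis
  qed simp
qed

lemma has_integral_fst: "(f has_integral I) S \<Longrightarrow> ((\<lambda>x. fst (f x)) has_integral fst I) S"
  by (drule has_integral_linear[OF _ bounded_linear_fst]) (simp add: o_def)

lemma has_integral_snd: "(f has_integral I) S \<Longrightarrow> ((\<lambda>x. snd (f x)) has_integral snd I) S"
  by (drule has_integral_linear[OF _ bounded_linear_snd]) (simp add: o_def)

lemma integrable_on_Pair:
  fixes f g :: "real \<Rightarrow> real"
  assumes "f integrable_on S" "g integrable_on S"
  shows "(\<lambda>x. (f x, g x)) integrable_on S"
proof -
  have "(\<lambda>x. f x *\<^sub>R (1::real, 0::real) + g x *\<^sub>R (0, 1)) integrable_on S"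
    by (intro integrable_add integrable_on_scaleR_left assms)
  then show ?thesis by (simp add: scaleR_prod_def)
qed

text \<open>This yields Lipschitz constant 2 for the planar field below. With
  \<open>ode_exists\<close> it explains why flows are built for times up to 2/5.\<close>

lemma norm_Pair_le_scaled:
  fixes a b x y :: real
  assumes "\<bar>a\<bar> \<le> \<bar>y\<bar> + (\<bar>x\<bar> + \<bar>y\<bar>) / 100" "\<bar>b\<bar> \<le> (\<bar>x\<bar> + \<bar>y\<bar>) / 100"
  shows "norm (a, b) \<le> 2 * norm (x, y)"
proof -
  have "norm (a, b) \<le> \<bar>a\<bar> + \<bar>b\<bar>" using norm_Pair_le[of a b] by simp
  moreover have "\<bar>x\<bar> \<le> norm (x, y)" "\<bar>y\<bar> \<le> norm (x, y)"
    using norm_fst_le[of x y] norm_snd_le[of y x] by auto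
  moreover have "0 \<le> norm (x, y)" by simp
  moreover have "n \<le> 2 * N" if "n \<le> A + B" "X \<le> N" "Y \<le> N" "0 \<le> N" "A \<le> Y + (X + Y) / 100" "B \<le> (X + Y) / 100"
    for n N A B X Y :: real
    using that by (simp add: field_simps)
  ultimately show ?thesis using assms by blast
qed

section \<open>The perturbed double integrator\<close>

lemma has_integral_shift_arg:
  fixes f :: "real \<Rightarrow> 'a::banach"
  assumes "(f has_integral I) {a + c..b + c}"
  shows "((\<lambda>x. f (x + c)) has_integral I) {a..b}"
proof -
  have "((f \<circ> (+) c) has_integral I) {a..b}" using assms has_integral_shift_Icc_real by blast
  moreover have "f \<circ> (+) c = (\<lambda>x. f (x + c))" by (auto simp: o_def add.commute)
  ultimately show ?thesis by simp
qed

lemma has_integral_reverse_arg: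
  fixes f :: "real \<Rightarrow> 'a::banach"
  assumes "(f has_integral I) {c - b..c - a}"
  shows "((\<lambda>x. f (c - x)) has_integral I) {a..b}"
proof -
  have "((\<lambda>x. f (- x)) has_integral I) {a - c..b - c}"
    using assms has_integral_reflect_real[of f I "c - a" "c - b"] by simp
  then have "((\<lambda>x. f (- (x + - c))) has_integral I) {a..b}"
    by (intro has_integral_shift_arg[where f = "\<lambda>x. f (- x)"]) simp
  then show ?thesis by simp
qed

lemma attains_sup_abs:
  fixes f :: "real \<Rightarrow> real"
  assumes "continuous_on {0..t} f" "0 \<le> t"
  obtains D s where "s \<in> {0..t}" "D = \<bar>f s\<bar>" "\<And>r. r \<in> {0..t} \<Longrightarrow> \<bar>f r\<bar> \<le> D"
proof -
  have "continuous_on {0..t} (\<lambda>x. \<bar>f x\<bar>)" by (intro continuous_intros assms)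
  then obtain s where "s \<in> {0..t}" "\<And>r. r \<in> {0..t} \<Longrightarrow> \<bar>f r\<bar> \<le> \<bar>f s\<bar>"
    using continuous_attains_sup[of "{0..t}"] assms(2) by (metis atLeastatMost_empty_iff compact_Icc not_le)
  then show thesis using that by blast
qed

text \<open>The double integrator \<open>x1' = x2\<close>, \<open>x2' = v w\<close> with perturbations \<open>r1\<close>, \<open>r2\<close>. The
  assumptions \<open>dm1\<close>--\<open>dp2\<close> bound their dependence on the control by its deviation from the extremal
  controls \<open>um\<close>, \<open>up\<close>.\<close>
locale double_integrator =
  fixes r1 r2 :: "real \<Rightarrow> real \<Rightarrow> 'u \<Rightarrow> real" and v :: "'u \<Rightarrow> real"
    and U :: "'u set" and Ctl :: "(real \<Rightarrow> 'u) set" and um up u0 :: 'u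
  assumes lip1: "w \<in> U \<Longrightarrow> \<bar>r1 x1 x2 w - r1 z1 z2 w\<bar> \<le> (\<bar>x1 - z1\<bar> + \<bar>x2 - z2\<bar>) / 100"
    and lip2: "w \<in> U \<Longrightarrow> \<bar>r2 x1 x2 w - r2 z1 z2 w\<bar> \<le> (\<bar>x1 - z1\<bar> + \<bar>x2 - z2\<bar>) / 100"
    and zero1: "w \<in> U \<Longrightarrow> r1 0 0 w = 0"
    and zero2: "w \<in> U \<Longrightarrow> r2 0 0 w = 0"
    and bnd1: "w \<in> U \<Longrightarrow> \<bar>r1 x1 x2 w\<bar> \<le> 1/10"
    and bnd2: "w \<in> U \<Longrightarrow> \<bar>r2 x1 x2 w\<bar> \<le> 1/10"
    and dm1: "w \<in> U \<Longrightarrow> \<bar>r1 x1 x2 w - r1 x1 x2 um\<bar> \<le> (\<bar>x1\<bar> + \<bar>x2\<bar>) / 100 * (1 + v w)"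
    and dm2: "w \<in> U \<Longrightarrow> \<bar>r2 x1 x2 w - r2 x1 x2 um\<bar> \<le> (\<bar>x1\<bar> + \<bar>x2\<bar>) / 100 * (1 + v w)"
    and dp1: "w \<in> U \<Longrightarrow> \<bar>r1 x1 x2 w - r1 x1 x2 up\<bar> \<le> (\<bar>x1\<bar> + \<bar>x2\<bar>) / 100 * (1 - v w)"
    and dp2: "w \<in> U \<Longrightarrow> \<bar>r2 x1 x2 w - r2 x1 x2 up\<bar> \<le> (\<bar>x1\<bar> + \<bar>x2\<bar>) / 100 * (1 - v w)"
    and v_bnd: "w \<in> U \<Longrightarrow> - 1 \<le> v w \<and> v w \<le> 1"
    and v_vals: "v um = - 1" "v up = 1" "v u0 = 0"
    and U_vals: "um \<in> U" "up \<in> U" "u0 \<in> U"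
    and Ctl_U: "u \<in> Ctl \<Longrightarrow> u s \<in> U"
    and Ctl_const: "w \<in> {um, up, u0} \<Longrightarrow> (\<lambda>_. w) \<in> Ctl"
    and Ctl_join: "u \<in> Ctl \<Longrightarrow> u' \<in> Ctl \<Longrightarrow> (\<lambda>\<tau>. if \<tau> \<le> s then u \<tau> else u' (\<tau> + - s)) \<in> Ctl"
    and Ctl_shift: "u \<in> Ctl \<Longrightarrow> (\<lambda>\<tau>. u (\<tau> + s)) \<in> Ctl"
    and int1: "u \<in> Ctl \<Longrightarrow> continuous_on {a..b} y1 \<Longrightarrow> continuous_on {a..b} y2 \<Longrightarrow>
        (\<lambda>\<tau>. r1 (y1 \<tau>) (y2 \<tau>) (u \<tau>)) integrable_on {a..b}"
    and int2: "u \<in> Ctl \<Longrightarrow> continuous_on {a..b} y1 \<Longrightarrow> continuous_on {a..b} y2 \<Longrightarrow>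
        (\<lambda>\<tau>. r2 (y1 \<tau>) (y2 \<tau>) (u \<tau>)) integrable_on {a..b}"
    and intv: "u \<in> Ctl \<Longrightarrow> (\<lambda>\<tau>. v (u \<tau>)) integrable_on {a..b}"
begin

text \<open>The point reflection exchanges the extremal controls \<open>um\<close> and
  \<open>up\<close>. Statements are proved on one side only and carried to the other by interpreting
  the locale at the reflected data.\<close>

lemma reflected: "double_integrator (\<lambda>x1 x2 w. - r1 (- x1) (- x2) w) (\<lambda>x1 x2 w. - r2 (- x1) (- x2) w)
    (\<lambda>w. - v w) U Ctl up um u0"
proof
  fix w x1 x2 z1 z2 assume w: "w \<in> U"
  show "\<bar>- r1 (- x1) (- x2) w - - r1 (- z1) (- z2) w\<bar> \<le> (\<bar>x1 - z1\<bar> + \<bar>x2 - z2\<bar>) / 100"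
    using lip1[OF w, of "-x1" "-x2" "-z1" "-z2"] by (simp add: abs_minus_commute)
  show "\<bar>- r2 (- x1) (- x2) w - - r2 (- z1) (- z2) w\<bar> \<le> (\<bar>x1 - z1\<bar> + \<bar>x2 - z2\<bar>) / 100"
    using lip2[OF w, of "-x1" "-x2" "-z1" "-z2"] by (simp add: abs_minus_commute)
  show "\<bar>- r1 (- x1) (- x2) w - - r1 (- x1) (- x2) um\<bar> \<le> (\<bar>x1\<bar> + \<bar>x2\<bar>) / 100 * (1 - - v w)"
    using dm1[OF w, of "-x1" "-x2"] by (simp add: abs_minus_commute)
  show "\<bar>- r2 (- x1) (- x2) w - - r2 (- x1) (- x2) um\<bar> \<le> (\<bar>x1\<bar> + \<bar>x2\<bar>) / 100 * (1 - - v w)"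
    using dm2[OF w, of "-x1" "-x2"] by (simp add: abs_minus_commute)
  show "\<bar>- r1 (- x1) (- x2) w - - r1 (- x1) (- x2) up\<bar> \<le> (\<bar>x1\<bar> + \<bar>x2\<bar>) / 100 * (1 + - v w)"
    using dp1[OF w, of "-x1" "-x2"] by (simp add: abs_minus_commute)
  show "\<bar>- r2 (- x1) (- x2) w - - r2 (- x1) (- x2) up\<bar> \<le> (\<bar>x1\<bar> + \<bar>x2\<bar>) / 100 * (1 + - v w)"
    using dp2[OF w, of "-x1" "-x2"] by (simp add: abs_minus_commute)
next
  fix u a b and y1 y2 :: "real \<Rightarrow> real"
  assume u: "u \<in> Ctl" and c: "continuous_on {a..b} y1" "continuous_on {a..b} y2"
  have "continuous_on {a..b} (\<lambda>x. - y1 x)" "continuous_on {a..b} (\<lambda>x. - y2 x)"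
    using c by (auto intro: continuous_intros)
  from int1[OF u this] int2[OF u this]
  show "(\<lambda>\<tau>. - r1 (- y1 \<tau>) (- y2 \<tau>) (u \<tau>)) integrable_on {a..b}"
    "(\<lambda>\<tau>. - r2 (- y1 \<tau>) (- y2 \<tau>) (u \<tau>)) integrable_on {a..b}" by (auto intro: integrable_neg)
qed (use zero1 zero2 bnd1 bnd2 v_bnd v_vals U_vals Ctl_U Ctl_const Ctl_join Ctl_shift intv in
    \<open>auto intro: integrable_neg simp: minus_le_iff\<close>)

definition "f1 x1 x2 w = x2 + r1 x1 x2 w"
definition "f2 x1 x2 w = v w + r2 x1 x2 w"

text \<open>The integral equation is required on every subinterval, not only from 0, so initial
  pieces and tails of trajectories are again trajectories.\<close>

definition "traj u y1 y2 t \<longleftrightarrow> u \<in> Ctl \<and> 0 \<le> t \<and> continuous_on {0..t} y1 \<and> continuous_on {0..t} y2 \<and>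
  (\<forall>a b. 0 \<le> a \<longrightarrow> a \<le> b \<longrightarrow> b \<le> t \<longrightarrow>
    ((\<lambda>\<tau>. f1 (y1 \<tau>) (y2 \<tau>) (u \<tau>)) has_integral (y1 b - y1 a)) {a..b} \<and>
    ((\<lambda>\<tau>. f2 (y1 \<tau>) (y2 \<tau>) (u \<tau>)) has_integral (y2 b - y2 a)) {a..b})"

text \<open>Arrival by time \<open>t\<close>, not at time \<open>t\<close>: the relation is monotone
  in \<open>t\<close>, and estimates of times may be weakened freely.\<close>

definition "reaches x1 x2 z1 z2 t \<longleftrightarrow> (\<exists>u y1 y2 s. s \<le> t \<and> traj u y1 y2 s \<and>
    y1 0 = x1 \<and> y2 0 = x2 \<and> y1 s = z1 \<and> y2 s = z2)"

lemma trajD: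
  assumes "traj u y1 y2 t"
  shows "u \<in> Ctl" "0 \<le> t" "continuous_on {0..t} y1" "continuous_on {0..t} y2" "u s \<in> U"
  using assms Ctl_U by (auto simp: traj_def)

lemma traj_int:
  assumes "traj u y1 y2 t" "0 \<le> a" "a \<le> b" "b \<le> t"
  shows "((\<lambda>\<tau>. f1 (y1 \<tau>) (y2 \<tau>) (u \<tau>)) has_integral (y1 b - y1 a)) {a..b}"
    "((\<lambda>\<tau>. f2 (y1 \<tau>) (y2 \<tau>) (u \<tau>)) has_integral (y2 b - y2 a)) {a..b}"
  using assms by (auto simp: traj_def)

lemma traj_cont:
  assumes "traj u y1 y2 t" "0 \<le> a" "b \<le> t"
  shows "continuous_on {a..b} y1" "continuous_on {a..b} y2"
  using trajD(3,4)[OF assms(1)] assms(2,3) by (auto elim!: continuous_on_subset)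

lemma traj_init:
  assumes "traj u y1 y2 t" "0 \<le> s" "s \<le> t"
  shows "traj u y1 y2 s"
  using assms traj_cont[OF assms(1), of 0 s] by (auto simp: traj_def)

lemma traj_tail:
  assumes "traj u y1 y2 t" "0 \<le> s" "s \<le> t"
  shows "traj (\<lambda>\<tau>. u (\<tau> + s)) (\<lambda>\<tau>. y1 (\<tau> + s)) (\<lambda>\<tau>. y2 (\<tau> + s)) (t - s)"
  unfolding traj_def
proof (intro conjI allI impI)
  show "(\<lambda>\<tau>. u (\<tau> + s)) \<in> Ctl" using assms by (intro Ctl_shift) (auto simp: traj_def)
  show "continuous_on {0..t - s} (\<lambda>\<tau>. y1 (\<tau> + s))" "continuous_on {0..t - s} (\<lambda>\<tau>. y2 (\<tau> + s))"
    using assms by (auto intro!: continuous_intros continuous_on_compose2[OF trajD(3)[OF assms(1)]]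
      continuous_on_compose2[OF trajD(4)[OF assms(1)]])
  fix a b assume "0 \<le> a" "a \<le> b" "b \<le> t - s"
  then have *: "0 \<le> a + s" "a + s \<le> b + s" "b + s \<le> t" using assms by auto
  show "((\<lambda>\<tau>. f1 (y1 (\<tau> + s)) (y2 (\<tau> + s)) (u (\<tau> + s))) has_integral (y1 (b + s) - y1 (a + s))) {a..b}"
    by (rule has_integral_shift_arg[where f = "\<lambda>\<tau>. f1 (y1 \<tau>) (y2 \<tau>) (u \<tau>)"]) (rule traj_int[OF assms(1) *])
  show "((\<lambda>\<tau>. f2 (y1 (\<tau> + s)) (y2 (\<tau> + s)) (u (\<tau> + s))) has_integral (y2 (b + s) - y2 (a + s))) {a..b}"
    by (rule has_integral_shift_arg[where f = "\<lambda>\<tau>. f2 (y1 \<tau>) (y2 \<tau>) (u \<tau>)"]) (rule traj_int[OF assms(1) *])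
qed (use assms in auto)

lemma reaches_seg:
  assumes "traj u y1 y2 t" "0 \<le> a" "a \<le> b" "b \<le> t"
  shows "reaches (y1 a) (y2 a) (y1 b) (y2 b) (b - a)"
  unfolding reaches_def using traj_tail[OF traj_init[OF assms(1), of b], of a] assms
  by (intro exI[of _ "\<lambda>\<tau>. u (\<tau> + a)"] exI[of _ "\<lambda>\<tau>. y1 (\<tau> + a)"] exI[of _ "\<lambda>\<tau>. y2 (\<tau> + a)"] exI[of _ "b - a"]) auto

lemma reaches_mono: "reaches x1 x2 z1 z2 s \<Longrightarrow> s \<le> t \<Longrightarrow> reaches x1 x2 z1 z2 t"
  proof -
  assume "reaches x1 x2 z1 z2 s" "s \<le> t"
  then obtain u y1 y2 s' where "s' \<le> t" "traj u y1 y2 s'" "y1 0 = x1" "y2 0 = x2" "y1 s' = z1" "y2 s' = z2"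
    unfolding reaches_def using order_trans by blast
  then show ?thesis unfolding reaches_def by blast
qed

lemma reaches_nonneg: "reaches x1 x2 z1 z2 t \<Longrightarrow> 0 \<le> t"
  unfolding reaches_def using trajD(2) by (meson order_trans)

lemma traj_join:
  assumes A: "traj u y1 y2 s" and B: "traj u' w1 w2 t" and eq: "y1 s = w1 0" "y2 s = w2 0"
  shows "traj (\<lambda>\<tau>. if \<tau> \<le> s then u \<tau> else u' (\<tau> + - s)) (\<lambda>\<tau>. if \<tau> \<le> s then y1 \<tau> else w1 (\<tau> + - s))
    (\<lambda>\<tau>. if \<tau> \<le> s then y2 \<tau> else w2 (\<tau> + - s)) (s + t)"
    (is "traj ?u ?y1 ?y2 _")
proof -
  have st: "0 \<le> s" "0 \<le> t" using trajD(2)[OF A] trajD(2)[OF B] .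
  have c: "continuous_on {0..s+t} (\<lambda>\<tau>. if \<tau> \<le> s then y \<tau> else w (\<tau> + - s))"
    if "continuous_on {0..s} y" "continuous_on {0..t} w" "y s = w 0" for y w :: "real \<Rightarrow> real"
  proof (rule continuous_on_cases_le[where h = "\<lambda>x. x"])
    show "continuous_on {x \<in> {0..s + t}. x \<le> s} y" by (rule continuous_on_subset[OF that(1)]) auto
    show "continuous_on {x \<in> {0..s + t}. s \<le> x} (\<lambda>x. w (x + - s))"
      by (rule continuous_on_compose2[OF that(2)]) (auto intro: continuous_intros)
  qed (use that in auto)
  have int: "((\<lambda>\<tau>. f (?y1 \<tau>) (?y2 \<tau>) (?u \<tau>)) has_integral Y b - Y a) {a..b}"
    if 1: "\<And>a b. 0 \<le> a \<Longrightarrow> a \<le> b \<Longrightarrow> b \<le> s \<Longrightarrow> ((\<lambda>\<tau>. f (y1 \<tau>) (y2 \<tau>) (u \<tau>)) has_integral (y b - y a)) {a..b}"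
    and 2: "\<And>a b. 0 \<le> a \<Longrightarrow> a \<le> b \<Longrightarrow> b \<le> t \<Longrightarrow> ((\<lambda>\<tau>. f (w1 \<tau>) (w2 \<tau>) (u' \<tau>)) has_integral (w b - w a)) {a..b}"
    and Y: "\<And>\<tau>. Y \<tau> = (if \<tau> \<le> s then y \<tau> else w (\<tau> + - s))" and yw: "y s = w 0"
    and ab: "0 \<le> a" "a \<le> b" "b \<le> s + t"
    for f :: "real \<Rightarrow> real \<Rightarrow> 'u \<Rightarrow> real" and a b and y w Y :: "real \<Rightarrow> real"
  proof -
    have L: "((\<lambda>\<tau>. f (?y1 \<tau>) (?y2 \<tau>) (?u \<tau>)) has_integral Y b - Y a) {a..b}" if "0 \<le> a" "a \<le> b" "b \<le> s" for a b
    proof -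
      have "((\<lambda>\<tau>. f (?y1 \<tau>) (?y2 \<tau>) (?u \<tau>)) has_integral y b - y a) {a..b}"
        by (rule has_integral_eq[OF _ 1]) (use that in auto)
      then show ?thesis using that by (simp add: Y)
    qed
    have R: "((\<lambda>\<tau>. f (?y1 \<tau>) (?y2 \<tau>) (?u \<tau>)) has_integral Y b - Y a) {a..b}" if "s \<le> a" "a \<le> b" "b \<le> s + t" for a b
    proof -
      have "((\<lambda>\<tau>. f (w1 (\<tau> + - s)) (w2 (\<tau> + - s)) (u' (\<tau> + - s))) has_integral w (b + - s) - w (a + - s)) {a..b}"
        by (rule has_integral_shift_arg[where f = "\<lambda>\<tau>. f (w1 \<tau>) (w2 \<tau>) (u' \<tau>)"]) (rule 2, use that in auto)
      \<comment> \<open>At the junction the joined control takes its value from the first piece; the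
        integrands differ at that single time only.\<close>
      then have "((\<lambda>\<tau>. f (?y1 \<tau>) (?y2 \<tau>) (?u \<tau>)) has_integral w (b + - s) - w (a + - s)) {a..b}"
        by (rule has_integral_spike_finite[of "{s}", rotated 2]) (use that in auto)
      moreover have "Y b = w (b + - s)" "Y a = w (a + - s)"
        using that yw by (cases "b = s"; cases "a = s"; simp add: Y)+
      ultimately show ?thesis by simp
    qed
    consider "b \<le> s" | "s \<le> a" | "a \<le> s" "s \<le> b" by linarith
    then show ?thesis
    proof cases
      case 3
      from has_integral_combine[OF this L[OF ab(1) 3(1) order_refl] R[OF order_refl 3(2) ab(3)]] show ?thesis by simp
    qed (use L R ab in auto)
  qed
  show ?thesis unfolding traj_def
  proof (intro conjI allI impI)
    show "?u \<in> Ctl" using trajD(1)[OF A] trajD(1)[OF B] by (rule Ctl_join)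
    fix a b assume ab: "0 \<le> a" "a \<le> b" "b \<le> s + t"
    show "((\<lambda>\<tau>. f1 (?y1 \<tau>) (?y2 \<tau>) (?u \<tau>)) has_integral ?y1 b - ?y1 a) {a..b}"
      by (rule int[where f = f1 and y = y1 and w = w1 and Y = ?y1, OF traj_int(1)[OF A] traj_int(1)[OF B] refl eq(1) ab])
    show "((\<lambda>\<tau>. f2 (?y1 \<tau>) (?y2 \<tau>) (?u \<tau>)) has_integral ?y2 b - ?y2 a) {a..b}"
      by (rule int[where f = f2 and y = y2 and w = w2 and Y = ?y2, OF traj_int(2)[OF A] traj_int(2)[OF B] refl eq(2) ab])
  qed (use st c[OF trajD(3)[OF A] trajD(3)[OF B] eq(1)] c[OF trajD(4)[OF A] trajD(4)[OF B] eq(2)] in auto)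
qed

lemma reaches_trans:
  assumes "reaches x1 x2 w1 w2 s" "reaches w1 w2 z1 z2 t"
  shows "reaches x1 x2 z1 z2 (s + t)"
proof -
  obtain u y1 y2 s' where A: "s' \<le> s" "traj u y1 y2 s'" "y1 0 = x1" "y2 0 = x2" "y1 s' = w1" "y2 s' = w2"
    using assms(1) unfolding reaches_def by blast
  obtain u' y1' y2' t' where B: "t' \<le> t" "traj u' y1' y2' t'" "y1' 0 = w1" "y2' 0 = w2" "y1' t' = z1" "y2' t' = z2"
    using assms(2) unfolding reaches_def by blast
  have nn: "0 \<le> s'" "0 \<le> t'" using trajD(2) A(2) B(2) by blast+
  have "(if s' + t' \<le> s' then y1 (s' + t') else y1' (s' + t' + - s')) = z1"
    "(if s' + t' \<le> s' then y2 (s' + t') else y2' (s' + t' + - s')) = z2"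
  proof -
    show "(if s' + t' \<le> s' then y1 (s' + t') else y1' (s' + t' + - s')) = z1"
      using nn A(5) B(3,5) by (cases "t' = 0") simp_all
    show "(if s' + t' \<le> s' then y2 (s' + t') else y2' (s' + t' + - s')) = z2"
      using nn A(6) B(4,6) by (cases "t' = 0") simp_all
  qed
  then show ?thesis unfolding reaches_def
    using traj_join[OF A(2) B(2)] A B nn
    by (intro exI[of _ "\<lambda>\<tau>. if \<tau> \<le> s' then u \<tau> else u' (\<tau> + - s')"]
        exI[of _ "\<lambda>\<tau>. if \<tau> \<le> s' then y1 \<tau> else y1' (\<tau> + - s')"]
        exI[of _ "\<lambda>\<tau>. if \<tau> \<le> s' then y2 \<tau> else y2' (\<tau> + - s')"] exI[of _ "s' + t'"]) simp
qed

lemma f1_lip: "w \<in> U \<Longrightarrow> \<bar>f1 x1 x2 w - f1 z1 z2 w\<bar> \<le> \<bar>x2 - z2\<bar> + (\<bar>x1 - z1\<bar> + \<bar>x2 - z2\<bar>) / 100"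
  using lip1[of w x1 x2 z1 z2] unfolding f1_def by linarith

lemma f2_lip: "w \<in> U \<Longrightarrow> \<bar>f2 x1 x2 w - f2 z1 z2 w\<bar> \<le> (\<bar>x1 - z1\<bar> + \<bar>x2 - z2\<bar>) / 100"
  using lip2[of w x1 x2 z1 z2] by (simp add: f2_def)

lemma r1_small: "w \<in> U \<Longrightarrow> \<bar>r1 x1 x2 w\<bar> \<le> (\<bar>x1\<bar> + \<bar>x2\<bar>) / 100"
  using lip1[of w x1 x2 0 0] zero1[of w] by simp

lemma r2_small: "w \<in> U \<Longrightarrow> \<bar>r2 x1 x2 w\<bar> \<le> (\<bar>x1\<bar> + \<bar>x2\<bar>) / 100"
  using lip2[of w x1 x2 0 0] zero2[of w] by simp

lemma f_integrable:
  assumes "u \<in> Ctl" "continuous_on {a..b} y1" "continuous_on {a..b} y2"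
  shows "(\<lambda>\<tau>. f1 (y1 \<tau>) (y2 \<tau>) (u \<tau>)) integrable_on {a..b}" "(\<lambda>\<tau>. f2 (y1 \<tau>) (y2 \<tau>) (u \<tau>)) integrable_on {a..b}"
  unfolding f1_def f2_def using assms
  by (auto intro: integrable_add int1 int2 intv integrable_continuous_real)

lemma flow_exists:
  assumes u: "u \<in> Ctl" and t: "0 \<le> t" "t \<le> 2/5"
  obtains y1 y2 where "traj u y1 y2 t" "y1 0 = x1" "y2 0 = x2"
proof -
  define g where "g s p = (f1 (fst p) (snd p) (u s), f2 (fst p) (snd p) (u s))" for s p
  obtain y where y: "continuous_on UNIV y" "y 0 = (x1, x2)"
    "\<And>a b. 0 \<le> a \<Longrightarrow> a \<le> b \<Longrightarrow> b \<le> t \<Longrightarrow> ((\<lambda>s. g s (y s)) has_integral (y b - y a)) {a..b}"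
  proof (rule ode_exists[of t 2 g])
    fix s x x'
    have "norm (f1 (fst x) (snd x) (u s) - f1 (fst x') (snd x') (u s), f2 (fst x) (snd x) (u s) - f2 (fst x') (snd x') (u s))
        \<le> 2 * norm (fst x - fst x', snd x - snd x')"
      by (rule norm_Pair_le_scaled[OF f1_lip f2_lip]) (use Ctl_U[OF u] in auto)
    then show "norm (g s x - g s x') \<le> 2 * norm (x - x')" by (cases x; cases x') (simp add: g_def)
  next
    fix y :: "real \<Rightarrow> real \<times> real" assume "continuous_on UNIV y"
    then have "continuous_on {0..t} (\<lambda>s. fst (y s))" "continuous_on {0..t} (\<lambda>s. snd (y s))"
      by (auto intro!: continuous_intros elim: continuous_on_subset)
    then show "(\<lambda>s. g s (y s)) integrable_on {0..t}" unfolding g_def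
      by (intro integrable_on_Pair f_integrable u)
  qed (use t in auto)
  show thesis
  proof (rule that[of "\<lambda>s. fst (y s)" "\<lambda>s. snd (y s)"])
    show "traj u (\<lambda>s. fst (y s)) (\<lambda>s. snd (y s)) t" unfolding traj_def
    proof (intro conjI allI impI)
      show "continuous_on {0..t} (\<lambda>s. fst (y s))" "continuous_on {0..t} (\<lambda>s. snd (y s))"
        using y(1) by (auto intro!: continuous_intros elim: continuous_on_subset)
      fix a b assume "0 \<le> a" "a \<le> b" "b \<le> t"
      from has_integral_fst[OF y(3)[OF this]] has_integral_snd[OF y(3)[OF this]]
      show "((\<lambda>\<tau>. f1 (fst (y \<tau>)) (snd (y \<tau>)) (u \<tau>)) has_integral fst (y b) - fst (y a)) {a..b}"
        "((\<lambda>\<tau>. f2 (fst (y \<tau>)) (snd (y \<tau>)) (u \<tau>)) has_integral snd (y b) - snd (y a)) {a..b}"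
        by (auto simp: g_def)
    qed (use u t in auto)
  qed (use y in auto)
qed

lemma flow_back_exists:
  assumes u: "u \<in> Ctl" and t: "0 \<le> t" "t \<le> 2/5"
  obtains y1 y2 where "traj u y1 y2 t" "y1 t = z1" "y2 t = z2"
proof -
  \<comment> \<open>A terminal value problem becomes an initial value problem for the negated field
    with the control read backwards.\<close>
  define g where "g s p = (- f1 (fst p) (snd p) (u (t - s)), - f2 (fst p) (snd p) (u (t - s)))" for s p
  obtain y where y: "continuous_on UNIV y" "y 0 = (z1, z2)"
    "\<And>a b. 0 \<le> a \<Longrightarrow> a \<le> b \<Longrightarrow> b \<le> t \<Longrightarrow> ((\<lambda>s. g s (y s)) has_integral (y b - y a)) {a..b}"
  proof (rule ode_exists[of t 2 g])
    fix s x x'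
    have "norm (f1 (fst x) (snd x) (u (t-s)) - f1 (fst x') (snd x') (u (t-s)), f2 (fst x) (snd x) (u (t-s)) - f2 (fst x') (snd x') (u (t-s)))
        \<le> 2 * norm (fst x - fst x', snd x - snd x')"
      by (rule norm_Pair_le_scaled[OF f1_lip f2_lip]) (use Ctl_U[OF u] in auto)
    moreover have "g s x - g s x' = - (f1 (fst x) (snd x) (u (t-s)) - f1 (fst x') (snd x') (u (t-s)), f2 (fst x) (snd x) (u (t-s)) - f2 (fst x') (snd x') (u (t-s)))"
      by (simp add: g_def)
    ultimately show "norm (g s x - g s x') \<le> 2 * norm (x - x')"
      by (cases x; cases x') (simp only: norm_minus_cancel fst_conv snd_conv diff_Pair)
  next
    fix y :: "real \<Rightarrow> real \<times> real" assume y: "continuous_on UNIV y"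
    have "continuous_on {0..t} (\<lambda>s. fst (y (t - s)))" "continuous_on {0..t} (\<lambda>s. snd (y (t - s)))"
      by (intro continuous_intros continuous_on_compose2[OF y]; simp)+
    from f_integrable[OF u this]
    have "(\<lambda>s. (- f1 (fst (y (t - s))) (snd (y (t - s))) (u s), - f2 (fst (y (t - s))) (snd (y (t - s))) (u s))) integrable_on {0..t}"
      by (intro integrable_on_Pair integrable_neg)
    then obtain I where "((\<lambda>s. (- f1 (fst (y (t - s))) (snd (y (t - s))) (u s), - f2 (fst (y (t - s))) (snd (y (t - s))) (u s))) has_integral I) {t - t..t - 0}"
      unfolding integrable_on_def by (simp only: diff_self diff_0_right) blast
    from has_integral_reverse_arg[OF this] show "(\<lambda>s. g s (y s)) integrable_on {0..t}" by (auto simp: g_def)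
  qed (use t in auto)
  show thesis
  proof (rule that[of "\<lambda>s. fst (y (t - s))" "\<lambda>s. snd (y (t - s))"])
    show "traj u (\<lambda>s. fst (y (t - s))) (\<lambda>s. snd (y (t - s))) t" unfolding traj_def
    proof (intro conjI allI impI)
      show "continuous_on {0..t} (\<lambda>s. fst (y (t - s)))" "continuous_on {0..t} (\<lambda>s. snd (y (t - s)))"
        by (intro continuous_intros continuous_on_compose2[OF y(1)]; simp)+
      fix a b assume "0 \<le> a" "a \<le> b" "b \<le> t"
      then have "((\<lambda>s. g s (y s)) has_integral (y (t - a) - y (t - b))) {t - b..t - a}" by (intro y(3)) auto
      from has_integral_neg[OF has_integral_reverse_arg[OF this]]
      have "((\<lambda>s. - g (t - s) (y (t - s))) has_integral (y (t - b) - y (t - a))) {a..b}" by simp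
      from has_integral_fst[OF this] has_integral_snd[OF this]
      show "((\<lambda>\<tau>. f1 (fst (y (t - \<tau>))) (snd (y (t - \<tau>))) (u \<tau>)) has_integral fst (y (t - b)) - fst (y (t - a))) {a..b}"
        "((\<lambda>\<tau>. f2 (fst (y (t - \<tau>))) (snd (y (t - \<tau>))) (u \<tau>)) has_integral snd (y (t - b)) - snd (y (t - a))) {a..b}"
        by (auto simp: g_def)
    qed (use u t in auto)
  qed (use y in auto)
qed

end

section \<open>Speed bounds, trajectories with the same control, vertical corrections, and one
  branch of the curve\<close>

context double_integrator
begin

lemma f2_between: "w \<in> U \<Longrightarrow> v w - 1/10 \<le> f2 x1 x2 w" "w \<in> U \<Longrightarrow> f2 x1 x2 w \<le> v w + 1/10"
  using bnd2[of w x1 x2] unfolding f2_def by linarith+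

lemma f2_abs: "w \<in> U \<Longrightarrow> \<bar>f2 x1 x2 w\<bar> \<le> 11/10"
  using f2_between[of w x1 x2] v_bnd[of w] by linarith

lemma f1_abs: "w \<in> U \<Longrightarrow> \<bar>f1 x1 x2 w\<bar> \<le> \<bar>x2\<bar> + 1/10"
  using bnd1[of w x1 x2] unfolding f1_def by linarith

lemma traj_y2_inc:
  assumes "traj u y1 y2 t" "a \<in> {0..t}" "b \<in> {0..t}"
  shows "\<bar>y2 b - y2 a\<bar> \<le> 11/10 * \<bar>b - a\<bar>"
proof -
  have *: "\<bar>y2 b - y2 a\<bar> \<le> 11/10 * (b - a)" if "0 \<le> a" "a \<le> b" "b \<le> t" for a b
    by (rule has_integral_abs_le_const[OF traj_int(2)[OF assms(1)]])
      (use that f2_abs trajD(5)[OF assms(1)] in auto)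
  show ?thesis using *[of a b] *[of b a] assms(2,3) by (cases "a \<le> b") (auto simp: abs_minus_commute)
qed

lemma traj_y1_inc:
  assumes "traj u y1 y2 t" "a \<in> {0..t}" "b \<in> {0..t}" "\<And>s. s \<in> {0..t} \<Longrightarrow> \<bar>y2 s\<bar> \<le> c"
  shows "\<bar>y1 b - y1 a\<bar> \<le> (c + 1/10) * \<bar>b - a\<bar>"
proof -
  have *: "\<bar>y1 b - y1 a\<bar> \<le> (c + 1/10) * (b - a)" if "0 \<le> a" "a \<le> b" "b \<le> t" for a b
  proof (rule has_integral_abs_le_const[OF traj_int(1)[OF assms(1)]])
    fix s assume "s \<in> {a..b}"
    then show "\<bar>f1 (y1 s) (y2 s) (u s)\<bar> \<le> c + 1/10"
      using f1_abs[OF trajD(5)[OF assms(1), of s], of "y1 s" "y2 s"] assms(4)[of s] that by auto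
  qed (use that in auto)
  show ?thesis using *[of a b] *[of b a] assms(2,3) by (cases "a \<le> b") (auto simp: abs_minus_commute)
qed

lemma um_decreasing:
  assumes "traj (\<lambda>_. um) y1 y2 t" "0 \<le> a" "a \<le> b" "b \<le> t"
  shows "y2 b - y2 a \<le> - 9/10 * (b - a)" "- 11/10 * (b - a) \<le> y2 b - y2 a"
  using has_integral_le_const[OF traj_int(2)[OF assms], of "-9/10"]
    has_integral_ge_const[OF traj_int(2)[OF assms], of "-11/10"]
    f2_between[OF U_vals(1)] v_vals(1) assms by (force, force)

text \<open>Time spans are at most 1/5, so the suprema of the differences satisfy a contraction
  inequality and no Gronwall exponential is needed.\<close>
lemma same_control:
  assumes Y: "traj u y1 y2 t" and W: "traj u w1 w2 t" and t: "t \<le> 1/5" and p: "p \<in> {0..t}" and s: "s \<in> {0..t}"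
  shows "\<bar>(w1 s - y1 s) - (w1 p - y1 p)\<bar> \<le> \<bar>w1 p - y1 p\<bar> / 100 + \<bar>w2 p - y2 p\<bar> / 4"
    "\<bar>(w2 s - y2 s) - (w2 p - y2 p)\<bar> \<le> (\<bar>w1 p - y1 p\<bar> + \<bar>w2 p - y2 p\<bar>) / 100"
proof -
  define \<delta>1 where "\<delta>1 s = w1 s - y1 s" for s
  define \<delta>2 where "\<delta>2 s = w2 s - y2 s" for s
  have t0: "0 \<le> t" using trajD(2)[OF Y] .
  have "continuous_on {0..t} \<delta>1" "continuous_on {0..t} \<delta>2" unfolding \<delta>1_def \<delta>2_def
    using trajD(3,4)[OF Y] trajD(3,4)[OF W] by (auto intro!: continuous_intros)
  from attains_sup_abs[OF this(1) t0] attains_sup_abs[OF this(2) t0]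
  obtain D sD E sE where D: "sD \<in> {0..t}" "D = \<bar>\<delta>1 sD\<bar>" "\<And>r. r \<in> {0..t} \<Longrightarrow> \<bar>\<delta>1 r\<bar> \<le> D"
    and E: "sE \<in> {0..t}" "E = \<bar>\<delta>2 sE\<bar>" "\<And>r. r \<in> {0..t} \<Longrightarrow> \<bar>\<delta>2 r\<bar> \<le> E" by metis
  have nn: "0 \<le> D" "0 \<le> E" using D(2) E(2) by auto
  have 1: "\<bar>\<delta>1 b - \<delta>1 a\<bar> \<le> (E + (D + E) / 100) / 5" "\<bar>\<delta>2 b - \<delta>2 a\<bar> \<le> ((D + E) / 100) / 5"
    if "0 \<le> a" "a \<le> b" "b \<le> t" for a b
  proof -
    have I: "((\<lambda>\<tau>. f1 (w1 \<tau>) (w2 \<tau>) (u \<tau>) - f1 (y1 \<tau>) (y2 \<tau>) (u \<tau>)) has_integral (\<delta>1 b - \<delta>1 a)) {a..b}"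
      "((\<lambda>\<tau>. f2 (w1 \<tau>) (w2 \<tau>) (u \<tau>) - f2 (y1 \<tau>) (y2 \<tau>) (u \<tau>)) has_integral (\<delta>2 b - \<delta>2 a)) {a..b}"
      using has_integral_diff[OF traj_int(1)[OF W that] traj_int(1)[OF Y that]]
        has_integral_diff[OF traj_int(2)[OF W that] traj_int(2)[OF Y that]]
      by (simp_all add: \<delta>1_def \<delta>2_def algebra_simps)
    have b5: "b - a \<le> 1/5" using that t by simp
    have "\<bar>\<delta>1 b - \<delta>1 a\<bar> \<le> (E + (D + E) / 100) * (b - a)"
    proof (rule has_integral_abs_le_const[OF I(1) that(2)])
      fix x assume "x \<in> {a..b}"
      then show "\<bar>f1 (w1 x) (w2 x) (u x) - f1 (y1 x) (y2 x) (u x)\<bar> \<le> E + (D + E) / 100"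
        using D(3)[of x] E(3)[of x] that unfolding \<delta>1_def \<delta>2_def
        by (intro order_trans[OF f1_lip[OF trajD(5)[OF Y, of x]]] add_mono divide_right_mono) auto
    qed
    also have "\<dots> \<le> (E + (D + E) / 100) * (1/5)" using b5 nn by (intro mult_left_mono) auto
    finally show "\<bar>\<delta>1 b - \<delta>1 a\<bar> \<le> (E + (D + E) / 100) / 5" by simp
    have "\<bar>\<delta>2 b - \<delta>2 a\<bar> \<le> ((D + E) / 100) * (b - a)"
    proof (rule has_integral_abs_le_const[OF I(2) that(2)])
      fix x assume "x \<in> {a..b}"
      then show "\<bar>f2 (w1 x) (w2 x) (u x) - f2 (y1 x) (y2 x) (u x)\<bar> \<le> (D + E) / 100"
        using D(3)[of x] E(3)[of x] that unfolding \<delta>1_def \<delta>2_def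
        by (intro order_trans[OF f2_lip[OF trajD(5)[OF Y, of x]]] add_mono divide_right_mono) auto
    qed
    also have "\<dots> \<le> ((D + E) / 100) * (1/5)" using b5 nn by (intro mult_left_mono) auto
    finally show "\<bar>\<delta>2 b - \<delta>2 a\<bar> \<le> ((D + E) / 100) / 5" by simp
  qed
  have 2: "\<bar>\<delta>1 b - \<delta>1 a\<bar> \<le> (E + (D + E) / 100) / 5" "\<bar>\<delta>2 b - \<delta>2 a\<bar> \<le> ((D + E) / 100) / 5"
    if "a \<in> {0..t}" "b \<in> {0..t}" for a b
    using 1[of a b] 1[of b a] that by (cases "a \<le> b"; force simp: abs_minus_commute)+
  define d1 d2 where "d1 = \<bar>\<delta>1 p\<bar>" and "d2 = \<bar>\<delta>2 p\<bar>"
  \<comment> \<open>Evaluating the increments at the maximising times closes a pair of linear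
    inequalities in \<open>D\<close> and \<open>E\<close>, which can be solved because of the factor
    1/5.\<close>
  have "D \<le> d1 + (E + (D + E) / 100) / 5" using 2(1)[OF p D(1)] D(2) d1_def by linarith
  moreover have "E \<le> d2 + ((D + E) / 100) / 5" using 2(2)[OF p E(1)] E(2) d2_def by linarith
  moreover have "0 \<le> d1" "0 \<le> d2" by (auto simp: d1_def d2_def)
  ultimately have "(E + (D + E) / 100) / 5 \<le> d1 / 100 + d2 / 4" "((D + E) / 100) / 5 \<le> (d1 + d2) / 100"
    using nn by (simp_all add: field_simps)
  with 2[OF p s] show "\<bar>(w1 s - y1 s) - (w1 p - y1 p)\<bar> \<le> \<bar>w1 p - y1 p\<bar> / 100 + \<bar>w2 p - y2 p\<bar> / 4"
    "\<bar>(w2 s - y2 s) - (w2 p - y2 p)\<bar> \<le> (\<bar>w1 p - y1 p\<bar> + \<bar>w2 p - y2 p\<bar>) / 100"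
    by (auto simp: d1_def d2_def \<delta>1_def \<delta>2_def)
qed

lemma traj_reflected:
  "double_integrator.traj (\<lambda>x1 x2 w. - r1 (- x1) (- x2) w) (\<lambda>x1 x2 w. - r2 (- x1) (- x2) w) (\<lambda>w. - v w) Ctl u y1 y2 t
    \<longleftrightarrow> traj u (\<lambda>s. - y1 s) (\<lambda>s. - y2 s) t"
proof -
  interpret R: double_integrator "\<lambda>x1 x2 w. - r1 (- x1) (- x2) w" "\<lambda>x1 x2 w. - r2 (- x1) (- x2) w" "\<lambda>w. - v w" U Ctl up um u0
    by (rule reflected)
  have 1: "R.f1 x1 x2 w = - f1 (- x1) (- x2) w" "R.f2 x1 x2 w = - f2 (- x1) (- x2) w" for x1 x2 w
    by (simp_all add: R.f1_def f1_def R.f2_def f2_def)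
  have 2: "continuous_on S (\<lambda>s. - y s) \<longleftrightarrow> continuous_on S y" for y :: "real \<Rightarrow> real" and S
    using continuous_on_minus[of S y] continuous_on_minus[of S "\<lambda>s. - y s"] by auto
  have 3: "((\<lambda>\<tau>. - g \<tau>) has_integral I) S \<longleftrightarrow> (g has_integral (- I)) S" for g :: "real \<Rightarrow> real" and I S
    using has_integral_neg[of "\<lambda>\<tau>. - g \<tau>" I S] has_integral_neg[of g "- I" S] by auto
  show ?thesis unfolding R.traj_def traj_def 1 2 3 by (simp add: algebra_simps)
qed

lemma reaches_reflected:
  "double_integrator.reaches (\<lambda>x1 x2 w. - r1 (- x1) (- x2) w) (\<lambda>x1 x2 w. - r2 (- x1) (- x2) w) (\<lambda>w. - v w) Ctl x1 x2 z1 z2 t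
    \<longleftrightarrow> reaches (- x1) (- x2) (- z1) (- z2) t"
proof -
  interpret R: double_integrator "\<lambda>x1 x2 w. - r1 (- x1) (- x2) w" "\<lambda>x1 x2 w. - r2 (- x1) (- x2) w" "\<lambda>w. - v w" U Ctl up um u0
    by (rule reflected)
  show ?thesis
  proof
    assume "R.reaches x1 x2 z1 z2 t"
    then obtain u y1 y2 s where "s \<le> t" "R.traj u y1 y2 s" "y1 0 = x1" "y2 0 = x2" "y1 s = z1" "y2 s = z2"
      unfolding R.reaches_def by blast
    then show "reaches (- x1) (- x2) (- z1) (- z2) t" unfolding reaches_def traj_reflected
      by (intro exI[of _ u] exI[of _ "\<lambda>s. - y1 s"] exI[of _ "\<lambda>s. - y2 s"] exI[of _ s]) simp
  next
    assume "reaches (- x1) (- x2) (- z1) (- z2) t"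
    then obtain u y1 y2 s where "s \<le> t" "traj u y1 y2 s" "y1 0 = - x1" "y2 0 = - x2" "y1 s = - z1" "y2 s = - z2"
      unfolding reaches_def by blast
    then show "R.reaches x1 x2 z1 z2 t" unfolding R.reaches_def traj_reflected
      by (intro exI[of _ u] exI[of _ "\<lambda>s. - y1 s"] exI[of _ "\<lambda>s. - y2 s"] exI[of _ s]) simp
  qed
qed

text \<open>Followed backwards from the target with control \<open>um\<close>, the height rises at
  rate at least 9/10, so within time 6/5 k it gains k. The horizontal speed stays below 9/10 + 1/10
  = 1, which bounds the drift. This is the price of a vertical correction.\<close>

lemma arrive_from_above:
  assumes k: "0 \<le> k" "k \<le> 1/10" and p: "\<bar>p2\<bar> \<le> 3/4"
  obtains q where "\<bar>q - p1\<bar> \<le> 6/5 * k" "reaches q (p2 + k) p1 p2 (6/5 * k)"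
proof -
  define \<tau> where "\<tau> = 6/5 * k"
  have \<tau>: "0 \<le> \<tau>" "\<tau> \<le> 2/5" using k by (auto simp: \<tau>_def)
  obtain y1 y2 where Y: "traj (\<lambda>_. um) y1 y2 \<tau>" "y1 \<tau> = p1" "y2 \<tau> = p2"
    using flow_back_exists[OF Ctl_const[of um] \<tau>] by blast
  have "p2 + k \<le> y2 0" using um_decreasing(1)[OF Y(1), of 0 \<tau>] \<tau> Y k by (simp add: \<tau>_def)
  then obtain s where s: "0 \<le> s" "s \<le> \<tau>" "y2 s = p2 + k"
    using IVT2'[of y2 \<tau> "p2 + k" 0] trajD(4)[OF Y(1)] \<tau> k Y(3) by auto
  have "\<bar>y2 r\<bar> \<le> 9/10" if "r \<in> {0..\<tau>}" for r
  proof -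
    have "\<bar>y2 r - y2 \<tau>\<bar> \<le> 11/10 * \<bar>r - \<tau>\<bar>" using \<tau> that by (intro traj_y2_inc[OF Y(1)]) auto
    also have "\<dots> \<le> 11/10 * (12/100)" using that k by (auto simp: \<tau>_def)
    finally show ?thesis using p Y(3) by linarith
  qed
  then have "\<bar>y1 s - y1 \<tau>\<bar> \<le> (9/10 + 1/10) * \<bar>s - \<tau>\<bar>" using s \<tau> by (intro traj_y1_inc[OF Y(1)]) auto
  moreover have "\<bar>s - \<tau>\<bar> \<le> \<tau>" using s by auto
  moreover have "reaches (y1 s) (y2 s) (y1 \<tau>) (y2 \<tau>) (\<tau> - s)" using s by (intro reaches_seg[OF Y(1)]) auto
  then have "reaches (y1 s) (p2 + k) p1 p2 (6/5 * k)" using reaches_mono[of _ _ _ _ "\<tau> - s" \<tau>] s Y(2,3) by (auto simp: \<tau>_def)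
  ultimately show thesis using that[of "y1 s"] Y by (auto simp: \<tau>_def)
qed

lemma arrive_from_below:
  assumes k: "0 \<le> k" "k \<le> 1/10" and p: "\<bar>p2\<bar> \<le> 3/4"
  obtains q where "\<bar>q - p1\<bar> \<le> 6/5 * k" "reaches q (p2 - k) p1 p2 (6/5 * k)"
proof -
  interpret R: double_integrator "\<lambda>x1 x2 w. - r1 (- x1) (- x2) w" "\<lambda>x1 x2 w. - r2 (- x1) (- x2) w" "\<lambda>w. - v w" U Ctl up um u0
    by (rule reflected)
  obtain q where q: "\<bar>q - - p1\<bar> \<le> 6/5 * k" "R.reaches q (- p2 + k) (- p1) (- p2) (6/5 * k)"
    using R.arrive_from_above[OF k, of "- p2" "- p1"] p by auto
  show thesis by (rule that[of "- q"]) (use q reaches_reflected[of q "- p2 + k" "- p1" "- p2"] in \<open>auto simp: abs_if split: if_splits\<close>)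
qed

lemma arrive_vertical:
  assumes k: "\<bar>k\<bar> \<le> 1/10" and p: "\<bar>p2\<bar> \<le> 3/4"
  obtains q where "\<bar>q - p1\<bar> \<le> 6/5 * \<bar>k\<bar>" "reaches q (p2 + k) p1 p2 (6/5 * \<bar>k\<bar>)"
proof (cases "0 \<le> k")
  case True
  then show thesis using arrive_from_above[of k p2 p1] k p that by (metis abs_of_nonneg)
next
  case False
  then obtain q where "\<bar>q - p1\<bar> \<le> 6/5 * (- k)" "reaches q (p2 - - k) p1 p2 (6/5 * (- k))"
    using arrive_from_below[of "- k" p2 p1] k p by auto
  then show thesis using that[of q] False by simp
qed

text \<open>Since \<open>f2\<close> is at most -9/10 under \<open>um\<close>, the extremal
  trajectory into the origin is a graph over its height s and solves a scalar equation with
  right-hand side f1/f2. Without perturbation it is the parabola -s^2/2, and the slope bounds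
  enclose the parabola's slope -s.\<close>

lemma half_curve:
  obtains g gd where "g 0 = 0" "\<And>s. s \<in> {0..1/4} \<Longrightarrow> (g has_real_derivative gd s) (at s within {0..1/4})"
    "\<And>s. s \<in> {0..1/4} \<Longrightarrow> gd s * f2 (g s) s um = f1 (g s) s um"
    "\<And>s. s \<in> {0..1/4} \<Longrightarrow> - 6/5 * s \<le> gd s \<and> gd s \<le> - 4/5 * s"
proof -
  define q where "q s x = f1 x s um / f2 x s um" for s x
  have f2m: "- 11/10 \<le> f2 x s um" "f2 x s um \<le> - 9/10" for x s
    using f2_between[OF U_vals(1), of x s] v_vals(1) by auto
  have cont: "continuous_on S (\<lambda>s. r1 (x s) s um)" "continuous_on S (\<lambda>s. r2 (x s) s um)" if "continuous_on S x" for x S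
  proof -
    have *: "continuous_on S (\<lambda>s. r (x s) s um)"
      if r: "\<And>x1 x2 z1 z2. \<bar>r x1 x2 um - r z1 z2 um\<bar> \<le> (\<bar>x1 - z1\<bar> + \<bar>x2 - z2\<bar>) / 100" for r :: "real \<Rightarrow> real \<Rightarrow> 'u \<Rightarrow> real"
      unfolding continuous_on_def
    proof
      fix s assume s: "s \<in> S"
      have "((\<lambda>t. (\<bar>x t - x s\<bar> + \<bar>t - s\<bar>) / 100) \<longlongrightarrow> (\<bar>x s - x s\<bar> + \<bar>s - s\<bar>) / 100) (at s within S)"
        using \<open>continuous_on S x\<close> s by (intro tendsto_intros) (auto simp: continuous_on_def)
      then have "((\<lambda>t. (\<bar>x t - x s\<bar> + \<bar>t - s\<bar>) / 100) \<longlongrightarrow> 0) (at s within S)" by simp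
      then have "((\<lambda>t. r (x t) t um - r (x s) s um) \<longlongrightarrow> 0) (at s within S)"
        by (rule Lim_null_comparison[rotated]) (use r in auto)
      then show "((\<lambda>t. r (x t) t um) \<longlongrightarrow> r (x s) s um) (at s within S)" by (simp add: LIM_zero_iff)
    qed
    show "continuous_on S (\<lambda>s. r1 (x s) s um)" "continuous_on S (\<lambda>s. r2 (x s) s um)"
      using * lip1[OF U_vals(1)] lip2[OF U_vals(1)] by auto
  qed
  have qc: "continuous_on S (\<lambda>s. q s (x s))" if "continuous_on S x" for x S
    unfolding q_def using f2m cont[OF that] by (auto simp: f1_def f2_def intro!: continuous_intros) (metis f2_def f2m(2) less_numeral_extra(3) neg_less_0_iff_less not_le zero_less_divide_iff zero_less_numeral divide_minus_left)
  \<comment> \<open>The quotient estimate gives 6/100; constant 1 is enough for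
    \<open>ode_exists\<close> on an interval of length 1/4.\<close>
  have ql: "\<bar>q s x - q s z\<bar> \<le> 1 * \<bar>x - z\<bar>" if "s \<in> {0..1/4}" for s x z
  proof -
    define A B a b where "A = f1 x s um" and "B = f2 x s um" and "a = f1 z s um" and "b = f2 z s um"
    have A: "\<bar>A - a\<bar> \<le> \<bar>x - z\<bar> / 100" "\<bar>B - b\<bar> \<le> \<bar>x - z\<bar> / 100" "\<bar>a\<bar> \<le> 1"
      using f1_lip[OF U_vals(1), of x s z s] f2_lip[OF U_vals(1), of x s z s] f1_abs[OF U_vals(1), of z s] that
      by (auto simp: A_def B_def a_def b_def)
    have B: "B \<le> - 9/10" "b \<le> - 9/10" using f2m by (auto simp: B_def b_def)
    have Bb: "1/2 \<le> B * b" using mult_mono[of "9/10" "-B" "9/10" "-b"] B by simp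
    have "b \<ge> - 11/10" using f2m by (simp add: b_def)
    have "A / B - a / b = ((A - a) * b - a * (B - b)) / (B * b)" using B by (simp add: field_simps)
    moreover have "\<bar>(A - a) * b - a * (B - b)\<bar> \<le> \<bar>A - a\<bar> * \<bar>b\<bar> + \<bar>a\<bar> * \<bar>B - b\<bar>"
      using abs_triangle_ineq4[of "(A - a) * b" "a * (B - b)"] by (simp add: abs_mult)
    moreover have "\<bar>A - a\<bar> * \<bar>b\<bar> \<le> (\<bar>x - z\<bar> / 100) * 2" using A B \<open>b \<ge> - 11/10\<close> by (intro mult_mono) auto
    moreover have "\<bar>a\<bar> * \<bar>B - b\<bar> \<le> 1 * (\<bar>x - z\<bar> / 100)" using A by (intro mult_mono) auto
    ultimately have "\<bar>A / B - a / b\<bar> \<le> (3/100 * \<bar>x - z\<bar>) / (1/2)"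
      using Bb by (simp only: abs_divide) (rule frac_le, auto)
    then have "\<bar>A / B - a / b\<bar> \<le> 6/100 * \<bar>x - z\<bar>" by simp
    also have "\<dots> \<le> 1 * \<bar>x - z\<bar>" by (intro mult_right_mono) auto
    finally show ?thesis by (simp add: q_def A_def B_def a_def b_def)
  qed
  obtain y where y: "continuous_on UNIV y" "y 0 = 0"
    "\<And>a b. 0 \<le> a \<Longrightarrow> a \<le> b \<Longrightarrow> b \<le> 1/4 \<Longrightarrow> ((\<lambda>s. q s (y s)) has_integral (y b - y a)) {a..b}"
  proof (rule ode_exists[of "1/4" 1 q])
    fix y :: "real \<Rightarrow> real" assume "continuous_on UNIV y"
    then show "(\<lambda>s. q s (y s)) integrable_on {0..1/4}"
      by (intro integrable_continuous_real qc) (auto elim: continuous_on_subset)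
  qed (use ql in auto)
  have yd: "(y has_real_derivative q s (y s)) (at s within {0..1/4})" if "s \<in> {0..1/4}" for s
  proof -
    have "((\<lambda>x. integral {0..x} (\<lambda>s. q s (y s))) has_real_derivative q s (y s)) (at s within {0..1/4})"
      by (rule integral_has_real_derivative[OF qc that]) (rule continuous_on_subset[OF y(1)], simp)
    moreover have "integral {0..x} (\<lambda>s. q s (y s)) = y x" if "x \<in> {0..1/4}" for x
      using y(3)[of 0 x] that y(2) by (auto intro: integral_unique)
    ultimately show ?thesis using that
      by (elim has_field_derivative_transform_within[where d = 1]) auto
  qed
  \<comment> \<open>A crude bound from slope at most 1. Fed back into the perturbation, it shows
    that f1 differs from s by at most s/50, and this gives the sharp slope bounds.\<close>
  have ys: "\<bar>y s\<bar> \<le> s" if "s \<in> {0..1/4}" for s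
  proof -
    have "\<bar>y s - y 0\<bar> \<le> 1 * (s - 0)"
    proof (rule has_integral_abs_le_const[OF y(3)])
      fix x assume x: "x \<in> {0..s}"
      have "\<bar>f1 (y x) x um\<bar> \<le> 9/10" using f1_abs[OF U_vals(1), of "y x" x] x that by auto
      also have "\<dots> \<le> \<bar>f2 (y x) x um\<bar>" using f2m[of "y x" x] by simp
      finally show "\<bar>q x (y x)\<bar> \<le> 1" unfolding q_def abs_divide using f2m[of "y x" x] by (intro divide_le_eq_1[THEN iffD2]) auto
    qed (use that in auto)
    then show ?thesis by (simp add: y(2))
  qed
  show thesis
  proof (rule that[of y "\<lambda>s. q s (y s)"])
    fix s :: real assume s: "s \<in> {0..1/4}"
    show "q s (y s) * f2 (y s) s um = f1 (y s) s um" unfolding q_def using f2m[of "y s" s] by simp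
    have "\<bar>f1 (y s) s um - s\<bar> \<le> s / 50" using r1_small[OF U_vals(1), of "y s" s] ys[OF s] s by (simp add: f1_def)
    then have a: "f1 (y s) s um - s \<le> s / 50" "s - f1 (y s) s um \<le> s / 50" by linarith+
    define F where "F = - f2 (y s) s um"
    have F: "9/10 \<le> F" "F \<le> 11/10" using f2m[of "y s" s] by (auto simp: F_def)
    have q: "q s (y s) = - (f1 (y s) s um / F)" by (simp add: q_def F_def)
    have "4/5 * s * F \<le> 4/5 * s * (11/10)" using F s by (intro mult_left_mono) auto
    also have "\<dots> \<le> f1 (y s) s um" using a s by auto
    finally have "4/5 * s \<le> f1 (y s) s um / F" using F by (simp add: le_divide_eq)
    moreover have "6/5 * s * (9/10) \<le> 6/5 * s * F" using F s by (intro mult_left_mono) auto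
    then have "f1 (y s) s um \<le> 6/5 * s * F" using a s unfolding atLeastAtMost_iff by linarith
    then have "f1 (y s) s um / F \<le> 6/5 * s" using F by (simp add: divide_le_eq)
    ultimately show "- 6/5 * s \<le> q s (y s) \<and> q s (y s) \<le> - 4/5 * s" unfolding q by simp
  qed (use y yd in auto)
qed

end

section \<open>The switching curve\<close>

text \<open>The curve \<open>x1 = \<gamma> x2\<close> consists of the two extremal trajectories that end in the origin.\<close>
locale switching_curve = double_integrator +
  fixes \<gamma> \<gamma>d :: "real \<Rightarrow> real"
  assumes \<gamma>_zero: "\<gamma> 0 = 0"
    and der_pos: "s \<in> {0..1/4} \<Longrightarrow> (\<gamma> has_real_derivative \<gamma>d s) (at s within {0..1/4})"
    and der_neg: "s \<in> {-1/4..0} \<Longrightarrow> (\<gamma> has_real_derivative \<gamma>d s) (at s within {-1/4..0})"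
    and slope_um: "s \<in> {0..1/4} \<Longrightarrow> \<gamma>d s * f2 (\<gamma> s) s um = f1 (\<gamma> s) s um"
    and slope_up: "s \<in> {-1/4..0} \<Longrightarrow> \<gamma>d s * f2 (\<gamma> s) s up = f1 (\<gamma> s) s up"
    and \<gamma>d_bnd: "s \<in> {-1/4..1/4} \<Longrightarrow> - 6/5 * \<bar>s\<bar> \<le> \<gamma>d s \<and> \<gamma>d s \<le> - 4/5 * \<bar>s\<bar>"

lemma has_real_derivative_reflect:
  fixes g :: "real \<Rightarrow> real"
  assumes "(g has_real_derivative d) (at (- s) within {a..b})"
  shows "((\<lambda>s. - g (- s)) has_real_derivative d) (at s within {-b..-a})"
proof -
  have im: "uminus ` {-b..-a} = {a..b}" by force
  have "((\<lambda>s. g (- s)) has_real_derivative d * (- 1)) (at s within {-b..-a})"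
    by (rule DERIV_image_chain[of g d uminus s "{-b..-a}", unfolded o_def]) (auto simp: im assms intro!: derivative_eq_intros)
  from DERIV_minus[OF this] show ?thesis by simp
qed

lemma (in double_integrator) curve_exists: "\<exists>\<gamma> \<gamma>d. switching_curve r1 r2 v U Ctl um up u0 \<gamma> \<gamma>d"
proof -
  interpret R: double_integrator "\<lambda>x1 x2 w. - r1 (- x1) (- x2) w" "\<lambda>x1 x2 w. - r2 (- x1) (- x2) w" "\<lambda>w. - v w" U Ctl up um u0
    by (rule reflected)
  have ref: "R.f1 x1 x2 w = - f1 (- x1) (- x2) w" "R.f2 x1 x2 w = - f2 (- x1) (- x2) w" for x1 x2 w
    by (simp_all add: R.f1_def f1_def R.f2_def f2_def)
  obtain g gd where g: "g 0 = 0" "\<And>s. s \<in> {0..1/4} \<Longrightarrow> (g has_real_derivative gd s) (at s within {0..1/4})"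
    "\<And>s. s \<in> {0..1/4} \<Longrightarrow> gd s * f2 (g s) s um = f1 (g s) s um"
    "\<And>s. s \<in> {0..1/4} \<Longrightarrow> - 6/5 * s \<le> gd s \<and> gd s \<le> - 4/5 * s" by (rule half_curve) (rule that)
  obtain h hd where h: "h 0 = 0" "\<And>s. s \<in> {0..1/4} \<Longrightarrow> (h has_real_derivative hd s) (at s within {0..1/4})"
    "\<And>s. s \<in> {0..1/4} \<Longrightarrow> hd s * R.f2 (h s) s up = R.f1 (h s) s up"
    "\<And>s. s \<in> {0..1/4} \<Longrightarrow> - 6/5 * s \<le> hd s \<and> hd s \<le> - 4/5 * s" by (rule R.half_curve) (rule that)
  define \<gamma> where "\<gamma> s = (if 0 \<le> s then g s else - h (- s))" for s
  define \<gamma>d where "\<gamma>d s = (if 0 \<le> s then gd s else hd (- s))" for s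
  \<comment> \<open>The negative half is the reflected system's branch, reflected back. Both slopes
    vanish at 0, so the two descriptions also agree there.\<close>
  have \<gamma>n: "\<gamma> s = - h (- s)" "\<gamma>d s = hd (- s)" if "s \<le> 0" for s
    using that g(1) h(1) g(4)[of 0] h(4)[of 0] by (cases "s = 0"; simp add: \<gamma>_def \<gamma>d_def)+
  have \<gamma>p: "\<gamma> s = g s" "\<gamma>d s = gd s" if "0 \<le> s" for s using that by (auto simp: \<gamma>_def \<gamma>d_def)
  have "switching_curve r1 r2 v U Ctl um up u0 \<gamma> \<gamma>d"
  proof
    show "\<gamma> 0 = 0" by (simp add: \<gamma>_def g)
    show "(\<gamma> has_real_derivative \<gamma>d s) (at s within {0..1/4})" if "s \<in> {0..1/4}" for s
      unfolding \<gamma>p(2)[of s, OF that[unfolded atLeastAtMost_iff, THEN conjunct1]]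
      by (rule has_field_derivative_transform_within[OF g(2)[OF that], of 1]) (use that \<gamma>p in auto)
    show "(\<gamma> has_real_derivative \<gamma>d s) (at s within {-1/4..0})" if "s \<in> {-1/4..0}" for s
    proof -
      have "((\<lambda>s. - h (- s)) has_real_derivative hd (- s)) (at s within {-(1/4)..-0})"
        by (rule has_real_derivative_reflect[OF h(2)]) (use that in auto)
      then have "((\<lambda>s. - h (- s)) has_real_derivative \<gamma>d s) (at s within {-1/4..0})" using that \<gamma>n(2)[of s] by simp
      then show ?thesis
        by (rule has_field_derivative_transform_within[of _ _ _ _ 1]) (use that \<gamma>n(1) in auto)
    qed
    show "\<gamma>d s * f2 (\<gamma> s) s um = f1 (\<gamma> s) s um" if "s \<in> {0..1/4}" for s using g(3)[OF that] that \<gamma>p by auto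
    show "\<gamma>d s * f2 (\<gamma> s) s up = f1 (\<gamma> s) s up" if "s \<in> {-1/4..0}" for s
      using h(3)[of "- s"] that \<gamma>n[of s] by (auto simp: ref)
    show "- 6/5 * \<bar>s\<bar> \<le> \<gamma>d s \<and> \<gamma>d s \<le> - 4/5 * \<bar>s\<bar>" if "s \<in> {-1/4..1/4}" for s
      using g(4)[of s] h(4)[of "- s"] that by (auto simp: \<gamma>d_def)
  qed
  then show ?thesis by blast
qed

context switching_curve
begin

lemma reflected_curve: "switching_curve (\<lambda>x1 x2 w. - r1 (- x1) (- x2) w) (\<lambda>x1 x2 w. - r2 (- x1) (- x2) w)
    (\<lambda>w. - v w) U Ctl up um u0 (\<lambda>s. - \<gamma> (- s)) (\<lambda>s. \<gamma>d (- s))"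
proof -
  interpret R: double_integrator "\<lambda>x1 x2 w. - r1 (- x1) (- x2) w" "\<lambda>x1 x2 w. - r2 (- x1) (- x2) w" "\<lambda>w. - v w" U Ctl up um u0
    by (rule reflected)
  have ref: "R.f1 x1 x2 w = - f1 (- x1) (- x2) w" "R.f2 x1 x2 w = - f2 (- x1) (- x2) w" for x1 x2 w
    by (simp_all add: R.f1_def f1_def R.f2_def f2_def)
  show ?thesis
  proof
    show "((\<lambda>s. - \<gamma> (- s)) has_real_derivative \<gamma>d (- s)) (at s within {0..1/4})" if "s \<in> {0..1/4}" for s
      using has_real_derivative_reflect[OF der_neg[of "- s"]] that by simp
    show "((\<lambda>s. - \<gamma> (- s)) has_real_derivative \<gamma>d (- s)) (at s within {-1/4..0})" if "s \<in> {-1/4..0}" for s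
      using has_real_derivative_reflect[OF der_pos[of "- s"]] that by simp
    show "\<gamma>d (- s) * R.f2 (- \<gamma> (- s)) s up = R.f1 (- \<gamma> (- s)) s up" if "s \<in> {0..1/4}" for s
      using slope_up[of "- s"] that by (simp add: ref)
    show "\<gamma>d (- s) * R.f2 (- \<gamma> (- s)) s um = R.f1 (- \<gamma> (- s)) s um" if "s \<in> {-1/4..0}" for s
      using slope_um[of "- s"] that by (simp add: ref)
    show "- 6/5 * \<bar>s\<bar> \<le> \<gamma>d (- s) \<and> \<gamma>d (- s) \<le> - 4/5 * \<bar>s\<bar>" if "s \<in> {-1/4..1/4}" for s
      using \<gamma>d_bnd[of "- s"] that by simp
  qed (simp add: \<gamma>_zero)
qed

lemma curve_mvt:
  assumes "0 \<le> a" "a \<le> b" "b \<le> 1/4"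
  obtains \<xi> where "a \<le> \<xi>" "\<xi> \<le> b" "\<gamma> b - \<gamma> a = \<gamma>d \<xi> * (b - a)"
proof -
  have "(\<gamma> has_derivative (\<lambda>h. \<gamma>d x * h)) (at x within {a..b})" if "a \<le> x" "x \<le> b" for x
    using has_field_derivative_subset[OF der_pos[of x], of "{a..b}"] that assms by (auto simp: has_field_derivative_def)
  from mvt_very_simple[OF assms(2) this] show thesis using that by auto
qed

text \<open>The constant 3/10 is the slope bound 6/5 |s| at |s| = 1/4. That it is far below 2 later
  makes the oblique lines transversal to the curve.\<close>

lemma curve_pos:
  assumes "0 \<le> s" "s \<le> 1/4"
  shows "- 3/10 * s \<le> \<gamma> s" "\<gamma> s \<le> 0"
proof -
  obtain \<xi> where x: "0 \<le> \<xi>" "\<xi> \<le> s" "\<gamma> s - \<gamma> 0 = \<gamma>d \<xi> * (s - 0)" using curve_mvt[of 0 s] assms by auto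
  then have "- 3/10 \<le> \<gamma>d \<xi>" "\<gamma>d \<xi> \<le> 0" using \<gamma>d_bnd[of \<xi>] assms by auto
  with x(3) show "- 3/10 * s \<le> \<gamma> s" "\<gamma> s \<le> 0"
    using mult_right_mono[of "-3/10" "\<gamma>d \<xi>" s] mult_right_mono[of "\<gamma>d \<xi>" 0 s] assms by (auto simp: \<gamma>_zero)
qed

lemma curve_neg:
  assumes "- 1/4 \<le> s" "s \<le> 0"
  shows "0 \<le> \<gamma> s" "\<gamma> s \<le> - 3/10 * s"
proof -
  interpret R: switching_curve "\<lambda>x1 x2 w. - r1 (- x1) (- x2) w" "\<lambda>x1 x2 w. - r2 (- x1) (- x2) w" "\<lambda>w. - v w" U Ctl up um u0
    "\<lambda>s. - \<gamma> (- s)" "\<lambda>s. \<gamma>d (- s)" by (rule reflected_curve)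
  show "0 \<le> \<gamma> s" "\<gamma> s \<le> - 3/10 * s" using R.curve_pos[of "- s"] assms by auto
qed

lemma curve_lip_pos:
  assumes "0 \<le> a" "a \<le> b" "b \<le> 1/4"
  shows "\<bar>\<gamma> b - \<gamma> a\<bar> \<le> 3/10 * (b - a)"
proof -
  obtain \<xi> where x: "a \<le> \<xi>" "\<xi> \<le> b" "\<gamma> b - \<gamma> a = \<gamma>d \<xi> * (b - a)" using curve_mvt[of a b] assms by auto
  then have "\<bar>\<gamma>d \<xi>\<bar> \<le> 3/10" using \<gamma>d_bnd[of \<xi>] assms by auto
  then show ?thesis unfolding x(3) using mult_right_mono[of "\<bar>\<gamma>d \<xi>\<bar>" "3/10" "b - a"] assms by (simp add: abs_mult)
qed

lemma curve_lip_neg: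
  assumes "- 1/4 \<le> a" "a \<le> b" "b \<le> 0"
  shows "\<bar>\<gamma> b - \<gamma> a\<bar> \<le> 3/10 * (b - a)"
proof -
  interpret R: switching_curve "\<lambda>x1 x2 w. - r1 (- x1) (- x2) w" "\<lambda>x1 x2 w. - r2 (- x1) (- x2) w" "\<lambda>w. - v w" U Ctl up um u0
    "\<lambda>s. - \<gamma> (- s)" "\<lambda>s. \<gamma>d (- s)" by (rule reflected_curve)
  show ?thesis using R.curve_lip_pos[of "- b" "- a"] assms by (auto simp: abs_minus_commute)
qed

lemma curve_lip_le:
  assumes "- 1/4 \<le> a" "a \<le> b" "b \<le> 1/4"
  shows "\<bar>\<gamma> b - \<gamma> a\<bar> \<le> 3/10 * (b - a)"
proof -
  consider "0 \<le> a" | "b \<le> 0" | "a \<le> 0" "0 \<le> b" by linarith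
  then show ?thesis
  proof cases
    case 3
    then have "\<bar>\<gamma> b - \<gamma> 0\<bar> \<le> 3/10 * (b - 0)" "\<bar>\<gamma> 0 - \<gamma> a\<bar> \<le> 3/10 * (0 - a)"
      using curve_lip_pos[of 0 b] curve_lip_neg[of a 0] assms by auto
    then show ?thesis by argo
  qed (use curve_lip_pos[of a b] curve_lip_neg[of a b] assms in auto)
qed

lemma curve_lip:
  assumes "\<bar>a\<bar> \<le> 1/4" "\<bar>b\<bar> \<le> 1/4"
  shows "\<bar>\<gamma> b - \<gamma> a\<bar> \<le> 3/10 * \<bar>b - a\<bar>"
  using curve_lip_le[of a b] curve_lip_le[of b a] assms by (cases "a \<le> b") (auto simp: abs_minus_commute)

lemma curve_abs: "\<bar>s\<bar> \<le> 1/4 \<Longrightarrow> \<bar>\<gamma> s\<bar> \<le> 3/10 * \<bar>s\<bar>"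
  using curve_lip[of 0 s] by (simp add: \<gamma>_zero)

lemma curve_continuous: "continuous_on {-1/4..1/4} \<gamma>"
proof (rule continuous_onI)
  fix x e :: real assume x: "x \<in> {-1/4..1/4}" "0 < e"
  show "\<exists>d>0. \<forall>x'\<in>{-1/4..1/4}. dist x' x < d \<longrightarrow> dist (\<gamma> x') (\<gamma> x) \<le> e"
  proof (intro exI[of _ e] conjI ballI impI)
    fix x' :: real assume "x' \<in> {-1/4..1/4}" "dist x' x < e"
    then have "\<bar>x' - x\<bar> < e" "\<bar>x\<bar> \<le> 1/4" "\<bar>x'\<bar> \<le> 1/4" using x by (auto simp: dist_real_def abs_le_iff)
    with curve_lip[of x x'] have "\<bar>\<gamma> x' - \<gamma> x\<bar> \<le> 3/10 * \<bar>x' - x\<bar>" "\<bar>x' - x\<bar> < e" by auto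
    then show "dist (\<gamma> x') (\<gamma> x) \<le> e" unfolding dist_real_def by argo
  qed (use x in auto)
qed

text \<open>The curve is semipermeable: relative to it every admissible velocity points to the right,
  up to an error that vanishes on the curve.\<close>
lemma semipermeable:
  assumes s: "s \<in> {0..1/4}" and w: "w \<in> U"
  shows "- \<bar>e\<bar> / 50 \<le> f1 (\<gamma> s + e) s w - \<gamma>d s * f2 (\<gamma> s + e) s w"
    "\<bar>f1 (\<gamma> s + e) s um - \<gamma>d s * f2 (\<gamma> s + e) s um\<bar> \<le> \<bar>e\<bar> / 50"
proof -
  have d: "- 3/10 \<le> \<gamma>d s" "\<gamma>d s \<le> - 4/5 * s" "\<gamma>d s \<le> 0" using \<gamma>d_bnd[of s] s by auto
  have shift: "\<bar>(f1 (\<gamma> s + e) s w - \<gamma>d s * f2 (\<gamma> s + e) s w) - (f1 (\<gamma> s) s w - \<gamma>d s * f2 (\<gamma> s) s w)\<bar> \<le> \<bar>e\<bar> / 50"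
    if w: "w \<in> U" for w
  proof -
    have 1: "\<bar>f1 (\<gamma> s + e) s w - f1 (\<gamma> s) s w\<bar> \<le> \<bar>e\<bar> / 100" "\<bar>f2 (\<gamma> s + e) s w - f2 (\<gamma> s) s w\<bar> \<le> \<bar>e\<bar> / 100"
      using f1_lip[OF w, of "\<gamma> s + e" s "\<gamma> s" s] f2_lip[OF w, of "\<gamma> s + e" s "\<gamma> s" s] by auto
    have "\<bar>\<gamma>d s * (f2 (\<gamma> s + e) s w - f2 (\<gamma> s) s w)\<bar> \<le> 1 * (\<bar>e\<bar> / 100)"
      unfolding abs_mult using d 1(2) by (intro mult_mono) auto
    then show ?thesis using 1(1) unfolding right_diff_distrib by linarith
  qed
  define q where "q = 1 + v w"
  have q: "0 \<le> q" using v_bnd[OF w] by (simp add: q_def)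
  have m: "(\<bar>\<gamma> s\<bar> + \<bar>s\<bar>) / 100 \<le> s / 50" using curve_abs[of s] s by auto
  have A: "- (s / 50 * q) \<le> f1 (\<gamma> s) s w - f1 (\<gamma> s) s um"
    using dm1[OF w, of "\<gamma> s" s] mult_right_mono[OF m q] unfolding f1_def q_def by linarith
  have "s / 50 * q \<le> q / 10" using mult_right_mono[of "s/50" "1/10" q] s q by auto
  then have B: "9/10 * q \<le> f2 (\<gamma> s) s w - f2 (\<gamma> s) s um"
    using dm2[OF w, of "\<gamma> s" s] mult_right_mono[OF m q] unfolding f2_def q_def v_vals by argo
  \<comment> \<open>Replacing \<open>um\<close> by w costs at most s/50 q in the first velocity
    component. It gains at least 9/10 q in the second, which is weighted with a factor of at least
    4/5 s, so the gain dominates.\<close>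
  have "4/5 * s * (9/10 * q) \<le> (- \<gamma>d s) * (f2 (\<gamma> s) s w - f2 (\<gamma> s) s um)"
    using d s q B by (intro mult_mono) auto
  moreover have "s / 50 * q \<le> 4/5 * s * (9/10 * q)" using mult_right_mono[of "1/50" "4/5*9/10" "s * q"] s q by simp
  ultimately have "0 \<le> f1 (\<gamma> s) s w - \<gamma>d s * f2 (\<gamma> s) s w"
    using A slope_um[OF s] by (simp add: algebra_simps)
  then show "- \<bar>e\<bar> / 50 \<le> f1 (\<gamma> s + e) s w - \<gamma>d s * f2 (\<gamma> s + e) s w" using shift[OF w] by linarith
  show "\<bar>f1 (\<gamma> s + e) s um - \<gamma>d s * f2 (\<gamma> s + e) s um\<bar> \<le> \<bar>e\<bar> / 50"
    using shift[OF U_vals(1)] slope_um[OF s] by simp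
qed

text \<open>The horizontal offset from the curve can decrease only at a rate proportional to its own
  size, and along \<open>um\<close> it can also increase only at such a rate. The control is merely
  measurable, so there is no pointwise chain rule; the slope of the curve is frozen on short
  intervals instead and \<open>increment_lower_bound\<close> removes the error.\<close>

lemma curve_offset_increment:
  assumes Y: "traj u y1 y2 t" and ab: "0 \<le> a" "a \<le> b" "b \<le> t"
    and r: "\<And>s. s \<in> {a..b} \<Longrightarrow> 0 \<le> y2 s \<and> y2 s \<le> 1/4" and \<beta>: "\<And>s. s \<in> {a..b} \<Longrightarrow> \<bar>y1 s - \<gamma> (y2 s)\<bar> \<le> \<beta>"
  shows "- (\<beta> / 50) * (b - a) \<le> (y1 b - \<gamma> (y2 b)) - (y1 a - \<gamma> (y2 a))"
    "u = (\<lambda>_. um) \<Longrightarrow> (y1 b - \<gamma> (y2 b)) - (y1 a - \<gamma> (y2 a)) \<le> (\<beta> / 50) * (b - a)"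
proof -
  \<comment> \<open>The mean value theorem for \<open>\<gamma>\<close> gives an intermediate height,
    and the intermediate value theorem for \<open>y2\<close> gives a time at which it is attained.
    Slope and state are frozen at that time, while the control keeps its own time.\<close>
  have freeze: "\<exists>\<sigma>. \<sigma> \<in> {s..s'} \<and>
      ((\<lambda>\<tau>. f1 (y1 \<tau>) (y2 \<tau>) (u \<tau>) - \<gamma>d (y2 \<sigma>) * f2 (y1 \<tau>) (y2 \<tau>) (u \<tau>)) has_integral
        ((y1 s' - \<gamma> (y2 s')) - (y1 s - \<gamma> (y2 s)))) {s..s'} \<and>
      (\<forall>\<tau>\<in>{s..s'}. \<bar>(f1 (y1 \<tau>) (y2 \<tau>) (u \<tau>) - \<gamma>d (y2 \<sigma>) * f2 (y1 \<tau>) (y2 \<tau>) (u \<tau>)) -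
        (f1 (y1 \<sigma>) (y2 \<sigma>) (u \<tau>) - \<gamma>d (y2 \<sigma>) * f2 (y1 \<sigma>) (y2 \<sigma>) (u \<tau>))\<bar> \<le> 2 * (s' - s))"
    if s: "a \<le> s" "s \<le> s'" "s' \<le> b" for s s'
  proof -
    have r': "0 \<le> y2 x \<and> y2 x \<le> 1/4" if "x \<in> {s..s'}" for x using r[of x] that s by auto
    have c: "continuous_on {s..s'} y2" using traj_cont(2)[OF Y] s ab by auto
    obtain \<sigma> where \<sigma>: "\<sigma> \<in> {s..s'}" "\<gamma> (y2 s') - \<gamma> (y2 s) = \<gamma>d (y2 \<sigma>) * (y2 s' - y2 s)"
    proof (cases "y2 s \<le> y2 s'")
      case True
      then obtain \<xi> where x: "y2 s \<le> \<xi>" "\<xi> \<le> y2 s'" "\<gamma> (y2 s') - \<gamma> (y2 s) = \<gamma>d \<xi> * (y2 s' - y2 s)"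
        using curve_mvt[of "y2 s" "y2 s'"] r' s by auto
      then obtain \<sigma> where "s \<le> \<sigma>" "\<sigma> \<le> s'" "y2 \<sigma> = \<xi>" using IVT'[of y2 s \<xi> s'] c s by auto
      then show ?thesis using that x by auto
    next
      case False
      then obtain \<xi> where x: "y2 s' \<le> \<xi>" "\<xi> \<le> y2 s" "\<gamma> (y2 s) - \<gamma> (y2 s') = \<gamma>d \<xi> * (y2 s - y2 s')"
        using curve_mvt[of "y2 s'" "y2 s"] r' s by auto
      then obtain \<sigma> where "s \<le> \<sigma>" "\<sigma> \<le> s'" "y2 \<sigma> = \<xi>" using IVT2'[of y2 s' \<xi> s] c s by auto
      then show ?thesis using that[of \<sigma>] x by (auto simp: algebra_simps)
    qed
    have st: "0 \<le> s" "s' \<le> t" using s ab by auto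
    have "((\<lambda>\<tau>. f1 (y1 \<tau>) (y2 \<tau>) (u \<tau>) - \<gamma>d (y2 \<sigma>) * f2 (y1 \<tau>) (y2 \<tau>) (u \<tau>)) has_integral
        ((y1 s' - y1 s) - \<gamma>d (y2 \<sigma>) * (y2 s' - y2 s))) {s..s'}"
      by (intro has_integral_diff has_integral_mult_right traj_int[OF Y] st s)
    then have I: "((\<lambda>\<tau>. f1 (y1 \<tau>) (y2 \<tau>) (u \<tau>) - \<gamma>d (y2 \<sigma>) * f2 (y1 \<tau>) (y2 \<tau>) (u \<tau>)) has_integral
        ((y1 s' - \<gamma> (y2 s')) - (y1 s - \<gamma> (y2 s)))) {s..s'}"
      unfolding \<sigma>(2)[symmetric] by (simp add: algebra_simps)
    have err: "\<bar>(f1 (y1 \<tau>) (y2 \<tau>) (u \<tau>) - \<gamma>d (y2 \<sigma>) * f2 (y1 \<tau>) (y2 \<tau>) (u \<tau>)) -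
        (f1 (y1 \<sigma>) (y2 \<sigma>) (u \<tau>) - \<gamma>d (y2 \<sigma>) * f2 (y1 \<sigma>) (y2 \<sigma>) (u \<tau>))\<bar> \<le> 2 * (s' - s)"
      if \<tau>: "\<tau> \<in> {s..s'}" for \<tau>
    proof -
      define h where "h = s' - s"
      have w: "u \<tau> \<in> U" using trajD(5)[OF Y] .
      have ts: "\<bar>\<tau> - \<sigma>\<bar> \<le> h" using \<tau> \<sigma>(1) by (auto simp: h_def)
      have 2: "\<bar>y2 \<tau> - y2 \<sigma>\<bar> \<le> 11/10 * h"
      proof -
        have "\<sigma> \<in> {0..t}" "\<tau> \<in> {0..t}" using \<tau> \<sigma>(1) s ab by auto
        from traj_y2_inc[OF Y this] ts show ?thesis by argo
      qed
      have T: "traj (\<lambda>x. u (x + s)) (\<lambda>x. y1 (x + s)) (\<lambda>x. y2 (x + s)) (s' - s)"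
        using traj_tail[OF traj_init[OF Y, of s'], of s] s ab by auto
      have "\<bar>y1 (\<tau> - s + s) - y1 (\<sigma> - s + s)\<bar> \<le> (1/4 + 1/10) * \<bar>(\<tau> - s) - (\<sigma> - s)\<bar>"
        by (rule traj_y1_inc[OF T]) (use \<tau> \<sigma>(1) r' in \<open>simp_all add: abs_le_iff\<close>)
      then have "\<bar>y1 \<tau> - y1 \<sigma>\<bar> \<le> (1/4 + 1/10) * \<bar>\<tau> - \<sigma>\<bar>" by simp
      then have 1: "\<bar>y1 \<tau> - y1 \<sigma>\<bar> \<le> 4/10 * h" using ts by argo
      have 3: "\<bar>f1 (y1 \<tau>) (y2 \<tau>) (u \<tau>) - f1 (y1 \<sigma>) (y2 \<sigma>) (u \<tau>)\<bar> \<le> 11/10 * h + (4/10 * h + 11/10 * h) / 100"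
        using 1 2 by (intro order_trans[OF f1_lip[OF w]] add_mono divide_right_mono) auto
      have 4: "\<bar>f2 (y1 \<tau>) (y2 \<tau>) (u \<tau>) - f2 (y1 \<sigma>) (y2 \<sigma>) (u \<tau>)\<bar> \<le> (4/10 * h + 11/10 * h) / 100"
        using 1 2 by (intro order_trans[OF f2_lip[OF w]] add_mono divide_right_mono) auto
      have "\<bar>\<gamma>d (y2 \<sigma>)\<bar> \<le> 1" using \<gamma>d_bnd[of "y2 \<sigma>"] r'[OF \<sigma>(1)] by auto
      then have "\<bar>\<gamma>d (y2 \<sigma>) * (f2 (y1 \<tau>) (y2 \<tau>) (u \<tau>) - f2 (y1 \<sigma>) (y2 \<sigma>) (u \<tau>))\<bar> \<le> 1 * ((4/10 * h + 11/10 * h) / 100)"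
        unfolding abs_mult using 4 by (intro mult_mono) auto
      moreover have "0 \<le> h" using s by (simp add: h_def)
      moreover have "\<bar>(A - g * B) - (a - g * b)\<bar> \<le> 2 * h"
        if "\<bar>g * (B - b)\<bar> \<le> 1 * ((4/10 * h + 11/10 * h) / 100)" "0 \<le> h" "\<bar>A - a\<bar> \<le> 11/10 * h + (4/10 * h + 11/10 * h) / 100"
        for A B a b g :: real
        proof -
        have "(A - g * B) - (a - g * b) = (A - a) - g * (B - b)" by (simp add: algebra_simps)
        then have "\<bar>(A - g * B) - (a - g * b)\<bar> \<le> \<bar>A - a\<bar> + \<bar>g * (B - b)\<bar>" by (metis abs_triangle_ineq4)
        with that show ?thesis by argo
      qed
      ultimately show ?thesis using 3 unfolding h_def[symmetric] by blast
    qed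
    show ?thesis by (rule exI[of _ \<sigma>]) (intro conjI ballI \<sigma>(1) I err)
  qed
  show "- (\<beta> / 50) * (b - a) \<le> (y1 b - \<gamma> (y2 b)) - (y1 a - \<gamma> (y2 a))"
  proof (rule increment_lower_bound[where C = 2, OF ab(2)])
    fix s s' assume s: "a \<le> s" "s \<le> s'" "s' \<le> b"
    obtain \<sigma> where \<sigma>: "\<sigma> \<in> {s..s'}"
      and I: "((\<lambda>\<tau>. f1 (y1 \<tau>) (y2 \<tau>) (u \<tau>) - \<gamma>d (y2 \<sigma>) * f2 (y1 \<tau>) (y2 \<tau>) (u \<tau>)) has_integral
        ((y1 s' - \<gamma> (y2 s')) - (y1 s - \<gamma> (y2 s)))) {s..s'}"
      and err: "\<forall>\<tau>\<in>{s..s'}. \<bar>(f1 (y1 \<tau>) (y2 \<tau>) (u \<tau>) - \<gamma>d (y2 \<sigma>) * f2 (y1 \<tau>) (y2 \<tau>) (u \<tau>)) -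
        (f1 (y1 \<sigma>) (y2 \<sigma>) (u \<tau>) - \<gamma>d (y2 \<sigma>) * f2 (y1 \<sigma>) (y2 \<sigma>) (u \<tau>))\<bar> \<le> 2 * (s' - s)"
      using freeze[OF s] by (elim exE conjE) (rule that)
    have \<beta>\<sigma>: "\<bar>y1 \<sigma> - \<gamma> (y2 \<sigma>)\<bar> \<le> \<beta>" using \<beta>[of \<sigma>] \<sigma> s by simp
    have "(- (\<beta> / 50) - 2 * (s' - s)) * (s' - s) \<le> (y1 s' - \<gamma> (y2 s')) - (y1 s - \<gamma> (y2 s))"
    proof (rule has_integral_ge_const[OF I s(2)])
      fix \<tau> assume \<tau>: "\<tau> \<in> {s..s'}"
      have "- \<bar>y1 \<sigma> - \<gamma> (y2 \<sigma>)\<bar> / 50 \<le> f1 (y1 \<sigma>) (y2 \<sigma>) (u \<tau>) - \<gamma>d (y2 \<sigma>) * f2 (y1 \<sigma>) (y2 \<sigma>) (u \<tau>)"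
        using semipermeable(1)[of "y2 \<sigma>" "u \<tau>" "y1 \<sigma> - \<gamma> (y2 \<sigma>)"] r[of \<sigma>] \<sigma> s trajD(5)[OF Y] by simp
      then show "- (\<beta> / 50) - 2 * (s' - s) \<le> f1 (y1 \<tau>) (y2 \<tau>) (u \<tau>) - \<gamma>d (y2 \<sigma>) * f2 (y1 \<tau>) (y2 \<tau>) (u \<tau>)"
        using err[rule_format, OF \<tau>] \<beta>\<sigma> by argo
    qed
    then show "- (\<beta> / 50) * (s' - s) - 2 * (s' - s)\<^sup>2 \<le> (y1 s' - \<gamma> (y2 s')) - (y1 s - \<gamma> (y2 s))"
      by (simp add: algebra_simps power2_eq_square)
  qed
  assume um: "u = (\<lambda>_. um)"
  have "- (\<beta> / 50) * (b - a) \<le> (- (y1 b - \<gamma> (y2 b))) - (- (y1 a - \<gamma> (y2 a)))"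
  proof (rule increment_lower_bound[where C = 2, OF ab(2)])
    fix s s' assume s: "a \<le> s" "s \<le> s'" "s' \<le> b"
    obtain \<sigma> where \<sigma>: "\<sigma> \<in> {s..s'}"
      and I: "((\<lambda>\<tau>. f1 (y1 \<tau>) (y2 \<tau>) (u \<tau>) - \<gamma>d (y2 \<sigma>) * f2 (y1 \<tau>) (y2 \<tau>) (u \<tau>)) has_integral
        ((y1 s' - \<gamma> (y2 s')) - (y1 s - \<gamma> (y2 s)))) {s..s'}"
      and err: "\<forall>\<tau>\<in>{s..s'}. \<bar>(f1 (y1 \<tau>) (y2 \<tau>) (u \<tau>) - \<gamma>d (y2 \<sigma>) * f2 (y1 \<tau>) (y2 \<tau>) (u \<tau>)) -
        (f1 (y1 \<sigma>) (y2 \<sigma>) (u \<tau>) - \<gamma>d (y2 \<sigma>) * f2 (y1 \<sigma>) (y2 \<sigma>) (u \<tau>))\<bar> \<le> 2 * (s' - s)"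
      using freeze[OF s] by (elim exE conjE) (rule that)
    have \<beta>\<sigma>: "\<bar>y1 \<sigma> - \<gamma> (y2 \<sigma>)\<bar> \<le> \<beta>" using \<beta>[of \<sigma>] \<sigma> s by simp
    have "(y1 s' - \<gamma> (y2 s')) - (y1 s - \<gamma> (y2 s)) \<le> (\<beta> / 50 + 2 * (s' - s)) * (s' - s)"
    proof (rule has_integral_le_const[OF I s(2)])
      fix \<tau> assume \<tau>: "\<tau> \<in> {s..s'}"
      have "\<bar>f1 (y1 \<sigma>) (y2 \<sigma>) (u \<tau>) - \<gamma>d (y2 \<sigma>) * f2 (y1 \<sigma>) (y2 \<sigma>) (u \<tau>)\<bar> \<le> \<bar>y1 \<sigma> - \<gamma> (y2 \<sigma>)\<bar> / 50"
        using semipermeable(2)[of "y2 \<sigma>" um "y1 \<sigma> - \<gamma> (y2 \<sigma>)"] r[of \<sigma>] \<sigma> s U_vals(1) um by simp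
      then show "f1 (y1 \<tau>) (y2 \<tau>) (u \<tau>) - \<gamma>d (y2 \<sigma>) * f2 (y1 \<tau>) (y2 \<tau>) (u \<tau>) \<le> \<beta> / 50 + 2 * (s' - s)"
        using err[rule_format, OF \<tau>] \<beta>\<sigma> by argo
    qed
    then show "- (\<beta> / 50) * (s' - s) - 2 * (s' - s)\<^sup>2 \<le> (- (y1 s' - \<gamma> (y2 s'))) - (- (y1 s - \<gamma> (y2 s)))"
      by (simp add: algebra_simps power2_eq_square)
  qed
  then show "(y1 b - \<gamma> (y2 b)) - (y1 a - \<gamma> (y2 a)) \<le> (\<beta> / 50) * (b - a)" by simp
qed

end

section \<open>Comparing arrival times\<close>

context switching_curve
begin

lemma offset_continuous:
  assumes "traj u y1 y2 t" "0 \<le> a" "b \<le> t" "\<And>s. s \<in> {a..b} \<Longrightarrow> \<bar>y2 s\<bar> \<le> 1/4"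
  shows "continuous_on {a..b} (\<lambda>s. y1 s - \<gamma> (y2 s))"
proof -
  have "y2 ` {a..b} \<subseteq> {-1/4..1/4}" using assms(4) by (fastforce simp: abs_le_iff)
  then show ?thesis
    by (intro continuous_intros traj_cont(1)[OF assms(1-3)]
        continuous_on_compose2[OF curve_continuous traj_cont(2)[OF assms(1-3)]])
qed

text \<open>Invariance of the curve under \<open>um\<close>: the largest offset along the run is at
  most 1/50 of itself, hence zero.\<close>

lemma curve_run:
  assumes c: "0 \<le> c" "c \<le> 17/100"
  obtains \<sigma> y1 y2 where "traj (\<lambda>_. um) y1 y2 \<sigma>" "\<sigma> \<le> 1/5" "9/10 * \<sigma> \<le> c" "y1 0 = \<gamma> c" "y2 0 = c" "y1 \<sigma> = 0" "y2 \<sigma> = 0"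
    "\<And>s. s \<in> {0..\<sigma>} \<Longrightarrow> y1 s = \<gamma> (y2 s)" "\<And>s. s \<in> {0..\<sigma>} \<Longrightarrow> 0 \<le> y2 s \<and> y2 s \<le> c"
proof -
  obtain y1 y2 where Y: "traj (\<lambda>_. um) y1 y2 (1/5)" "y1 0 = \<gamma> c" "y2 0 = c"
    by (rule flow_exists[OF Ctl_const[of um], of "1/5" "\<gamma> c" c]) auto
  \<comment> \<open>In time 1/5 the height falls by at least 18/100, which is why \<open>c\<close>
    is limited to 17/100.\<close>
  have "y2 (1/5) \<le> 0" using um_decreasing(1)[OF Y(1), of 0 "1/5"] c Y(3) by simp
  then obtain \<sigma> where \<sigma>: "0 \<le> \<sigma>" "\<sigma> \<le> 1/5" "y2 \<sigma> = 0" "\<And>r. 0 \<le> r \<Longrightarrow> r \<le> \<sigma> \<Longrightarrow> 0 \<le> y2 r"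
    using first_hit[OF trajD(4)[OF Y(1)], of 0] c Y(3) by auto
  have T: "traj (\<lambda>_. um) y1 y2 \<sigma>" using traj_init[OF Y(1)] \<sigma> by simp
  have le: "0 \<le> y2 s \<and> y2 s \<le> c" if "s \<in> {0..\<sigma>}" for s
    using \<sigma>(4)[of s] um_decreasing(1)[OF T, of 0 s] that Y(3) by auto
  have "continuous_on {0..\<sigma>} (\<lambda>s. y1 s - \<gamma> (y2 s))"
    by (rule offset_continuous[OF T]) (use le c in force)+
  from attains_sup_abs[OF this \<sigma>(1)] obtain \<beta> p where p: "p \<in> {0..\<sigma>}" "\<beta> = \<bar>y1 p - \<gamma> (y2 p)\<bar>"
    "\<And>r. r \<in> {0..\<sigma>} \<Longrightarrow> \<bar>y1 r - \<gamma> (y2 r)\<bar> \<le> \<beta>" by metis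
  have r: "0 \<le> y2 s \<and> y2 s \<le> 1/4" if "s \<in> {0..p}" for s using le[of s] that p(1) c by auto
  have \<beta>: "\<bar>y1 s - \<gamma> (y2 s)\<bar> \<le> \<beta>" if "s \<in> {0..p}" for s using p(3)[of s] that p(1) by auto
  have p': "0 \<le> p" "p \<le> \<sigma>" using p(1) by auto
  have inc: "- (\<beta> / 50) * (p - 0) \<le> (y1 p - \<gamma> (y2 p)) - (y1 0 - \<gamma> (y2 0))"
    "(y1 p - \<gamma> (y2 p)) - (y1 0 - \<gamma> (y2 0)) \<le> (\<beta> / 50) * (p - 0)"
    by (rule curve_offset_increment[OF T order_refl p']; use r \<beta> in simp)+
  have 0: "y1 0 - \<gamma> (y2 0) = 0" using Y by simp
  \<comment> \<open>\<open>p\<close> is a time where the offset is largest and is less than 1; the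
    offset at the start is zero.\<close>
  have "(\<beta> / 50) * (p - 0) \<le> (\<beta> / 50) * 1" using p' \<sigma> p(2) by (intro mult_left_mono) auto
  then have "\<beta> \<le> \<beta> / 50" using inc p(2) unfolding 0 by argo
  then have "\<beta> \<le> 0" by simp
  then have on: "y1 s = \<gamma> (y2 s)" if "s \<in> {0..\<sigma>}" for s using p(3)[OF that] by simp
  have "9/10 * \<sigma> \<le> c" using um_decreasing(1)[OF T, of 0 \<sigma>] \<sigma> Y(3) by simp
  then show thesis using that[OF T \<sigma>(2) _ Y(2,3) _ \<sigma>(3) on le] on[of \<sigma>] \<sigma> \<gamma>_zero by simp
qed

text \<open>From points of the curve the curve itself is almost the fastest way home, measured
  against any trajectory that starts nearby. Let I be the integral of 1 + v along the competitor,
  its deviation from \<open>um\<close>. Up to small errors I enters the height difference in full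
  with positive sign, so deviating keeps the competitor high and delays it. Its influence on the
  horizontal difference carries only the factor 1/100, which is where the bounds \<open>dm1\<close>
  and \<open>dm2\<close> enter.\<close>

lemma near_curve_pos:
  assumes Y: "traj u y1 y2 t" and t: "t \<le> 1/5" and e: "y1 t = 0" "y2 t = 0" and c: "0 \<le> c" "c \<le> 17/100"
  shows "reaches (\<gamma> c) c 0 0 (t + \<bar>y1 0 - \<gamma> c\<bar> / 50 + 6/5 * \<bar>y2 0 - c\<bar>)"
proof -
  obtain \<sigma> w1 w2 where W: "traj (\<lambda>_. um) w1 w2 \<sigma>" "\<sigma> \<le> 1/5" "9/10 * \<sigma> \<le> c" "w1 0 = \<gamma> c" "w2 0 = c" "w1 \<sigma> = 0" "w2 \<sigma> = 0"
    "\<And>s. s \<in> {0..\<sigma>} \<Longrightarrow> w1 s = \<gamma> (w2 s)" "\<And>s. s \<in> {0..\<sigma>} \<Longrightarrow> 0 \<le> w2 s \<and> w2 s \<le> c" by (rule curve_run[OF c]) (rule that)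
  have run: "reaches (\<gamma> c) c 0 0 \<sigma>" using reaches_seg[OF W(1) order_refl trajD(2)[OF W(1)] order_refl] W by simp
  show ?thesis
  proof (cases "\<sigma> \<le> t")
    case True
    then have "\<sigma> \<le> t + \<bar>y1 0 - \<gamma> c\<bar> / 50 + 6/5 * \<bar>y2 0 - c\<bar>"
      using abs_ge_zero[of "y1 0 - \<gamma> c"] abs_ge_zero[of "y2 0 - c"] by argo
    then show ?thesis by (rule reaches_mono[OF run])
  next
    case False
    have t0: "0 \<le> t" using trajD(2)[OF Y] .
    have V: "traj (\<lambda>_. um) w1 w2 t" using traj_init[OF W(1) t0] False by simp
    define \<delta>1 where "\<delta>1 s = y1 s - w1 s" for s
    define \<delta>2 where "\<delta>2 s = y2 s - w2 s" for s
    have "continuous_on {0..t} \<delta>1" "continuous_on {0..t} \<delta>2" unfolding \<delta>1_def \<delta>2_def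
      using trajD(3,4)[OF Y] trajD(3,4)[OF V] by (auto intro!: continuous_intros)
    from attains_sup_abs[OF this(1) t0] attains_sup_abs[OF this(2) t0]
    obtain D sD E sE where D: "sD \<in> {0..t}" "D = \<bar>\<delta>1 sD\<bar>" "\<And>r. r \<in> {0..t} \<Longrightarrow> \<bar>\<delta>1 r\<bar> \<le> D"
      and E: "sE \<in> {0..t}" "E = \<bar>\<delta>2 sE\<bar>" "\<And>r. r \<in> {0..t} \<Longrightarrow> \<bar>\<delta>2 r\<bar> \<le> E" by metis
    have nn: "0 \<le> D" "0 \<le> E" using D(2) E(2) by auto
    define q where "q \<tau> = 1 + v (u \<tau>)" for \<tau>
    have q0: "0 \<le> q \<tau>" for \<tau> using v_bnd[OF trajD(5)[OF Y, of \<tau>]] by (simp add: q_def)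
    have qi: "q integrable_on {a..b}" for a b unfolding q_def
      by (intro integrable_add intv trajD(1)[OF Y]) auto
    define I where "I = integral {0..t} q"
    have Q: "integral {0..s} q \<le> I" "0 \<le> integral {0..s} q" if "s \<in> {0..t}" for s
      using that q0 qi by (auto simp: I_def intro!: integral_subset_le integral_nonneg)
    have I0: "0 \<le> I" using Q(2)[of t] t0 by (simp add: I_def)
    have small: "(\<bar>w1 \<tau>\<bar> + \<bar>w2 \<tau>\<bar>) / 100 * q \<tau> \<le> 1/100 * q \<tau>" if "\<tau> \<in> {0..t}" for \<tau>
    proof (rule mult_right_mono[OF _ q0])
      have w: "0 \<le> w2 \<tau>" "w2 \<tau> \<le> c" using W(9)[of \<tau>] that False by auto
      then have "\<bar>\<gamma> (w2 \<tau>)\<bar> \<le> 3/10 * \<bar>w2 \<tau>\<bar>" using c by (intro curve_abs) auto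
      then show "(\<bar>w1 \<tau>\<bar> + \<bar>w2 \<tau>\<bar>) / 100 \<le> 1/100" using W(8)[of \<tau>] that False w c by auto
    qed
    have U: "u \<tau> \<in> U" for \<tau> using trajD(5)[OF Y] .
    have g2: "\<bar>f2 (y1 \<tau>) (y2 \<tau>) (u \<tau>) - f2 (w1 \<tau>) (w2 \<tau>) um - q \<tau>\<bar> \<le> (D + E) / 100 + 1/100 * q \<tau>"
      and g1: "\<bar>f1 (y1 \<tau>) (y2 \<tau>) (u \<tau>) - f1 (w1 \<tau>) (w2 \<tau>) um\<bar> \<le> E + (D + E) / 100 + 1/100 * q \<tau>"
      if \<tau>: "\<tau> \<in> {0..t}" for \<tau>
    proof -
      have DE: "\<bar>y1 \<tau> - w1 \<tau>\<bar> \<le> D" "\<bar>y2 \<tau> - w2 \<tau>\<bar> \<le> E" using D(3)[OF \<tau>] E(3)[OF \<tau>] by (auto simp: \<delta>1_def \<delta>2_def)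
      have l: "\<bar>r1 (y1 \<tau>) (y2 \<tau>) (u \<tau>) - r1 (w1 \<tau>) (w2 \<tau>) (u \<tau>)\<bar> \<le> (D + E) / 100"
        "\<bar>r2 (y1 \<tau>) (y2 \<tau>) (u \<tau>) - r2 (w1 \<tau>) (w2 \<tau>) (u \<tau>)\<bar> \<le> (D + E) / 100"
        using DE by - (rule order_trans[OF lip1[OF U]], argo, rule order_trans[OF lip2[OF U]], argo)
      have m: "\<bar>r1 (w1 \<tau>) (w2 \<tau>) (u \<tau>) - r1 (w1 \<tau>) (w2 \<tau>) um\<bar> \<le> 1/100 * q \<tau>"
        "\<bar>r2 (w1 \<tau>) (w2 \<tau>) (u \<tau>) - r2 (w1 \<tau>) (w2 \<tau>) um\<bar> \<le> 1/100 * q \<tau>"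
        using dm1[OF U, of "w1 \<tau>" "w2 \<tau>" \<tau>] dm2[OF U, of "w1 \<tau>" "w2 \<tau>" \<tau>] small[OF \<tau>] unfolding q_def by linarith+
      show "\<bar>f2 (y1 \<tau>) (y2 \<tau>) (u \<tau>) - f2 (w1 \<tau>) (w2 \<tau>) um - q \<tau>\<bar> \<le> (D + E) / 100 + 1/100 * q \<tau>"
        using l(2) m(2) unfolding f2_def v_vals q_def by argo
      show "\<bar>f1 (y1 \<tau>) (y2 \<tau>) (u \<tau>) - f1 (w1 \<tau>) (w2 \<tau>) um\<bar> \<le> E + (D + E) / 100 + 1/100 * q \<tau>"
        using l(1) m(1) DE(2) unfolding f1_def by argo
    qed
    have I2: "((\<lambda>\<tau>. f2 (y1 \<tau>) (y2 \<tau>) (u \<tau>) - f2 (w1 \<tau>) (w2 \<tau>) um) has_integral (\<delta>2 s - \<delta>2 0)) {0..s}"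
      and I1: "((\<lambda>\<tau>. f1 (y1 \<tau>) (y2 \<tau>) (u \<tau>) - f1 (w1 \<tau>) (w2 \<tau>) um) has_integral (\<delta>1 s - \<delta>1 0)) {0..s}"
      if "s \<in> {0..t}" for s
    proof -
      have s: "0 \<le> s" "s \<le> t" using that by auto
      show "((\<lambda>\<tau>. f2 (y1 \<tau>) (y2 \<tau>) (u \<tau>) - f2 (w1 \<tau>) (w2 \<tau>) um) has_integral (\<delta>2 s - \<delta>2 0)) {0..s}"
        "((\<lambda>\<tau>. f1 (y1 \<tau>) (y2 \<tau>) (u \<tau>) - f1 (w1 \<tau>) (w2 \<tau>) um) has_integral (\<delta>1 s - \<delta>1 0)) {0..s}"
        using has_integral_diff[OF traj_int(2)[OF Y order_refl s] traj_int(2)[OF V order_refl s]]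
          has_integral_diff[OF traj_int(1)[OF Y order_refl s] traj_int(1)[OF V order_refl s]]
        by (simp_all add: \<delta>1_def \<delta>2_def algebra_simps)
    qed
    have hc: "((\<lambda>\<tau>. k * q \<tau> + m) has_integral (k * integral {0..s} q + m * s)) {0..s}" if "s \<in> {0..t}" for k m s
    proof -
      have "((\<lambda>\<tau>. m) has_integral m * s) {0..s}" using has_integral_const_real[of m 0 s] that by (simp add: mult.commute)
      then show ?thesis by (intro has_integral_add has_integral_mult_right integrable_integral qi)
    qed
    have ts: "m * s \<le> m / 5" if "s \<in> {0..t}" "0 \<le> m" for m s using mult_left_mono[of s "1/5" m] that t by auto
    have b2: "\<bar>\<delta>2 s - \<delta>2 0\<bar> \<le> 101/100 * I + (D + E) / 500" if s: "s \<in> {0..t}" for s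
    proof -
      have "\<delta>2 s - \<delta>2 0 \<le> 101/100 * integral {0..s} q + (D + E) / 100 * s"
        by (rule has_integral_le[OF I2[OF s] hc[OF s]]) (use g2 s q0 in \<open>force simp: abs_le_iff\<close>)
      moreover have "(-101/100) * integral {0..s} q + (- ((D + E) / 100)) * s \<le> \<delta>2 s - \<delta>2 0"
      proof (rule has_integral_le[OF hc[OF s] I2[OF s]])
        fix x assume "x \<in> {0..s}"
        then show "(-101/100) * q x + - ((D + E) / 100) \<le> f2 (y1 x) (y2 x) (u x) - f2 (w1 x) (w2 x) um"
          using g2[of x] q0[of x] s by (auto simp: abs_le_iff)
      qed
      moreover have "((D + E) / 100) * s \<le> ((D + E) / 100) / 5" by (rule ts[OF s]) (use nn in simp)
      ultimately show ?thesis using Q[OF s] by (intro abs_leI) (simp_all add: field_simps)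
    qed
    have b1: "\<bar>\<delta>1 s - \<delta>1 0\<bar> \<le> 1/100 * I + (E + (D + E) / 100) / 5" if s: "s \<in> {0..t}" for s
    proof -
      have "\<delta>1 s - \<delta>1 0 \<le> 1/100 * integral {0..s} q + (E + (D + E) / 100) * s"
        by (rule has_integral_le[OF I1[OF s] hc[OF s]]) (use g1 s in \<open>force simp: abs_le_iff\<close>)
      moreover have "(-1/100) * integral {0..s} q + (- (E + (D + E) / 100)) * s \<le> \<delta>1 s - \<delta>1 0"
      proof (rule has_integral_le[OF hc[OF s] I1[OF s]])
        fix x assume "x \<in> {0..s}"
        then show "(-1/100) * q x + - (E + (D + E) / 100) \<le> f1 (y1 x) (y2 x) (u x) - f1 (w1 x) (w2 x) um"
          using g1[of x] q0[of x] s by (auto simp: abs_le_iff)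
      qed
      moreover have "(E + (D + E) / 100) * s \<le> (E + (D + E) / 100) / 5" by (rule ts[OF s]) (use nn in simp)
      ultimately show ?thesis using Q[OF s] by (intro abs_leI) (simp_all add: field_simps)
    qed
    have tt: "t \<in> {0..t}" using t0 by simp
    \<comment> \<open>Only this lower bound uses the sign of the deviation. At time \<open>t\<close>
      the competitor is at height 0, so it turns into an upper bound for the height still to be lost
      along the curve.\<close>
    have low: "99/100 * I - (D + E) / 500 \<le> \<delta>2 t - \<delta>2 0"
    proof -
      have "99/100 * integral {0..t} q + (- ((D + E) / 100)) * t \<le> \<delta>2 t - \<delta>2 0"
      proof (rule has_integral_le[OF hc[OF tt] I2[OF tt]])
        fix x assume "x \<in> {0..t}"
        then show "99/100 * q x + - ((D + E) / 100) \<le> f2 (y1 x) (y2 x) (u x) - f2 (w1 x) (w2 x) um"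
          using g2[of x] q0[of x] by (auto simp: abs_le_iff)
      qed
      moreover have "((D + E) / 100) * t \<le> ((D + E) / 100) / 5" by (rule ts[OF tt]) (use nn in simp)
      ultimately show ?thesis unfolding I_def by (simp add: field_simps)
    qed
    define d1 d2 where "d1 = \<bar>y1 0 - \<gamma> c\<bar>" and "d2 = \<bar>y2 0 - c\<bar>"
    have d: "d1 = \<bar>\<delta>1 0\<bar>" "d2 = \<bar>\<delta>2 0\<bar>" "0 \<le> d1" "0 \<le> d2" using W(4,5) by (auto simp: d1_def d2_def \<delta>1_def \<delta>2_def)
    have "D \<le> d1 + 1/100 * I + (E + (D + E) / 100) / 5" using b1[OF D(1)] D(2) d(1) by argo
    moreover have "E \<le> d2 + 101/100 * I + (D + E) / 500" using b2[OF E(1)] E(2) d(2) by argo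
    \<comment> \<open>The contribution of \<open>I\<close> to the error terms is a small multiple of
      \<open>I\<close>, absorbed by the 99/100 of \<open>I\<close> in \<open>low\<close>.\<close>
    ultimately have "D + E \<le> 2 * (d1 + d2 + I)" using nn I0 d(3,4) by (simp add: field_simps)
    moreover have "- d2 \<le> \<delta>2 0" using d(2) by linarith
    ultimately have "w2 t \<le> d1 / 100 + 101/100 * d2" using low I0 d(3,4) e(2) by (simp add: \<delta>2_def field_simps)
    moreover have "9/10 * (\<sigma> - t) \<le> w2 t"
      using um_decreasing(1)[OF W(1), of t \<sigma>] t0 False W(7) by auto
    ultimately have "\<sigma> \<le> t + d1 / 50 + 6/5 * d2" using d(3,4) by (simp add: field_simps)
    then show ?thesis using reaches_mono[OF run] by (simp add: d1_def d2_def)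
  qed
qed

lemma near_curve:
  assumes Y: "traj u y1 y2 t" and t: "t \<le> 1/5" and e: "y1 t = 0" "y2 t = 0" and c: "\<bar>c\<bar> \<le> 17/100"
  shows "reaches (\<gamma> c) c 0 0 (t + \<bar>y1 0 - \<gamma> c\<bar> / 50 + 6/5 * \<bar>y2 0 - c\<bar>)"
proof (cases "0 \<le> c")
  case True
  then show ?thesis using near_curve_pos[OF assms(1-4)] c by simp
next
  case False
  interpret R: switching_curve "\<lambda>x1 x2 w. - r1 (- x1) (- x2) w" "\<lambda>x1 x2 w. - r2 (- x1) (- x2) w" "\<lambda>w. - v w" U Ctl up um u0
    "\<lambda>s. - \<gamma> (- s)" "\<lambda>s. \<gamma>d (- s)" by (rule reflected_curve)
  have T: "R.traj u (\<lambda>s. - y1 s) (\<lambda>s. - y2 s) t" unfolding traj_reflected using Y by simp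
  have "R.reaches (- \<gamma> (- (- c))) (- c) 0 0 (t + \<bar>- y1 0 - - \<gamma> (- (- c))\<bar> / 50 + 6/5 * \<bar>- y2 0 - - c\<bar>)"
    by (rule R.near_curve_pos[OF T t]) (use e c False in auto)
  moreover have "\<bar>- y1 0 - - \<gamma> c\<bar> = \<bar>y1 0 - \<gamma> c\<bar>" "\<bar>- y2 0 - - c\<bar> = \<bar>y2 0 - c\<bar>" by linarith+
  ultimately show ?thesis unfolding reaches_reflected by simp
qed

lemma on_curve_pos:
  assumes c: "0 \<le> c" "c \<le> 17/100"
  shows "reaches (\<gamma> c) c 0 0 (10/9 * c)"
proof -
  obtain \<sigma> w1 w2 where W: "traj (\<lambda>_. um) w1 w2 \<sigma>" "9/10 * \<sigma> \<le> c" "w1 0 = \<gamma> c" "w2 0 = c" "w1 \<sigma> = 0" "w2 \<sigma> = 0"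
    by (rule curve_run[OF c]) (rule that)
  have "reaches (\<gamma> c) c 0 0 \<sigma>" using reaches_seg[OF W(1) order_refl trajD(2)[OF W(1)] order_refl] W by simp
  then show ?thesis by (rule reaches_mono) (use W(2) in simp)
qed

lemma on_curve:
  assumes c: "\<bar>c\<bar> \<le> 17/100"
  shows "reaches (\<gamma> c) c 0 0 (10/9 * \<bar>c\<bar>)"
proof (cases "0 \<le> c")
  case True
  then show ?thesis using on_curve_pos[of c] c by simp
next
  case False
  interpret R: switching_curve "\<lambda>x1 x2 w. - r1 (- x1) (- x2) w" "\<lambda>x1 x2 w. - r2 (- x1) (- x2) w" "\<lambda>w. - v w" U Ctl up um u0
    "\<lambda>s. - \<gamma> (- s)" "\<lambda>s. \<gamma>d (- s)" by (rule reflected_curve)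
  have "R.reaches (- \<gamma> (- (- c))) (- c) 0 0 (10/9 * (- c))" by (rule R.on_curve_pos) (use c False in auto)
  then show ?thesis unfolding reaches_reflected using False by simp
qed

text \<open>The trajectory with the same control started closer to the curve must cross the curve; from
  the crossing point the curve itself is nearly the fastest way home.\<close>
lemma toward_curve_right:
  assumes x2: "\<bar>x2\<bar> \<le> 1/20" and \<eta>: "0 \<le> \<eta>" "x1 + \<eta> \<le> \<gamma> x2" and S: "reaches x1 x2 0 0 t" and t: "t \<le> 1/10"
  shows "reaches (x1 + \<eta>) x2 0 0 (t + \<eta>)"
proof -
  obtain u y1 y2 s where Y: "s \<le> t" "traj u y1 y2 s" "y1 0 = x1" "y2 0 = x2" "y1 s = 0" "y2 s = 0"
    using S unfolding reaches_def by blast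
  have s: "0 \<le> s" "s \<le> 1/10" "s \<le> 2/5" "s \<le> 1/5" using trajD(2)[OF Y(2)] Y(1) t by auto
  obtain w1 w2 where W: "traj u w1 w2 s" "w1 0 = x1 + \<eta>" "w2 0 = x2"
    using flow_exists[OF trajD(1)[OF Y(2)] s(1,3), of "x1 + \<eta>" x2] by blast
  have d: "\<bar>(w1 r - y1 r) - \<eta>\<bar> \<le> \<eta> / 100" "\<bar>w2 r - y2 r\<bar> \<le> \<eta> / 100" if "r \<in> {0..s}" for r
    using same_control[OF Y(2) W(1) s(4), of 0 r] that s W Y \<eta>(1) by auto
  have w2: "\<bar>w2 r\<bar> \<le> 16/100" if "r \<in> {0..s}" for r
  proof -
    have "\<bar>w2 r - w2 0\<bar> \<le> 11/10 * \<bar>r - 0\<bar>" using that s by (intro traj_y2_inc[OF W(1)]) auto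
    moreover have "\<bar>r - 0\<bar> \<le> 1/10" using that s by auto
    ultimately show ?thesis using W(3) x2 by argo
  qed
  have cont: "continuous_on {0..s} (\<lambda>r. w1 r - \<gamma> (w2 r))"
    by (rule offset_continuous[OF W(1)]) (use w2 in force)+
  have ss: "s \<in> {0..s}" using s by simp
  \<comment> \<open>At the final time the shifted trajectory is within \<eta>/100 of (\<eta>, 0) in
    each coordinate, hence on or to the right of the curve, while it started on or to the left of
    it: it must meet the curve.\<close>
  have "\<bar>\<gamma> (w2 s)\<bar> \<le> 3/10 * \<bar>w2 s\<bar>" by (rule curve_abs) (use w2[OF ss] in argo)
  then have "0 \<le> w1 s - \<gamma> (w2 s)" using d[OF ss] Y(5,6) \<eta>(1) by argo
  moreover have "w1 0 - \<gamma> (w2 0) \<le> 0" using W \<eta> by simp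
  ultimately obtain \<sigma> where \<sigma>: "0 \<le> \<sigma>" "\<sigma> \<le> s" "w1 \<sigma> - \<gamma> (w2 \<sigma>) = 0"
    using IVT'[of "\<lambda>r. w1 r - \<gamma> (w2 r)" 0 0 s] cont s by blast
  have \<sigma>': "\<sigma> \<in> {0..s}" using \<sigma> by simp
  have "reaches (\<gamma> (w2 \<sigma>)) (w2 \<sigma>) 0 0 ((s - \<sigma>) + \<bar>y1 (0 + \<sigma>) - \<gamma> (w2 \<sigma>)\<bar> / 50 + 6/5 * \<bar>y2 (0 + \<sigma>) - w2 \<sigma>\<bar>)"
    by (rule near_curve[OF traj_tail[OF Y(2) \<sigma>(1,2)]]) (use \<sigma> s Y w2[OF \<sigma>'] in auto)
  moreover have "reaches (x1 + \<eta>) x2 (\<gamma> (w2 \<sigma>)) (w2 \<sigma>) (\<sigma> - 0)"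
    using reaches_seg[OF W(1) order_refl \<sigma>(1,2)] W \<sigma>(3) by simp
  ultimately have "reaches (x1 + \<eta>) x2 0 0 ((\<sigma> - 0) + ((s - \<sigma>) + \<bar>y1 (0 + \<sigma>) - \<gamma> (w2 \<sigma>)\<bar> / 50 + 6/5 * \<bar>y2 (0 + \<sigma>) - w2 \<sigma>\<bar>))"
    using reaches_trans by blast
  then show ?thesis
  proof (rule reaches_mono)
    \<comment> \<open>The horizontal distance is about \<eta>, but \<open>near_curve\<close> weights
      it by 1/50; the vertical one is at most \<eta>/100. Together they cost less than
      \<eta>.\<close>
    have "\<bar>y1 \<sigma> - \<gamma> (w2 \<sigma>)\<bar> \<le> 101/100 * \<eta>" "\<bar>y2 \<sigma> - w2 \<sigma>\<bar> \<le> \<eta> / 100" using d[OF \<sigma>'] \<sigma>(3) by argo+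
    then show "(\<sigma> - 0) + ((s - \<sigma>) + \<bar>y1 (0 + \<sigma>) - \<gamma> (w2 \<sigma>)\<bar> / 50 + 6/5 * \<bar>y2 (0 + \<sigma>) - w2 \<sigma>\<bar>) \<le> t + \<eta>"
      unfolding add_0 using Y(1) \<eta>(1) by argo
  qed
qed

lemma toward_curve_left:
  assumes x2: "\<bar>x2\<bar> \<le> 1/20" and \<eta>: "0 \<le> \<eta>" "\<gamma> x2 \<le> x1 - \<eta>" and S: "reaches x1 x2 0 0 t" and t: "t \<le> 1/10"
  shows "reaches (x1 - \<eta>) x2 0 0 (t + \<eta>)"
proof -
  interpret R: switching_curve "\<lambda>x1 x2 w. - r1 (- x1) (- x2) w" "\<lambda>x1 x2 w. - r2 (- x1) (- x2) w" "\<lambda>w. - v w" U Ctl up um u0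
    "\<lambda>s. - \<gamma> (- s)" "\<lambda>s. \<gamma>d (- s)" by (rule reflected_curve)
  have "R.reaches (- x1 + \<eta>) (- x2) 0 0 (t + \<eta>)"
    by (rule R.toward_curve_right) (use assms in \<open>auto simp: reaches_reflected\<close>)
  then show ?thesis unfolding reaches_reflected by (simp add: algebra_simps)
qed

text \<open>Local controllability at the scale of the double integrator: displacements of order s^2
  are removed in time of order s. Under \<open>um\<close> the trajectory meets the curve within time
  s at height at most 12/10 s, and the curve takes it home in a further 10/9 * 12/10 s.\<close>

lemma small_time_right:
  assumes s: "0 < s" "s \<le> 1/25" and x: "\<bar>x1\<bar> \<le> s\<^sup>2 / 20" "\<bar>x2\<bar> \<le> s\<^sup>2 / 20" and off: "\<gamma> x2 \<le> x1"
  shows "reaches x1 x2 0 0 (3 * s)"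
proof -
  have sq: "s\<^sup>2 \<le> s / 25" using mult_left_mono[OF s(2), of s] s(1) by (simp add: power2_eq_square)
  have s': "0 \<le> s" "s \<le> 2/5" using s by auto
  obtain y1 y2 where Y: "traj (\<lambda>_. um) y1 y2 s" "y1 0 = x1" "y2 0 = x2"
    using flow_exists[OF Ctl_const[of um] s', of x1 x2] by blast
  have y2: "y2 r \<le> x2 - 9/10 * r" "x2 - 11/10 * r \<le> y2 r" if "r \<in> {0..s}" for r
    using um_decreasing[OF Y(1), of 0 r] that Y(3) by auto
  have y2a: "\<bar>y2 r\<bar> \<le> 12/10 * s" if "r \<in> {0..s}" for r
    using y2[OF that] that x(2) sq unfolding atLeastAtMost_iff by argo
  obtain D p where D: "p \<in> {0..s}" "D = \<bar>y1 p\<bar>" "\<And>r. r \<in> {0..s} \<Longrightarrow> \<bar>y1 r\<bar> \<le> D"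
    using attains_sup_abs[OF trajD(3)[OF Y(1)] s'(1)] by metis
  have r1b: "\<bar>r1 (y1 r) (y2 r) um\<bar> \<le> (D + 12/10 * s) / 100" if "r \<in> {0..s}" for r
    using r1_small[OF U_vals(1), of "y1 r" "y2 r"] D(3)[OF that] y2a[OF that] by argo
  have "\<bar>y1 p - y1 0\<bar> \<le> (12/10 * s + (D + 12/10 * s) / 100) * (p - 0)"
  proof (rule has_integral_abs_le_const[OF traj_int(1)[OF Y(1)]])
    fix r assume "r \<in> {0..p}"
    then have "r \<in> {0..s}" using D(1) by auto
    from r1b[OF this] y2a[OF this]
    show "\<bar>f1 (y1 r) (y2 r) um\<bar> \<le> 12/10 * s + (D + 12/10 * s) / 100" unfolding f1_def by argo
  qed (use D(1) in auto)
  also have "\<dots> \<le> (12/10 * s + (D + 12/10 * s) / 100) * (1/25)"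
    using D(1,2) s by (intro mult_left_mono) auto
  finally have "D \<le> s" using D(2) x(1) sq Y(2) s(1) by argo
  then have r1c: "\<bar>r1 (y1 r) (y2 r) um\<bar> \<le> 22/1000 * s" if "r \<in> {0..s}" for r using r1b[OF that] by argo
  have A: "y1 (s/2) - y1 0 \<le> (3/100 * s) * (s/2 - 0)"
  proof (rule has_integral_le_const[OF traj_int(1)[OF Y(1)]])
    fix r assume "r \<in> {0..s/2}"
    then have r: "r \<in> {0..s}" "0 \<le> r" using s by auto
    show "f1 (y1 r) (y2 r) um \<le> 3/100 * s" using r1c[OF r(1)] y2(1)[OF r(1)] r(2) x(2) sq s(1) unfolding f1_def by argo
  qed (use s in auto)
  have B: "y1 s - y1 (s/2) \<le> (- 42/100 * s) * (s - s/2)"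
  proof (rule has_integral_le_const[OF traj_int(1)[OF Y(1)]])
    fix r assume "r \<in> {s/2..s}"
    then have r: "r \<in> {0..s}" "s/2 \<le> r" using s by auto
    show "f1 (y1 r) (y2 r) um \<le> - 42/100 * s" using r1c[OF r(1)] y2(1)[OF r(1)] r(2) x(2) sq s(1) unfolding f1_def by argo
  qed (use s in auto)
  \<comment> \<open>The initial displacement s^2/20 and the drift of at most 3/200 s^2 in the first
    half are outweighed by 21/100 s^2 of leftward motion in the second half.\<close>
  have "y1 s \<le> s\<^sup>2 / 20 + (3/100 * s) * (s/2 - 0) + (- 42/100 * s) * (s - s/2)" using A B x(1) Y(2) by argo
  also have "\<dots> \<le> 0" by (simp add: power2_eq_square field_simps)
  finally have y1s: "y1 s \<le> 0" .
  have ss: "s \<in> {0..s}" using s by simp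
  have "0 \<le> \<gamma> (y2 s)" by (rule curve_neg) (use y2[OF ss] y2a[OF ss] x(2) sq s in argo)+
  then have "y1 s - \<gamma> (y2 s) \<le> 0" using y1s by simp
  moreover have "0 \<le> y1 0 - \<gamma> (y2 0)" using off Y by simp
  moreover have "continuous_on {0..s} (\<lambda>r. y1 r - \<gamma> (y2 r))"
    by (rule offset_continuous[OF Y(1)]) (use y2a s in force)+
  ultimately obtain \<sigma> where \<sigma>: "0 \<le> \<sigma>" "\<sigma> \<le> s" "y1 \<sigma> - \<gamma> (y2 \<sigma>) = 0"
    using IVT2'[of "\<lambda>r. y1 r - \<gamma> (y2 r)" s 0 0] s' by blast
  have y2\<sigma>: "\<bar>y2 \<sigma>\<bar> \<le> 12/10 * s" using y2a[of \<sigma>] \<sigma> by simp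
  have "reaches x1 x2 (\<gamma> (y2 \<sigma>)) (y2 \<sigma>) (\<sigma> - 0)" using reaches_seg[OF Y(1) order_refl \<sigma>(1,2)] Y \<sigma>(3) by simp
  moreover have "reaches (\<gamma> (y2 \<sigma>)) (y2 \<sigma>) 0 0 (10/9 * \<bar>y2 \<sigma>\<bar>)" by (rule on_curve) (use y2\<sigma> s in argo)
  ultimately have "reaches x1 x2 0 0 ((\<sigma> - 0) + 10/9 * \<bar>y2 \<sigma>\<bar>)" using reaches_trans by blast
  then show ?thesis by (rule reaches_mono) (use \<sigma> y2\<sigma> s in argo)
qed

lemma small_time:
  assumes s: "0 < s" "s \<le> 1/25" and x: "\<bar>x1\<bar> \<le> s\<^sup>2 / 20" "\<bar>x2\<bar> \<le> s\<^sup>2 / 20"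
  shows "reaches x1 x2 0 0 (3 * s)"
proof (cases "\<gamma> x2 \<le> x1")
  case True
  then show ?thesis using small_time_right assms by blast
next
  case False
  interpret R: switching_curve "\<lambda>x1 x2 w. - r1 (- x1) (- x2) w" "\<lambda>x1 x2 w. - r2 (- x1) (- x2) w" "\<lambda>w. - v w" U Ctl up um u0
    "\<lambda>s. - \<gamma> (- s)" "\<lambda>s. \<gamma>d (- s)" by (rule reflected_curve)
  have "R.reaches (- x1) (- x2) 0 0 (3 * s)"
    by (rule R.small_time_right[OF s]) (use x False in auto)
  then show ?thesis unfolding reaches_reflected by simp
qed

text \<open>The old control steers the new point close to the origin, and \<open>small_time\<close>
  finishes. This is the square-root modulus of continuity of the minimum time, the only two-sided
  estimate that holds across the curve.\<close>

lemma uniformly_close_times: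
  assumes s: "0 < s" "s \<le> 1/25" and d: "\<bar>z1 - x1\<bar> \<le> s\<^sup>2 / 60" "\<bar>z2 - x2\<bar> \<le> s\<^sup>2 / 60"
    and S: "reaches x1 x2 0 0 t" and t: "t \<le> 1/5"
  shows "reaches z1 z2 0 0 (t + 3 * s)"
proof -
  obtain u y1 y2 \<tau> where Y: "\<tau> \<le> t" "traj u y1 y2 \<tau>" "y1 0 = x1" "y2 0 = x2" "y1 \<tau> = 0" "y2 \<tau> = 0"
    using S unfolding reaches_def by blast
  have \<tau>: "0 \<le> \<tau>" "\<tau> \<le> 2/5" "\<tau> \<le> 1/5" using trajD(2)[OF Y(2)] Y(1) t by auto
  obtain w1 w2 where W: "traj u w1 w2 \<tau>" "w1 0 = z1" "w2 0 = z2"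
    using flow_exists[OF trajD(1)[OF Y(2)] \<tau>(1,2), of z1 z2] by blast
  have "\<bar>(w1 \<tau> - y1 \<tau>) - (w1 0 - y1 0)\<bar> \<le> \<bar>w1 0 - y1 0\<bar> / 100 + \<bar>w2 0 - y2 0\<bar> / 4"
    "\<bar>(w2 \<tau> - y2 \<tau>) - (w2 0 - y2 0)\<bar> \<le> (\<bar>w1 0 - y1 0\<bar> + \<bar>w2 0 - y2 0\<bar>) / 100"
    using \<tau> by (intro same_control[OF Y(2) W(1) \<tau>(3)]; simp)+
  then have "\<bar>w1 \<tau>\<bar> \<le> s\<^sup>2 / 20" "\<bar>w2 \<tau>\<bar> \<le> s\<^sup>2 / 20" unfolding W(2,3) Y(3-6) using d by argo+
  from small_time[OF s this] have "reaches (w1 \<tau>) (w2 \<tau>) 0 0 (3 * s)" .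
  moreover have "reaches z1 z2 (w1 \<tau>) (w2 \<tau>) (\<tau> - 0)" using reaches_seg[OF W(1) order_refl \<tau>(1) order_refl] W by simp
  ultimately have "reaches z1 z2 0 0 ((\<tau> - 0) + 3 * s)" using reaches_trans by blast
  then show ?thesis by (rule reaches_mono) (use Y(1) in simp)
qed

end

section \<open>Moving away from the curve, and the two oblique directions\<close>

context switching_curve
begin

text \<open>Starting to the right of the curve, a trajectory cannot reach the origin without moving
  left at a definite speed.\<close>
lemma excursion:
  assumes Y: "traj u y1 y2 t" and t: "t \<le> 1/10" and e: "y1 t = 0" "y2 t = 0" and x2: "\<bar>y2 0\<bar> \<le> 1/20"
    and a: "0 < a" "\<gamma> (y2 0) + a \<le> y1 0"
  obtains s where "s \<in> {0..t}" "y2 s \<le> - 3 * a" "0 \<le> y1 s" "y1 s \<le> a / 2"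
proof -
  have t0: "0 \<le> t" using trajD(2)[OF Y] .
  have y2: "\<bar>y2 r\<bar> \<le> 16/100" if "r \<in> {0..t}" for r
  proof -
    have "\<bar>y2 r - y2 0\<bar> \<le> 11/10 * \<bar>r - 0\<bar>" using that t0 by (intro traj_y2_inc[OF Y]) auto
    moreover have "\<bar>r - 0\<bar> \<le> 1/10" using that t by auto
    ultimately show ?thesis using x2 by argo
  qed
  obtain p where p: "0 \<le> p" "p \<le> t" "a / 2 \<le> y1 p"
  proof (cases "y2 0 \<le> 0")
    case True
    then have "0 \<le> \<gamma> (y2 0)" by (intro curve_neg) (use x2 in argo)+
    then have "a / 2 \<le> y1 0" using a by argo
    then show ?thesis using that[of 0] t0 by simp
  next
    case False
    obtain \<sigma> where \<sigma>: "0 \<le> \<sigma>" "\<sigma> \<le> t" "y2 \<sigma> = 0" "\<And>r. 0 \<le> r \<Longrightarrow> r \<le> \<sigma> \<Longrightarrow> 0 \<le> y2 r"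
      using first_hit[OF trajD(4)[OF Y] t0, of 0] e(2) False by auto
    define d where "d s = y1 s - \<gamma> (y2 s)" for s
    have cont: "continuous_on {x..z} d" if "0 \<le> x" "z \<le> t" for x z unfolding d_def
      proof (rule offset_continuous[OF Y that])
      fix s assume "s \<in> {x..z}"
      then have "s \<in> {0..t}" using that by auto
      from y2[OF this] show "\<bar>y2 s\<bar> \<le> 1/4" by argo
    qed
    have d0: "a \<le> d 0" using a(2) by (simp add: d_def)
    \<comment> \<open>On a stretch where the offset lies between a/2 and a it decreases at rate at
      most a/50, which is too slow to lose a/2 in the available time.\<close>
    have "a / 2 \<le> d \<sigma>"
    proof (rule ccontr)
      assume neg: "\<not> a / 2 \<le> d \<sigma>"
      obtain s1 where s1: "0 \<le> s1" "s1 \<le> \<sigma>" "d s1 = a / 2" "\<And>r. 0 \<le> r \<Longrightarrow> r \<le> s1 \<Longrightarrow> a / 2 \<le> d r"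
        using first_hit[OF cont[OF order_refl \<sigma>(2)] \<sigma>(1), of "a/2"] neg d0 a(1) by auto
      have "s1 \<le> t" using s1 \<sigma> by simp
      obtain s0 where s0: "0 \<le> s0" "s0 \<le> s1" "d s0 = a" "\<And>r. s0 \<le> r \<Longrightarrow> r \<le> s1 \<Longrightarrow> d r \<le> a"
        using last_hit[OF cont[OF order_refl \<open>s1 \<le> t\<close>] s1(1), of a] d0 s1(3) a(1) by auto
      have "- (a / 50) * (s1 - s0) \<le> (y1 s1 - \<gamma> (y2 s1)) - (y1 s0 - \<gamma> (y2 s0))"
      proof (rule curve_offset_increment(1)[OF Y s0(1,2) \<open>s1 \<le> t\<close>])
        fix r assume r: "r \<in> {s0..s1}"
        show "0 \<le> y2 r \<and> y2 r \<le> 1/4" using \<sigma>(4)[of r] y2[of r] r s0 s1 \<open>s1 \<le> t\<close> by (auto simp: abs_le_iff)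
        show "\<bar>y1 r - \<gamma> (y2 r)\<bar> \<le> a" using s0(4)[of r] s1(4)[of r] r s0(1) a(1) by (simp add: d_def abs_le_iff)
      qed
      then have "a / 2 \<le> (a / 50) * (s1 - s0)" using s0(3) s1(3) unfolding d_def by argo
      also have "\<dots> \<le> (a / 50) * 1" using a(1) s0 s1 \<open>s1 \<le> t\<close> t by (intro mult_left_mono) auto
      finally show False using a(1) by simp
    qed
    then have "a / 2 \<le> y1 \<sigma>" using \<sigma>(3) \<gamma>_zero by (simp add: d_def)
    then show ?thesis using that \<sigma> by blast
  qed
  have c1: "continuous_on {x..z} y1" if "0 \<le> x" "z \<le> t" for x z using traj_cont(1)[OF Y that] .
  obtain s3 where s3: "p \<le> s3" "s3 \<le> t" "y1 s3 = 0" "\<And>r. p \<le> r \<Longrightarrow> r \<le> s3 \<Longrightarrow> 0 \<le> y1 r"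
    using first_hit[OF c1[OF p(1) order_refl] p(2), of 0] p(3) a(1) e(1) by auto
  obtain s0 where s0: "p \<le> s0" "s0 \<le> s3" "y1 s0 = a / 2" "\<And>r. s0 \<le> r \<Longrightarrow> r \<le> s3 \<Longrightarrow> y1 r \<le> a / 2"
    using last_hit[OF c1[OF p(1) s3(2)] s3(1), of "a/2"] p(3) a(1) s3(3) by auto
  \<comment> \<open>The distance a/2 is covered in time at most 1/10, so the mean leftward speed is
    at least 5a; at a time of high speed the height must be very negative, since the perturbation of
    the first equation is small.\<close>
  have "\<exists>s\<in>{s0..s3}. f1 (y1 s) (y2 s) (u s) < - 4 * a"
  proof (rule ccontr)
    assume "\<not> ?thesis"
    then have ge: "- 4 * a \<le> f1 (y1 s) (y2 s) (u s)" if "s \<in> {s0..s3}" for s using that by force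
    have "- 4 * a * (s3 - s0) \<le> y1 s3 - y1 s0"
      by (rule has_integral_ge_const[OF traj_int(1)[OF Y]]) (use ge p s0 s3 in auto)
    moreover have "4 * a * (s3 - s0) \<le> 4 * a * (1/10)" using a(1) p s0 s3 t by (intro mult_left_mono) auto
    ultimately show False using s3(3) s0(3) a(1) by simp
  qed
  then obtain s where s: "s \<in> {s0..s3}" "f1 (y1 s) (y2 s) (u s) < - 4 * a" by blast
  have y: "0 \<le> y1 s" "y1 s \<le> a / 2" using s3(4)[of s] s0(4)[of s] s(1) s0(1) by auto
  have "\<bar>r1 (y1 s) (y2 s) (u s)\<bar> \<le> (\<bar>y1 s\<bar> + \<bar>y2 s\<bar>) / 100" by (rule r1_small[OF trajD(5)[OF Y]])
  then have "y2 s \<le> - 3 * a" using s(2) y a(1) unfolding f1_def by argo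
  then show thesis using that[of s] y s(1) p(1) s0 s3 by auto
qed

text \<open>Under the neutral control \<open>u0\<close> the height stays near -M and the first
  coordinate falls at a rate close to M. Prepending a coast of length h thus moves the starting
  point by about h M to the right; the lower the height, the cheaper the displacement.\<close>

lemma coast:
  assumes M: "0 < M" "z2 = - M" "\<bar>z1\<bar> \<le> M" and h: "0 \<le> h" "h \<le> 1/10"
  obtains w1 w2 where "reaches w1 w2 z1 z2 h" "9/10 * (h * M) \<le> w1 - z1" "w1 - z1 \<le> 11/10 * (h * M)" "\<bar>w2 - z2\<bar> \<le> h * M / 40"
proof -
  obtain y1 y2 where Y: "traj (\<lambda>_. u0) y1 y2 h" "y1 h = z1" "y2 h = z2"
    using flow_back_exists[OF Ctl_const[of u0], of h z1 z2] h by auto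
  obtain D sD where D: "sD \<in> {0..h}" "D = \<bar>y1 sD\<bar>" "\<And>r. r \<in> {0..h} \<Longrightarrow> \<bar>y1 r\<bar> \<le> D"
    using attains_sup_abs[OF trajD(3)[OF Y(1)] h(1)] by metis
  obtain E sE where E: "sE \<in> {0..h}" "E = \<bar>y2 sE\<bar>" "\<And>r. r \<in> {0..h} \<Longrightarrow> \<bar>y2 r\<bar> \<le> E"
    using attains_sup_abs[OF trajD(4)[OF Y(1)] h(1)] by metis
  have nn: "0 \<le> D" "0 \<le> E" using D(2) E(2) by auto
  have rb: "\<bar>r1 (y1 r) (y2 r) u0\<bar> \<le> (D + E) / 100" "\<bar>r2 (y1 r) (y2 r) u0\<bar> \<le> (D + E) / 100" if "r \<in> {0..h}" for r
    using r1_small[OF U_vals(3), of "y1 r" "y2 r"] r2_small[OF U_vals(3), of "y1 r" "y2 r"] D(3)[OF that] E(3)[OF that] by argo+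
  have b2: "\<bar>y2 h - y2 r\<bar> \<le> (D + E) / 100 * (h - r)" if "r \<in> {0..h}" for r
    by (rule has_integral_abs_le_const[OF traj_int(2)[OF Y(1)]]) (use that rb v_vals in \<open>auto simp: f2_def\<close>)
  have b1: "\<bar>y1 h - y1 r\<bar> \<le> (E + (D + E) / 100) * (h - r)" if "r \<in> {0..h}" for r
  proof (rule has_integral_abs_le_const[OF traj_int(1)[OF Y(1)]])
    fix x assume "x \<in> {r..h}"
    then have "x \<in> {0..h}" using that by auto
    from rb(1)[OF this] E(3)[OF this] show "\<bar>f1 (y1 x) (y2 x) u0\<bar> \<le> E + (D + E) / 100" unfolding f1_def by argo
  qed (use that in auto)
  have sm: "k * (h - r) \<le> k / 10" if "r \<in> {0..h}" "0 \<le> k" for k r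
    using mult_left_mono[of "h - r" "1/10" k] that h by auto
  have "E \<le> M + (D + E) / 100 / 10" using b2[OF E(1)] sm[OF E(1), of "(D + E) / 100"] nn E(2) Y(3) M by argo
  moreover have "D \<le> M + (E + (D + E) / 100) / 10" using b1[OF D(1)] sm[OF D(1), of "E + (D + E) / 100"] nn D(2) Y(2) M by argo
  ultimately have DE: "(D + E) / 100 \<le> M / 40" using M(1) by argo
  have 0: "0 \<in> {0..h}" using h by simp
  have "(D + E) / 100 * (h - 0) \<le> M / 40 * (h - 0)" by (rule mult_right_mono[OF DE]) (use h in simp)
  then have w2: "\<bar>y2 0 - z2\<bar> \<le> h * M / 40" using b2[OF 0] Y(3) by (simp add: abs_minus_commute mult.commute)
  have y2: "\<bar>y2 r + M\<bar> \<le> M / 400" if "r \<in> {0..h}" for r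
    using b2[OF that] sm[OF that, of "(D + E) / 100"] DE nn Y(3) M by argo
  have f: "- 11/10 * M \<le> f1 (y1 r) (y2 r) u0" "f1 (y1 r) (y2 r) u0 \<le> - 9/10 * M" if "r \<in> {0..h}" for r
    using rb(1)[OF that] y2[OF that] DE M(1) unfolding f1_def by argo+
  have I: "((\<lambda>\<tau>. f1 (y1 \<tau>) (y2 \<tau>) u0) has_integral y1 h - y1 0) {0..h}" using traj_int(1)[OF Y(1), of 0 h] h by simp
  have "- 11/10 * M * (h - 0) \<le> y1 h - y1 0" "y1 h - y1 0 \<le> - 9/10 * M * (h - 0)"
    using has_integral_ge_const[OF I h(1) f(1)] has_integral_le_const[OF I h(1) f(2)] by blast+
  then have "9/10 * (h * M) \<le> y1 0 - z1" "y1 0 - z1 \<le> 11/10 * (h * M)" using Y(2) by (simp_all add: algebra_simps)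
  moreover have "reaches (y1 0) (y2 0) z1 z2 h" using reaches_seg[OF Y(1) order_refl h(1) order_refl] Y by simp
  ultimately show thesis using that w2 by blast
qed

text \<open>Insert a coasting phase where the trajectory moves left fast, transport the gained displacement
  back to the start, and correct the second coordinate by an extremal arc.\<close>
lemma away_from_curve_right:
  assumes x2: "\<bar>x2\<bar> \<le> 1/20" and a: "0 < a" "a \<le> 1" "\<gamma> x2 + a \<le> x1" and S: "reaches x1 x2 0 0 t" and t: "t \<le> 1/20"
    and \<eta>: "0 \<le> \<eta>" "\<eta> \<le> a / 50"
  shows "reaches (x1 + \<eta>) x2 0 0 (t + (1 / a + 2) * \<eta>)"
proof -
  obtain u y1 y2 T where Y: "T \<le> t" "traj u y1 y2 T" "y1 0 = x1" "y2 0 = x2" "y1 T = 0" "y2 T = 0"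
    using S unfolding reaches_def by blast
  have T: "0 \<le> T" "T \<le> 1/10" using trajD(2)[OF Y(2)] Y(1) t by auto
  obtain s where s: "s \<in> {0..T}" "y2 s \<le> - 3 * a" "0 \<le> y1 s" "y1 s \<le> a / 2"
    by (rule excursion[OF Y(2) T(2) Y(5,6), of a]) (use Y x2 a in auto)
  have s': "0 \<le> s" "s \<le> T" "s \<le> 2/5" "s \<le> 1/5" using s(1) T by auto
  define M where "M = - y2 s"
  have M: "3 * a \<le> M" "0 < M" using s(2) a(1) by (auto simp: M_def)
  \<comment> \<open>The coast gains 2\<eta>, twice what is needed. Transport back to time 0 and the
    vertical correction distort this by less than \<eta>, so at least \<eta> survives.\<close>
  define h where "h = 2 * \<eta> / M"
  have hM: "h * M = 2 * \<eta>" using M by (simp add: h_def)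
  have h1: "h \<le> 2/3 * (\<eta> / a)"
  proof -
    have "2 * \<eta> / M \<le> 2 * \<eta> / (3 * a)" using M a(1) \<eta>(1) by (intro divide_left_mono) auto
    then show ?thesis by (simp add: h_def)
  qed
  have ea: "0 \<le> \<eta> / a" "\<eta> / a \<le> 1/50" using \<eta> a(1) by (auto simp: divide_le_eq)
  have "0 \<le> h" using \<eta>(1) M by (simp add: h_def)
  then have h0: "0 \<le> h" "h \<le> 1/10" using h1 ea by argo+
  obtain w1 w2 where W: "reaches w1 w2 (y1 s) (y2 s) h" "9/10 * (h * M) \<le> w1 - y1 s" "w1 - y1 s \<le> 11/10 * (h * M)"
    "\<bar>w2 - y2 s\<bar> \<le> h * M / 40"
    by (rule coast[of M "y2 s" "y1 s" h]) (use M s h0 a in \<open>auto simp: M_def\<close>)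
  obtain z1 z2 where Z: "traj u z1 z2 s" "z1 s = w1" "z2 s = w2"
    using flow_back_exists[OF trajD(1)[OF Y(2)] s'(1,3), of w1 w2] by blast
  note Ys = traj_init[OF Y(2) s'(1,2)]
  have "\<bar>(z1 0 - y1 0) - (z1 s - y1 s)\<bar> \<le> \<bar>z1 s - y1 s\<bar> / 100 + \<bar>z2 s - y2 s\<bar> / 4"
    "\<bar>(z2 0 - y2 0) - (z2 s - y2 s)\<bar> \<le> (\<bar>z1 s - y1 s\<bar> + \<bar>z2 s - y2 s\<bar>) / 100"
    using s' by (intro same_control[OF Ys Z(1) s'(4)]; simp)+
  then have z: "\<bar>(z1 0 - x1) - 2 * \<eta>\<bar> \<le> 3/10 * \<eta>" "\<bar>z2 0 - x2\<bar> \<le> 9/100 * \<eta>"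
    using W(2-4) \<eta>(1) unfolding Y(3,4) Z(2,3) hM by argo+
  have \<eta>1: "\<eta> \<le> 1/50" using \<eta> a by simp
  have "\<bar>x2 - z2 0\<bar> \<le> 1/10" "\<bar>z2 0\<bar> \<le> 3/4" using z(2) \<eta>1 x2 by argo+
  from arrive_vertical[OF this] obtain q where q: "\<bar>q - z1 0\<bar> \<le> 6/5 * \<bar>x2 - z2 0\<bar>"
    "reaches q (z2 0 + (x2 - z2 0)) (z1 0) (z2 0) (6/5 * \<bar>x2 - z2 0\<bar>)" by metis
  have qz: "q - x1 \<le> 5/2 * \<eta>" "\<eta> \<le> q - x1" using q(1) z \<eta>(1) by argo+
  have r1: "reaches q x2 (z1 0) (z2 0) (\<eta> / 5)"
    using q(2) by (simp, elim reaches_mono) (use z(2) \<eta>(1) in argo)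
  have r2: "reaches (z1 0) (z2 0) w1 w2 (s - 0)" using reaches_seg[OF Z(1) order_refl s'(1) order_refl] Z by simp
  have r3: "reaches (y1 s) (y2 s) 0 0 (T - s)" using reaches_seg[OF Y(2) s'(1,2) order_refl] Y by simp
  have "reaches q x2 0 0 (\<eta> / 5 + ((s - 0) + (h + (T - s))))"
    using reaches_trans[OF r1 reaches_trans[OF r2 reaches_trans[OF W(1) r3]]] .
  then have Sq: "reaches q x2 0 0 (t + \<eta> / 5 + h)" by (rule reaches_mono) (use Y(1) in argo)
  \<comment> \<open>The surplus is given back by a motion toward the curve, which has linear
    cost.\<close>
  have "reaches (q - (q - x1 - \<eta>)) x2 0 0 (t + \<eta> / 5 + h + (q - x1 - \<eta>))"
    by (rule toward_curve_left[OF x2 _ _ Sq]) (use qz a \<eta>(1) h1 ea \<eta>1 t in argo)+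
  then have "reaches (x1 + \<eta>) x2 0 0 (t + \<eta> / 5 + h + (q - x1 - \<eta>))" by simp
  then show ?thesis
  proof (rule reaches_mono)
    have "(1 / a + 2) * \<eta> = \<eta> / a + 2 * \<eta>" by (simp add: algebra_simps)
    then show "t + \<eta> / 5 + h + (q - x1 - \<eta>) \<le> t + (1 / a + 2) * \<eta>" using h1 ea qz \<eta>(1) by argo
  qed
qed

text \<open>The vertical correction by h drifts by at most 6/5 h. The remaining horizontal
  displacement towards (x1 - 2h) is therefore still directed at the curve, and only the cheap
  horizontal estimate is needed. This is the origin of the factor 2.\<close>

lemma toward_curve_oblique_left:
  assumes k: "\<bar>k\<bar> = 1" and x2: "\<bar>x2\<bar> \<le> 1/40" and h: "0 \<le> h" "h \<le> 1/100" and S: "reaches x1 x2 0 0 t" and t: "t \<le> 1/20"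
    and off: "\<gamma> (x2 - k * h) \<le> x1 - 2 * h"
  shows "reaches (x1 - 2 * h) (x2 - k * h) 0 0 (t + 5 * h)"
proof -
  have kh: "\<bar>- k * h\<bar> = h" using k h by (simp add: abs_mult)
  have "\<bar>- k * h\<bar> \<le> 1/10" "\<bar>x2\<bar> \<le> 3/4" using kh h x2 by argo+
  from arrive_vertical[OF this, of x1] obtain q where q: "\<bar>q - x1\<bar> \<le> 6/5 * h" "reaches q (x2 - k * h) x1 x2 (6/5 * h)"
    unfolding kh by auto
  have x2': "\<bar>x2 - k * h\<bar> \<le> 1/20" using x2 kh h(2) by argo
  have Sq: "reaches q (x2 - k * h) 0 0 (6/5 * h + t)" by (rule reaches_trans[OF q(2) S])
  have "reaches (q - (q - x1 + 2 * h)) (x2 - k * h) 0 0 (6/5 * h + t + (q - x1 + 2 * h))"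
    by (rule toward_curve_left[OF x2' _ _ Sq]) (use q(1) h off t in argo)+
  then have "reaches (x1 - 2 * h) (x2 - k * h) 0 0 (6/5 * h + t + (q - x1 + 2 * h))" by (simp add: algebra_simps)
  then show ?thesis by (rule reaches_mono) (use q(1) h in argo)
qed

text \<open>Since h is at most a/1000, the vertically corrected point keeps offset at least a/2. The
  horizontal estimate with a/2 and a displacement of at most 32/10 h then yields the constant 7/a +
  8.\<close>

lemma away_from_curve_oblique_right:
  assumes k: "\<bar>k\<bar> = 1" and x2: "\<bar>x2\<bar> \<le> 1/40" and a: "0 < a" "a \<le> 1" "\<gamma> x2 + a \<le> x1" and h: "0 \<le> h" "h \<le> a / 1000"
    and S: "reaches x1 x2 0 0 t" and t: "t \<le> 1/40"
  shows "reaches (x1 + 2 * h) (x2 + k * h) 0 0 (t + (7 / a + 8) * h)"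
proof -
  have h1: "h \<le> 1/1000" using h a by argo
  have kh: "\<bar>k * h\<bar> = h" using k h by (simp add: abs_mult)
  have "\<bar>k * h\<bar> \<le> 1/10" "\<bar>x2\<bar> \<le> 3/4" using kh h1 x2 by argo+
  from arrive_vertical[OF this, of x1] obtain q where q: "\<bar>q - x1\<bar> \<le> 6/5 * h" "reaches q (x2 + k * h) x1 x2 (6/5 * h)"
    unfolding kh by metis
  have x2': "\<bar>x2 + k * h\<bar> \<le> 1/20" using x2 kh h1 by argo
  have Sq: "reaches q (x2 + k * h) 0 0 (6/5 * h + t)" by (rule reaches_trans[OF q(2) S])
  have "\<bar>\<gamma> (x2 + k * h) - \<gamma> x2\<bar> \<le> 3/10 * \<bar>(x2 + k * h) - x2\<bar>" by (rule curve_lip) (use x2 x2' in argo)+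
  then have g: "\<gamma> (x2 + k * h) \<le> \<gamma> x2 + 3/10 * h" using kh unfolding add_diff_cancel_left' by argo
  define \<eta> where "\<eta> = x1 + 2 * h - q"
  have \<eta>: "0 \<le> \<eta>" "\<eta> \<le> 32/10 * h" unfolding \<eta>_def using q(1) h by argo+
  have "reaches (q + \<eta>) (x2 + k * h) 0 0 (6/5 * h + t + (1 / (a / 2) + 2) * \<eta>)"
    by (rule away_from_curve_right[OF x2' _ _ _ Sq]) (use q(1) h h1 a g t \<eta> in argo)+
  then have "reaches (x1 + 2 * h) (x2 + k * h) 0 0 (6/5 * h + t + (1 / (a / 2) + 2) * \<eta>)" by (simp add: \<eta>_def)
  then show ?thesis
  proof (rule reaches_mono)
    have "(1 / (a / 2) + 2) * \<eta> \<le> (1 / (a / 2) + 2) * (32/10 * h)" using \<eta> a by (intro mult_left_mono) auto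
    also have "\<dots> = 64/10 * (h / a) + 64/10 * h" by (simp add: algebra_simps)
    finally have "(1 / (a / 2) + 2) * \<eta> \<le> 64/10 * (h / a) + 64/10 * h" .
    moreover have "(7 / a + 8) * h = 7 * (h / a) + 8 * h" by (simp add: algebra_simps)
    moreover have "0 \<le> h / a" using h a by simp
    ultimately show "6/5 * h + t + (1 / (a / 2) + 2) * \<eta> \<le> t + (7 / a + 8) * h" using h by argo
  qed
qed

lemma toward_curve_oblique_right:
  assumes k: "\<bar>k\<bar> = 1" and x2: "\<bar>x2\<bar> \<le> 1/40" and h: "0 \<le> h" "h \<le> 1/100" and S: "reaches x1 x2 0 0 t" and t: "t \<le> 1/20"
    and off: "x1 + 2 * h \<le> \<gamma> (x2 + k * h)"
  shows "reaches (x1 + 2 * h) (x2 + k * h) 0 0 (t + 5 * h)"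
proof -
  interpret R: switching_curve "\<lambda>x1 x2 w. - r1 (- x1) (- x2) w" "\<lambda>x1 x2 w. - r2 (- x1) (- x2) w" "\<lambda>w. - v w" U Ctl up um u0
    "\<lambda>s. - \<gamma> (- s)" "\<lambda>s. \<gamma>d (- s)" by (rule reflected_curve)
  have "R.reaches (- x1 - 2 * h) (- x2 - k * h) 0 0 (t + 5 * h)"
    by (rule R.toward_curve_oblique_left[OF k _ h _ t]) (use x2 S off in \<open>auto simp: reaches_reflected add.commute\<close>)
  then show ?thesis unfolding reaches_reflected by (simp add: add.commute)
qed

lemma away_from_curve_oblique_left:
  assumes k: "\<bar>k\<bar> = 1" and x2: "\<bar>x2\<bar> \<le> 1/40" and a: "0 < a" "a \<le> 1" "x1 \<le> \<gamma> x2 - a" and h: "0 \<le> h" "h \<le> a / 1000"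
    and S: "reaches x1 x2 0 0 t" and t: "t \<le> 1/40"
  shows "reaches (x1 - 2 * h) (x2 - k * h) 0 0 (t + (7 / a + 8) * h)"
proof -
  interpret R: switching_curve "\<lambda>x1 x2 w. - r1 (- x1) (- x2) w" "\<lambda>x1 x2 w. - r2 (- x1) (- x2) w" "\<lambda>w. - v w" U Ctl up um u0
    "\<lambda>s. - \<gamma> (- s)" "\<lambda>s. \<gamma>d (- s)" by (rule reflected_curve)
  have "R.reaches (- x1 + 2 * h) (- x2 + k * h) 0 0 (t + (7 / a + 8) * h)"
    by (rule R.away_from_curve_oblique_right[OF k _ a(1,2) _ h _ t]) (use x2 S a in \<open>auto simp: reaches_reflected\<close>)
  then show ?thesis unfolding reaches_reflected by (simp add: algebra_simps)
qed

end

section \<open>Weak derivatives along lines\<close>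

lemma integral_lborel_prod_iterated:
  fixes f :: "real \<times> real \<Rightarrow> real"
  assumes "integrable lborel f"
  shows "(\<integral>p. f p \<partial>lborel) = (\<integral>y. (\<integral>s. f (s, y) \<partial>lborel) \<partial>lborel)"
    "integrable lborel (\<lambda>y. \<integral>s. f (s, y) \<partial>lborel)"
proof -
  have "integrable (lborel \<Otimes>\<^sub>M lborel) (case_prod (\<lambda>s y. f (s, y)))" using assms by (simp add: lborel_prod)
  from lborel_pair.integral_snd[OF this] lborel_pair.integrable_snd[OF this]
  show "(\<integral>p. f p \<partial>lborel) = (\<integral>y. (\<integral>s. f (s, y) \<partial>lborel) \<partial>lborel)"
    "integrable lborel (\<lambda>y. \<integral>s. f (s, y) \<partial>lborel)" by (simp_all add: lborel_prod)
qed

text \<open>\<open>g\<close> is a generalised inverse of the monotone \<open>h\<close>. The kernel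
  \<phi>'(s), restricted to w \<le> h(s), is integrated in both orders: over s first, the
  fundamental theorem gives -\<phi>(g w); over w first, it gives (h s - h a) \<phi>'(s). The term
  with h a drops out because \<phi> vanishes at both ends.\<close>

lemma stieltjes_by_parts:
  fixes h g \<phi> \<phi>' :: "real \<Rightarrow> real"
  assumes ab: "a \<le> b" and mono: "\<And>s s'. a \<le> s \<Longrightarrow> s \<le> s' \<Longrightarrow> s' \<le> b \<Longrightarrow> h s \<le> h s'"
    and hm[measurable]: "h \<in> borel_measurable borel"
    and g: "\<And>w s. h a < w \<Longrightarrow> w \<le> h b \<Longrightarrow> s \<in> {a..b} \<Longrightarrow> g w \<le> s \<longleftrightarrow> w \<le> h s"
    and gr: "\<And>w. h a < w \<Longrightarrow> w \<le> h b \<Longrightarrow> g w \<in> {a..b}"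
    and der: "\<And>s. (\<phi> has_real_derivative \<phi>' s) (at s)" and cont: "continuous_on UNIV \<phi>'"
    and \<phi>: "\<phi> a = 0" "\<phi> b = 0"
  shows "(\<integral>w. indicator {h a<..h b} w * \<phi> (g w) \<partial>lborel) = - (\<integral>s. indicator {a..b} s * (h s * \<phi>' s) \<partial>lborel)"
proof -
  have m[measurable]: "\<phi>' \<in> borel_measurable borel" using cont by (rule borel_measurable_continuous_onI)
  have isC: "isCont \<phi>' x" for x using cont by (simp add: continuous_on_eq_continuous_at)
  obtain B where B: "\<And>s. s \<in> {a..b} \<Longrightarrow> \<bar>\<phi>' s\<bar> \<le> B"
  proof -
    have "compact (\<phi>' ` {a..b})" by (intro compact_continuous_image continuous_on_subset[OF cont]) auto
    then obtain B where "\<forall>x\<in>\<phi>' ` {a..b}. norm x \<le> B" using compact_imp_bounded bounded_iff by metis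
    then show thesis using that[of B] by auto
  qed
  define K where "K w s = indicator {h a<..h b} w * (indicator {a..b} s * (if w \<le> h s then \<phi>' s else 0))" for w s
  have Kint: "integrable (lborel \<Otimes>\<^sub>M lborel) (case_prod K)"
  proof (rule integrableI_bounded_set[where A = "{h a<..h b} \<times> {a..b}" and B = B])
    show "case_prod K \<in> borel_measurable (lborel \<Otimes>\<^sub>M lborel)" unfolding K_def split_def by measurable
    show "emeasure (lborel \<Otimes>\<^sub>M lborel) ({h a<..h b} \<times> {a..b}) < \<infinity>"
      by (subst lborel.emeasure_pair_measure_Times) (auto simp: ab mono ennreal_mult_less_top)
    have "norm (case_prod K p) \<le> B" if "p \<in> {h a<..h b} \<times> {a..b}" for p
      using that B[of "snd p"] by (auto simp: K_def split_def indicator_def)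
    then show "AE p \<in> {h a<..h b} \<times> {a..b} in lborel \<Otimes>\<^sub>M lborel. norm (case_prod K p) \<le> B" by simp
    show "AE p in lborel \<Otimes>\<^sub>M lborel. p \<notin> {h a<..h b} \<times> {a..b} \<longrightarrow> case_prod K p = 0"
      by (rule AE_I2) (auto simp: K_def indicator_def split: if_splits)
  qed auto
  have 1: "(\<integral>s. K w s \<partial>lborel) = - (indicator {h a<..h b} w * \<phi> (g w))" for w
  proof (cases "w \<in> {h a<..h b}")
    case True
    then have gw: "g w \<in> {a..b}" using gr by auto
    have eq: "s \<in> {a..b} \<and> w \<le> h s \<longleftrightarrow> s \<in> {g w..b}" for s using g[of w s] gw True by auto
    have "K w s = \<phi>' s * indicator {g w..b} s" for s using eq[of s] True by (auto simp: K_def indicator_def)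
    then have "(\<integral>s. K w s \<partial>lborel) = (\<integral>s. \<phi>' s * indicator {g w..b} s \<partial>lborel)" by simp
    also have "\<dots> = \<phi> b - \<phi> (g w)" by (rule integral_FTC_Icc_real) (use gw der isC in auto)
    finally show ?thesis using True \<phi> by simp
  qed (simp add: K_def)
  have 2: "(\<integral>w. K w s \<partial>lborel) = indicator {a..b} s * (h s * \<phi>' s) - h a * (\<phi>' s * indicator {a..b} s)" for s
  proof (cases "s \<in> {a..b}")
    case True
    then have hs: "h a \<le> h s" "h s \<le> h b" using mono by auto
    have "(\<integral>w. K w s \<partial>lborel) = (\<integral>w. indicator {h a<..h s} w * \<phi>' s \<partial>lborel)"
      using True hs by (intro Bochner_Integration.integral_cong refl) (auto simp: K_def indicator_def)
    also have "\<dots> = (h s - h a) * \<phi>' s" using hs by simp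
    finally show ?thesis using True by (simp add: algebra_simps)
  qed (simp add: K_def)
  have i2: "integrable lborel (\<lambda>s. \<phi>' s * indicator {a..b} s)"
    by (rule integrableI_bounded_set[where A = "{a..b}" and B = B]) (use B ab in \<open>auto simp: indicator_def\<close>)
  have i1: "integrable lborel (\<lambda>s. indicator {a..b} s * (h s * \<phi>' s))"
    using Bochner_Integration.integrable_add[OF lborel_pair.integrable_snd[OF Kint] integrable_mult_right[OF i2, of "h a"]] by (simp add: 2)
  have "(\<integral>w. (\<integral>s. K w s \<partial>lborel) \<partial>lborel) = (\<integral>s. (\<integral>w. K w s \<partial>lborel) \<partial>lborel)"
    using lborel_pair.Fubini_integral[OF Kint] by simp
  then have "- (\<integral>w. indicator {h a<..h b} w * \<phi> (g w) \<partial>lborel) = (\<integral>s. indicator {a..b} s * (h s * \<phi>' s) \<partial>lborel) - h a * (\<integral>s. \<phi>' s * indicator {a..b} s \<partial>lborel)"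
    unfolding 1 2 by (simp add: Bochner_Integration.integral_diff[OF i1 integrable_mult_right[OF i2]])
  moreover have "(\<integral>s. \<phi>' s * indicator {a..b} s \<partial>lborel) = \<phi> b - \<phi> a"
    by (rule integral_FTC_Icc_real) (use ab der isC in auto)
  ultimately show ?thesis using \<phi> by simp
qed

text \<open>Only the derivative in the first variable is recorded, because monotonicity will be
  known along horizontal lines only.\<close>

definition box_test :: "real \<Rightarrow> real \<Rightarrow> real \<Rightarrow> real \<Rightarrow> (real \<times> real \<Rightarrow> real) \<Rightarrow> (real \<times> real \<Rightarrow> real) \<Rightarrow> bool" where
  "box_test a b c d \<phi> \<phi>' \<longleftrightarrow> continuous_on UNIV \<phi> \<and> continuous_on UNIV \<phi>' \<and>
     (\<forall>p. p \<notin> {a<..<b} \<times> {c<..<d} \<longrightarrow> \<phi> p = 0 \<and> \<phi>' p = 0) \<and>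
     (\<forall>s y. ((\<lambda>s. \<phi> (s, y)) has_real_derivative \<phi>' (s, y)) (at s))"

lemma box_test_bounded:
  assumes "box_test a b c d \<phi> \<phi>'"
  obtains B where "\<And>p. \<bar>\<phi> p\<bar> \<le> B" "\<And>p. \<bar>\<phi>' p\<bar> \<le> B"
proof -
  have bd: "\<exists>B. \<forall>p. \<bar>f p\<bar> \<le> B" if "continuous_on UNIV f" "\<And>p. p \<notin> {a<..<b} \<times> {c<..<d} \<Longrightarrow> f p = 0" for f :: "real \<times> real \<Rightarrow> real"
  proof -
    have "compact (f ` ({a..b} \<times> {c..d}))"
      by (intro compact_continuous_image continuous_on_subset[OF that(1)] compact_Times) auto
    then obtain B where B: "\<forall>x\<in>f ` ({a..b} \<times> {c..d}). norm x \<le> B" using compact_imp_bounded bounded_iff by metis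
    have "\<bar>f p\<bar> \<le> \<bar>B\<bar>" for p
    proof (cases "p \<in> {a<..<b} \<times> {c<..<d}")
      case True
      then have "p \<in> {a..b} \<times> {c..d}" by auto
      then show ?thesis using B by force
    qed (use that(2) in auto)
    then show ?thesis by blast
  qed
  obtain B1 B2 where "\<forall>p. \<bar>\<phi> p\<bar> \<le> B1" "\<forall>p. \<bar>\<phi>' p\<bar> \<le> B2"
    using bd[of \<phi>] bd[of \<phi>'] assms unfolding box_test_def by metis
  then show thesis by (intro that[of "max B1 B2"]) (auto simp: le_max_iff_disj)
qed

text \<open>The distributional derivative of a function that is monotone along horizontal lines is the
  image of Lebesgue measure under the inverse map; it is absolutely continuous when the lines
  send null sets to null sets.\<close>
lemma monotone_weak_derivative:
  fixes h :: "real \<Rightarrow> real \<Rightarrow> real"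
  assumes ab: "a \<le> b" and cd: "c \<le> d" and hm: "(\<lambda>p. h (fst p) (snd p)) \<in> borel_measurable borel"
    and cont: "\<And>y. continuous_on {a..b} (\<lambda>s. h s y)"
    and mono: "\<And>s s' y. a \<le> s \<Longrightarrow> s \<le> s' \<Longrightarrow> s' \<le> b \<Longrightarrow> h s y \<le> h s' y"
    and bdd: "\<And>s y. s \<in> {a..b} \<Longrightarrow> \<bar>h s y\<bar> \<le> C"
    and null: "\<And>y N. negligible N \<Longrightarrow> N \<subseteq> {a..b} \<Longrightarrow> negligible ((\<lambda>s. h s y) ` N)"
  obtains \<kappa> where "integrable lborel \<kappa>"
    "\<And>\<phi> \<phi>'. box_test a b c d \<phi> \<phi>' \<Longrightarrow> (\<integral>p. h (fst p) (snd p) * \<phi>' p \<partial>lborel) = - (\<integral>p. \<kappa> p * \<phi> p \<partial>lborel)"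
proof -
  have hm1[measurable]: "(\<lambda>y. h s y) \<in> borel_measurable borel" for s
    using measurable_compose[of "\<lambda>y. (s, y)" borel borel, OF _ hm] by (simp add: borel_measurable_Pair)
  have hm2[measurable]: "(\<lambda>s. h s y) \<in> borel_measurable borel" for y
    using measurable_compose[of "\<lambda>s. (s, y)" borel borel, OF _ hm] by (simp add: borel_measurable_Pair)
  \<comment> \<open>Points (w, y) such that w lies in the range of values of \<open>h\<close> on
    line y: the space on which the inverse map lives.\<close>
  define W where "W = {p :: real \<times> real. snd p \<in> {c..d} \<and> h a (snd p) < fst p \<and> fst p \<le> h b (snd p)}"
  \<comment> \<open>The inverse of \<open>h\<close> on each line. The value b + 1 outside
    \<open>W\<close> exceeds all genuine values, so sublevel sets below it lie in
    \<open>W\<close>.\<close>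
  define g where "g p = (if p \<in> W then Inf {s \<in> {a..b}. fst p \<le> h s (snd p)} else b + 1)" for p
  have Wm[measurable]: "W \<in> sets borel"
  proof -
    have "{p \<in> space (borel \<Otimes>\<^sub>M borel). snd p \<in> {c..d} \<and> h a (snd p) < fst p \<and> fst p \<le> h b (snd p)} \<in> sets (borel \<Otimes>\<^sub>M borel)"
      by measurable
    then show ?thesis unfolding borel_prod W_def by simp
  qed
  have gW: "g p \<in> {a..b} \<and> fst p \<le> h (g p) (snd p) \<and> (\<forall>s\<in>{a..b}. fst p \<le> h s (snd p) \<longrightarrow> g p \<le> s)" if p: "p \<in> W" for p
  proof -
    define K where "K = {s \<in> {a..b}. fst p \<le> h s (snd p)}"
    have "K = {a..b} \<inter> (\<lambda>s. h s (snd p)) -` {fst p..}" by (auto simp: K_def)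
    then have "closed K" using continuous_closed_preimage[OF cont closed_atLeastAtMost closed_atLeast] by simp
    moreover have ne: "K \<noteq> {}" "bdd_below K" using p ab by (auto simp: K_def W_def intro!: exI[of _ b])
    ultimately have "Inf K \<in> K" using closed_contains_Inf by blast
    moreover have "Inf K \<le> s" if "s \<in> K" for s using ne that by (intro cInf_lower) auto
    ultimately show ?thesis using p by (auto simp: g_def K_def)
  qed
  have gle: "g p \<le> s \<longleftrightarrow> fst p \<le> h s (snd p)" if "p \<in> W" "s \<in> {a..b}" for p s
    using gW[OF that(1)] that(2) mono[of "g p" s "snd p"] by auto
  have gval: "h (g p) (snd p) = fst p" if p: "p \<in> W" for p
  proof -
    obtain s where s: "a \<le> s" "s \<le> b" "h s (snd p) = fst p"
      using IVT'[of "\<lambda>s. h s (snd p)" a "fst p" b] p ab cont by (auto simp: W_def)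
    then have "g p \<le> s" using gle[OF p, of s] by simp
    then have "h (g p) (snd p) \<le> fst p" using mono[of "g p" s "snd p"] gW[OF p] s by auto
    then show ?thesis using gW[OF p] by simp
  qed
  have gm[measurable]: "g \<in> borel_measurable borel"
  proof (rule borel_measurable_iff_le[THEN iffD2], rule allI)
    fix s
    consider "b + 1 \<le> s" | "s < a" | "a \<le> s" "s < b + 1" by linarith
    then show "{w \<in> space borel. g w \<le> s} \<in> sets borel"
    proof cases
      case 1
      have "g w \<le> s" for w using 1 gW[of w] by (cases "w \<in> W") (auto simp: g_def)
      then show ?thesis by simp
    next
      case 2
      have "\<not> g w \<le> s" for w using 2 gW[of w] ab by (cases "w \<in> W") (auto simp: g_def)
      then show ?thesis by simp
    next
      case 3
      have "g w \<le> s \<longleftrightarrow> w \<in> W \<and> fst w \<le> h (min s b) (snd w)" for w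
      proof (cases "w \<in> W")
        case True
        have "g w \<le> s \<longleftrightarrow> g w \<le> min s b" using gW[OF True] by auto
        then show ?thesis using True gle[OF True, of "min s b"] 3 ab by auto
      qed (use 3 in \<open>auto simp: g_def\<close>)
      then have "{w \<in> space borel. g w \<le> s} = W \<inter> {w. fst w \<le> h (min s b) (snd w)}" by auto
      moreover have "{p \<in> space (borel \<Otimes>\<^sub>M borel). fst p \<le> h (min s b) (snd p)} \<in> sets (borel \<Otimes>\<^sub>M borel)"
        by measurable
      then have "{w. fst w \<le> h (min s b) (snd w)} \<in> sets borel" unfolding borel_prod by simp
      ultimately show ?thesis using Wm by simp
    qed
  qed
  \<comment> \<open>The candidate for the derivative: Lebesgue measure on \<open>W\<close> carried
    back to the box by the inverse map.\<close>
  define \<mu> where "\<mu> = distr (density lborel (indicator W)) borel (\<lambda>p. (g p, snd p))"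
  have \<Theta>m: "(\<lambda>p. (g p, snd p)) \<in> borel_measurable borel" by (intro borel_measurable_Pair gm borel_measurable_continuous_onI continuous_intros)
  have Wfin: "emeasure lborel W < \<infinity>"
  proof -
    have "W \<subseteq> {-C..C} \<times> {c..d}"
    proof
      fix p assume "p \<in> W"
      then show "p \<in> {-C..C} \<times> {c..d}" using bdd[of a "snd p"] bdd[of b "snd p"] ab
        by (cases p) (simp add: W_def abs_le_iff)
    qed
    then have "emeasure lborel W \<le> emeasure (lborel \<Otimes>\<^sub>M lborel) ({-C..C} \<times> {c..d})"
      unfolding lborel_prod by (intro emeasure_mono) (auto simp: borel_prod[symmetric])
    also have "\<dots> < \<infinity>" by (subst lborel.emeasure_pair_measure_Times) (auto simp: cd ennreal_mult_less_top emeasure_lborel_Icc_eq)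
    finally show ?thesis .
  qed
  have em: "emeasure \<mu> X = emeasure lborel (W \<inter> (\<lambda>p. (g p, snd p)) -` X)" if "X \<in> sets borel" for X
  proof -
    have "(\<lambda>p. (g p, snd p)) -` X \<in> sets lborel" using measurable_sets[OF \<Theta>m that] by simp
    note A = this
    have "emeasure \<mu> X = emeasure (density lborel (indicator W)) ((\<lambda>p. (g p, snd p)) -` X)"
      unfolding \<mu>_def using that \<Theta>m by (subst emeasure_distr) auto
    also have "\<dots> = (\<integral>\<^sup>+p. indicator W p * indicator ((\<lambda>p. (g p, snd p)) -` X) p \<partial>lborel)"
      using A by (subst emeasure_density) auto
    also have "\<dots> = (\<integral>\<^sup>+p. indicator (W \<inter> (\<lambda>p. (g p, snd p)) -` X) p \<partial>lborel)"
      by (simp add: indicator_inter_arith)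
    also have "\<dots> = emeasure lborel (W \<inter> (\<lambda>p. (g p, snd p)) -` X)"
      using A Wm by (intro nn_integral_indicator) auto
    finally show ?thesis .
  qed
  have fin: "finite_measure \<mu>"
    by (rule finite_measureI) (use Wfin em[of UNIV] in \<open>auto simp: \<mu>_def\<close>)
  have ac: "absolutely_continuous lborel \<mu>" unfolding absolutely_continuous_def
  proof
    fix N :: "(real \<times> real) set" assume N: "N \<in> null_sets lborel"
    then have Nb: "N \<in> sets borel" by auto
    define X where "X = W \<inter> (\<lambda>p. (g p, snd p)) -` N"
    have Xb: "X \<in> sets (lborel \<Otimes>\<^sub>M lborel)" unfolding X_def lborel_prod using measurable_sets[OF \<Theta>m Nb] by auto
    have Nb': "N \<in> sets (lborel \<Otimes>\<^sub>M lborel)" unfolding lborel_prod using Nb by simp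
    have "emeasure (lborel \<Otimes>\<^sub>M lborel) N = 0" unfolding lborel_prod using N by auto
    then have "(\<integral>\<^sup>+y. emeasure lborel ((\<lambda>x. (x, y)) -` N) \<partial>lborel) = 0"
      by (simp add: lborel_pair.emeasure_pair_measure_alt2[OF Nb'])
    then have "AE y in lborel. emeasure lborel ((\<lambda>x. (x, y)) -` N) = 0"
      using lborel_pair.measurable_emeasure_Pair2[OF Nb'] by (subst (asm) nn_integral_0_iff_AE) auto
    then have "AE y in lborel. emeasure lborel ((\<lambda>x. (x, y)) -` X) = 0"
    proof (rule AE_mp, intro AE_I2 impI)
      fix y assume 0: "emeasure lborel ((\<lambda>x. (x, y)) -` N) = 0"
      have Ny: "(\<lambda>x. (x, y)) -` N \<in> sets borel" using sets_Pair2[OF Nb', of y] by simp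
      have Xy: "(\<lambda>x. (x, y)) -` X \<in> sets borel" using sets_Pair2[OF Xb, of y] by simp
      have "negligible ((\<lambda>x. (x, y)) -` N)"
        using 0 Ny by (simp add: negligible_iff_null_sets null_sets_completionI null_setsI)
      then have "negligible ((\<lambda>s. h s y) ` (((\<lambda>x. (x, y)) -` N) \<inter> {a..b}))"
        by (intro null negligible_Int) auto
      \<comment> \<open>On each line the values sent into the null set are images of its slice under
        \<open>h\<close>; by condition (N) they form a null set, and Fubini concludes.\<close>
      moreover have "(\<lambda>x. (x, y)) -` X \<subseteq> (\<lambda>s. h s y) ` (((\<lambda>x. (x, y)) -` N) \<inter> {a..b})"
      proof
        fix w assume "w \<in> (\<lambda>x. (x, y)) -` X"
        then have w: "(w, y) \<in> W" "(g (w, y), y) \<in> N" by (auto simp: X_def)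
        show "w \<in> (\<lambda>s. h s y) ` (((\<lambda>x. (x, y)) -` N) \<inter> {a..b})"
          using gval[OF w(1)] gW[OF w(1)] w(2) by (intro image_eqI[of _ _ "g (w, y)"]) auto
      qed
      ultimately have "negligible ((\<lambda>x. (x, y)) -` X)" by (rule negligible_subset)
      then show "emeasure lborel ((\<lambda>x. (x, y)) -` X) = 0"
        using Xy by (auto simp: negligible_iff_null_sets null_sets_completion_iff)
    qed
    then have "emeasure (lborel \<Otimes>\<^sub>M lborel) X = 0"
      unfolding lborel_pair.emeasure_pair_measure_alt2[OF Xb]
      using lborel_pair.measurable_emeasure_Pair2[OF Xb] by (subst nn_integral_0_iff_AE) auto
    then have "emeasure \<mu> N = 0" using em[OF Nb] by (simp add: X_def lborel_prod)
    then show "N \<in> null_sets \<mu>" using Nb by (auto simp: \<mu>_def null_sets_def)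
  qed
  have sets\<mu>: "sets \<mu> = sets lborel" by (simp add: \<mu>_def)
  obtain \<kappa> where \<kappa>: "\<kappa> \<in> borel_measurable lborel" "AE x in lborel. RN_deriv lborel \<mu> x = ennreal (\<kappa> x)" "\<And>x. 0 \<le> \<kappa> x"
    using sigma_finite_measure.real_RN_deriv[OF lborel.sigma_finite_measure_axioms fin ac sets\<mu>] by metis
  have dens: "\<mu> = density lborel (\<lambda>x. ennreal (\<kappa> x))"
    using sigma_finite_measure.density_RN_deriv[OF lborel.sigma_finite_measure_axioms ac sets\<mu>] density_cong[OF _ _ \<kappa>(2)] \<kappa>(1) by auto
  have \<kappa>i: "integrable lborel \<kappa>"
  proof (rule integrableI_nonneg[OF \<kappa>(1)])
    have "(\<integral>\<^sup>+ x. ennreal (\<kappa> x) \<partial>lborel) = emeasure \<mu> UNIV" using \<kappa>(1) by (simp add: dens emeasure_density)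
    then show "(\<integral>\<^sup>+ x. ennreal (\<kappa> x) \<partial>lborel) < \<infinity>" using finite_measure.emeasure_finite[OF fin, of UNIV] by (simp add: less_top)
  qed (use \<kappa>(3) in auto)
  show thesis
  proof (rule that[OF \<kappa>i])
    fix \<phi> \<phi>' assume T: "box_test a b c d \<phi> \<phi>'"
    obtain B where B: "\<And>p. \<bar>\<phi> p\<bar> \<le> B" "\<And>p. \<bar>\<phi>' p\<bar> \<le> B" using box_test_bounded[OF T] by metis
    have m[measurable]: "\<phi> \<in> borel_measurable borel" "\<phi>' \<in> borel_measurable borel"
      using T by (auto simp: box_test_def intro: borel_measurable_continuous_onI)
    have sub: "{a<..<b} \<times> {c<..<d} \<subseteq> {a..b} \<times> {c..d}" by auto
    have out: "\<phi> p = 0" "\<phi>' p = 0" if "p \<notin> {a<..<b} \<times> {c<..<d}" for p using T that unfolding box_test_def by blast+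
    have "(\<integral>p. \<kappa> p * \<phi> p \<partial>lborel) = (\<integral>p. \<phi> p \<partial>\<mu>)" unfolding dens using \<kappa> by (subst integral_density) auto
    also have "\<dots> = (\<integral>p. \<phi> (g p, snd p) \<partial>density lborel (indicator W))"
      unfolding \<mu>_def using \<Theta>m by (subst integral_distr) auto
    also have "\<dots> = (\<integral>p. indicator W p * \<phi> (g p, snd p) \<partial>lborel)"
    proof -
      have "(\<integral>p. \<phi> (g p, snd p) \<partial>density lborel (\<lambda>x. ennreal (indicator W x))) = (\<integral>p. indicator W p *\<^sub>R \<phi> (g p, snd p) \<partial>lborel)"
        using measurable_compose[OF \<Theta>m m(1)] by (subst integral_density) auto
      then show ?thesis by (simp add: ennreal_indicator)
    qed
    also have "\<dots> = (\<integral>y. (\<integral>w. indicator W (w, y) * \<phi> (g (w, y), y) \<partial>lborel) \<partial>lborel)"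
    proof -
      have "integrable lborel (\<lambda>p. indicator W p * \<phi> (g p, snd p))"
        by (rule integrableI_bounded_set[where A = W and B = B])
          (use Wfin B measurable_compose[OF \<Theta>m m(1)] in \<open>auto simp: indicator_def\<close>)
      from integral_lborel_prod_iterated(1)[OF this] show ?thesis by simp
    qed
    also have "\<dots> = (\<integral>y. - (\<integral>s. h s y * \<phi>' (s, y) \<partial>lborel) \<partial>lborel)"
    proof (intro Bochner_Integration.integral_cong refl)
      fix y
      show "(\<integral>w. indicator W (w, y) * \<phi> (g (w, y), y) \<partial>lborel) = - (\<integral>s. h s y * \<phi>' (s, y) \<partial>lborel)"
      proof (cases "y \<in> {c..d}")
        case True
        have "(\<integral>w. indicator W (w, y) * \<phi> (g (w, y), y) \<partial>lborel) = (\<integral>w. indicator {h a y<..h b y} w * \<phi> (g (w, y), y) \<partial>lborel)"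
          using True by (intro Bochner_Integration.integral_cong refl) (auto simp: W_def indicator_def)
        also have "\<dots> = - (\<integral>s. indicator {a..b} s * (h s y * \<phi>' (s, y)) \<partial>lborel)"
        proof (rule stieltjes_by_parts[where h = "\<lambda>s. h s y" and g = "\<lambda>w. g (w, y)" and \<phi> = "\<lambda>s. \<phi> (s, y)" and \<phi>' = "\<lambda>s. \<phi>' (s, y)", OF ab mono hm2])
          fix w s assume "h a y < w" "w \<le> h b y" "s \<in> {a..b}"
          then show "g (w, y) \<le> s \<longleftrightarrow> w \<le> h s y" using gle[of "(w, y)" s] True by (simp add: W_def)
        next
          fix w assume "h a y < w" "w \<le> h b y"
          then have "(w, y) \<in> W" using True by (simp add: W_def)
          from gW[OF this] show "g (w, y) \<in> {a..b}" by blast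
        next
          have "continuous_on UNIV \<phi>'" using T by (simp add: box_test_def)
          from continuous_on_compose2[OF this, of UNIV "\<lambda>s. (s, y)"]
          show "continuous_on UNIV (\<lambda>s. \<phi>' (s, y))" by (simp add: continuous_on_Pair)
        next
          show "((\<lambda>s. \<phi> (s, y)) has_real_derivative \<phi>' (s, y)) (at s)" for s using T by (simp add: box_test_def)
        qed (use out(1)[of "(a, y)"] out(1)[of "(b, y)"] in simp_all)
        also have "(\<integral>s. indicator {a..b} s * (h s y * \<phi>' (s, y)) \<partial>lborel) = (\<integral>s. h s y * \<phi>' (s, y) \<partial>lborel)"
        proof -
          have "indicator {a..b} s * (h s y * \<phi>' (s, y)) = h s y * \<phi>' (s, y)" for s
            by (cases "s \<in> {a..b}") (use out(2)[of "(s, y)"] in \<open>force+\<close>)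
          then show ?thesis by (rule Bochner_Integration.integral_cong[OF refl])
        qed
        finally show ?thesis .
      next
        case False
        then have "\<phi>' (w, y) = 0" for w by (intro out(2)) auto
        moreover have "indicator W (w, y) = (0::real)" for w using False by (auto simp: W_def indicator_def)
        ultimately show ?thesis by simp
      qed
    qed
    also have "\<dots> = - (\<integral>p. h (fst p) (snd p) * \<phi>' p \<partial>lborel)"
    proof -
      have "integrable lborel (\<lambda>p. h (fst p) (snd p) * \<phi>' p)"
      proof (rule integrableI_bounded_set[where A = "{a..b} \<times> {c..d}" and B = "C * B"])
        show "emeasure lborel ({a..b} \<times> {c..d}) < \<infinity>" unfolding lborel_prod[symmetric]
          by (subst lborel.emeasure_pair_measure_Times) (auto simp: ab cd ennreal_mult_less_top)
        show "{a..b} \<times> {c..d} \<in> sets (lborel :: (real \<times> real) measure)" by (auto simp: borel_prod[symmetric])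
        have "norm (h (fst p) (snd p) * \<phi>' p) \<le> C * B" if "p \<in> {a..b} \<times> {c..d}" for p
        proof -
          have 1: "\<bar>h (fst p) (snd p)\<bar> \<le> C" using that by (intro bdd) auto
          show ?thesis unfolding real_norm_def abs_mult using order_trans[OF abs_ge_zero 1] by (intro mult_mono 1 B(2)) auto
        qed
        then show "AE p \<in> {a..b} \<times> {c..d} in lborel. norm (h (fst p) (snd p) * \<phi>' p) \<le> C * B" by (intro AE_I2) blast
        show "AE p in lborel. p \<notin> {a..b} \<times> {c..d} \<longrightarrow> h (fst p) (snd p) * \<phi>' p = 0"
          using out(2) sub by (intro AE_I2 impI) (simp, blast)
        show "(\<lambda>p. h (fst p) (snd p) * \<phi>' p) \<in> borel_measurable lborel" using hm m(2) by simp
      qed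
      from integral_lborel_prod_iterated(1)[OF this] show ?thesis by simp
    qed
    finally show "(\<integral>p. h (fst p) (snd p) * \<phi>' p \<partial>lborel) = - (\<integral>p. \<kappa> p * \<phi> p \<partial>lborel)" by simp
  qed
qed

text \<open>Condition (N) survives one bad point, which adds a single point to the image. No bound
  near \<sigma> is needed, so the Lipschitz constants may blow up there.\<close>

lemma negligible_image_locally_lipschitz:
  fixes f :: "real \<Rightarrow> real"
  assumes N: "negligible N" "N \<subseteq> {a..b}"
    and lip: "\<And>s. s \<in> {a..b} \<Longrightarrow> s \<noteq> \<sigma> \<Longrightarrow> \<exists>e>0. \<exists>B. \<forall>s'\<in>{a..b}. \<bar>s' - s\<bar> < e \<longrightarrow> \<bar>f s' - f s\<bar> \<le> B * \<bar>s' - s\<bar>"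
  shows "negligible (f ` N)"
proof -
  have "negligible (f ` (N - {\<sigma>}))"
  proof (rule negligible_locally_Lipschitz_image)
    show "negligible (N - {\<sigma>})" using N(1) by (rule negligible_diff)
    fix x assume x: "x \<in> N - {\<sigma>}"
    then obtain e B where e: "0 < e" "\<forall>s'\<in>{a..b}. \<bar>s' - x\<bar> < e \<longrightarrow> \<bar>f s' - f x\<bar> \<le> B * \<bar>s' - x\<bar>"
      using lip[of x] N(2) by blast
    show "\<exists>T B. open T \<and> x \<in> T \<and> (\<forall>y\<in>(N - {\<sigma>}) \<inter> T. norm (f y - f x) \<le> B * norm (y - x))"
      using e N(2) by (intro exI[of _ "ball x e"] exI[of _ B]) (auto simp: dist_real_def abs_minus_commute)
  qed simp
  then have "negligible (insert (f \<sigma>) (f ` (N - {\<sigma>})))" by simp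
  moreover have "f ` N \<subseteq> insert (f \<sigma>) (f ` (N - {\<sigma>}))" by auto
  ultimately show ?thesis by (rule negligible_subset)
qed

text \<open>Along every horizontal line the function falls (up to slope C) before \<open>\<sigma> y\<close> and rises (up to
  slope -C) after it, so it is a difference of functions covered by the monotone case.\<close>
lemma valley_weak_derivative:
  fixes f :: "real \<Rightarrow> real \<Rightarrow> real"
  assumes ab: "a \<le> b" and cd: "c \<le> d" and C: "0 \<le> C"
    and cont: "continuous_on UNIV (\<lambda>p. f (fst p) (snd p))" and bdd: "\<And>s y. \<bar>f s y\<bar> \<le> M"
    and \<sigma>m: "\<sigma> \<in> borel_measurable borel" and \<sigma>: "\<And>y. \<sigma> y \<in> {a..b}"
    and fall: "\<And>s s' y. a \<le> s \<Longrightarrow> s \<le> s' \<Longrightarrow> s' \<le> \<sigma> y \<Longrightarrow> f s' y \<le> f s y + C * (s' - s)"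
    and rise: "\<And>s s' y. \<sigma> y \<le> s \<Longrightarrow> s \<le> s' \<Longrightarrow> s' \<le> b \<Longrightarrow> f s y \<le> f s' y + C * (s' - s)"
    and lip: "\<And>s y. s \<in> {a..b} \<Longrightarrow> s \<noteq> \<sigma> y \<Longrightarrow> \<exists>e>0. \<exists>B. \<forall>s'\<in>{a..b}. \<bar>s' - s\<bar> < e \<longrightarrow> \<bar>f s' y - f s y\<bar> \<le> B * \<bar>s' - s\<bar>"
  obtains g where "integrable lborel g"
    "\<And>\<phi> \<phi>'. box_test a b c d \<phi> \<phi>' \<Longrightarrow> (\<integral>p. f (fst p) (snd p) * \<phi>' p \<partial>lborel) = - (\<integral>p. g p * \<phi> p \<partial>lborel)"
proof -
  have fm[measurable]: "(\<lambda>p. f (fst p) (snd p)) \<in> borel_measurable borel" by (rule borel_measurable_continuous_onI[OF cont])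
  have fm2: "(\<lambda>p. f (u p) (snd p)) \<in> borel_measurable borel" if "u \<in> borel_measurable borel" for u :: "real \<times> real \<Rightarrow> real"
  proof -
    have "(\<lambda>p. (u p, snd p)) \<in> borel_measurable borel"
      by (intro borel_measurable_Pair that borel_measurable_continuous_onI continuous_intros)
    from measurable_compose[OF this fm] show ?thesis by simp
  qed
  have fstm: "(\<lambda>p::real \<times> real. fst p) \<in> borel_measurable borel" by (intro borel_measurable_continuous_onI continuous_intros)
  have sm: "(\<lambda>p::real \<times> real. \<sigma> (snd p)) \<in> borel_measurable borel"
    by (rule measurable_compose[OF _ \<sigma>m]) (intro borel_measurable_continuous_onI continuous_intros)
  have fc: "continuous_on UNIV (\<lambda>s. f s y)" for y
  proof -
    have "continuous_on UNIV (\<lambda>s. (s, y))" by (intro continuous_intros)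
    from continuous_on_compose2[OF cont this] show ?thesis by simp
  qed
  have lipC: "\<bar>C * s' - C * s\<bar> \<le> C * \<bar>s' - s\<bar>" for s s' using C by (simp add: abs_mult flip: right_diff_distrib)
  \<comment> \<open>The function is frozen on one side of the valley point. Adding C s makes both
    halves increasing; on the falling side this is true after a change of sign.\<close>
  define hL where "hL s y = C * s - f (min s (\<sigma> y)) y" for s y
  define hR where "hR s y = C * s + f (max s (\<sigma> y)) y" for s y
  have bd: "\<bar>C * s + e\<bar> \<le> C * (\<bar>a\<bar> + \<bar>b\<bar>) + M" if "s \<in> {a..b}" "\<bar>e\<bar> \<le> M" for s e
  proof -
    have "\<bar>s\<bar> \<le> \<bar>a\<bar> + \<bar>b\<bar>" using that(1) by auto
    then have "\<bar>C * s\<bar> \<le> C * (\<bar>a\<bar> + \<bar>b\<bar>)" using C by (simp add: abs_mult mult_left_mono)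
    then show ?thesis using that(2) by linarith
  qed
  have loc: "\<exists>e>0. \<exists>B. \<forall>s'\<in>{a..b}. \<bar>s' - s\<bar> < e \<longrightarrow> \<bar>(C * s' + k * f (m s') y) - (C * s + k * f (m s) y)\<bar> \<le> B * \<bar>s' - s\<bar>"
    if s: "s \<in> {a..b}" "s \<noteq> \<sigma> y" and k: "\<bar>k\<bar> = 1" and m: "m = (\<lambda>s. min s (\<sigma> y)) \<or> m = (\<lambda>s. max s (\<sigma> y))" for s y k m
  proof -
    obtain e B where e: "0 < e" "\<And>s'. s' \<in> {a..b} \<Longrightarrow> \<bar>s' - s\<bar> < e \<Longrightarrow> \<bar>f s' y - f s y\<bar> \<le> B * \<bar>s' - s\<bar>"
      using lip[OF s] by blast
    define e' where "e' = min e \<bar>s - \<sigma> y\<bar>"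
    have "\<bar>(C * s' + k * f (m s') y) - (C * s + k * f (m s) y)\<bar> \<le> (C + \<bar>B\<bar>) * \<bar>s' - s\<bar>"
      if s': "s' \<in> {a..b}" "\<bar>s' - s\<bar> < e'" for s'
    proof -
      have "(m s' = s' \<and> m s = s) \<or> (m s' = \<sigma> y \<and> m s = \<sigma> y)"
      proof -
        have "\<bar>s' - s\<bar> < \<bar>s - \<sigma> y\<bar>" using s'(2) by (simp add: e'_def)
        then have "(s < \<sigma> y \<and> s' < \<sigma> y) \<or> (\<sigma> y < s \<and> \<sigma> y < s')" by linarith
        then show ?thesis using m by auto
      qed
      moreover have "\<bar>f s' y - f s y\<bar> \<le> \<bar>B\<bar> * \<bar>s' - s\<bar>"
        using e(2)[of s'] s' mult_right_mono[OF abs_ge_self abs_ge_zero, of B "s' - s"] by (simp add: e'_def)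
      ultimately have "\<bar>f (m s') y - f (m s) y\<bar> \<le> \<bar>B\<bar> * \<bar>s' - s\<bar>" by auto
      then have "\<bar>k * f (m s') y - k * f (m s) y\<bar> \<le> \<bar>B\<bar> * \<bar>s' - s\<bar>" using k by (simp add: abs_mult flip: right_diff_distrib)
      then show ?thesis using lipC[of s' s] by (simp add: distrib_right)
    qed
    moreover have "0 < e'" using e s by (simp add: e'_def)
    ultimately show ?thesis by blast
  qed
  obtain \<kappa>L where L: "integrable lborel \<kappa>L"
    "\<And>\<phi> \<phi>'. box_test a b c d \<phi> \<phi>' \<Longrightarrow> (\<integral>p. hL (fst p) (snd p) * \<phi>' p \<partial>lborel) = - (\<integral>p. \<kappa>L p * \<phi> p \<partial>lborel)"
  proof (rule monotone_weak_derivative[OF ab cd, where h = hL and C = "C * (\<bar>a\<bar> + \<bar>b\<bar>) + M"])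
    show "(\<lambda>p. hL (fst p) (snd p)) \<in> borel_measurable borel" unfolding hL_def
      by (intro borel_measurable_diff borel_measurable_times fm2 borel_measurable_min fstm sm borel_measurable_const)
    show "continuous_on {a..b} (\<lambda>s. hL s y)" for y unfolding hL_def
      by (intro continuous_intros continuous_on_compose2[OF fc]) auto
    show "hL s y \<le> hL s' y" if "a \<le> s" "s \<le> s'" "s' \<le> b" for s s' y
    proof -
      have "f (min s' (\<sigma> y)) y \<le> f (min s (\<sigma> y)) y + C * (min s' (\<sigma> y) - min s (\<sigma> y))"
        by (rule fall) (use that \<sigma>[of y] in auto)
      also have "C * (min s' (\<sigma> y) - min s (\<sigma> y)) \<le> C * (s' - s)" using C that by (intro mult_left_mono) auto
      finally show ?thesis by (simp add: hL_def right_diff_distrib)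
    qed
    show "\<bar>hL s y\<bar> \<le> C * (\<bar>a\<bar> + \<bar>b\<bar>) + M" if "s \<in> {a..b}" for s y
      using bd[OF that, of "- f (min s (\<sigma> y)) y"] bdd by (simp add: hL_def)
    show "negligible ((\<lambda>s. hL s y) ` N)" if "negligible N" "N \<subseteq> {a..b}" for y N
      using negligible_image_locally_lipschitz[OF that loc[where k = "- 1" and m = "\<lambda>s. min s (\<sigma> y)"]] by (simp add: hL_def)
  qed (rule that)
  obtain \<kappa>R where R: "integrable lborel \<kappa>R"
    "\<And>\<phi> \<phi>'. box_test a b c d \<phi> \<phi>' \<Longrightarrow> (\<integral>p. hR (fst p) (snd p) * \<phi>' p \<partial>lborel) = - (\<integral>p. \<kappa>R p * \<phi> p \<partial>lborel)"
  proof (rule monotone_weak_derivative[OF ab cd, where h = hR and C = "C * (\<bar>a\<bar> + \<bar>b\<bar>) + M"])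
    show "(\<lambda>p. hR (fst p) (snd p)) \<in> borel_measurable borel" unfolding hR_def
      by (intro borel_measurable_add borel_measurable_times fm2 borel_measurable_max fstm sm borel_measurable_const)
    show "continuous_on {a..b} (\<lambda>s. hR s y)" for y unfolding hR_def
      by (intro continuous_intros continuous_on_compose2[OF fc]) auto
    show "hR s y \<le> hR s' y" if "a \<le> s" "s \<le> s'" "s' \<le> b" for s s' y
    proof -
      have "f (max s (\<sigma> y)) y \<le> f (max s' (\<sigma> y)) y + C * (max s' (\<sigma> y) - max s (\<sigma> y))"
        by (rule rise) (use that \<sigma>[of y] in auto)
      also have "C * (max s' (\<sigma> y) - max s (\<sigma> y)) \<le> C * (s' - s)" using C that by (intro mult_left_mono) auto
      finally show ?thesis by (simp add: hR_def right_diff_distrib)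
    qed
    show "\<bar>hR s y\<bar> \<le> C * (\<bar>a\<bar> + \<bar>b\<bar>) + M" if "s \<in> {a..b}" for s y
      using bd[OF that bdd] by (simp add: hR_def)
    show "negligible ((\<lambda>s. hR s y) ` N)" if "negligible N" "N \<subseteq> {a..b}" for y N
      using negligible_image_locally_lipschitz[OF that loc[where k = 1 and m = "\<lambda>s. max s (\<sigma> y)"]] by (simp add: hR_def)
  qed (rule that)
  have split: "f s y = hR s y - hL s y - f (\<sigma> y) y" for s y
    by (cases "s \<le> \<sigma> y") (auto simp: hR_def hL_def min_def max_def)
  show thesis
  proof (rule that[of "\<lambda>p. \<kappa>R p - \<kappa>L p"])
    show "integrable lborel (\<lambda>p. \<kappa>R p - \<kappa>L p)" using L R by simp
    fix \<phi> \<phi>' assume T: "box_test a b c d \<phi> \<phi>'"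
    obtain B where B: "\<And>p. \<bar>\<phi> p\<bar> \<le> B" "\<And>p. \<bar>\<phi>' p\<bar> \<le> B" using box_test_bounded[OF T] by metis
    have m[measurable]: "\<phi> \<in> borel_measurable borel" "\<phi>' \<in> borel_measurable borel"
      using T by (auto simp: box_test_def intro: borel_measurable_continuous_onI)
    have sub: "{a<..<b} \<times> {c<..<d} \<subseteq> {a..b} \<times> {c..d}" by auto
    have out: "\<phi> p = 0" "\<phi>' p = 0" if "p \<notin> {a<..<b} \<times> {c<..<d}" for p using T that unfolding box_test_def by blast+
    have int: "integrable lborel (\<lambda>p. w p * \<phi>' p)"
      if w: "w \<in> borel_measurable borel" "\<And>p. p \<in> {a..b} \<times> {c..d} \<Longrightarrow> \<bar>w p\<bar> \<le> D" for w D
    proof (rule integrableI_bounded_set[where A = "{a..b} \<times> {c..d}" and B = "D * B"])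
      show "emeasure lborel ({a..b} \<times> {c..d}) < \<infinity>" unfolding lborel_prod[symmetric]
        by (subst lborel.emeasure_pair_measure_Times) (auto simp: ab cd ennreal_mult_less_top)
      show "{a..b} \<times> {c..d} \<in> sets (lborel :: (real \<times> real) measure)" by (auto simp: borel_prod[symmetric])
      have "norm (w p * \<phi>' p) \<le> D * B" if "p \<in> {a..b} \<times> {c..d}" for p
        unfolding real_norm_def abs_mult using order_trans[OF abs_ge_zero w(2)[OF that]] by (intro mult_mono w(2)[OF that] B(2)) auto
      then show "AE p \<in> {a..b} \<times> {c..d} in lborel. norm (w p * \<phi>' p) \<le> D * B" by (intro AE_I2) blast
      show "AE p in lborel. p \<notin> {a..b} \<times> {c..d} \<longrightarrow> w p * \<phi>' p = 0" using out(2) sub by (intro AE_I2 impI) (simp, blast)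
      show "(\<lambda>p. w p * \<phi>' p) \<in> borel_measurable lborel" using w(1) m(2) by simp
    qed
    have iL: "integrable lborel (\<lambda>p. hL (fst p) (snd p) * \<phi>' p)"
    proof (rule int)
      show "(\<lambda>p. hL (fst p) (snd p)) \<in> borel_measurable borel" unfolding hL_def
        by (intro borel_measurable_diff borel_measurable_times fm2 borel_measurable_min fstm sm borel_measurable_const)
      show "\<bar>hL (fst p) (snd p)\<bar> \<le> C * (\<bar>a\<bar> + \<bar>b\<bar>) + M" if "p \<in> {a..b} \<times> {c..d}" for p
        using bd[of "fst p" "- f (min (fst p) (\<sigma> (snd p))) (snd p)"] bdd that by (auto simp: hL_def)
    qed
    have iR: "integrable lborel (\<lambda>p. hR (fst p) (snd p) * \<phi>' p)"
    proof (rule int)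
      show "(\<lambda>p. hR (fst p) (snd p)) \<in> borel_measurable borel" unfolding hR_def
        by (intro borel_measurable_add borel_measurable_times fm2 borel_measurable_max fstm sm borel_measurable_const)
      show "\<bar>hR (fst p) (snd p)\<bar> \<le> C * (\<bar>a\<bar> + \<bar>b\<bar>) + M" if "p \<in> {a..b} \<times> {c..d}" for p
        using bd[of "fst p" "f (max (fst p) (\<sigma> (snd p))) (snd p)"] bdd that by (auto simp: hR_def)
    qed
    have iS: "integrable lborel (\<lambda>p. f (\<sigma> (snd p)) (snd p) * \<phi>' p)" by (rule int[OF fm2[OF sm]]) (rule bdd)
    \<comment> \<open>The remaining summand of \<open>split\<close> is constant along each line, and
      the derivative of a test function integrates to zero there.\<close>
    have "(\<integral>p. f (\<sigma> (snd p)) (snd p) * \<phi>' p \<partial>lborel) = (\<integral>y. f (\<sigma> y) y * (\<integral>s. \<phi>' (s, y) \<partial>lborel) \<partial>lborel)"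
      using integral_lborel_prod_iterated(1)[OF iS] by simp
    also have "\<dots> = 0"
    proof -
      have "(\<integral>s. \<phi>' (s, y) \<partial>lborel) = 0" for y
      proof -
        have "isCont (\<lambda>s. \<phi>' (s, y)) x" for x
        proof -
          have "continuous_on UNIV \<phi>'" using T by (simp add: box_test_def)
          from continuous_on_compose2[OF this, of UNIV "\<lambda>s. (s, y)"]
          have "continuous_on UNIV (\<lambda>s. \<phi>' (s, y))" by (simp add: continuous_on_Pair)
          then show ?thesis by (simp add: continuous_on_eq_continuous_at)
        qed
        then have "(\<integral>s. \<phi>' (s, y) * indicator {a..b} s \<partial>lborel) = \<phi> (b, y) - \<phi> (a, y)"
          using T ab unfolding box_test_def by (intro integral_FTC_Icc_real) simp_all
        moreover have "\<phi>' (s, y) * indicator {a..b} s = \<phi>' (s, y)" for s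
          by (cases "s \<in> {a..b}") (use out(2)[of "(s, y)"] in \<open>force+\<close>)
        ultimately show ?thesis using out(1)[of "(a, y)"] out(1)[of "(b, y)"] by simp
      qed
      then show ?thesis by simp
    qed
    finally have S0: "(\<integral>p. f (\<sigma> (snd p)) (snd p) * \<phi>' p \<partial>lborel) = 0" .
    have k\<phi>: "integrable lborel (\<lambda>p. \<kappa> p * \<phi> p)" if \<kappa>: "integrable lborel \<kappa>" for \<kappa>
    proof (rule Bochner_Integration.integrable_bound[OF integrable_mult_right[OF integrable_abs[OF \<kappa>], of B]])
      show "(\<lambda>p. \<kappa> p * \<phi> p) \<in> borel_measurable lborel" using \<kappa> m(1) by simp
      have "norm (\<kappa> p * \<phi> p) \<le> norm (B * \<bar>\<kappa> p\<bar>)" for p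
        using mult_right_mono[OF B(1)[of p] abs_ge_zero, of "\<kappa> p"] abs_ge_self[of "B * \<bar>\<kappa> p\<bar>"]
        unfolding real_norm_def abs_mult[of "\<kappa> p"] by (simp add: mult.commute)
      then show "AE p in lborel. norm (\<kappa> p * \<phi> p) \<le> norm (B * \<bar>\<kappa> p\<bar>)" by simp
    qed
    have "(\<integral>p. f (fst p) (snd p) * \<phi>' p \<partial>lborel) = (\<integral>p. hR (fst p) (snd p) * \<phi>' p - hL (fst p) (snd p) * \<phi>' p - f (\<sigma> (snd p)) (snd p) * \<phi>' p \<partial>lborel)"
      by (subst split) (simp add: algebra_simps)
    also have "\<dots> = - (\<integral>p. \<kappa>R p * \<phi> p \<partial>lborel) + (\<integral>p. \<kappa>L p * \<phi> p \<partial>lborel)"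
      using iL iR iS S0 L(2)[OF T] R(2)[OF T] by simp
    also have "\<dots> = - (\<integral>p. (\<kappa>R p - \<kappa>L p) * \<phi> p \<partial>lborel)"
      using k\<phi>[OF L(1)] k\<phi>[OF R(1)] by (simp add: left_diff_distrib)
    finally show "(\<integral>p. f (fst p) (snd p) * \<phi>' p \<partial>lborel) = - (\<integral>p. (\<kappa>R p - \<kappa>L p) * \<phi> p \<partial>lborel)" .
  qed
qed

section \<open>Weak derivatives in linear coordinates\<close>

lemma Basis_real2: "(Basis :: (real^2) set) = {axis 1 1, axis 2 1}"
  by (auto simp: Basis_vec_def UNIV_2)

lemma prod_Basis_real2: "(\<Prod>b\<in>(Basis :: (real^2) set). x \<bullet> b) = x $ 1 * x $ 2"
  by (simp add: Basis_real2 axis_eq_axis inner_axis)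

definition vec2 :: "real \<times> real \<Rightarrow> real^2" where "vec2 p = fst p *\<^sub>R axis 1 1 + snd p *\<^sub>R axis 2 1"

lemma vec2_nth [simp]: "vec2 p $ 1 = fst p" "vec2 p $ 2 = snd p"
  by (simp_all add: vec2_def axis_def)

lemma vec2_measurable: "vec2 \<in> borel_measurable borel"
  unfolding vec2_def by (intro borel_measurable_continuous_onI continuous_intros)

text \<open>Connects Fubini on \<open>real \<times> real\<close> with Lebesgue measure on
  \<open>real^2\<close>; agreement on boxes suffices.\<close>

lemma lborel_vec2: "distr lborel borel vec2 = lborel"
proof (rule lborel_eqI[symmetric])
  fix l u :: "real^2" assume lu: "\<And>b. b \<in> Basis \<Longrightarrow> l \<bullet> b \<le> u \<bullet> b"
  then have le: "l $ 1 \<le> u $ 1" "l $ 2 \<le> u $ 2"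
    using lu[of "axis 1 1"] lu[of "axis 2 1"] by (auto simp: Basis_real2 inner_axis)
  have eq: "vec2 -` box l u = {l $ 1<..<u $ 1} \<times> {l $ 2<..<u $ 2}"
    by (auto simp: mem_box_cart forall_2)
  have "emeasure (distr lborel borel vec2) (box l u)
      = emeasure (lborel \<Otimes>\<^sub>M lborel) ({l $ 1<..<u $ 1} \<times> {l $ 2<..<u $ 2})"
    using vec2_measurable by (subst emeasure_distr) (auto simp: eq lborel_prod)
  also have "\<dots> = ennreal ((u $ 1 - l $ 1) * (u $ 2 - l $ 2))"
    using le by (subst lborel.emeasure_pair_measure_Times) (auto simp: ennreal_mult)
  finally show "emeasure (distr lborel borel vec2) (box l u) = (\<Prod>b\<in>Basis. (u - l) \<bullet> b)"
    by (simp add: prod_Basis_real2)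
qed simp

text \<open>A basis \<open>D1\<close>, \<open>D2\<close> of the plane with its dual basis
  \<open>p1\<close>, \<open>p2\<close>.\<close>

locale coords2 =
  fixes D1 D2 :: "real^2" and p1 p2 :: "real^2 \<Rightarrow> real"
  assumes lin: "linear p1" "linear p2"
    and decomp: "\<And>x. p1 x *\<^sub>R D1 + p2 x *\<^sub>R D2 = x"
    and proj: "\<And>s y. p1 (s *\<^sub>R D1 + y *\<^sub>R D2) = s" "\<And>s y. p2 (s *\<^sub>R D1 + y *\<^sub>R D2) = y"
begin

definition "emb p = fst p *\<^sub>R D1 + snd p *\<^sub>R D2"

lemma coords_emb: "p1 (emb p) = fst p" "p2 (emb p) = snd p" by (simp_all add: emb_def proj)

lemma emb_continuous: "continuous_on S emb" unfolding emb_def by (intro continuous_intros)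

lemma emb_measurable: "emb \<in> borel_measurable borel" by (rule borel_measurable_continuous_onI[OF emb_continuous])

lemma coords_continuous: "continuous_on S p1" "continuous_on S p2"
  using lin by (auto simp: linear_conv_bounded_linear intro: linear_continuous_on)

text \<open>Linear change of variables up to a constant. Its value may stay unspecified: both sides
  of a weak derivative identity scale by it.\<close>

lemma lborel_emb: "\<exists>k>0. lborel = density (distr lborel borel emb) (\<lambda>_. ennreal k)"
proof -
  define A where "A z = z $ 1 *\<^sub>R D1 + z $ 2 *\<^sub>R D2" for z :: "real^2"
  define A' where "A' x = vec2 (p1 x, p2 x)" for x
  have AA': "A (A' x) = x" "A' (A z) = z" for x z
    by (auto simp: A_def A'_def decomp proj vec_eq_iff forall_2)
  have linA': "linear A'"
    by (rule linearI) (auto simp: A'_def vec_eq_iff forall_2 linear_add[OF lin(1)] linear_add[OF lin(2)] linear_cmul[OF lin(1)] linear_cmul[OF lin(2)])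
  have inj: "inj A'" by (rule inj_on_inverseI[of _ A]) (rule AA')
  define c where "c = \<bar>det (matrix A')\<bar>"
  have c: "0 < c" unfolding c_def using inj det_nz_iff_inj[OF linA'] by simp
  have box: "emeasure lborel (emb -` box l u) = ennreal (c * measure lborel (box l u))" for l u
  proof -
    have emb: "emb -` S = vec2 -` (A -` S)" for S by (auto simp: emb_def A_def)
    have im: "A -` S = A' ` S" for S using AA' by (auto simp: image_iff) metis
    have op: "open (A -` box l u)" unfolding A_def
      by (intro continuous_open_vimage continuous_intros open_box)
    have "emeasure lborel (emb -` box l u) = emeasure (distr lborel borel vec2) (A -` box l u)"
      using op vec2_measurable by (subst emeasure_distr) (auto simp: emb)
    also have "\<dots> = emeasure lebesgue (A' ` box l u)" using op by (simp add: lborel_vec2 im)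
    also have "\<dots> = ennreal (measure lebesgue (A' ` box l u))"
      using measurable_linear_image[OF linA', of "box l u"] by (intro emeasure_eq_measure2) auto
    also have "\<dots> = ennreal (c * measure lebesgue (box l u))" using measure_linear_image[OF linA', of "box l u"] by (simp add: c_def)
    finally show ?thesis by simp
  qed
  have "lborel = density (distr lborel borel emb) (\<lambda>_. ennreal (1 / c))"
  proof (rule lborel_eqI)
    fix l u :: "real^2" assume lu: "\<And>b. b \<in> Basis \<Longrightarrow> l \<bullet> b \<le> u \<bullet> b"
    have "emeasure (density (distr lborel borel emb) (\<lambda>_. ennreal (1 / c))) (box l u) = ennreal (1 / c) * ennreal (c * measure lborel (box l u))"
      using emb_measurable by (subst emeasure_density) (auto simp: nn_integral_cmult emeasure_distr box)
    also have "\<dots> = ennreal (measure lborel (box l u))" using c by (simp flip: ennreal_mult)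
    finally show "emeasure (density (distr lborel borel emb) (\<lambda>_. ennreal (1 / c))) (box l u) = (\<Prod>b\<in>Basis. (u - l) \<bullet> b)"
      using lu by (simp add: measure_lborel_box)
  qed simp
  then show ?thesis using c by (intro exI[of _ "1 / c"]) simp
qed

end

section \<open>Test functions, directional weak derivatives, and absence of a Cantor part\<close>

lemma test_C1D:
  assumes "test_C1 V \<phi>"
  shows "(\<phi> has_derivative frechet_derivative \<phi> (at x)) (at x)"
    "continuous_on UNIV (\<lambda>x. frechet_derivative \<phi> (at x) D)"
    "continuous_on UNIV \<phi>"
    "x \<notin> V \<Longrightarrow> \<phi> x = 0" "x \<notin> V \<Longrightarrow> frechet_derivative \<phi> (at x) D = 0"
proof -
  obtain \<phi>' where d: "\<And>x. (\<phi> has_derivative \<phi>' x) (at x)" and c: "\<And>i. i \<in> Basis \<Longrightarrow> continuous_on UNIV (\<lambda>x. \<phi>' x i)"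
    using assms unfolding test_C1_def by blast
  have fd: "frechet_derivative \<phi> (at x) = \<phi>' x" for x using frechet_derivative_at[OF d[of x]] by simp
  show hd: "(\<phi> has_derivative frechet_derivative \<phi> (at x)) (at x)" using d by (simp add: fd)
  show "continuous_on UNIV (\<lambda>x. frechet_derivative \<phi> (at x) D)"
  proof -
    \<comment> \<open>Only the partial derivatives are continuous by definition; an arbitrary
      direction is expanded in the basis.\<close>
    have rep: "\<phi>' x D = (\<Sum>i\<in>Basis. (D \<bullet> i) *\<^sub>R \<phi>' x i)" for x
    proof -
      interpret bounded_linear "\<phi>' x" using d by (rule has_derivative_bounded_linear)
      have "\<phi>' x (\<Sum>i\<in>Basis. (D \<bullet> i) *\<^sub>R i) = (\<Sum>i\<in>Basis. (D \<bullet> i) *\<^sub>R \<phi>' x i)" by (simp add: sum scaleR)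
      then show ?thesis by (simp add: euclidean_representation)
    qed
    have "continuous_on UNIV (\<lambda>x. \<Sum>i\<in>Basis. (D \<bullet> i) *\<^sub>R \<phi>' x i)" by (intro continuous_intros c)
    then show ?thesis unfolding fd by (rule continuous_on_eq) (rule rep[symmetric])
  qed
  show "continuous_on UNIV \<phi>" by (intro continuous_at_imp_continuous_on ballI has_derivative_continuous[OF d])
  show "\<phi> x = 0" if "x \<notin> V"
  proof -
    have "{x. \<phi> x \<noteq> 0} \<subseteq> V" using assms closure_subset[of "{x. \<phi> x \<noteq> 0}"] by (auto simp: test_C1_def)
    then show ?thesis using that by auto
  qed
  show "frechet_derivative \<phi> (at x) D = 0" if "x \<notin> V"
  proof -
    \<comment> \<open>The closed support lies in V, so off V the function vanishes on a whole
      neighbourhood and its derivative vanishes as well.\<close>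
    define S where "S = - closure {x. \<phi> x \<noteq> 0}"
    have "x \<in> S" "open S" using that assms by (auto simp: S_def test_C1_def)
    moreover have "\<phi> y = 0" if "y \<in> S" for y using that closure_subset[of "{x. \<phi> x \<noteq> 0}"] by (auto simp: S_def)
    ultimately have "(\<phi> has_derivative (\<lambda>_. 0)) (at x)"
      using has_derivative_transform_within_open[OF has_derivative_const[of 0 "at x"], of S \<phi>] by simp
    from frechet_derivative_at[OF this] show ?thesis by (metis)
  qed
qed

text \<open>Composed with \<open>emb\<close>, a test function on V becomes a box test whose first
  partial derivative is the derivative in direction \<open>D1\<close>. The extension
  \<open>f\<close> has to agree with \<open>T\<close> only over V, where test functions
  live.\<close>

lemma (in coords2) weak_derivative_transfer:
  assumes g: "integrable lborel g"
    and wd: "\<And>\<phi> \<phi>'. box_test a b c d \<phi> \<phi>' \<Longrightarrow> (\<integral>p. f p * \<phi>' p \<partial>lborel) = - (\<integral>p. g p * \<phi> p \<partial>lborel)"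
    and fm: "f \<in> borel_measurable borel"
    and V: "open V" "\<And>x. x \<in> V \<Longrightarrow> p1 x \<in> {a<..<b} \<and> p2 x \<in> {c<..<d}"
    and T: "continuous_on V T" "\<And>x. x \<in> V \<Longrightarrow> T x = f (p1 x, p2 x)"
  shows "\<exists>G. integrable lborel G \<and> (\<forall>\<phi>. test_C1 V \<phi> \<longrightarrow>
    (\<integral>x. indicator V x * T x * frechet_derivative \<phi> (at x) D1 \<partial>lebesgue) = - (\<integral>x. G x * \<phi> x \<partial>lborel))"
proof -
  obtain k where k: "0 < k" "lborel = density (distr lborel borel emb) (\<lambda>_. ennreal k)" using lborel_emb by blast
  have pm: "(\<lambda>x. (p1 x, p2 x)) \<in> borel_measurable borel"
    by (intro borel_measurable_continuous_onI continuous_intros coords_continuous)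
  have ch: "(\<integral>x. w x \<partial>lborel) = k * (\<integral>p. w (emb p) \<partial>lborel)" if w: "w \<in> borel_measurable borel" for w :: "real^2 \<Rightarrow> real"
  proof -
    have "(\<integral>x. w x \<partial>lborel) = (\<integral>x. w x \<partial>density (distr lborel borel emb) (\<lambda>_. ennreal k))" using k(2) by simp
    also have "\<dots> = (\<integral>x. k *\<^sub>R w x \<partial>distr lborel borel emb)" using w k(1) by (subst integral_density) auto
    also have "\<dots> = k * (\<integral>p. w (emb p) \<partial>lborel)" using w emb_measurable by (subst integral_distr) auto
    finally show ?thesis .
  qed
  have gm: "g \<in> borel_measurable borel" using g by (simp add: borel_measurable_integrable)
  define G where "G x = g (p1 x, p2 x)" for x
  have Gm: "G \<in> borel_measurable borel" unfolding G_def by (rule measurable_compose[OF pm gm])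
  have Gi: "integrable lborel G"
  proof -
    have "integrable (density (distr lborel borel emb) (\<lambda>_. ennreal k)) G"
    proof (subst integrable_density)
      show "integrable (distr lborel borel emb) (\<lambda>x. k *\<^sub>R G x)"
      proof (subst integrable_distr_eq)
        show "integrable lborel (\<lambda>p. k *\<^sub>R G (emb p))" using g by (simp add: G_def coords_emb)
      qed (use Gm emb_measurable in auto)
    qed (use Gm k in auto)
    then show ?thesis using k(2) by simp
  qed
  show ?thesis
  proof (intro exI[of _ G] conjI allI impI Gi)
    fix \<phi> assume t: "test_C1 V \<phi>"
    note tD = test_C1D[OF t]
    have fdm: "(\<lambda>x. frechet_derivative \<phi> (at x) D1) \<in> borel_measurable borel" by (rule borel_measurable_continuous_onI[OF tD(2)])
    have \<phi>m: "\<phi> \<in> borel_measurable borel" by (rule borel_measurable_continuous_onI[OF tD(3)])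
    have eq: "indicator V x * T x * frechet_derivative \<phi> (at x) D1 = f (p1 x, p2 x) * frechet_derivative \<phi> (at x) D1" for x
      using T(2)[of x] tD(5)[of x D1] by (cases "x \<in> V") auto
    have m: "(\<lambda>x. f (p1 x, p2 x) * frechet_derivative \<phi> (at x) D1) \<in> borel_measurable borel"
      by (intro borel_measurable_times fdm measurable_compose[OF pm fm])
    have "(\<integral>x. indicator V x * T x * frechet_derivative \<phi> (at x) D1 \<partial>lebesgue) = (\<integral>x. f (p1 x, p2 x) * frechet_derivative \<phi> (at x) D1 \<partial>lborel)"
      unfolding eq using m by (subst integral_completion) auto
    also have "\<dots> = k * (\<integral>p. f p * frechet_derivative \<phi> (at (emb p)) D1 \<partial>lborel)"
      by (subst ch[OF m]) (simp add: coords_emb)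
    also have "(\<integral>p. f p * frechet_derivative \<phi> (at (emb p)) D1 \<partial>lborel) = - (\<integral>p. g p * \<phi> (emb p) \<partial>lborel)"
    proof (rule wd, unfold box_test_def, intro conjI allI impI)
      show "continuous_on UNIV (\<lambda>p. \<phi> (emb p))" by (rule continuous_on_compose2[OF tD(3) emb_continuous]) auto
      show "continuous_on UNIV (\<lambda>p. frechet_derivative \<phi> (at (emb p)) D1)"
        by (rule continuous_on_compose2[OF tD(2) emb_continuous]) auto
      fix p assume "p \<notin> {a<..<b} \<times> {c<..<d}"
      then have "emb p \<notin> V" using V(2)[of "emb p"] by (cases p) (auto simp: coords_emb)
      then show "\<phi> (emb p) = 0" "frechet_derivative \<phi> (at (emb p)) D1 = 0" using tD by auto
    next
      fix s y
      have "((\<lambda>s. emb (s, y)) has_derivative (\<lambda>h. h *\<^sub>R D1)) (at s)"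
        unfolding emb_def by (auto intro!: derivative_eq_intros)
      from has_derivative_compose[OF this tD(1)]
      have "((\<lambda>s. \<phi> (emb (s, y))) has_derivative (\<lambda>h. frechet_derivative \<phi> (at (emb (s, y))) (h *\<^sub>R D1))) (at s)" .
      moreover have "frechet_derivative \<phi> (at (emb (s, y))) (h *\<^sub>R D1) = frechet_derivative \<phi> (at (emb (s, y))) D1 * h" for h
        using linear_cmul[OF bounded_linear.linear[OF has_derivative_bounded_linear[OF tD(1)]]] by simp
      ultimately show "((\<lambda>s. \<phi> (emb (s, y))) has_real_derivative frechet_derivative \<phi> (at (emb (s, y))) D1) (at s)"
        unfolding has_field_derivative_def by simp
    qed
    also have "k * - (\<integral>p. g p * \<phi> (emb p) \<partial>lborel) = - (\<integral>x. G x * \<phi> x \<partial>lborel)"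
      using ch[OF borel_measurable_times[OF Gm \<phi>m]] by (simp add: G_def coords_emb)
    finally show "(\<integral>x. indicator V x * T x * frechet_derivative \<phi> (at x) D1 \<partial>lebesgue) = - (\<integral>x. G x * \<phi> x \<partial>lborel)" .
  qed
qed

lemma integrable_mult_test:
  assumes "integrable lborel G" "test_C1 V \<phi>"
  shows "integrable lborel (\<lambda>x. G x * \<phi> x)"
proof -
  have c: "compact (closure {x. \<phi> x \<noteq> 0})" using assms(2) by (simp add: test_C1_def)
  then have "compact (\<phi> ` closure {x. \<phi> x \<noteq> 0})"
    by (intro compact_continuous_image continuous_on_subset[OF test_C1D(3)[OF assms(2)]]) auto
  then obtain B where B: "\<forall>y\<in>\<phi> ` closure {x. \<phi> x \<noteq> 0}. norm y \<le> B" using compact_imp_bounded bounded_iff by metis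
  have B': "\<bar>\<phi> x\<bar> \<le> \<bar>B\<bar>" for x
    using B closure_subset[of "{x. \<phi> x \<noteq> 0}"] by (cases "\<phi> x = 0") force+
  show ?thesis
  proof (rule Bochner_Integration.integrable_bound[OF integrable_mult_right[OF integrable_abs[OF assms(1)], of "\<bar>B\<bar>"]])
    show "(\<lambda>x. G x * \<phi> x) \<in> borel_measurable lborel"
      using assms(1) borel_measurable_continuous_onI[OF test_C1D(3)[OF assms(2)]] by simp
    have "norm (G x * \<phi> x) \<le> norm (\<bar>B\<bar> * \<bar>G x\<bar>)" for x
      using mult_right_mono[OF B'[of x] abs_ge_zero[of "G x"]] by (simp add: abs_mult mult.commute)
    then show "AE x in lborel. norm (G x * \<phi> x) \<le> norm (\<bar>B\<bar> * \<bar>G x\<bar>)" by simp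
  qed
qed

text \<open>The gradient has an integrable density G, so it has no singular part at all, and the
  null set carrying that part can be taken empty.\<close>

lemma SBV_on_if_weakly_differentiable:
  fixes T :: "'a::euclidean_space \<Rightarrow> real"
  assumes V: "open V" and T: "set_integrable lebesgue V T"
    and wd: "\<And>i. i \<in> Basis \<Longrightarrow> \<exists>G. integrable lborel G \<and> (\<forall>\<phi>. test_C1 V \<phi> \<longrightarrow>
      (\<integral>x. indicator V x * T x * frechet_derivative \<phi> (at x) i \<partial>lebesgue) = - (\<integral>x. G x * \<phi> x \<partial>lborel))"
  shows "SBV_on V T"
proof -
  obtain G where G: "\<And>i. i \<in> Basis \<Longrightarrow> integrable lborel (G i)"
    "\<And>i \<phi>. i \<in> Basis \<Longrightarrow> test_C1 V \<phi> \<Longrightarrow>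
      (\<integral>x. indicator V x * T x * frechet_derivative \<phi> (at x) i \<partial>lebesgue) = - (\<integral>x. G i x * \<phi> x \<partial>lborel)"
    using wd by metis
  \<comment> \<open>Positive part of the density. The indicator concentrates the measure on V as
    required and changes no integral of a test function.\<close>
  define P where "P i = density lborel (\<lambda>x. ennreal (indicator V x * max 0 (G i x)))" for i
  define N where "N i = density lborel (\<lambda>x. ennreal (indicator V x * max 0 (- G i x)))" for i
  have Vm: "V \<in> sets lborel" using V by simp
  have int: "integrable lborel (\<lambda>x. indicator V x * max 0 (H x))" if "integrable lborel H" for H :: "'a \<Rightarrow> real"
  proof (rule Bochner_Integration.integrable_bound[OF that])
    show "(\<lambda>x. indicator V x * max 0 (H x)) \<in> borel_measurable lborel"
      using that Vm by (intro borel_measurable_times borel_measurable_indicator borel_measurable_max) auto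
  qed (auto simp: indicator_def)
  have fin: "finite_measure (density lborel (\<lambda>x. ennreal (indicator V x * max 0 (H x)))) \<and>
      emeasure (density lborel (\<lambda>x. ennreal (indicator V x * max 0 (H x)))) (- V) = 0"
    if H: "integrable lborel H" for H :: "'a \<Rightarrow> real"
  proof
    note i = int[OF H]
    have m: "(\<lambda>x. ennreal (indicator V x * max 0 (H x))) \<in> borel_measurable lborel" using i by simp
    show "finite_measure (density lborel (\<lambda>x. ennreal (indicator V x * max 0 (H x))))"
    proof (rule finite_measureI)
      have "emeasure (density lborel (\<lambda>x. ennreal (indicator V x * max 0 (H x)))) UNIV = (\<integral>\<^sup>+x. ennreal (indicator V x * max 0 (H x)) \<partial>lborel)"
        using m by (simp add: emeasure_density)
      also have "\<dots> = ennreal (\<integral>x. indicator V x * max 0 (H x) \<partial>lborel)" by (rule nn_integral_eq_integral[OF i]) auto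
      finally show "emeasure (density lborel (\<lambda>x. ennreal (indicator V x * max 0 (H x)))) (space (density lborel (\<lambda>x. ennreal (indicator V x * max 0 (H x))))) \<noteq> \<infinity>" by simp
    qed
    have "emeasure (density lborel (\<lambda>x. ennreal (indicator V x * max 0 (H x)))) (- V) = (\<integral>\<^sup>+x. ennreal (indicator V x * max 0 (H x)) * indicator (- V) x \<partial>lborel)"
      using m Vm V by (intro emeasure_density) auto
    also have "\<dots> = (\<integral>\<^sup>+x. 0 \<partial>(lborel :: 'a measure))" by (intro nn_integral_cong) (auto simp: indicator_def)
    finally show "emeasure (density lborel (\<lambda>x. ennreal (indicator V x * max 0 (H x)))) (- V) = 0" by simp
  qed
  have Gn: "integrable lborel (\<lambda>x. - G i x)" if "i \<in> Basis" for i using G(1)[OF that] by simp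
  have fs: "finite_signed_on V (P i) (N i)" if "i \<in> Basis" for i
    using fin[OF G(1)[OF that]] fin[OF Gn[OF that]] by (simp add: finite_signed_on_def P_def N_def)
  have dg: "is_distr_gradient V T P N" unfolding is_distr_gradient_def
  proof (intro conjI ballI allI impI fs)
    fix \<phi> i assume t: "test_C1 V \<phi>" and i: "i \<in> (Basis :: 'a set)"
    have \<phi>m: "\<phi> \<in> borel_measurable borel" by (rule borel_measurable_continuous_onI[OF test_C1D(3)[OF t]])
    have dn: "(\<integral>x. \<phi> x \<partial>density lborel (\<lambda>x. ennreal (indicator V x * max 0 (H x)))) = (\<integral>x. (indicator V x * max 0 (H x)) * \<phi> x \<partial>lborel)"
      if H: "integrable lborel H" for H
      using int[OF H] \<phi>m by (subst integral_density) auto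
    have "(\<integral>x. \<phi> x \<partial>(P i)) - (\<integral>x. \<phi> x \<partial>(N i)) = (\<integral>x. (indicator V x * max 0 (G i x)) * \<phi> x - (indicator V x * max 0 (- G i x)) * \<phi> x \<partial>lborel)"
      unfolding P_def N_def dn[OF G(1)[OF i]] dn[OF Gn[OF i]]
      using integrable_mult_test[OF int[OF G(1)[OF i]] t] integrable_mult_test[OF int[OF Gn[OF i]] t] by simp
    also have "\<dots> = (\<integral>x. G i x * \<phi> x \<partial>lborel)"
    proof (intro Bochner_Integration.integral_cong refl)
      fix x
      have "max 0 (G i x) - max 0 (- G i x) = G i x" by simp
      then show "(indicator V x * max 0 (G i x)) * \<phi> x - (indicator V x * max 0 (- G i x)) * \<phi> x = G i x * \<phi> x"
        using test_C1D(4)[OF t, of x] by (cases "x \<in> V") (simp_all flip: left_diff_distrib)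
    qed
    finally show "(\<integral>x. indicator V x * T x * frechet_derivative \<phi> (at x) i \<partial>lebesgue) = - ((\<integral>x. \<phi> x \<partial>(P i)) - (\<integral>x. \<phi> x \<partial>(N i)))"
      using G(2)[OF i t] by simp
  qed
  have ac: "measure (density lborel h) B = 0" if "emeasure lborel B = 0" "B \<in> sets borel" "h \<in> borel_measurable lborel" for B and h :: "'a \<Rightarrow> ennreal"
  proof -
    have "B \<in> null_sets (density lborel h)" 
    proof (subst null_sets_density_iff[OF that(3)], intro conjI)
      have "AE x in lborel. x \<notin> B" by (rule AE_not_in) (use that in \<open>auto intro: null_setsI\<close>)
      then show "AE x in lborel. x \<in> B \<longrightarrow> h x = 0" by eventually_elim simp
    qed (use that in simp)
    then show ?thesis by (simp add: measure_def null_setsD1)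
  qed
  \<comment> \<open>With the empty set in place of \<open>Z\<close>, the first clause is absolute
    continuity on all Lebesgue null sets and the second concerns only the empty B.\<close>
  have main: "\<forall>i\<in>Basis. \<forall>B\<in>sets borel. (B \<inter> {} = {} \<and> emeasure lborel B = 0 \<longrightarrow> measure (P i) B = measure (N i) B) \<and>
      (B \<subseteq> {} - jump_set V T \<longrightarrow> measure (P i) B = measure (N i) B)"
  proof (intro ballI)
    fix i B assume i: "i \<in> (Basis :: 'a set)" and B: "B \<in> sets (borel :: 'a measure)"
    have m: "(\<lambda>x. ennreal (indicator V x * max 0 (G i x))) \<in> borel_measurable lborel"
      "(\<lambda>x. ennreal (indicator V x * max 0 (- G i x))) \<in> borel_measurable lborel"
      using int[OF G(1)[OF i]] int[OF Gn[OF i]] by simp_all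
    show "(B \<inter> {} = {} \<and> emeasure lborel B = 0 \<longrightarrow> measure (P i) B = measure (N i) B) \<and>
      (B \<subseteq> {} - jump_set V T \<longrightarrow> measure (P i) B = measure (N i) B)"
      using ac[OF _ B m(1)] ac[OF _ B m(2)] by (auto simp: P_def N_def)
  qed
  show ?thesis unfolding SBV_on_def
    by (intro conjI V T exI[of _ P] exI[of _ N] exI[of _ "{}"] dg main) auto
qed

section \<open>The minimum time in scaled coordinates\<close>

context switching_curve
begin

definition "tau x1 x2 = Inf {t. reaches x1 x2 0 0 t}"

text \<open>The size admits \<open>small_time\<close> with s = 1/240, as s^2/20 = 1/1152000. All
  these points reach the origin within 3s = 1/80, small enough for every comparison of times
  above.\<close>

definition "near0 x1 x2 \<longleftrightarrow> \<bar>x1\<bar> \<le> 1/1200000 \<and> \<bar>x2\<bar> \<le> 1/1200000"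

lemma tau_le: "reaches x1 x2 0 0 t \<Longrightarrow> tau x1 x2 \<le> t"
  unfolding tau_def by (rule cInf_lower) (auto intro!: bdd_belowI[of _ 0] dest: reaches_nonneg)

lemma reaches_if_tau_less: "reaches x1 x2 0 0 s \<Longrightarrow> tau x1 x2 < t \<Longrightarrow> reaches x1 x2 0 0 t"
  unfolding tau_def by (subst (asm) cInf_less_iff) (auto intro!: bdd_belowI[of _ 0] intro: reaches_mono[OF _ less_imp_le] dest: reaches_nonneg)

lemma tau_nonneg: "reaches x1 x2 0 0 s \<Longrightarrow> 0 \<le> tau x1 x2"
  unfolding tau_def by (rule cInf_greatest) (auto dest: reaches_nonneg)

lemma near0_reaches:
  assumes "near0 x1 x2"
  shows "reaches x1 x2 0 0 (1/80)"
  using small_time[of "1/240" x1 x2] assms by (simp add: near0_def power2_eq_square)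

lemma near0_tau:
  assumes "near0 x1 x2"
  shows "tau x1 x2 \<le> 1/80" "0 \<le> tau x1 x2" "tau x1 x2 < t \<Longrightarrow> reaches x1 x2 0 0 t"
  using tau_le tau_nonneg reaches_if_tau_less near0_reaches[OF assms] by blast+

text \<open>The infimum need not be attained, so the implication is applied at times slightly above
  it; the cap 1/80 keeps them below 1/40.\<close>

lemma tau_transfer:
  assumes x: "near0 x1 x2" and imp: "\<And>t. t \<le> 1/40 \<Longrightarrow> reaches x1 x2 0 0 t \<Longrightarrow> reaches z1 z2 0 0 (t + d)"
  shows "tau z1 z2 \<le> tau x1 x2 + d"
proof (rule field_le_epsilon)
  fix e :: real assume e: "0 < e"
  define t where "t = tau x1 x2 + min e (1/80)"
  have "t \<le> 1/40" "reaches x1 x2 0 0 t" using near0_tau[OF x] e by (auto simp: t_def)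
  from tau_le[OF imp[OF this]] show "tau z1 z2 \<le> tau x1 x2 + d + e" by (simp add: t_def)
qed

lemma tau_uniformly_continuous:
  assumes s: "0 < s" "s \<le> 1/25" and x: "near0 x1 x2" "near0 z1 z2" and d: "\<bar>z1 - x1\<bar> \<le> s\<^sup>2 / 60" "\<bar>z2 - x2\<bar> \<le> s\<^sup>2 / 60"
  shows "\<bar>tau z1 z2 - tau x1 x2\<bar> \<le> 3 * s"
proof -
  have "tau z1 z2 \<le> tau x1 x2 + 3 * s"
    by (rule tau_transfer[OF x(1)]) (rule uniformly_close_times[OF s d], simp_all)
  moreover have "tau x1 x2 \<le> tau z1 z2 + 3 * s"
    by (rule tau_transfer[OF x(2)]) (rule uniformly_close_times[OF s], use d in \<open>simp_all add: abs_minus_commute\<close>)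
  ultimately show ?thesis by linarith
qed

lemma tau_continuous: "continuous_on {p. near0 (fst p) (snd p)} (\<lambda>p. tau (fst p) (snd p))"
proof (rule continuous_onI)
  fix p :: "real \<times> real" and e :: real assume p: "p \<in> {p. near0 (fst p) (snd p)}" and e: "0 < e"
  define s where "s = min (e / 3) (1/25)"
  have s: "0 < s" "s \<le> 1/25" "3 * s \<le> e" using e by (auto simp: s_def)
  show "\<exists>d>0. \<forall>p'\<in>{p. near0 (fst p) (snd p)}. dist p' p < d \<longrightarrow> dist (tau (fst p') (snd p')) (tau (fst p) (snd p)) \<le> e"
  proof (intro exI[of _ "s\<^sup>2 / 60"] conjI ballI impI)
    fix p' :: "real \<times> real" assume p': "p' \<in> {p. near0 (fst p) (snd p)}" "dist p' p < s\<^sup>2 / 60"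
    have "\<bar>fst p' - fst p\<bar> \<le> s\<^sup>2 / 60" "\<bar>snd p' - snd p\<bar> \<le> s\<^sup>2 / 60"
      using dist_fst_le[of p' p] dist_snd_le[of p' p] p'(2) by (auto simp: dist_real_def)
    then show "dist (tau (fst p') (snd p')) (tau (fst p) (snd p)) \<le> e"
      using tau_uniformly_continuous[OF s(1,2)] p p'(1) s(3) unfolding dist_real_def by fastforce
  qed (use s in simp)
qed

text \<open>In the coordinates s (2,k) + y (2,-k) every horizontal line runs in an oblique direction
  and meets the curve once. The estimates for the oblique directions are exactly the hypotheses of
  \<open>valley_weak_derivative\<close>, the crossing being the valley point. The value of \<rho>
  keeps the first scaled coordinate, at most 6\<rho>, inside \<open>near0\<close>.\<close>

lemma tau_weak_derivative:
  fixes k :: real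
  assumes k: "k = 1 \<or> k = - 1" and \<rho>: "\<rho> = 1/7200000"
  obtains f g where "integrable lborel g" "f \<in> borel_measurable borel"
    "\<And>p. p \<in> {- 2 * \<rho>..2 * \<rho>} \<times> {- \<rho>..\<rho>} \<Longrightarrow> f p = tau (2 * fst p + 2 * snd p) (k * (fst p - snd p))"
    "\<And>\<phi> \<phi>'. box_test (- 2 * \<rho>) (2 * \<rho>) (- \<rho>) \<rho> \<phi> \<phi>' \<Longrightarrow> (\<integral>p. f p * \<phi>' p \<partial>lborel) = - (\<integral>p. g p * \<phi> p \<partial>lborel)"
proof -
  have k1: "\<bar>k\<bar> = 1" using k by auto
  \<comment> \<open>Clamping both coordinates extends the minimum time continuously and boundedly to
    the whole plane.\<close>
  define cs where "cs s = max (- 2 * \<rho>) (min (2 * \<rho>) s)" for s :: real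
  define cy where "cy y = max (- \<rho>) (min \<rho> y)" for y :: real
  have \<rho>0: "0 < \<rho>" using \<rho> by simp
  have cs: "cs s \<in> {- 2 * \<rho>..2 * \<rho>}" for s using \<rho>0 by (auto simp: cs_def)
  have cs_id: "cs s = s" if "s \<in> {- 2 * \<rho>..2 * \<rho>}" for s using that by (auto simp: cs_def)
  have cy: "cy y \<in> {- \<rho>..\<rho>}" for y using \<rho>0 by (auto simp: cy_def)
  have cy_id: "cy y = y" if "y \<in> {- \<rho>..\<rho>}" for y using that by (auto simp: cy_def)
  define X1 where "X1 s y = 2 * s + 2 * y" for s y :: real
  define X2 where "X2 s y = k * (s - y)" for s y :: real
  have X2b: "\<bar>X2 s y\<bar> \<le> 3 * \<rho>" "near0 (X1 s y) (X2 s y)" if "s \<in> {- 2 * \<rho>..2 * \<rho>}" "y \<in> {- \<rho>..\<rho>}" for s y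
  proof -
    show 2: "\<bar>X2 s y\<bar> \<le> 3 * \<rho>" using that k by (auto simp: X2_def abs_le_iff)
    have "\<bar>X1 s y\<bar> \<le> 6 * \<rho>" using that by (auto simp: X1_def abs_le_iff)
    then show "near0 (X1 s y) (X2 s y)" using 2 \<rho> by (simp add: near0_def)
  qed
  define off where "off s y = X1 s y - \<gamma> (X2 s y)" for s y
  \<comment> \<open>The horizontal coordinate grows with slope 2 and the curve contributes at most
    3/10, so the offset is strictly increasing along each line and has at most one zero.\<close>
  have off_inc: "\<bar>off s' y - off s y - 2 * (s' - s)\<bar> \<le> 3/10 * \<bar>s' - s\<bar>"
    if "s \<in> {- 2 * \<rho>..2 * \<rho>}" "s' \<in> {- 2 * \<rho>..2 * \<rho>}" "y \<in> {- \<rho>..\<rho>}" for s s' y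
  proof -
    have "\<bar>\<gamma> (X2 s' y) - \<gamma> (X2 s y)\<bar> \<le> 3/10 * \<bar>X2 s' y - X2 s y\<bar>"
      using X2b(1)[OF that(1,3)] X2b(1)[OF that(2,3)] \<rho> by (intro curve_lip) simp_all
    moreover have "\<bar>X2 s' y - X2 s y\<bar> = \<bar>s' - s\<bar>" using k by (auto simp: X2_def)
    ultimately show ?thesis unfolding off_def X1_def by argo
  qed
  have off_cont: "continuous_on ({- 2 * \<rho>..2 * \<rho>} \<times> {- \<rho>..\<rho>}) (\<lambda>p. off (fst p) (snd p))"
  proof -
    have "continuous_on ({- 2 * \<rho>..2 * \<rho>} \<times> {- \<rho>..\<rho>}) (\<lambda>p. \<gamma> (X2 (fst p) (snd p)))"
    proof (rule continuous_on_compose2[OF curve_continuous])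
      show "continuous_on ({- 2 * \<rho>..2 * \<rho>} \<times> {- \<rho>..\<rho>}) (\<lambda>p. X2 (fst p) (snd p))" unfolding X2_def by (intro continuous_intros)
      have "X2 (fst p) (snd p) \<in> {- 1/4..1/4}" if "p \<in> {- 2 * \<rho>..2 * \<rho>} \<times> {- \<rho>..\<rho>}" for p
      proof -
        have "\<bar>X2 (fst p) (snd p)\<bar> \<le> 3 * \<rho>" using that by (intro X2b(1)) auto
        then show ?thesis using \<rho> unfolding atLeastAtMost_iff by argo
      qed
      then show "(\<lambda>p. X2 (fst p) (snd p)) ` ({- 2 * \<rho>..2 * \<rho>} \<times> {- \<rho>..\<rho>}) \<subseteq> {- 1/4..1/4}" by blast
    qed
    then show ?thesis unfolding off_def X1_def by (intro continuous_intros)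
  qed
  \<comment> \<open>The range of s is twice that of y: at its ends the horizontal coordinate is at
    least 2\<rho> in size, while the curve stays within \<rho>.\<close>
  have zero_ex: "\<exists>s\<in>{- 2 * \<rho>..2 * \<rho>}. off s y = 0" if y: "y \<in> {- \<rho>..\<rho>}" for y
  proof -
    have e: "- 2 * \<rho> \<in> {- 2 * \<rho>..2 * \<rho>}" "2 * \<rho> \<in> {- 2 * \<rho>..2 * \<rho>}" using \<rho>0 by auto
    have "\<bar>\<gamma> (X2 s y)\<bar> \<le> \<rho>" if "s \<in> {- 2 * \<rho>..2 * \<rho>}" for s
    proof -
      have "\<bar>\<gamma> (X2 s y)\<bar> \<le> 3/10 * \<bar>X2 s y\<bar>" using X2b(1)[OF that y] \<rho> by (intro curve_abs) simp
      then show ?thesis using X2b(1)[OF that y] \<rho>0 by argo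
    qed
    from this[OF e(1)] this[OF e(2)] have "off (- 2 * \<rho>) y \<le> 0" "0 \<le> off (2 * \<rho>) y"
      using y \<rho>0 unfolding off_def X1_def atLeastAtMost_iff by argo+
    moreover have "continuous_on {- 2 * \<rho>..2 * \<rho>} (\<lambda>s. off s y)"
    proof -
      have "continuous_on {- 2 * \<rho>..2 * \<rho>} (\<lambda>s. (s, y))" by (intro continuous_intros)
      moreover have "(\<lambda>s. (s, y)) ` {- 2 * \<rho>..2 * \<rho>} \<subseteq> {- 2 * \<rho>..2 * \<rho>} \<times> {- \<rho>..\<rho>}" using y by blast
      ultimately have "continuous_on {- 2 * \<rho>..2 * \<rho>} (\<lambda>s. off (fst (s, y)) (snd (s, y)))" by (rule continuous_on_compose2[OF off_cont])
      then show ?thesis by simp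
    qed
    ultimately show ?thesis using IVT'[of "\<lambda>s. off s y" "- 2 * \<rho>" 0 "2 * \<rho>"] \<rho>0 by auto
  qed
  have "\<forall>y. \<exists>s. s \<in> {- 2 * \<rho>..2 * \<rho>} \<and> off s (cy y) = 0" using zero_ex[OF cy] by blast
  then obtain \<sigma> where \<sigma>: "\<And>y. \<sigma> y \<in> {- 2 * \<rho>..2 * \<rho>}" "\<And>y. off (\<sigma> y) (cy y) = 0" by metis
  have off_le: "off s (cy y) \<le> - (s' - s)" if "s \<in> {- 2 * \<rho>..2 * \<rho>}" "s \<le> s'" "s' = \<sigma> y" for s s' y
    using off_inc[OF that(1) \<sigma>(1)[of y] cy[of y]] \<sigma>(2)[of y] that(2,3) by argo
  have off_ge: "s - s' \<le> off s (cy y)" if "s \<in> {- 2 * \<rho>..2 * \<rho>}" "s' \<le> s" "s' = \<sigma> y" for s s' y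
    using off_inc[OF \<sigma>(1)[of y] that(1) cy[of y]] \<sigma>(2)[of y] that(2,3) by argo
  have \<sigma>m: "\<sigma> \<in> borel_measurable borel"
  proof (rule borel_measurable_iff_le[THEN iffD2], rule allI)
    fix s
    consider "s < - 2 * \<rho>" | "2 * \<rho> < s" | "s \<in> {- 2 * \<rho>..2 * \<rho>}" by fastforce
    then show "{w \<in> space borel. \<sigma> w \<le> s} \<in> sets borel"
    proof cases
      case 1
      then have "\<not> \<sigma> w \<le> s" for w using \<sigma>(1)[of w] by auto
      then show ?thesis by simp
    next
      case 2
      then have "\<sigma> w \<le> s" for w using \<sigma>(1)[of w] by auto
      then show ?thesis by simp
    next
      case 3
      \<comment> \<open>The sign of the offset decides on which side of the crossing s lies, so
        sublevel sets of \<sigma> are closed.\<close>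
      have "\<sigma> y \<le> s \<longleftrightarrow> off s (cy y) \<in> {0..}" for y
      proof (cases "\<sigma> y \<le> s")
        case True then show ?thesis using off_ge[OF 3 True refl] by simp
      next
        case False then show ?thesis using off_le[of s "\<sigma> y" y, OF 3] by simp
      qed
      then have "{w \<in> space borel. \<sigma> w \<le> s} = (\<lambda>y. off s (cy y)) -` {0..}" by auto
      moreover have "continuous_on UNIV (\<lambda>y. off s (cy y))"
      proof -
        have "continuous_on UNIV (\<lambda>y. (s, cy y))" unfolding cy_def by (intro continuous_intros)
        moreover have "(\<lambda>y. (s, cy y)) ` UNIV \<subseteq> {- 2 * \<rho>..2 * \<rho>} \<times> {- \<rho>..\<rho>}" using 3 cy by blast
        ultimately have "continuous_on UNIV (\<lambda>y. off (fst (s, cy y)) (snd (s, cy y)))" by (rule continuous_on_compose2[OF off_cont])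
        then show ?thesis by simp
      qed
      then have "closed ((\<lambda>y. off s (cy y)) -` {0..})" by (intro continuous_closed_vimage) (auto simp: continuous_on_eq_continuous_at)
      ultimately show ?thesis by simp
    qed
  qed
  define f where "f s y = tau (X1 (cs s) (cy y)) (X2 (cs s) (cy y))" for s y
  have X_step: "X1 (s + h) y = X1 s y + 2 * h" "X2 (s + h) y = X2 s y + k * h"
    "X1 (s - h) y = X1 s y - 2 * h" "X2 (s - h) y = X2 s y - k * h" for s h y
    by (simp_all add: X1_def X2_def algebra_simps)
  have small: "\<bar>X2 s y\<bar> \<le> 1/40" if "s \<in> {- 2 * \<rho>..2 * \<rho>}" "y \<in> {- \<rho>..\<rho>}" for s y
    using X2b(1)[OF that] \<rho> by simp
  define F where "F s y = tau (X1 s y) (X2 s y)" for s y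
  have fF: "f s y = F s (cy y)" if "s \<in> {- 2 * \<rho>..2 * \<rho>}" for s y using cs_id[OF that] by (simp add: f_def F_def)
  have toR: "F (s + h) y \<le> F s y + 5 * h" if "s \<in> {- 2 * \<rho>..2 * \<rho>}" "s + h \<in> {- 2 * \<rho>..2 * \<rho>}" "y \<in> {- \<rho>..\<rho>}" "0 \<le> h" "off (s + h) y \<le> 0" for s h y
    unfolding F_def
  proof (rule tau_transfer[OF X2b(2)[OF that(1,3)]])
    fix t :: real assume t: "t \<le> 1/40" "reaches (X1 s y) (X2 s y) 0 0 t"
    show "reaches (X1 (s + h) y) (X2 (s + h) y) 0 0 (t + 5 * h)" unfolding X_step
      by (rule toward_curve_oblique_right[OF k1 small[OF that(1,3)] that(4) _ t(2)]) (use that \<rho> t in \<open>auto simp: off_def X_step\<close>)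
  qed
  have toL: "F (s - h) y \<le> F s y + 5 * h" if "s \<in> {- 2 * \<rho>..2 * \<rho>}" "s - h \<in> {- 2 * \<rho>..2 * \<rho>}" "y \<in> {- \<rho>..\<rho>}" "0 \<le> h" "0 \<le> off (s - h) y" for s h y
    unfolding F_def
  proof (rule tau_transfer[OF X2b(2)[OF that(1,3)]])
    fix t :: real assume t: "t \<le> 1/40" "reaches (X1 s y) (X2 s y) 0 0 t"
    show "reaches (X1 (s - h) y) (X2 (s - h) y) 0 0 (t + 5 * h)" unfolding X_step
      by (rule toward_curve_oblique_left[OF k1 small[OF that(1,3)] that(4) _ t(2)]) (use that \<rho> t in \<open>auto simp: off_def X_step\<close>)
  qed
  have awR: "F (s + h) y \<le> F s y + (7 / a + 8) * h" if "s \<in> {- 2 * \<rho>..2 * \<rho>}" "y \<in> {- \<rho>..\<rho>}" "0 < a" "a \<le> 1" "a \<le> off s y" "0 \<le> h" "h \<le> a / 1000" for s h y a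
    unfolding F_def
  proof (rule tau_transfer[OF X2b(2)[OF that(1,2)]])
    fix t :: real assume t: "t \<le> 1/40" "reaches (X1 s y) (X2 s y) 0 0 t"
    show "reaches (X1 (s + h) y) (X2 (s + h) y) 0 0 (t + (7 / a + 8) * h)" unfolding X_step
      by (rule away_from_curve_oblique_right[OF k1 small[OF that(1,2)] that(3,4) _ that(6,7) t(2,1)]) (use that in \<open>auto simp: off_def\<close>)
  qed
  have awL: "F (s - h) y \<le> F s y + (7 / a + 8) * h" if "s \<in> {- 2 * \<rho>..2 * \<rho>}" "y \<in> {- \<rho>..\<rho>}" "0 < a" "a \<le> 1" "off s y \<le> - a" "0 \<le> h" "h \<le> a / 1000" for s h y a
    unfolding F_def
  proof (rule tau_transfer[OF X2b(2)[OF that(1,2)]])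
    fix t :: real assume t: "t \<le> 1/40" "reaches (X1 s y) (X2 s y) 0 0 t"
    show "reaches (X1 (s - h) y) (X2 (s - h) y) 0 0 (t + (7 / a + 8) * h)" unfolding X_step
      by (rule away_from_curve_oblique_left[OF k1 small[OF that(1,2)] that(3,4) _ that(6,7) t(2,1)]) (use that in \<open>auto simp: off_def\<close>)
  qed
  \<comment> \<open>Of the two inequalities one moves toward the curve, with slope 5, the other away
    from it. The latter may have to start at s', whose offset is still at least a/2 in size; hence
    14/a instead of 7/a.\<close>
  have lipL: "\<bar>F s' y - F s y\<bar> \<le> (14 / a + 8) * \<bar>s' - s\<bar>"
    if s: "s \<in> {- 2 * \<rho>..2 * \<rho>}" "s' \<in> {- 2 * \<rho>..2 * \<rho>}" and y: "y \<in> {- \<rho>..\<rho>}" and a: "0 < a" "a \<le> 1" "off s y \<le> - a" and d: "\<bar>s' - s\<bar> \<le> a / 2000" for s s' y a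
  proof -
    have K: "5 * h \<le> (14 / a + 8) * h" "(7 / a + 8) * h \<le> (14 / a + 8) * h" "(7 / (a / 2) + 8) * h = (14 / a + 8) * h" if "0 \<le> h" for h
    proof -
      have "0 < 14 / a" "7 / a \<le> 14 / a" using a by (auto simp: divide_right_mono)
      then have "5 \<le> 14 / a + 8" "7 / a + 8 \<le> 14 / a + 8" by linarith+
      then show "5 * h \<le> (14 / a + 8) * h" "(7 / a + 8) * h \<le> (14 / a + 8) * h" using that by (auto intro: mult_right_mono)
      show "(7 / (a / 2) + 8) * h = (14 / a + 8) * h" by simp
    qed
    have o': "off s' y \<le> - (a / 2)" using off_inc[OF s y] a(1,3) d by argo
    show ?thesis
    proof (cases "s \<le> s'")
      case True
      have "F s' y \<le> F s y + 5 * (s' - s)" using toR[of s "s' - s" y] s y True o' a by simp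
      moreover have "F s y \<le> F s' y + (7 / (a / 2) + 8) * (s' - s)"
        using awL[of s' y "a / 2" "s' - s"] s y True o' a d by simp
      moreover have h: "0 \<le> s' - s" "\<bar>s' - s\<bar> = s' - s" using True by auto
      ultimately have "F s y \<le> F s' y + (14 / a + 8) * (s' - s)" "F s' y \<le> F s y + (14 / a + 8) * (s' - s)"
        using K[OF h(1)] by linarith+
      then show ?thesis unfolding h(2) by (intro abs_leI) linarith+
    next
      case False
      have "F s y \<le> F s' y + 5 * (s - s')" using toR[of s' "s - s'" y] s y False a by simp
      moreover have "F s' y \<le> F s y + (7 / a + 8) * (s - s')"
        using awL[of s y a "s - s'"] s y False a d by simp
      moreover have h: "0 \<le> s - s'" "\<bar>s' - s\<bar> = s - s'" using False by auto
      ultimately have "F s y \<le> F s' y + (14 / a + 8) * (s - s')" "F s' y \<le> F s y + (14 / a + 8) * (s - s')"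
        using K[OF h(1)] by linarith+
      then show ?thesis unfolding h(2) by (intro abs_leI) linarith+
    qed
  qed
  have lipR: "\<bar>F s' y - F s y\<bar> \<le> (14 / a + 8) * \<bar>s' - s\<bar>"
    if s: "s \<in> {- 2 * \<rho>..2 * \<rho>}" "s' \<in> {- 2 * \<rho>..2 * \<rho>}" and y: "y \<in> {- \<rho>..\<rho>}" and a: "0 < a" "a \<le> 1" "a \<le> off s y" and d: "\<bar>s' - s\<bar> \<le> a / 2000" for s s' y a
  proof -
    have K: "5 * h \<le> (14 / a + 8) * h" "(7 / a + 8) * h \<le> (14 / a + 8) * h" "(7 / (a / 2) + 8) * h = (14 / a + 8) * h" if "0 \<le> h" for h
    proof -
      have "0 < 14 / a" "7 / a \<le> 14 / a" using a by (auto simp: divide_right_mono)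
      then have "5 \<le> 14 / a + 8" "7 / a + 8 \<le> 14 / a + 8" by linarith+
      then show "5 * h \<le> (14 / a + 8) * h" "(7 / a + 8) * h \<le> (14 / a + 8) * h" using that by (auto intro: mult_right_mono)
      show "(7 / (a / 2) + 8) * h = (14 / a + 8) * h" by simp
    qed
    have o': "a / 2 \<le> off s' y" using off_inc[OF s y] a(1,3) d by argo
    show ?thesis
    proof (cases "s' \<le> s")
      case True
      have "F s' y \<le> F s y + 5 * (s - s')" using toL[of s "s - s'" y] s y True o' a by simp
      moreover have "F s y \<le> F s' y + (7 / (a / 2) + 8) * (s - s')"
        using awR[of s' y "a / 2" "s - s'"] s y True o' a d by simp
      moreover have h: "0 \<le> s - s'" "\<bar>s' - s\<bar> = s - s'" using True by auto
      ultimately have "F s y \<le> F s' y + (14 / a + 8) * (s - s')" "F s' y \<le> F s y + (14 / a + 8) * (s - s')"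
        using K[OF h(1)] by linarith+
      then show ?thesis unfolding h(2) by (intro abs_leI) linarith+
    next
      case False
      have "F s y \<le> F s' y + 5 * (s' - s)" using toL[of s' "s' - s" y] s y False a by simp
      moreover have "F s' y \<le> F s y + (7 / a + 8) * (s' - s)"
        using awR[of s y a "s' - s"] s y False a d by simp
      moreover have h: "0 \<le> s' - s" "\<bar>s' - s\<bar> = s' - s" using False by auto
      ultimately have "F s y \<le> F s' y + (14 / a + 8) * (s' - s)" "F s' y \<le> F s y + (14 / a + 8) * (s' - s)"
        using K[OF h(1)] by linarith+
      then show ?thesis unfolding h(2) by (intro abs_leI) linarith+
    qed
  qed
  have fc: "continuous_on UNIV (\<lambda>p. f (fst p) (snd p))"
  proof -
    have "continuous_on UNIV (\<lambda>p. (X1 (cs (fst p)) (cy (snd p)), X2 (cs (fst p)) (cy (snd p))))"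
      unfolding X1_def X2_def cs_def cy_def by (intro continuous_intros)
    moreover have "range (\<lambda>p. (X1 (cs (fst p)) (cy (snd p)), X2 (cs (fst p)) (cy (snd p)))) \<subseteq> {p. near0 (fst p) (snd p)}"
      using X2b(2)[OF cs cy] by auto
    ultimately have "continuous_on UNIV (\<lambda>p. tau (fst (X1 (cs (fst p)) (cy (snd p)), X2 (cs (fst p)) (cy (snd p)))) (snd (X1 (cs (fst p)) (cy (snd p)), X2 (cs (fst p)) (cy (snd p)))))"
      by (rule continuous_on_compose2[OF tau_continuous])
    then show ?thesis by (simp add: f_def)
  qed
  obtain g where g: "integrable lborel g"
    "\<And>\<phi> \<phi>'. box_test (- 2 * \<rho>) (2 * \<rho>) (- \<rho>) \<rho> \<phi> \<phi>' \<Longrightarrow> (\<integral>p. f (fst p) (snd p) * \<phi>' p \<partial>lborel) = - (\<integral>p. g p * \<phi> p \<partial>lborel)"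
  proof (rule valley_weak_derivative[where f = f and \<sigma> = \<sigma> and C = 5 and M = 1 and a = "- 2 * \<rho>" and b = "2 * \<rho>" and c = "- \<rho>" and d = \<rho>])
    show "\<bar>f s y\<bar> \<le> 1" for s y using near0_tau(1,2)[OF X2b(2)[OF cs[of s] cy[of y]]] by (simp add: f_def)
    show "f s' y \<le> f s y + 5 * (s' - s)" if "- 2 * \<rho> \<le> s" "s \<le> s'" "s' \<le> \<sigma> y" for s s' y
    proof -
      have m: "s \<in> {- 2 * \<rho>..2 * \<rho>}" "s' \<in> {- 2 * \<rho>..2 * \<rho>}" using that \<sigma>(1)[of y] by auto
      have "off s' (cy y) \<le> 0" using off_le[OF m(2) that(3) refl] that by simp
      then show ?thesis using toR[of s "s' - s" "cy y"] m cy that fF by simp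
    qed
    show "f s y \<le> f s' y + 5 * (s' - s)" if "\<sigma> y \<le> s" "s \<le> s'" "s' \<le> 2 * \<rho>" for s s' y
    proof -
      have m: "s \<in> {- 2 * \<rho>..2 * \<rho>}" "s' \<in> {- 2 * \<rho>..2 * \<rho>}" using that \<sigma>(1)[of y] by auto
      have "0 \<le> off s (cy y)" using off_ge[OF m(1) that(1) refl] that by simp
      then show ?thesis using toL[of s' "s' - s" "cy y"] m cy that fF by simp
    qed
    show "\<exists>e>0. \<exists>B. \<forall>s'\<in>{- 2 * \<rho>..2 * \<rho>}. \<bar>s' - s\<bar> < e \<longrightarrow> \<bar>f s' y - f s y\<bar> \<le> B * \<bar>s' - s\<bar>"
      if s: "s \<in> {- 2 * \<rho>..2 * \<rho>}" "s \<noteq> \<sigma> y" for s y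
    proof -
      \<comment> \<open>The constant 14/a is unbounded as s approaches the crossing, which
        \<open>valley_weak_derivative\<close> allows.\<close>
      define a where "a = min 1 \<bar>off s (cy y)\<bar>"
      have ne: "off s (cy y) \<noteq> 0" using off_le[OF s(1), of "\<sigma> y" y] off_ge[OF s(1), of "\<sigma> y" y] s(2) by (cases "s \<le> \<sigma> y") auto
      have a: "0 < a" "a \<le> 1" "off s (cy y) \<le> - a \<or> a \<le> off s (cy y)" using ne by (auto simp: a_def)
      have "\<bar>f s' y - f s y\<bar> \<le> (14 / a + 8) * \<bar>s' - s\<bar>" if "s' \<in> {- 2 * \<rho>..2 * \<rho>}" "\<bar>s' - s\<bar> < a / 2000" for s'
        using a(3) lipL[OF s(1) that(1) cy[of y] a(1,2)] lipR[OF s(1) that(1) cy[of y] a(1,2)] that fF s(1) by auto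
      then show ?thesis using a(1) by (intro exI[of _ "a / 2000"] conjI exI[of _ "14 / a + 8"]) auto
    qed
  qed (use \<rho>0 fc \<sigma>m \<sigma>(1) in auto)
  show thesis
  proof (rule that[OF g(1) borel_measurable_continuous_onI[OF fc] _ g(2)])
    fix p assume "p \<in> {- 2 * \<rho>..2 * \<rho>} \<times> {- \<rho>..\<rho>}"
    then show "f (fst p) (snd p) = tau (2 * fst p + 2 * snd p) (k * (fst p - snd p))"
      by (auto simp: f_def X1_def X2_def cs_id cy_id)
  qed
qed

end

section \<open>Scaling near the origin\<close>

lemma admissible_affine:
  assumes "admissible_control u" "c \<noteq> 0"
  shows "admissible_control (\<lambda>s. u (t + c * s))"
proof -
  have "(\<lambda>x. t + c * x) \<in> lebesgue \<rightarrow>\<^sub>M lebesgue"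
    using lebesgue_affine_measurable[where c = "\<lambda>x::real. c"] assms(2) by simp
  from measurable_compose[OF this] show ?thesis using assms(1) unfolding admissible_control_def by blast
qed

lemma admissible_join:
  assumes "admissible_control u" "admissible_control w"
  shows "admissible_control (\<lambda>\<tau>. if \<tau> \<le> s then u \<tau> else w (\<tau> + - s))"
proof -
  have w: "admissible_control (\<lambda>\<tau>. w (- s + 1 * \<tau>))" using assms(2) by (rule admissible_affine) simp
  have "{x \<in> space lebesgue. x \<le> s} \<in> sets lebesgue" by simp
  then have "(\<lambda>\<tau>. if \<tau> \<le> s then u \<tau> else w (\<tau> + - s)) \<in> borel_measurable lebesgue"
    using assms(1) w unfolding admissible_control_def by (intro measurable_If) (simp_all add: add.commute)
  then show ?thesis using assms unfolding admissible_control_def by auto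
qed

lemma admissible_const: "(\<And>k. w $ k \<in> {-1..1}) \<Longrightarrow> admissible_control (\<lambda>_. w)"
  unfolding admissible_control_def by auto

lemma has_integral_scale_arg:
  fixes f :: "real \<Rightarrow> 'a::banach"
  assumes "(f has_integral I) {e * a..e * b}" "0 < e"
  shows "((\<lambda>x. f (e * x)) has_integral (inverse e *\<^sub>R I)) {a..b}"
proof -
  have "(f has_integral I) (cbox (e * a) (e * b))" using assms(1) by simp
  from has_integral_affinity'[OF this assms(2), of 0] assms(2)
  show ?thesis by (simp add: field_simps)
qed

lemma steers_segment:
  fixes a b t :: real
  assumes "\<forall>s\<in>{0..t}. ((\<lambda>\<tau>. h \<tau>) has_integral (y s - x0)) {0..s}" "0 \<le> a" "a \<le> b" "b \<le> t"
  shows "(h has_integral (y b - y a :: real^2)) {a..b}"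
proof -
  have A: "(h has_integral (y a - x0)) {0..a}" using bspec[OF assms(1), of a] assms(2-4) by simp
  have B: "(h has_integral (y b - x0)) {0..b}" using bspec[OF assms(1), of b] assms(2-4) by simp
  have "h integrable_on {a..b}" by (rule integrable_on_subinterval[OF has_integral_integrable[OF B]]) (use assms in auto)
  then have C: "(h has_integral integral {a..b} h) {a..b}" by (rule integrable_integral)
  from has_integral_combine[OF assms(2,3) A C] B have "y a - x0 + integral {a..b} h = y b - x0" by (rule has_integral_unique)
  then have "integral {a..b} h = y b - y a" by (simp add: algebra_simps)
  with C show ?thesis by simp
qed

text \<open>The original system in blown-up coordinates: weights e^2 and e in space and e in time.
  The dynamics need to match only on the unit box, so the perturbations may be truncated outside
  it.\<close>

locale scaled = switching_curve r1 r2 v "{u. \<forall>k. u $ k \<in> {-1..1}}" "{u. admissible_control u}" um up u0 \<gamma> \<gamma>d +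
    E: coords2 E1 E2 P1 P2
  for r1 r2 :: "real \<Rightarrow> real \<Rightarrow> real^'m \<Rightarrow> real" and v um up u0 \<gamma> \<gamma>d E1 E2 P1 P2 +
  fixes F :: "real^2 \<Rightarrow> real^2" and G :: "real^2 \<Rightarrow> real^'m^2" and e :: real
  assumes e: "0 < e"
    and dyn1: "\<And>\<xi>1 \<xi>2 u. \<bar>\<xi>1\<bar> \<le> 1 \<Longrightarrow> \<bar>\<xi>2\<bar> \<le> 1 \<Longrightarrow> (\<forall>k. u $ k \<in> {-1..1}) \<Longrightarrow>
      P1 (F ((e\<^sup>2 * \<xi>1) *\<^sub>R E1 + (e * \<xi>2) *\<^sub>R E2) + G ((e\<^sup>2 * \<xi>1) *\<^sub>R E1 + (e * \<xi>2) *\<^sub>R E2) *v u) = e * (\<xi>2 + r1 \<xi>1 \<xi>2 u)"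
    and dyn2: "\<And>\<xi>1 \<xi>2 u. \<bar>\<xi>1\<bar> \<le> 1 \<Longrightarrow> \<bar>\<xi>2\<bar> \<le> 1 \<Longrightarrow> (\<forall>k. u $ k \<in> {-1..1}) \<Longrightarrow>
      P2 (F ((e\<^sup>2 * \<xi>1) *\<^sub>R E1 + (e * \<xi>2) *\<^sub>R E2) + G ((e\<^sup>2 * \<xi>1) *\<^sub>R E1 + (e * \<xi>2) *\<^sub>R E2) *v u) = v u + r2 \<xi>1 \<xi>2 u"
begin

definition "X1 x = P1 x / e\<^sup>2"
definition "X2 x = P2 x / e"
definition "pt \<xi>1 \<xi>2 = (e\<^sup>2 * \<xi>1) *\<^sub>R E1 + (e * \<xi>2) *\<^sub>R E2"

lemma X_pt: "X1 (pt a b) = a" "X2 (pt a b) = b"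
  using e by (simp_all add: X1_def X2_def pt_def E.proj)

lemma pt_X: "pt (X1 x) (X2 x) = x"
  using e E.decomp[of x] by (simp add: X1_def X2_def pt_def)

lemma X_linear: "linear X1" "linear X2"
  by (rule linearI; simp add: X1_def X2_def linear_add[OF E.lin(1)] linear_add[OF E.lin(2)] linear_cmul[OF E.lin(1)] linear_cmul[OF E.lin(2)] add_divide_distrib)+

lemma X_continuous: "continuous_on S X1" "continuous_on S X2"
  using X_linear by (auto simp: linear_conv_bounded_linear intro: linear_continuous_on)

text \<open>The distance from the origin is bounded by the time left. With at most 1/5 to go both
  coordinates are well inside the unit box, where the two descriptions of the dynamics
  agree.\<close>

lemma backward_bound:
  assumes t: "b \<le> 1/5" "0 \<le> a" "a \<le> b" and e: "y1 b = 0" "y2 b = 0"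
    and I: "\<And>c. a \<le> c \<Longrightarrow> c \<le> b \<Longrightarrow> ((\<lambda>\<tau>. f1 (y1 \<tau>) (y2 \<tau>) (u \<tau>)) has_integral (y1 b - y1 c)) {c..b}"
    "\<And>c. a \<le> c \<Longrightarrow> c \<le> b \<Longrightarrow> ((\<lambda>\<tau>. f2 (y1 \<tau>) (y2 \<tau>) (u \<tau>)) has_integral (y2 b - y2 c)) {c..b}"
    and u: "\<And>\<tau> k. u \<tau> $ k \<in> {-1..1}"
  shows "\<bar>y2 a\<bar> \<le> 11/10 * (b - a)" "\<bar>y1 a\<bar> \<le> 1/2 * (b - a)"
proof -
  have U: "u \<tau> \<in> {u. \<forall>k. u $ k \<in> {-1..1}}" for \<tau> using u by simp
  have 2: "\<bar>y2 c\<bar> \<le> 11/10 * (b - c)" if "a \<le> c" "c \<le> b" for c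
    using has_integral_abs_le_const[OF I(2)[OF that] that(2) f2_abs[OF U]] e by simp
  then show "\<bar>y2 a\<bar> \<le> 11/10 * (b - a)" using t by simp
  have "\<bar>y1 b - y1 a\<bar> \<le> 1/2 * (b - a)"
  proof (rule has_integral_abs_le_const[OF I(1)[OF order_refl t(3)] t(3)])
    fix x assume "x \<in> {a..b}"
    then have "\<bar>y2 x\<bar> \<le> 11/10 * (b - x)" "b - x \<le> 1/5" using 2[of x] t by auto
    then show "\<bar>f1 (y1 x) (y2 x) (u x)\<bar> \<le> 1/2" using f1_abs[OF U, of "y1 x" "y2 x" x] by argo
  qed
  then show "\<bar>y1 a\<bar> \<le> 1/2 * (b - a)" using e by simp
qed

lemma traj_bound:
  assumes "reaches x1 x2 0 0 t" "t \<le> 1/5"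
  shows "\<bar>x2\<bar> \<le> 11/10 * t" "\<bar>x1\<bar> \<le> 1/2 * t"
proof -
  obtain u y1 y2 s where Y: "s \<le> t" "traj u y1 y2 s" "y1 0 = x1" "y2 0 = x2" "y1 s = 0" "y2 s = 0"
    using assms(1) unfolding reaches_def by blast
  have u: "u \<tau> $ k \<in> {-1..1}" for \<tau> k using trajD(5)[OF Y(2), of \<tau>] by simp
  have s: "0 \<le> s" using trajD(2)[OF Y(2)] .
  have s5: "s \<le> 1/5" using Y(1) assms(2) by simp
  have "\<bar>y2 0\<bar> \<le> 11/10 * (s - 0)" "\<bar>y1 0\<bar> \<le> 1/2 * (s - 0)"
    by (rule backward_bound[OF s5 order_refl s Y(5,6) traj_int(1)[OF Y(2) _ _ order_refl] traj_int(2)[OF Y(2) _ _ order_refl] u]; assumption)+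
  then show "\<bar>x2\<bar> \<le> 11/10 * t" "\<bar>x1\<bar> \<le> 1/2 * t" using Y by auto
qed

lemma steers_if_reaches:
  assumes "reaches x1 x2 0 0 t" "t \<le> 1/5"
  shows "\<exists>T\<le>e * t. steers_to_origin F G (pt x1 x2) T"
proof -
  obtain u y1 y2 s where Y: "s \<le> t" "traj u y1 y2 s" "y1 0 = x1" "y2 0 = x2" "y1 s = 0" "y2 s = 0"
    using assms(1) unfolding reaches_def by blast
  have s: "0 \<le> s" "s \<le> 1/5" using trajD(2)[OF Y(2)] Y assms by auto
  have u: "admissible_control u" "\<forall>k. u \<tau> $ k \<in> {-1..1}" for \<tau> using trajD(1,5)[OF Y(2)] by auto
  have box: "\<bar>y1 r\<bar> \<le> 1" "\<bar>y2 r\<bar> \<le> 1" if "r \<in> {0..s}" for r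
  proof -
    have "reaches (y1 r) (y2 r) 0 0 (s - r)" using reaches_seg[OF Y(2), of r s] Y that by auto
    from traj_bound[OF this] that s show "\<bar>y1 r\<bar> \<le> 1" "\<bar>y2 r\<bar> \<le> 1" by auto
  qed
  define z where "z r = pt (y1 (inverse e * r)) (y2 (inverse e * r))" for r
  have "steers_to_origin F G (pt x1 x2) (e * s)" unfolding steers_to_origin_def
  proof (intro conjI exI[of _ "\<lambda>r. u (0 + inverse e * r)"] exI[of _ z] ballI)
    show "admissible_control (\<lambda>r. u (0 + inverse e * r))" using u(1) e by (intro admissible_affine) auto
    show "0 \<le> e * s" using e s by simp
    show "z 0 = pt x1 x2" "z (e * s) = 0" using e Y by (simp_all add: z_def pt_def field_simps)
    have im: "(\<lambda>r. inverse e * r) ` {0..e * s} \<subseteq> {0..s}" using e by (auto simp: field_simps)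
    have "continuous_on {0..e * s} (\<lambda>r. y1 (inverse e * r))" "continuous_on {0..e * s} (\<lambda>r. y2 (inverse e * r))"
      using im by (auto intro!: continuous_on_compose2[OF trajD(3)[OF Y(2)]] continuous_on_compose2[OF trajD(4)[OF Y(2)]] continuous_intros)
    then show "continuous_on {0..e * s} z" unfolding z_def pt_def by (intro continuous_intros)
    fix r assume r: "r \<in> {0..e * s}"
    define q where "q = inverse e * r"
    have q: "0 \<le> q" "q \<le> s" using r e by (auto simp: q_def field_simps)
    have sc: "((\<lambda>\<tau>. h (inverse e * \<tau>)) has_integral (e *\<^sub>R I)) {0..r}" if "(h has_integral I) {0..q}" for h :: "real \<Rightarrow> real" and I
      using has_integral_scale_arg[of h I "inverse e" 0 r] that e by (simp add: q_def)
    have Ha: "((\<lambda>\<tau>. (e * f1 (y1 (inverse e * \<tau>)) (y2 (inverse e * \<tau>)) (u (inverse e * \<tau>))) *\<^sub>R E1 +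
        f2 (y1 (inverse e * \<tau>)) (y2 (inverse e * \<tau>)) (u (inverse e * \<tau>)) *\<^sub>R E2) has_integral
        ((e * (e *\<^sub>R (y1 q - y1 0))) *\<^sub>R E1 + (e *\<^sub>R (y2 q - y2 0)) *\<^sub>R E2)) {0..r}"
      by (intro has_integral_add has_integral_scaleR_left has_integral_mult_right sc[OF traj_int(1)[OF Y(2) order_refl q]]
          sc[OF traj_int(2)[OF Y(2) order_refl q]])
    have Hb: "(e * (e *\<^sub>R (y1 q - y1 0))) *\<^sub>R E1 + (e *\<^sub>R (y2 q - y2 0)) *\<^sub>R E2 = z r - pt x1 x2"
      using Y by (simp add: z_def pt_def q_def algebra_simps power2_eq_square)
    have Hc: "F (z \<tau>) + G (z \<tau>) *v u (0 + inverse e * \<tau>) = (e * f1 (y1 (inverse e * \<tau>)) (y2 (inverse e * \<tau>)) (u (inverse e * \<tau>))) *\<^sub>R E1 +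
        f2 (y1 (inverse e * \<tau>)) (y2 (inverse e * \<tau>)) (u (inverse e * \<tau>)) *\<^sub>R E2" if "\<tau> \<in> {0..r}" for \<tau>
    proof -
      have "inverse e * \<tau> \<in> {0..s}" using that r im by (auto simp: image_subset_iff)
      note b = box[OF this]
      show ?thesis
        using E.decomp[of "F (z \<tau>) + G (z \<tau>) *v u (0 + inverse e * \<tau>)"] dyn1[OF b u(2)] dyn2[OF b u(2)]
        unfolding z_def pt_def f1_def f2_def by simp
    qed
    show "((\<lambda>\<tau>. F (z \<tau>) + G (z \<tau>) *v u (0 + inverse e * \<tau>)) has_integral z r - pt x1 x2) {0..r}"
      unfolding Hb[symmetric] by (rule has_integral_eq[OF _ Ha]) (rule Hc[symmetric])
  qed
  then show ?thesis using Y(1) e by (intro exI[of _ "e * s"]) auto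
qed

text \<open>A trajectory of the original system solves the scaled equations only while it is in the
  unit box; that it never leaves the box has to be shown.\<close>

lemma reaches_if_steers:
  assumes "steers_to_origin F G (pt x1 x2) T" "T \<le> e * t" "t \<le> 1/5"
  shows "reaches x1 x2 0 0 t"
proof -
  obtain u z where T0: "0 \<le> T" and u: "admissible_control u" and z: "continuous_on {0..T} z" "z 0 = pt x1 x2" "z T = 0"
    and I: "\<forall>s\<in>{0..T}. ((\<lambda>\<tau>. F (z \<tau>) + G (z \<tau>) *v u \<tau>) has_integral (z s - pt x1 x2)) {0..s}"
    using assms(1) unfolding steers_to_origin_def by blast
  define s where "s = inverse e * T"
  have eT: "e * s = T" using e by (simp add: s_def)
  have "0 \<le> s" "s \<le> t" using T0 assms e by (auto simp: s_def field_simps)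
  then have s: "0 \<le> s" "s \<le> t" "s \<le> 1/5" using assms(3) by auto
  define w where "w r = u (0 + e * r)" for r
  have wa: "admissible_control w" unfolding w_def using u e by (intro admissible_affine) auto
  have wU: "w r $ k \<in> {-1..1}" for r k using wa by (auto simp: admissible_control_def)
  define y1 where "y1 r = X1 (z (e * r))" for r
  define y2 where "y2 r = X2 (z (e * r))" for r
  have zy: "z (e * r) = (e\<^sup>2 * y1 r) *\<^sub>R E1 + (e * y2 r) *\<^sub>R E2" for r
    using pt_X[of "z (e * r)"] by (simp add: y1_def y2_def pt_def)
  have im: "(\<lambda>r. e * r) ` {0..s} \<subseteq> {0..T}" using e eT by (auto simp: eT[symmetric])
  have zc: "continuous_on {0..s} (\<lambda>r. z (e * r))"
    using im by (intro continuous_on_compose2[OF z(1)] continuous_intros) auto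
  have yc: "continuous_on {0..s} y1" "continuous_on {0..s} y2" unfolding y1_def y2_def
    by (intro continuous_on_compose2[OF X_continuous(1)[of UNIV] zc] continuous_on_compose2[OF X_continuous(2)[of UNIV] zc]; simp)+
  have fin: "y1 s = 0" "y2 s = 0" "y1 0 = x1" "y2 0 = x2"
    using eT z X_pt linear_0[OF X_linear(1)] linear_0[OF X_linear(2)] by (auto simp: y1_def y2_def)
  have int: "((\<lambda>r. f1 (y1 r) (y2 r) (w r)) has_integral (y1 b - y1 a)) {a..b}"
    "((\<lambda>r. f2 (y1 r) (y2 r) (w r)) has_integral (y2 b - y2 a)) {a..b}"
    if ab: "0 \<le> a" "a \<le> b" "b \<le> s" and box: "\<And>r. r \<in> {a..b} \<Longrightarrow> \<bar>y1 r\<bar> \<le> 1 \<and> \<bar>y2 r\<bar> \<le> 1" for a b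
  proof -
    have "((\<lambda>\<tau>. F (z \<tau>) + G (z \<tau>) *v u \<tau>) has_integral (z (e * b) - z (e * a))) {e * a..e * b}"
      by (rule steers_segment[OF I]) (use ab e eT in auto)
    from has_integral_scale_arg[OF this e]
    have J: "((\<lambda>r. F (z (e * r)) + G (z (e * r)) *v w r) has_integral (inverse e *\<^sub>R (z (e * b) - z (e * a)))) {a..b}"
      by (simp add: w_def)
    have J1: "((\<lambda>r. X1 (F (z (e * r)) + G (z (e * r)) *v w r)) has_integral X1 (inverse e *\<^sub>R (z (e * b) - z (e * a)))) {a..b}"
      using has_integral_linear[OF J, of X1] X_linear(1) by (simp add: linear_conv_bounded_linear o_def)
    have J2: "((\<lambda>r. X2 (F (z (e * r)) + G (z (e * r)) *v w r)) has_integral X2 (inverse e *\<^sub>R (z (e * b) - z (e * a)))) {a..b}"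
      using has_integral_linear[OF J, of X2] X_linear(2) by (simp add: linear_conv_bounded_linear o_def)
    have e1: "e * X1 (F (z (e * r)) + G (z (e * r)) *v w r) = f1 (y1 r) (y2 r) (w r)"
      and e2: "e * X2 (F (z (e * r)) + G (z (e * r)) *v w r) = f2 (y1 r) (y2 r) (w r)" if "r \<in> {a..b}" for r
      using dyn1[of "y1 r" "y2 r" "w r"] dyn2[of "y1 r" "y2 r" "w r"] box[OF that] wU e
      unfolding zy X1_def X2_def f1_def f2_def by (simp_all add: power2_eq_square)
    have ee: "e * (inverse e * d) = d" for d using e by simp
    have l: "X1 (inverse e *\<^sub>R (z (e * b) - z (e * a))) = inverse e * (y1 b - y1 a)" "X2 (inverse e *\<^sub>R (z (e * b) - z (e * a))) = inverse e * (y2 b - y2 a)"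
      using linear_cmul[OF X_linear(1)] linear_cmul[OF X_linear(2)] linear_diff[OF X_linear(1)] linear_diff[OF X_linear(2)]
      by (simp_all add: y1_def y2_def)
    have "((\<lambda>r. e * X1 (F (z (e * r)) + G (z (e * r)) *v w r)) has_integral (y1 b - y1 a)) {a..b}"
      using has_integral_mult_right[OF J1, of e] unfolding l ee .
    then show "((\<lambda>r. f1 (y1 r) (y2 r) (w r)) has_integral (y1 b - y1 a)) {a..b}" by (rule has_integral_eq[rotated]) (rule e1)
    have "((\<lambda>r. e * X2 (F (z (e * r)) + G (z (e * r)) *v w r)) has_integral (y2 b - y2 a)) {a..b}"
      using has_integral_mult_right[OF J2, of e] unfolding l ee .
    then show "((\<lambda>r. f2 (y1 r) (y2 r) (w r)) has_integral (y2 b - y2 a)) {a..b}" by (rule has_integral_eq[rotated]) (rule e2)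
  qed
  \<comment> \<open>After the last time on the boundary of the box the scaled equations hold, and
    \<open>backward_bound\<close> puts the trajectory strictly inside at that very time: a
    contradiction.\<close>
  have box: "\<bar>y1 r\<bar> \<le> 1 \<and> \<bar>y2 r\<bar> \<le> 1" if r: "r \<in> {0..s}" for r
  proof (rule ccontr)
    assume out: "\<not> ?thesis"
    define m where "m r = max \<bar>y1 r\<bar> \<bar>y2 r\<bar>" for r
    have "continuous_on {0..s} m" unfolding m_def by (intro continuous_intros yc)
    then have mc: "continuous_on {r..s} m" using r by (elim continuous_on_subset) auto
    have "r \<le> s" "1 \<le> m r" "m s \<le> 1" using r out fin by (auto simp: m_def)
    from last_hit[OF mc this] obtain q where q: "r \<le> q" "q \<le> s" "m q = 1" "\<And>x. q \<le> x \<Longrightarrow> x \<le> s \<Longrightarrow> m x \<le> 1" by blast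
    have q0: "0 \<le> q" using q r by simp
    have "\<bar>y2 q\<bar> \<le> 11/10 * (s - q)" "\<bar>y1 q\<bar> \<le> 1/2 * (s - q)"
    proof -
      have J: "((\<lambda>\<tau>. f1 (y1 \<tau>) (y2 \<tau>) (w \<tau>)) has_integral (y1 s - y1 c)) {c..s}"
        "((\<lambda>\<tau>. f2 (y1 \<tau>) (y2 \<tau>) (w \<tau>)) has_integral (y2 s - y2 c)) {c..s}" if "q \<le> c" "c \<le> s" for c
      proof -
        have "\<bar>y1 r\<bar> \<le> 1 \<and> \<bar>y2 r\<bar> \<le> 1" if "r \<in> {c..s}" for r using q(4)[of r] that \<open>q \<le> c\<close> by (simp add: m_def)
        from int[OF _ \<open>c \<le> s\<close> order_refl this] q0 \<open>q \<le> c\<close>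
        show "((\<lambda>\<tau>. f1 (y1 \<tau>) (y2 \<tau>) (w \<tau>)) has_integral (y1 s - y1 c)) {c..s}"
          "((\<lambda>\<tau>. f2 (y1 \<tau>) (y2 \<tau>) (w \<tau>)) has_integral (y2 s - y2 c)) {c..s}" by simp_all
      qed
      show "\<bar>y2 q\<bar> \<le> 11/10 * (s - q)" by (rule backward_bound(1)[OF s(3) q0 q(2) fin(1,2) J wU]) assumption+
      show "\<bar>y1 q\<bar> \<le> 1/2 * (s - q)" by (rule backward_bound(2)[OF s(3) q0 q(2) fin(1,2) J wU]) assumption+
    qed
    moreover have "\<bar>y1 q\<bar> = 1 \<or> \<bar>y2 q\<bar> = 1" using q(3) by (auto simp: m_def max_def split: if_splits)
    moreover have "11/10 * (s - q) \<le> 11/10 * (1/5)" "1/2 * (s - q) \<le> 1/2 * (1/5)"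
      using s q0 by (intro mult_left_mono; simp)+
    ultimately show False by (elim disjE) simp_all
  qed
  have "traj w y1 y2 s" unfolding traj_def
  proof (intro conjI allI impI)
    fix a b assume "0 \<le> a" "a \<le> b" "b \<le> s"
    with int[of a b] box show "((\<lambda>\<tau>. f1 (y1 \<tau>) (y2 \<tau>) (w \<tau>)) has_integral y1 b - y1 a) {a..b}"
      "((\<lambda>\<tau>. f2 (y1 \<tau>) (y2 \<tau>) (w \<tau>)) has_integral y2 b - y2 a) {a..b}" by auto
  qed (use wa s yc in auto)
  then show ?thesis unfolding reaches_def using fin s by blast
qed

lemma min_time_eq:
  assumes "near0 (X1 x) (X2 x)"
  shows "min_time F G x = ereal (e * tau (X1 x) (X2 x))"
proof (rule antisym)
  note n = near0_tau[OF assms]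
  show "min_time F G x \<le> ereal (e * tau (X1 x) (X2 x))"
  proof (rule ereal_le_epsilon2)
    fix d :: real assume d: "0 < d"
    define t where "t = tau (X1 x) (X2 x) + min (d / e) (1/10)"
    have t: "t \<le> 1/5" "reaches (X1 x) (X2 x) 0 0 t" using n d e by (auto simp: t_def)
    obtain T where T: "T \<le> e * t" "steers_to_origin F G x T" using steers_if_reaches[OF t(2,1)] by (auto simp: pt_X)
    have "min_time F G x \<le> ereal T" unfolding min_time_def using T(2) by (intro Inf_lower) auto
    also have "T \<le> e * tau (X1 x) (X2 x) + d"
    proof -
      have "e * min (d / e) (1/10) \<le> e * (d / e)" using e by (intro mult_left_mono) auto
      then show ?thesis using T(1) e by (simp add: t_def distrib_left)
    qed
    finally show "min_time F G x \<le> ereal (e * tau (X1 x) (X2 x)) + ereal d" by simp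
  qed
  show "ereal (e * tau (X1 x) (X2 x)) \<le> min_time F G x" unfolding min_time_def
  proof (rule Inf_greatest)
    fix y assume "y \<in> {ereal t |t. steers_to_origin F G x t}"
    then obtain T where T: "y = ereal T" "steers_to_origin F G x T" by blast
    have "e * tau (X1 x) (X2 x) \<le> T"
    proof (cases "T \<le> e * (1/5)")
      case True
      have "reaches (X1 x) (X2 x) 0 0 (T / e)"
        by (rule reaches_if_steers[of _ _ T]) (use T True e pt_X in \<open>auto simp: field_simps\<close>)
      from tau_le[OF this] show ?thesis using e by (simp add: field_simps)
    next
      case False
      have "e * tau (X1 x) (X2 x) \<le> e * (1/5)" using n(1) e by (intro mult_left_mono) auto
      then show ?thesis using False by simp
    qed
    then show "ereal (e * tau (X1 x) (X2 x)) \<le> y" by (simp add: T)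
  qed
qed

text \<open>Halving the time turns the bound on the infimum into a strict one, so that an actual
  steering time below \<open>e * t\<close> exists.\<close>

lemma reach_set_small:
  assumes "x \<in> reach_set F G (e * (t / 2))" "0 < t" "t \<le> 1/5"
  shows "\<bar>X2 x\<bar> \<le> 11/10 * t" "\<bar>X1 x\<bar> \<le> 1/2 * t"
proof -
  have "min_time F G x < ereal (e * t)"
    using assms(1,2) e by (auto simp: reach_set_def elim!: le_less_trans)
  then obtain T where T: "T < e * t" "steers_to_origin F G x T"
    unfolding min_time_def by (auto simp: Inf_less_iff)
  have "reaches (X1 x) (X2 x) 0 0 t" by (rule reaches_if_steers[of _ _ T]) (use T assms pt_X in auto)
  from traj_bound[OF this assms(3)] show "\<bar>X2 x\<bar> \<le> 11/10 * t" "\<bar>X1 x\<bar> \<le> 1/2 * t" .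
qed

end

text \<open>Weak derivatives in two independent directions determine those along the axes by
  linearity.\<close>

lemma (in coords2) SBV_on_from_coords:
  assumes V: "open V" "compact (closure V)" and T: "continuous_on V T" "\<And>x. x \<in> V \<Longrightarrow> \<bar>T x\<bar> \<le> M"
    and wd: "\<And>D. D \<in> {D1, D2} \<Longrightarrow> \<exists>G. integrable lborel G \<and> (\<forall>\<phi>. test_C1 V \<phi> \<longrightarrow>
      (\<integral>x. indicator V x * T x * frechet_derivative \<phi> (at x) D \<partial>lebesgue) = - (\<integral>x. G x * \<phi> x \<partial>lborel))"
  shows "SBV_on V T"
proof (rule SBV_on_if_weakly_differentiable[OF V(1)])
  have Vm: "V \<in> sets borel" using V(1) by simp
  have Vf: "emeasure lborel V < \<infinity>"
    using emeasure_mono[OF closure_subset, of V lborel] emeasure_compact_finite[OF V(2)] by (auto elim: order.strict_trans1)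
  have Tm: "(\<lambda>x. indicator V x * T x) \<in> borel_measurable borel"
    using borel_measurable_continuous_on_indicator[OF Vm T(1)] by simp
  have int: "integrable lebesgue (\<lambda>x. indicator V x * T x * w x)" if w: "continuous_on UNIV w" for w :: "real^2 \<Rightarrow> real"
  proof -
    have "compact (w ` closure V)" by (intro compact_continuous_image continuous_on_subset[OF w] V) auto
    then obtain B where B: "\<forall>x\<in>w ` closure V. norm x \<le> B" using compact_imp_bounded bounded_iff by metis
    have wm: "w \<in> borel_measurable borel" by (rule borel_measurable_continuous_onI[OF w])
    have "integrable lborel (\<lambda>x. indicator V x * T x * w x)"
    proof (rule integrableI_bounded_set[where A = V and B = "M * B"])
      show "(\<lambda>x. indicator V x * T x * w x) \<in> borel_measurable lborel" using Tm wm by simp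
      have "norm (indicator V x * T x * w x) \<le> M * B" if "x \<in> V" for x
      proof -
        have "\<bar>T x\<bar> \<le> M" "\<bar>w x\<bar> \<le> B" using T(2)[OF that] B that closure_subset by (auto simp: subset_iff)
        then have "\<bar>T x\<bar> * \<bar>w x\<bar> \<le> M * B" by (intro mult_mono) auto
        then show ?thesis using that by (simp add: abs_mult)
      qed
      then show "AE x\<in>V in lborel. norm (indicator V x * T x * w x) \<le> M * B" by simp
    qed (use Vm Vf in auto)
    then show ?thesis using Tm wm by (simp add: integrable_completion)
  qed
  show "set_integrable lebesgue V T" using int[of "\<lambda>_. 1"] by (simp add: set_integrable_def)
  fix i :: "real^2"
  obtain G1 where G1: "integrable lborel G1" "\<And>\<phi>. test_C1 V \<phi> \<Longrightarrow>
      (\<integral>x. indicator V x * T x * frechet_derivative \<phi> (at x) D1 \<partial>lebesgue) = - (\<integral>x. G1 x * \<phi> x \<partial>lborel)"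
    using wd[of D1] by blast
  obtain G2 where G2: "integrable lborel G2" "\<And>\<phi>. test_C1 V \<phi> \<Longrightarrow>
      (\<integral>x. indicator V x * T x * frechet_derivative \<phi> (at x) D2 \<partial>lebesgue) = - (\<integral>x. G2 x * \<phi> x \<partial>lborel)"
    using wd[of D2] by blast
  show "\<exists>G. integrable lborel G \<and> (\<forall>\<phi>. test_C1 V \<phi> \<longrightarrow>
      (\<integral>x. indicator V x * T x * frechet_derivative \<phi> (at x) i \<partial>lebesgue) = - (\<integral>x. G x * \<phi> x \<partial>lborel))"
  proof (intro exI[of _ "\<lambda>x. p1 i * G1 x + p2 i * G2 x"] conjI allI impI)
    show "integrable lborel (\<lambda>x. p1 i * G1 x + p2 i * G2 x)" using G1(1) G2(1) by simp
    fix \<phi> :: "real^2 \<Rightarrow> real" assume t: "test_C1 V \<phi>"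
    have "frechet_derivative \<phi> (at x) i = p1 i * frechet_derivative \<phi> (at x) D1 + p2 i * frechet_derivative \<phi> (at x) D2" for x
    proof -
      note l = bounded_linear.linear[OF has_derivative_bounded_linear[OF test_C1D(1)[OF t, of x]]]
      have "frechet_derivative \<phi> (at x) (p1 i *\<^sub>R D1 + p2 i *\<^sub>R D2) = p1 i * frechet_derivative \<phi> (at x) D1 + p2 i * frechet_derivative \<phi> (at x) D2"
        by (simp add: linear_add[OF l] linear_cmul[OF l])
      then show ?thesis by (simp only: decomp)
    qed
    then have "(\<integral>x. indicator V x * T x * frechet_derivative \<phi> (at x) i \<partial>lebesgue) =
        (\<integral>x. p1 i * (indicator V x * T x * frechet_derivative \<phi> (at x) D1) + p2 i * (indicator V x * T x * frechet_derivative \<phi> (at x) D2) \<partial>lebesgue)"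
      by (intro Bochner_Integration.integral_cong refl) (simp add: algebra_simps)
    also have "\<dots> = p1 i * - (\<integral>x. G1 x * \<phi> x \<partial>lborel) + p2 i * - (\<integral>x. G2 x * \<phi> x \<partial>lborel)"
      using int[OF test_C1D(2)[OF t]] G1(2)[OF t] G2(2)[OF t] by simp
    also have "\<dots> = - (\<integral>x. p1 i * (G1 x * \<phi> x) + p2 i * (G2 x * \<phi> x) \<partial>lborel)"
      using integrable_mult_test[OF G1(1) t] integrable_mult_test[OF G2(1) t] by simp
    also have "(\<integral>x. p1 i * (G1 x * \<phi> x) + p2 i * (G2 x * \<phi> x) \<partial>lborel) = (\<integral>x. (p1 i * G1 x + p2 i * G2 x) * \<phi> x \<partial>lborel)"
      by (simp add: algebra_simps)
    finally show "(\<integral>x. indicator V x * T x * frechet_derivative \<phi> (at x) i \<partial>lebesgue) = - (\<integral>x. (p1 i * G1 x + p2 i * G2 x) * \<phi> x \<partial>lborel)" .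
  qed
qed

context scaled
begin

lemma SBV_near_origin:
  shows "SBV_loc (interior (reach_set F G (e * (1/72000000)))) (\<lambda>x. real_of_ereal (min_time F G x))"
  unfolding SBV_loc_def
proof (intro allI impI, elim conjE)
  fix V assume V: "open V" "compact (closure V)" "closure V \<subseteq> interior (reach_set F G (e * (1/72000000)))"
  define \<rho> :: real where "\<rho> = 1/7200000"
  have \<rho>: "0 < \<rho>" by (simp add: \<rho>_def)
  have small: "\<bar>X2 x\<bar> \<le> 22/100 * \<rho>" "\<bar>X1 x\<bar> \<le> 1/10 * \<rho>" if "x \<in> V" for x
  proof -
    \<comment> \<open>The time 1/72000000 is \<rho>/10; \<open>reach_set_small\<close> with t =
      \<rho>/5 confines the scaled coordinates to a small part of the coordinate box.\<close>
    have "x \<in> reach_set F G (e * ((\<rho> / 5) / 2))"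
      using that V(3) closure_subset[of V] interior_subset by (auto simp: \<rho>_def)
    from reach_set_small[OF this] show "\<bar>X2 x\<bar> \<le> 22/100 * \<rho>" "\<bar>X1 x\<bar> \<le> 1/10 * \<rho>" by (simp_all add: \<rho>_def)
  qed
  have n: "near0 (X1 x) (X2 x)" if "x \<in> V" for x
    using small[OF that] by (simp add: near0_def \<rho>_def)
  define T where "T x = real_of_ereal (min_time F G x)" for x
  have T: "T x = e * tau (X1 x) (X2 x)" if "x \<in> V" for x unfolding T_def min_time_eq[OF n[OF that]] by simp
  have Tc: "continuous_on V T"
  proof -
    have "continuous_on V (\<lambda>x. (X1 x, X2 x))" by (intro continuous_intros X_continuous)
    moreover have "(\<lambda>x. (X1 x, X2 x)) ` V \<subseteq> {p. near0 (fst p) (snd p)}" using n by auto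
    ultimately have "continuous_on V (\<lambda>x. tau (fst (X1 x, X2 x)) (snd (X1 x, X2 x)))" by (rule continuous_on_compose2[OF tau_continuous])
    then have "continuous_on V (\<lambda>x. e * tau (X1 x) (X2 x))" by (intro continuous_intros) simp
    then show ?thesis by (rule continuous_on_eq) (simp add: T)
  qed
  have Tb: "\<bar>T x\<bar> \<le> e" if "x \<in> V" for x
    using near0_tau(1,2)[OF n[OF that]] e by (simp add: T[OF that] abs_mult)
  define D where "D k = pt 2 k" for k
  \<comment> \<open>The inverse of (s, y) \<mapsto> (2s + 2y, k (s - y)) when k^2 = 1.\<close>
  define p where "p k x = (X1 x / 2 + k * X2 x) / 2" for k x
  have co: "coords2 (D k) (D (- k)) (p k) (p (- k))" if k: "k = 1 \<or> k = - 1" for k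
  proof (rule coords2.intro)
    have kk: "k * k = 1" using k by auto
    show "linear (p k)" "linear (p (- k))"
      by (rule linearI; simp add: p_def linear_add[OF X_linear(1)] linear_add[OF X_linear(2)] linear_cmul[OF X_linear(1)] linear_cmul[OF X_linear(2)] field_simps)+
    have pt_lin: "s *\<^sub>R pt a b + y *\<^sub>R pt c d = pt (s * a + y * c) (s * b + y * d)" for s y a b c d
      by (simp add: pt_def algebra_simps)
    show "p k x *\<^sub>R D k + p (- k) x *\<^sub>R D (- k) = x" for x
    proof -
      have "p k x * 2 + p (- k) x * 2 = X1 x" by (simp add: p_def field_simps)
      moreover have "p k x * k + p (- k) x * - k = k * k * X2 x" by (simp add: p_def field_simps)
      ultimately show ?thesis unfolding D_def pt_lin using pt_X kk by simp
    qed
    show "p k (s *\<^sub>R D k + y *\<^sub>R D (- k)) = s" "p (- k) (s *\<^sub>R D k + y *\<^sub>R D (- k)) = y" for s y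
      unfolding D_def pt_lin p_def X_pt using k by (auto simp: field_simps)
  qed
  have wd: "\<exists>G'. integrable lborel G' \<and> (\<forall>\<phi>. test_C1 V \<phi> \<longrightarrow>
      (\<integral>x. indicator V x * T x * frechet_derivative \<phi> (at x) (D k) \<partial>lebesgue) = - (\<integral>x. G' x * \<phi> x \<partial>lborel))"
    if k: "k = 1 \<or> k = - 1" for k
  proof -
    interpret K: coords2 "D k" "D (- k)" "p k" "p (- k)" by (rule co[OF k])
    have kk: "k * k = 1" "\<bar>k\<bar> = 1" using k by auto
    obtain f g where fg: "integrable lborel g" "f \<in> borel_measurable borel"
      "\<And>p. p \<in> {- 2 * \<rho>..2 * \<rho>} \<times> {- \<rho>..\<rho>} \<Longrightarrow> f p = tau (2 * fst p + 2 * snd p) (k * (fst p - snd p))"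
      "\<And>\<phi> \<phi>'. box_test (- 2 * \<rho>) (2 * \<rho>) (- \<rho>) \<rho> \<phi> \<phi>' \<Longrightarrow> (\<integral>p. f p * \<phi>' p \<partial>lborel) = - (\<integral>p. g p * \<phi> p \<partial>lborel)"
      by (rule tau_weak_derivative[OF k \<rho>_def]) (rule that)
    have pb: "p j x \<in> {- \<rho><..<\<rho>}" if "x \<in> V" "\<bar>j\<bar> = 1" for j x
    proof -
      have "\<bar>j * X2 x\<bar> = \<bar>X2 x\<bar>" using that(2) by (simp add: abs_mult)
      then have "\<bar>X1 x / 2 + j * X2 x\<bar> \<le> 1/20 * \<rho> + 22/100 * \<rho>" using small[OF that(1)] by linarith
      then have "\<bar>X1 x / 2 + j * X2 x\<bar> < 2 * \<rho>" using \<rho> by linarith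
      moreover have "- \<rho> < q / 2 \<and> q / 2 < \<rho>" if "\<bar>q\<bar> < 2 * \<rho>" for q using that by auto
      ultimately show ?thesis unfolding p_def greaterThanLessThan_iff by blast
    qed
    show ?thesis
    proof (rule K.weak_derivative_transfer[where f = "\<lambda>q. e * f q" and g = "\<lambda>q. e * g q" and a = "- 2 * \<rho>" and b = "2 * \<rho>" and c = "- \<rho>" and d = \<rho>])
      fix \<phi> \<phi>' assume "box_test (- 2 * \<rho>) (2 * \<rho>) (- \<rho>) \<rho> \<phi> \<phi>'"
      from fg(4)[OF this] show "(\<integral>q. e * f q * \<phi>' q \<partial>lborel) = - (\<integral>q. e * g q * \<phi> q \<partial>lborel)"
        by (simp add: mult.assoc)
    next
      fix x assume x: "x \<in> V"
      show b: "p k x \<in> {- 2 * \<rho><..<2 * \<rho>} \<and> p (- k) x \<in> {- \<rho><..<\<rho>}"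
        using pb[OF x, of k] pb[OF x, of "- k"] kk \<rho> by auto
      have "2 * p k x + 2 * p (- k) x = X1 x" by (simp add: p_def field_simps)
      moreover have "k * (p k x - p (- k) x) = k * k * X2 x" by (simp add: p_def field_simps)
      moreover have "f (p k x, p (- k) x) = tau (2 * fst (p k x, p (- k) x) + 2 * snd (p k x, p (- k) x)) (k * (fst (p k x, p (- k) x) - snd (p k x, p (- k) x)))"
        using b by (intro fg(3)) auto
      ultimately show "T x = e * f (p k x, p (- k) x)" using T[OF x] kk by simp
    qed (use fg V Tc in auto)
  qed
  interpret K: coords2 "D 1" "D (- 1)" "p 1" "p (- 1)" by (rule co) simp
  have "SBV_on V T" by (rule K.SBV_on_from_coords[OF V(1,2) Tc Tb]) (use wd[of 1] wd[of "- 1"] in auto)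
  then show "SBV_on V (\<lambda>x. real_of_ereal (min_time F G x))" unfolding T_def .
qed

end

text \<open>Cramer's rule.\<close>

lemma coords2_explicit:
  fixes u w :: "real^2"
  assumes "u $ 1 * w $ 2 - u $ 2 * w $ 1 \<noteq> 0"
  shows "coords2 u w (\<lambda>x. (x $ 1 * w $ 2 - x $ 2 * w $ 1) / (u $ 1 * w $ 2 - u $ 2 * w $ 1))
    (\<lambda>x. (u $ 1 * x $ 2 - u $ 2 * x $ 1) / (u $ 1 * w $ 2 - u $ 2 * w $ 1))"
proof -
  define d where "d = u $ 1 * w $ 2 - u $ 2 * w $ 1"
  have d: "d \<noteq> 0" using assms by (simp add: d_def)
  show ?thesis unfolding d_def[symmetric]
  proof (rule coords2.intro)
    show "linear (\<lambda>x::real^2. (x $ 1 * w $ 2 - x $ 2 * w $ 1) / d)" "linear (\<lambda>x::real^2. (u $ 1 * x $ 2 - u $ 2 * x $ 1) / d)"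
      by (rule linearI; simp add: algebra_simps add_divide_distrib diff_divide_distrib)+
    fix x :: "real^2"
    have "(x $ 1 * w $ 2 - x $ 2 * w $ 1) * u $ i + (u $ 1 * x $ 2 - u $ 2 * x $ 1) * w $ i = d * x $ i" for i
      using exhaust_2[of i] by (auto simp: d_def algebra_simps)
    note eq = this
    have "(x $ 1 * w $ 2 - x $ 2 * w $ 1) / d * u $ i + (u $ 1 * x $ 2 - u $ 2 * x $ 1) / d * w $ i = x $ i" for i
    proof -
      have "(x $ 1 * w $ 2 - x $ 2 * w $ 1) / d * u $ i + (u $ 1 * x $ 2 - u $ 2 * x $ 1) / d * w $ i
          = ((x $ 1 * w $ 2 - x $ 2 * w $ 1) * u $ i + (u $ 1 * x $ 2 - u $ 2 * x $ 1) * w $ i) / d"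
        by (simp only: add_divide_distrib times_divide_eq_left)
      then show ?thesis unfolding eq using d by simp
    qed
    then show "((x $ 1 * w $ 2 - x $ 2 * w $ 1) / d) *\<^sub>R u + ((u $ 1 * x $ 2 - u $ 2 * x $ 1) / d) *\<^sub>R w = x"
      by (simp add: vec_eq_iff)
  next
    fix s y :: real
    have "(s * u $ 1 + y * w $ 1) * w $ 2 - (s * u $ 2 + y * w $ 2) * w $ 1 = s * d" by (simp add: d_def algebra_simps)
    then show "((s *\<^sub>R u + y *\<^sub>R w) $ 1 * w $ 2 - (s *\<^sub>R u + y *\<^sub>R w) $ 2 * w $ 1) / d = s" using d by simp
    have "u $ 1 * (s * u $ 2 + y * w $ 2) - u $ 2 * (s * u $ 1 + y * w $ 1) = y * d" by (simp add: d_def algebra_simps)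
    then show "(u $ 1 * (s *\<^sub>R u + y *\<^sub>R w) $ 2 - u $ 2 * (s *\<^sub>R u + y *\<^sub>R w) $ 1) / d = y" using d by simp
  qed
qed

text \<open>When the derivative vanishes at the origin, the Lipschitz constant on a ball is
  proportional to its radius. All smallness of the perturbations comes from here; the factor 2
  counts the partial derivatives.\<close>

lemma flat_component_lipschitz:
  fixes f :: "real^2 \<Rightarrow> real"
  assumes d: "\<And>x. (f has_derivative f' x) (at x)" and b: "\<And>x j. \<bar>f' x (axis j 1)\<bar> \<le> L * norm x"
    and xy: "norm x \<le> r" "norm y \<le> r" and L: "0 \<le> L"
  shows "\<bar>f x - f y\<bar> \<le> 2 * L * r * norm (x - y)"
proof -
  have "norm (f x - f y) \<le> (2 * L * r) * norm (x - y)"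
  proof (rule differentiable_bound[of "cball 0 r"])
    fix z :: "real^2" assume z: "z \<in> cball 0 r"
    show "(f has_derivative f' z) (at z within cball 0 r)" using d by (rule has_derivative_at_withinI)
    show "onorm (f' z) \<le> 2 * L * r"
    proof (rule onorm_le)
      fix h :: "real^2"
      interpret bounded_linear "f' z" using d by (rule has_derivative_bounded_linear)
      have h: "h = h $ 1 *\<^sub>R axis 1 1 + h $ 2 *\<^sub>R axis 2 1" by (simp add: vec_eq_iff forall_2 axis_def)
      have "f' z h = h $ 1 * f' z (axis 1 1) + h $ 2 * f' z (axis 2 1)"
        by (subst h) (simp add: add scaleR)
      moreover have "\<bar>h $ j * f' z (axis j 1)\<bar> \<le> norm h * (L * r)" for j
      proof -
        have "L * norm z \<le> L * r" using z L by (intro mult_left_mono) auto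
        then have "\<bar>f' z (axis j 1)\<bar> \<le> L * r" using b[of z j] by linarith
        then show ?thesis unfolding abs_mult by (intro mult_mono component_le_norm_cart) auto
      qed
      from this[of 1] this[of 2] have "\<bar>h $ 1 * f' z (axis 1 1) + h $ 2 * f' z (axis 2 1)\<bar> \<le> norm h * (L * r) + norm h * (L * r)" by linarith
      ultimately show "norm (f' z h) \<le> 2 * L * r * norm h" by (simp add: algebra_simps)
    qed
  qed (use xy in \<open>auto simp: dist_norm\<close>)
  then show ?thesis by simp
qed

section \<open>Parallel columns\<close>

lemma mem_Icc_abs: "x \<in> {-1..1} \<longleftrightarrow> \<bar>x\<bar> \<le> (1::real)"
  by auto

lemma integrable_continuous_times_control:
  assumes "admissible_control u" "continuous_on {a..b} w"
  shows "(\<lambda>\<tau>. u \<tau> $ k * w \<tau>) integrable_on {a..b::real}"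
proof -
  have m: "(\<lambda>\<tau>. u \<tau> $ k) \<in> borel_measurable lebesgue"
    using measurable_compose[of u lebesgue borel "\<lambda>x. x $ k" borel] assms(1)
    by (auto simp: admissible_control_def intro!: borel_measurable_continuous_onI continuous_intros)
  have "(\<lambda>\<tau>. u \<tau> $ k * w \<tau>) absolutely_integrable_on {a..b}"
  proof (rule absolutely_integrable_bounded_measurable_product_real)
    show "(\<lambda>\<tau>. u \<tau> $ k) \<in> borel_measurable (lebesgue_on {a..b})" using m by (rule measurable_restrict_space1)
    show "bounded ((\<lambda>\<tau>. u \<tau> $ k) ` {a..b})"
      unfolding bounded_iff using assms(1) by (intro exI[of _ 1]) (auto simp: admissible_control_def mem_Icc_abs simp del: atLeastAtMost_iff)
    show "w absolutely_integrable_on {a..b}" using assms(2) by (rule absolutely_integrable_continuous_real)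
  qed simp
  then show ?thesis by (rule absolutely_integrable_on_def[THEN iffD1, THEN conjunct1])
qed

lemma abs_component_mult_vec:
  fixes S :: "real^'m^2"
  assumes "\<And>k. \<bar>S $ i $ k\<bar> \<le> B"
  shows "\<bar>(S *v u) $ i\<bar> \<le> B * (\<Sum>k\<in>UNIV. \<bar>u $ k\<bar>)"
proof -
  have "\<bar>(S *v u) $ i\<bar> \<le> (\<Sum>k\<in>UNIV. \<bar>S $ i $ k * u $ k\<bar>)"
    unfolding matrix_vector_mult_def by (simp add: sum_abs)
  also have "\<dots> \<le> (\<Sum>k\<in>UNIV. B * \<bar>u $ k\<bar>)"
    by (intro sum_mono) (simp add: abs_mult assms mult_right_mono)
  finally show ?thesis by (simp add: sum_distrib_left)
qed

lemma C11_vec_remainder_lipschitz: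
  assumes CF: "C11_vec F F' L" and L: "0 \<le> L" and xy: "norm x \<le> r" "norm y \<le> r"
  shows "\<bar>(F x - matrix (F' 0) *v x) $ i - (F y - matrix (F' 0) *v y) $ i\<bar> \<le> 2 * L * r * norm (x - y)"
proof -
  have lF': "linear (F' x)" for x using CF by (auto simp: C11_vec_def dest: has_derivative_linear)
  have AF: "matrix (F' 0) *v z = F' 0 z" for z using fun_cong[OF matrix_vector_mul(2)[OF lF'[of 0]], of z] by simp
  have d: "((\<lambda>x. (F x - matrix (F' 0) *v x) $ i) has_derivative (\<lambda>h. (F' x h - matrix (F' 0) *v h) $ i)) (at x)" for x
  proof -
    have 1: "(F has_derivative F' x) (at x)" using CF by (simp add: C11_vec_def)
    have 2: "((\<lambda>h. matrix (F' 0) *v h) has_derivative (\<lambda>h. matrix (F' 0) *v h)) (at x)" by (rule bounded_linear_imp_has_derivative) simp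
    show ?thesis by (rule has_derivative_compose[OF has_derivative_diff[OF 1 2] bounded_linear_imp_has_derivative[OF bounded_linear_vec_nth]])
  qed
  have b: "\<bar>(F' z (axis j 1) - matrix (F' 0) *v axis j 1) $ i\<bar> \<le> L * norm z" for z j
  proof -
    have "\<bar>F' z (axis j 1) $ i - F' 0 (axis j 1) $ i\<bar> \<le> L * dist z 0" using CF unfolding C11_vec_def by blast
    then show ?thesis unfolding AF by simp
  qed
  show ?thesis by (rule flat_component_lipschitz[OF d b xy L])
qed

text \<open>Here the condition DG(0) = 0 enters: the control matrix varies only to second order near
  the origin, as does the nonlinear part of F.\<close>

lemma C11_mat_lipschitz:
  assumes CG: "C11_mat G G' L" and G'0: "G' 0 = (\<lambda>h. 0)" and L: "0 \<le> L" and xy: "norm x \<le> r" "norm y \<le> r"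
  shows "\<bar>G x $ i $ k - G y $ i $ k\<bar> \<le> 2 * L * r * norm (x - y)"
proof -
  have d: "((\<lambda>x. G x $ i $ k) has_derivative (\<lambda>h. G' x h $ i $ k)) (at x)" for x
  proof -
    have 1: "(G has_derivative G' x) (at x)" using CG by (simp add: C11_mat_def)
    show ?thesis
      by (rule has_derivative_compose[OF has_derivative_compose[OF 1 bounded_linear_imp_has_derivative[OF bounded_linear_vec_nth]] bounded_linear_imp_has_derivative[OF bounded_linear_vec_nth]])
  qed
  have b: "\<bar>G' z (axis j 1) $ i $ k\<bar> \<le> L * norm z" for z j
  proof -
    have "\<bar>G' z (axis j 1) $ i $ k - G' 0 (axis j 1) $ i $ k\<bar> \<le> L * dist z 0" using CG unfolding C11_mat_def by blast
    then show ?thesis by (simp add: G'0)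
  qed
  show ?thesis by (rule flat_component_lipschitz[OF d b xy L])
qed

text \<open>The scale e is fixed from G(0), DF(0) and L before F and G are introduced; this is what
  makes the final time uniform.\<close>

lemma parallel_columns_scaled:
  fixes G0 :: "real^'m^2" and A :: "real^2^2" and c0 :: "'m \<Rightarrow> real" and g0 :: "real^2"
  assumes par: "\<And>k. column k G0 = c0 k *\<^sub>R g0" and c0: "\<And>k. c0 k \<noteq> 0"
    and det: "g0 $ 1 * (A *v g0) $ 2 - g0 $ 2 * (A *v g0) $ 1 \<noteq> 0" and L: "0 \<le> L"
  shows "\<exists>e>0. \<forall>F F' G G'. C11_vec F F' L \<and> C11_mat G G' L \<and> F 0 = 0 \<and> G 0 = G0 \<and> matrix (F' 0) = A \<and> G' 0 = (\<lambda>h. 0) \<longrightarrow>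
    (\<exists>r1 r2 v um up u0 \<gamma> \<gamma>d E1 E2 P1 P2. scaled r1 r2 v um up u0 \<gamma> \<gamma>d E1 E2 P1 P2 F G e)"
proof -
  \<comment> \<open>After this normalisation the coefficients have absolute sum 1, so the effective
    scalar control v ranges over [-1,1] and is extremal at the sign vectors.\<close>
  define S where "S = (\<Sum>k\<in>UNIV. \<bar>c0 k\<bar>)"
  have S: "0 < S" unfolding S_def using c0 by (intro sum_pos) auto
  define g where "g = S *\<^sub>R g0"
  define c where "c k = c0 k / S" for k
  have c: "c k \<noteq> 0" for k using c0 S by (simp add: c_def)
  have csum: "(\<Sum>k\<in>UNIV. \<bar>c k\<bar>) = 1" using S unfolding c_def abs_divide sum_divide_distrib[symmetric] S_def by simp
  have col: "column k G0 = c k *\<^sub>R g" for k using par[of k] S by (simp add: c_def g_def)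
  define h where "h = A *v g"
  have hS: "h = S *\<^sub>R (A *v g0)" by (simp add: h_def g_def matrix_vector_mult_scaleR)
  have dhg: "h $ 1 * g $ 2 - h $ 2 * g $ 1 \<noteq> 0"
  proof -
    have "h $ 1 * g $ 2 - h $ 2 * g $ 1 = - (S * S) * (g0 $ 1 * (A *v g0) $ 2 - g0 $ 2 * (A *v g0) $ 1)"
      unfolding hS g_def by (simp add: algebra_simps)
    then show ?thesis using det S by simp
  qed
  \<comment> \<open>With h = A g and A h = \<alpha> h + \<beta> g, the vector E1 = h - \<alpha> g
    satisfies A g = E1 + \<alpha> g and A E1 = \<beta> g. In this basis the first linear equation is
    exactly x1' = x2.\<close>
  from coords2.decomp[OF coords2_explicit[OF dhg], of "A *v h"]
  obtain \<alpha> \<beta> where ab: "A *v h = \<alpha> *\<^sub>R h + \<beta> *\<^sub>R g" by metis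
  define E1 where "E1 = h - \<alpha> *\<^sub>R g"
  have dE: "E1 $ 1 * g $ 2 - E1 $ 2 * g $ 1 \<noteq> 0" using dhg by (simp add: E1_def algebra_simps)
  obtain P1 P2 where co: "coords2 E1 g P1 P2" using coords2_explicit[OF dE] by blast
  interpret E: coords2 E1 g P1 P2 by (rule co)
  have Ag: "A *v g = E1 + \<alpha> *\<^sub>R g" by (simp add: E1_def h_def)
  have AE1: "A *v E1 = \<beta> *\<^sub>R g" unfolding E1_def matrix_vector_mult_diff_distrib matrix_vector_mult_scaleR ab h_def[symmetric] by simp
  have bl: "bounded_linear P1" "bounded_linear P2" using E.lin by (simp_all add: linear_conv_bounded_linear)
  obtain K1 where K1: "0 < K1" "\<And>x. norm (P1 x) \<le> norm x * K1" using bounded_linear.pos_bounded[OF bl(1)] by blast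
  obtain K2 where K2: "0 < K2" "\<And>x. norm (P2 x) \<le> norm x * K2" using bounded_linear.pos_bounded[OF bl(2)] by blast
  define KP where "KP = max K1 K2"
  have KP: "0 < KP" using K1 by (simp add: KP_def)
  have PB: "\<bar>P1 x\<bar> \<le> KP * (2 * B)" "\<bar>P2 x\<bar> \<le> KP * (2 * B)" if "\<bar>x $ 1\<bar> \<le> B" "\<bar>x $ 2\<bar> \<le> B" for x B
  proof -
    have "norm x \<le> 2 * B" using norm_le_l1_cart[of x] that by (simp add: UNIV_2)
    then have "norm x * K1 \<le> (2 * B) * KP" "norm x * K2 \<le> (2 * B) * KP"
      using K1(1) K2(1) that by (auto intro!: mult_mono simp: KP_def)
    then show "\<bar>P1 x\<bar> \<le> KP * (2 * B)" "\<bar>P2 x\<bar> \<le> KP * (2 * B)"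
      using K1(2)[of x] K2(2)[of x] by (simp_all add: mult.commute)
  qed
  define M where "M = norm E1 + norm g"
  have M0: "0 \<le> M" by (simp add: M_def)
  define n where "n = real CARD('m)"
  define Cc where "Cc = (\<Sum>k\<in>UNIV. 1 / \<bar>c k\<bar>)"
  have Cc: "0 \<le> Cc" unfolding Cc_def by (intro sum_nonneg) auto
  \<comment> \<open>The product of the constants below: 2 KP from projecting, 2 L from flatness, and
    the factors 2 e M and e M from size and Lipschitz constant of the embedding; the powers of e are
    kept apart.\<close>
  define Q where "Q = 8 * KP * L * M\<^sup>2"
  have Q: "0 \<le> Q" using KP L by (simp add: Q_def)
  \<comment> \<open>\<open>W\<close> dominates every coefficient of the perturbation, so that e =
    1/(100 W) pushes all of them below 1/100.\<close>
  define W where "W = Q * (1 + n) + Q * Cc + \<bar>\<alpha>\<bar> + \<bar>\<beta>\<bar> + 1"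
  have n0: "0 \<le> n" by (simp add: n_def)
  have W: "1 \<le> W" using Q n0 Cc by (simp add: W_def)
  define e where "e = 1 / (100 * W)"
  have e: "0 < e" "e \<le> 1" using W by (auto simp: e_def)
  have eW: "e * W = 1/100" using W by (simp add: e_def)
  have e1: "e * X \<le> 1/100" if "X \<le> W" for X using mult_left_mono[OF that, of e] e eW by simp
  have b1: "e * (Q * (1 + n)) \<le> 1/100" "e * (Q * (1 + n) + \<bar>\<alpha>\<bar> + \<bar>\<beta>\<bar>) \<le> 1/100" "e * (Q * Cc) \<le> 1/100"
    using Q n0 Cc by (intro e1; simp add: W_def)+
  have ee: "e * e \<le> e" using e by (simp add: mult_left_le)
  show ?thesis
  proof (intro exI[of _ e] conjI allI impI e(1), elim conjE)
    fix F :: "real^2 \<Rightarrow> real^2" and F' G G'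
    assume CF: "C11_vec F F' L" and CG: "C11_mat G G' L" and F0: "F 0 = 0" and G0: "G 0 = G0" and A: "matrix (F' 0) = A" and G'0: "G' 0 = (\<lambda>h. 0)"
    define U :: "(real^'m) set" where "U = {u. \<forall>k. u $ k \<in> {-1..1}}"
    \<comment> \<open>Everything beyond the linear part at the origin: the remainder of F and the
      variation of G applied to the control.\<close>
    define N where "N x u = F x - A *v x + (G x - G0) *v u" for x and u :: "real^'m"
    have LF: "\<bar>(F x - A *v x) $ i - (F y - A *v y) $ i\<bar> \<le> 2 * L * r * norm (x - y)" if "norm x \<le> r" "norm y \<le> r" for x y r i
      using C11_vec_remainder_lipschitz[OF CF L that] unfolding A .
    have LG: "\<bar>(G x - G0) $ i $ k - (G y - G0) $ i $ k\<bar> \<le> 2 * L * r * norm (x - y)" if "norm x \<le> r" "norm y \<le> r" for x y r i k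
      using C11_mat_lipschitz[OF CG G'0 L that, of i k] by simp
    have usum: "(\<Sum>k\<in>UNIV. \<bar>u $ k\<bar>) \<le> n" if "u \<in> U" for u
    proof -
      have "(\<Sum>k\<in>UNIV. \<bar>u $ k\<bar>) \<le> (\<Sum>k\<in>(UNIV::'m set). 1)"
        using that by (intro sum_mono) (auto simp: U_def mem_Icc_abs simp del: atLeastAtMost_iff)
      then show ?thesis by (simp add: n_def)
    qed
    have LN: "\<bar>N x u $ i - N y u $ i\<bar> \<le> 2 * L * r * norm (x - y) * (1 + n)" if "norm x \<le> r" "norm y \<le> r" "u \<in> U" for x y r u i
    proof -
      have r: "0 \<le> r" using that(1) norm_ge_zero order_trans by blast
      have "\<bar>((G x - G0) - (G y - G0)) $ i $ k\<bar> \<le> 2 * L * r * norm (x - y)" for k using LG[OF that(1,2), of i k] by simp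
      from abs_component_mult_vec[OF this] have "\<bar>(((G x - G0) - (G y - G0)) *v u) $ i\<bar> \<le> 2 * L * r * norm (x - y) * (\<Sum>k\<in>UNIV. \<bar>u $ k\<bar>)" .
      also have "\<dots> \<le> 2 * L * r * norm (x - y) * n" using usum[OF that(3)] L r by (intro mult_left_mono) auto
      finally have 2: "\<bar>(((G x - G0) - (G y - G0)) *v u) $ i\<bar> \<le> 2 * L * r * norm (x - y) * n" .
      have "N x u $ i - N y u $ i = ((F x - A *v x) $ i - (F y - A *v y) $ i) + (((G x - G0) - (G y - G0)) *v u) $ i"
        unfolding N_def matrix_vector_mult_diff_rdistrib[of "G x - G0" "G y - G0"] by simp
      then show ?thesis using LF[OF that(1,2), of i] 2 by (simp add: distrib_left)
    qed
    have Nz: "N 0 u = 0" for u by (simp add: N_def F0 G0)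
    \<comment> \<open>Truncation makes the perturbations globally bounded and Lipschitz without
      changing them on the unit box.\<close>
    define cl where "cl s = max (- 1) (min 1 s)" for s :: real
    have cl: "\<bar>cl s\<bar> \<le> 1" "\<bar>cl s\<bar> \<le> \<bar>s\<bar>" "\<bar>cl s - cl s'\<bar> \<le> \<bar>s - s'\<bar>" "cl 0 = 0" "cl (cl s) = cl s" for s s'
      by (auto simp: cl_def max_def min_def)
    have cl_id: "cl s = s" if "\<bar>s\<bar> \<le> 1" for s using that by (auto simp: cl_def)
    define x where "x a b = (e\<^sup>2 * cl a) *\<^sub>R E1 + (e * cl b) *\<^sub>R g" for a b
    have x0: "x 0 0 = 0" by (simp add: x_def cl)
    have xd: "norm (x a b - x a' b') \<le> e * M * (\<bar>a - a'\<bar> + \<bar>b - b'\<bar>)" for a b a' b'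
    proof -
      have eq: "x a b - x a' b' = (e\<^sup>2 * (cl a - cl a')) *\<^sub>R E1 + (e * (cl b - cl b')) *\<^sub>R g"
        by (simp add: x_def algebra_simps)
      have "e\<^sup>2 * \<bar>cl a - cl a'\<bar> \<le> e * \<bar>a - a'\<bar>"
        using ee e cl(3)[of a a'] unfolding power2_eq_square by (intro mult_mono) auto
      then have "norm ((e\<^sup>2 * (cl a - cl a')) *\<^sub>R E1) \<le> (e * \<bar>a - a'\<bar>) * norm E1"
        using e by (simp add: abs_mult mult_right_mono)
      moreover have "norm ((e * (cl b - cl b')) *\<^sub>R g) \<le> (e * \<bar>b - b'\<bar>) * norm g"
        using e cl(3)[of b b'] by (auto simp: abs_mult intro!: mult_right_mono mult_mono)
      ultimately have "norm (x a b - x a' b') \<le> (e * \<bar>a - a'\<bar>) * norm E1 + (e * \<bar>b - b'\<bar>) * norm g"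
        unfolding eq by (intro norm_triangle_le add_mono)
      also have "\<dots> \<le> (e * \<bar>a - a'\<bar>) * M + (e * \<bar>b - b'\<bar>) * M"
        using e by (intro add_mono mult_left_mono) (auto simp: M_def)
      finally show ?thesis by (simp add: algebra_simps)
    qed
    have xn: "norm (x a b) \<le> 2 * (e * M)" for a b
    proof -
      have "x a b = x (cl a) (cl b)" by (simp add: x_def cl)
      then have "norm (x a b) \<le> e * M * (\<bar>cl a\<bar> + \<bar>cl b\<bar>)" using xd[of "cl a" "cl b" 0 0] by (simp add: x0)
      also have "\<dots> \<le> e * M * 2" using e M0 cl(1)[of a] cl(1)[of b] by (intro mult_left_mono) auto
      finally show ?thesis by simp
    qed
    have NL: "\<bar>P1 (N (x a b) u) - P1 (N (x a' b') u)\<bar> \<le> e * e * (Q * (1 + n)) * (\<bar>a - a'\<bar> + \<bar>b - b'\<bar>)"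
      "\<bar>P2 (N (x a b) u) - P2 (N (x a' b') u)\<bar> \<le> e * e * (Q * (1 + n)) * (\<bar>a - a'\<bar> + \<bar>b - b'\<bar>)" if u: "u \<in> U" for a b a' b' u
    proof -
      define B where "B = 2 * L * (2 * (e * M)) * (e * M * (\<bar>a - a'\<bar> + \<bar>b - b'\<bar>)) * (1 + n)"
      have "\<bar>(N (x a b) u - N (x a' b') u) $ i\<bar> \<le> B" for i
      proof -
        have "\<bar>N (x a b) u $ i - N (x a' b') u $ i\<bar> \<le> 2 * L * (2 * (e * M)) * norm (x a b - x a' b') * (1 + n)" by (rule LN[OF xn xn u])
        also have "\<dots> \<le> B" unfolding B_def using xd[of a b a' b'] L e M0 n0 by (intro mult_right_mono mult_left_mono) auto
        finally show ?thesis by simp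
      qed
      from PB[OF this this] have "\<bar>P1 (N (x a b) u - N (x a' b') u)\<bar> \<le> KP * (2 * B)" "\<bar>P2 (N (x a b) u - N (x a' b') u)\<bar> \<le> KP * (2 * B)" .
      moreover have "KP * (2 * B) = e * e * (Q * (1 + n)) * (\<bar>a - a'\<bar> + \<bar>b - b'\<bar>)" by (simp add: B_def Q_def power2_eq_square)
      ultimately show "\<bar>P1 (N (x a b) u) - P1 (N (x a' b') u)\<bar> \<le> e * e * (Q * (1 + n)) * (\<bar>a - a'\<bar> + \<bar>b - b'\<bar>)"
        "\<bar>P2 (N (x a b) u) - P2 (N (x a' b') u)\<bar> \<le> e * e * (Q * (1 + n)) * (\<bar>a - a'\<bar> + \<bar>b - b'\<bar>)"
        by (simp_all add: linear_diff[OF E.lin(1)] linear_diff[OF E.lin(2)])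
    qed
    \<comment> \<open>The control enters \<open>N\<close> only through G(x) - G(0), which is of
      order e^2. This makes the dependence of the perturbation on the control small.\<close>
    have NU: "\<bar>P1 (N (x a b) u) - P1 (N (x a b) w)\<bar> \<le> e * e * (Q * D) * (\<bar>a\<bar> + \<bar>b\<bar>)"
      "\<bar>P2 (N (x a b) u) - P2 (N (x a b) w)\<bar> \<le> e * e * (Q * D) * (\<bar>a\<bar> + \<bar>b\<bar>)" if D: "(\<Sum>k\<in>UNIV. \<bar>(u - w) $ k\<bar>) \<le> D" for a b u w D
    proof -
      have D0: "0 \<le> D" by (rule order_trans[OF sum_nonneg D]) simp
      define B where "B = 2 * L * (2 * (e * M)) * (e * M * (\<bar>a\<bar> + \<bar>b\<bar>)) * D"
      have "\<bar>(N (x a b) u - N (x a b) w) $ i\<bar> \<le> B" for i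
      proof -
        have "\<bar>(G (x a b) - G0) $ i $ k\<bar> \<le> 2 * L * (2 * (e * M)) * (e * M * (\<bar>a\<bar> + \<bar>b\<bar>))" for k
        proof -
          have "\<bar>(G (x a b) - G0) $ i $ k - (G 0 - G0) $ i $ k\<bar> \<le> 2 * L * (2 * (e * M)) * norm (x a b - 0)"
            using e M0 by (intro LG xn) auto
          also have "\<dots> \<le> 2 * L * (2 * (e * M)) * (e * M * (\<bar>a\<bar> + \<bar>b\<bar>))"
            using xd[of a b 0 0] L e M0 by (intro mult_left_mono) (auto simp: x0)
          finally show ?thesis by (simp add: G0)
        qed
        from abs_component_mult_vec[OF this]
        have "\<bar>((G (x a b) - G0) *v (u - w)) $ i\<bar> \<le> 2 * L * (2 * (e * M)) * (e * M * (\<bar>a\<bar> + \<bar>b\<bar>)) * (\<Sum>k\<in>UNIV. \<bar>(u - w) $ k\<bar>)" .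
        also have "\<dots> \<le> B" unfolding B_def using D L e M0 by (intro mult_left_mono) auto
        finally show ?thesis by (simp add: N_def matrix_vector_mult_diff_distrib)
      qed
      from PB[OF this this] have "\<bar>P1 (N (x a b) u - N (x a b) w)\<bar> \<le> KP * (2 * B)" "\<bar>P2 (N (x a b) u - N (x a b) w)\<bar> \<le> KP * (2 * B)" .
      moreover have "KP * (2 * B) = e * e * (Q * D) * (\<bar>a\<bar> + \<bar>b\<bar>)" by (simp add: B_def Q_def power2_eq_square)
      ultimately show "\<bar>P1 (N (x a b) u) - P1 (N (x a b) w)\<bar> \<le> e * e * (Q * D) * (\<bar>a\<bar> + \<bar>b\<bar>)"
        "\<bar>P2 (N (x a b) u) - P2 (N (x a b) w)\<bar> \<le> e * e * (Q * D) * (\<bar>a\<bar> + \<bar>b\<bar>)"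
        by (simp_all add: linear_diff[OF E.lin(1)] linear_diff[OF E.lin(2)])
    qed
    define v where "v u = (\<Sum>k\<in>UNIV. c k * u $ k)" for u :: "real^'m"
    define up where "up = (\<chi> k. sgn (c k))"
    define um where "um = (\<chi> k. - sgn (c k))"
    have UU: "um \<in> U" "up \<in> U" "0 \<in> U" by (auto simp: U_def um_def up_def sgn_real_def)
    have vv: "v um = - 1" "v up = 1" "v 0 = 0"
      using csum by (simp_all add: v_def um_def up_def abs_sgn sum_negf)
    have vp: "1 - v u = (\<Sum>k\<in>UNIV. \<bar>c k\<bar> - c k * u $ k)" "1 + v u = (\<Sum>k\<in>UNIV. \<bar>c k\<bar> + c k * u $ k)" for u
      using csum by (simp_all add: v_def sum_subtractf sum.distrib)
    have cu_nonneg: "0 \<le> \<bar>c k\<bar> - c k * u $ k" "0 \<le> \<bar>c k\<bar> + c k * u $ k" if "u \<in> U" for u k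
    proof -
      have "\<bar>c k * u $ k\<bar> \<le> \<bar>c k\<bar> * 1" unfolding abs_mult using that by (intro mult_left_mono) (auto simp: U_def mem_Icc_abs simp del: atLeastAtMost_iff)
      then show "0 \<le> \<bar>c k\<bar> - c k * u $ k" "0 \<le> \<bar>c k\<bar> + c k * u $ k" by (simp_all add: abs_le_iff)
    qed
    have vb: "- 1 \<le> v u" "v u \<le> 1" if "u \<in> U" for u
      using vp[of u] sum_nonneg[of UNIV "\<lambda>k. \<bar>c k\<bar> - c k * u $ k"] sum_nonneg[of UNIV "\<lambda>k. \<bar>c k\<bar> + c k * u $ k"] cu_nonneg[OF that] by auto
    \<comment> \<open>1 + v(u) is the sum of nonnegative terms |c_k| |u_k - um_k|, so it controls
      the whole distance from \<open>um\<close>. The division is possible because no column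
      vanishes.\<close>
    have um_dist: "(\<Sum>k\<in>UNIV. \<bar>(u - um) $ k\<bar>) \<le> Cc * (1 + v u)" if u: "u \<in> U" for u
    proof -
      have "\<bar>(u - um) $ k\<bar> \<le> 1 / \<bar>c k\<bar> * (1 + v u)" for k
      proof -
        have "\<bar>c k\<bar> * \<bar>(u - um) $ k\<bar> = \<bar>\<bar>c k\<bar> + c k * u $ k\<bar>" unfolding abs_mult[symmetric]
          by (simp add: um_def algebra_simps abs_sgn)
        also have "\<dots> \<le> 1 + v u" unfolding vp using cu_nonneg(2)[OF u] member_le_sum[of k UNIV "\<lambda>k. \<bar>c k\<bar> + c k * u $ k"] by simp
        finally show ?thesis using c[of k] by (simp add: field_simps)
      qed
      then have "(\<Sum>k\<in>UNIV. \<bar>(u - um) $ k\<bar>) \<le> (\<Sum>k\<in>UNIV. 1 / \<bar>c k\<bar> * (1 + v u))" by (intro sum_mono)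
      then show ?thesis by (simp add: Cc_def sum_distrib_right)
    qed
    have up_dist: "(\<Sum>k\<in>UNIV. \<bar>(u - up) $ k\<bar>) \<le> Cc * (1 - v u)" if u: "u \<in> U" for u
    proof -
      have mu: "- u \<in> U" using u by (auto simp: U_def mem_Icc_abs simp del: atLeastAtMost_iff)
      have "\<bar>(u - up) $ k\<bar> = \<bar>(- u - um) $ k\<bar>" for k by (simp add: um_def up_def)
      moreover have "v (- u) = - v u" by (simp add: v_def sum_negf)
      ultimately show ?thesis using um_dist[OF mu] by simp
    qed
    \<comment> \<open>The anisotropic scaling divides the first component by e. Since the remainder
      is of order e^2, a factor e is left.\<close>
    define r1 where "r1 a b u = P1 (N (x a b) u) / e" for a b u
    define r2 where "r2 a b u = e\<^sup>2 * \<beta> * cl a + e * \<alpha> * cl b + P2 (N (x a b) u)" for a b u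
    have lip: "\<bar>r1 a b u - r1 a' b' u\<bar> \<le> (\<bar>a - a'\<bar> + \<bar>b - b'\<bar>) / 100" "\<bar>r2 a b u - r2 a' b' u\<bar> \<le> (\<bar>a - a'\<bar> + \<bar>b - b'\<bar>) / 100" if u: "u \<in> U" for a b a' b' u
    proof -
      define d where "d = \<bar>a - a'\<bar> + \<bar>b - b'\<bar>"
      have d: "0 \<le> d" by (simp add: d_def)
      have "\<bar>r1 a b u - r1 a' b' u\<bar> = \<bar>P1 (N (x a b) u) - P1 (N (x a' b') u)\<bar> / e"
        using e by (simp add: r1_def diff_divide_distrib[symmetric])
      also have "\<dots> \<le> (e * e * (Q * (1 + n)) * d) / e" using NL(1)[OF u] e by (intro divide_right_mono) (auto simp: d_def)
      also have "\<dots> = (e * (Q * (1 + n))) * d" using e by simp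
      also have "\<dots> \<le> (1/100) * d" using b1(1) d by (rule mult_right_mono)
      finally show "\<bar>r1 a b u - r1 a' b' u\<bar> \<le> (\<bar>a - a'\<bar> + \<bar>b - b'\<bar>) / 100" by (simp add: d_def)
      have "\<bar>e\<^sup>2 * \<beta> * (cl a - cl a')\<bar> \<le> e * \<bar>\<beta>\<bar> * d"
        unfolding abs_mult using ee e cl(3)[of a a'] by (intro mult_mono) (auto simp: power2_eq_square d_def)
      moreover have "\<bar>e * \<alpha> * (cl b - cl b')\<bar> \<le> e * \<bar>\<alpha>\<bar> * d"
        unfolding abs_mult using e cl(3)[of b b'] by (intro mult_mono) (auto simp: d_def)
      moreover have "e * e * (Q * (1 + n)) * d \<le> e * (Q * (1 + n)) * d" using ee Q n0 d by (intro mult_right_mono) auto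
      ultimately have "\<bar>r2 a b u - r2 a' b' u\<bar> \<le> e * \<bar>\<beta>\<bar> * d + e * \<bar>\<alpha>\<bar> * d + e * (Q * (1 + n)) * d"
        using NL(2)[OF u, of a b a' b'] unfolding r2_def d_def[symmetric] right_diff_distrib by linarith
      also have "\<dots> = (e * (Q * (1 + n) + \<bar>\<alpha>\<bar> + \<bar>\<beta>\<bar>)) * d" by (simp add: algebra_simps)
      also have "\<dots> \<le> (1/100) * d" using b1(2) d by (rule mult_right_mono)
      finally show "\<bar>r2 a b u - r2 a' b' u\<bar> \<le> (\<bar>a - a'\<bar> + \<bar>b - b'\<bar>) / 100" by (simp add: d_def)
    qed
    have z: "r1 0 0 u = 0" "r2 0 0 u = 0" for u
      by (simp_all add: r1_def r2_def x0 Nz linear_0[OF E.lin(1)] linear_0[OF E.lin(2)] cl)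
    have bnd: "\<bar>r1 a b u\<bar> \<le> 1/10" "\<bar>r2 a b u\<bar> \<le> 1/10" if "u \<in> U" for a b u
    proof -
      \<comment> \<open>Truncated coordinates have absolute sum at most 2, so the Lipschitz bound
        from the origin gives 2/100.\<close>
      have "r1 a b u = r1 (cl a) (cl b) u" "r2 a b u = r2 (cl a) (cl b) u" by (simp_all add: r1_def r2_def x_def cl)
      then show "\<bar>r1 a b u\<bar> \<le> 1/10" "\<bar>r2 a b u\<bar> \<le> 1/10"
        using lip[OF that, of "cl a" "cl b" 0 0] cl(1)[of a] cl(1)[of b] by (simp_all add: z)
    qed
    have du: "\<bar>r1 a b u - r1 a b w\<bar> \<le> (\<bar>a\<bar> + \<bar>b\<bar>) / 100 * q" "\<bar>r2 a b u - r2 a b w\<bar> \<le> (\<bar>a\<bar> + \<bar>b\<bar>) / 100 * q"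
      if q: "(\<Sum>k\<in>UNIV. \<bar>(u - w) $ k\<bar>) \<le> Cc * q" "0 \<le> q" for a b u w q
    proof -
      define d where "d = (\<bar>a\<bar> + \<bar>b\<bar>) * q"
      have d: "0 \<le> d" using q(2) by (simp add: d_def)
      have eq: "e * e * (Q * (Cc * q)) * (\<bar>a\<bar> + \<bar>b\<bar>) = e * (e * (Q * Cc) * d)" by (simp add: d_def)
      have le: "e * (Q * Cc) * d \<le> (1/100) * d" using b1(3) d by (rule mult_right_mono)
      have "\<bar>r1 a b u - r1 a b w\<bar> = \<bar>P1 (N (x a b) u) - P1 (N (x a b) w)\<bar> / e"
        using e by (simp add: r1_def diff_divide_distrib[symmetric])
      also have "\<dots> \<le> (e * (e * (Q * Cc) * d)) / e" using NU(1)[OF q(1), of a b] e unfolding eq by (intro divide_right_mono) auto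
      also have "\<dots> = e * (Q * Cc) * d" using e by simp
      finally show "\<bar>r1 a b u - r1 a b w\<bar> \<le> (\<bar>a\<bar> + \<bar>b\<bar>) / 100 * q" using le by (simp add: d_def)
      have "\<bar>r2 a b u - r2 a b w\<bar> \<le> e * (e * (Q * Cc) * d)" using NU(2)[OF q(1), of a b] unfolding eq r2_def by simp
      also have "\<dots> \<le> 1 * (e * (Q * Cc) * d)" using e Q Cc d by (intro mult_right_mono) auto
      finally show "\<bar>r2 a b u - r2 a b w\<bar> \<le> (\<bar>a\<bar> + \<bar>b\<bar>) / 100 * q" using le by (simp add: d_def)
    qed
    have Fc: "continuous_on S' F" "continuous_on S' G" for S'
      using CF CG unfolding C11_vec_def C11_mat_def by (meson has_derivative_continuous continuous_at_imp_continuous_on)+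
    have Nint: "(\<lambda>\<tau>. P (N (x (y1 \<tau>) (y2 \<tau>)) (u \<tau>))) integrable_on {a..b}"
      if u: "admissible_control u" and y: "continuous_on {a..b} y1" "continuous_on {a..b} y2" and P: "linear P" for u a b y1 y2 and P :: "real^2 \<Rightarrow> real"
    proof -
      have Pc: "continuous_on S' P" for S' using P by (simp add: linear_conv_bounded_linear linear_continuous_on)
      define X where "X \<tau> = x (y1 \<tau>) (y2 \<tau>)" for \<tau>
      have Xc: "continuous_on {a..b} X" unfolding X_def x_def cl_def by (intro continuous_intros y)
      have FX: "continuous_on {a..b} (\<lambda>\<tau>. F (X \<tau>))" "continuous_on {a..b} (\<lambda>\<tau>. G (X \<tau>))"
        by (rule continuous_on_compose2[OF Fc(1)[of UNIV] Xc], simp) (rule continuous_on_compose2[OF Fc(2)[of UNIV] Xc], simp)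
      have AX: "continuous_on {a..b} (\<lambda>\<tau>. A *v X \<tau>)"
        by (rule continuous_on_compose2[OF linear_continuous_on[OF matrix_vector_mul_bounded_linear[of A], of UNIV] Xc]) simp
      have 1: "continuous_on {a..b} (\<lambda>\<tau>. P (F (X \<tau>) - A *v X \<tau>))"
        by (rule continuous_on_compose2[OF Pc[of UNIV]]) (auto intro!: continuous_intros FX AX)
      have 2: "continuous_on {a..b} (\<lambda>\<tau>. P (column k (G (X \<tau>) - G0)))" for k
      proof (rule continuous_on_compose2[OF Pc[of UNIV]])
        show "continuous_on {a..b} (\<lambda>\<tau>. column k (G (X \<tau>) - G0))" unfolding column_def
          by (intro continuous_on_vec_lambda continuous_intros FX)
      qed simp
      have eq: "P (N (X \<tau>) (u \<tau>)) = P (F (X \<tau>) - A *v X \<tau>) + (\<Sum>k\<in>UNIV. u \<tau> $ k * P (column k (G (X \<tau>) - G0)))" for \<tau>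
        unfolding N_def linear_add[OF P] matrix_mult_sum[of "G (X \<tau>) - G0"] linear_sum[OF P] by (simp add: linear_cmul[OF P] scalar_mult_eq_scaleR)
      have "(\<lambda>\<tau>. P (F (X \<tau>) - A *v X \<tau>) + (\<Sum>k\<in>UNIV. u \<tau> $ k * P (column k (G (X \<tau>) - G0)))) integrable_on {a..b}"
        by (intro integrable_add integrable_continuous_real 1 integrable_sum integrable_continuous_times_control[OF u 2]) auto
      then show ?thesis by (simp only: eq[symmetric] X_def[symmetric])
    qed
    have double_integrator: "double_integrator r1 r2 v U {u. admissible_control u} um up 0"
    proof
      show "\<bar>r1 a b w - r1 a b um\<bar> \<le> (\<bar>a\<bar> + \<bar>b\<bar>) / 100 * (1 + v w)" "\<bar>r2 a b w - r2 a b um\<bar> \<le> (\<bar>a\<bar> + \<bar>b\<bar>) / 100 * (1 + v w)"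
        if "w \<in> U" for w a b using du[OF um_dist[OF that]] vb[OF that] by auto
      show "\<bar>r1 a b w - r1 a b up\<bar> \<le> (\<bar>a\<bar> + \<bar>b\<bar>) / 100 * (1 - v w)" "\<bar>r2 a b w - r2 a b up\<bar> \<le> (\<bar>a\<bar> + \<bar>b\<bar>) / 100 * (1 - v w)"
        if "w \<in> U" for w a b using du[OF up_dist[OF that]] vb[OF that] by auto
      show "u s \<in> U" if "u \<in> {u. admissible_control u}" for u s using that by (auto simp: U_def admissible_control_def)
      show "(\<lambda>_. w) \<in> {u. admissible_control u}" if "w \<in> {um, up, 0}" for w
        using that UU by (auto simp: U_def intro!: admissible_const)
      show "(\<lambda>\<tau>. if \<tau> \<le> s then u \<tau> else u' (\<tau> + - s)) \<in> {u. admissible_control u}"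
        if "u \<in> {u. admissible_control u}" "u' \<in> {u. admissible_control u}" for u u' s
        using admissible_join that by auto
      show "(\<lambda>\<tau>. u (\<tau> + s)) \<in> {u. admissible_control u}" if "u \<in> {u. admissible_control u}" for u s
        using admissible_affine[of u 1 s] that by (simp add: add.commute)
      fix u a b and y1 y2 :: "real \<Rightarrow> real"
      assume u: "u \<in> {u :: real \<Rightarrow> real^'m. admissible_control u}"
      show "(\<lambda>\<tau>. v (u \<tau>)) integrable_on {a..b}" unfolding v_def
        using integrable_continuous_times_control[of u a b "\<lambda>_. c k" for k] u
        by (intro integrable_sum) (auto simp: mult.commute)
      assume y: "continuous_on {a..b} y1" "continuous_on {a..b} y2"
      have u': "admissible_control u" using u by simp
      show "(\<lambda>\<tau>. r1 (y1 \<tau>) (y2 \<tau>) (u \<tau>)) integrable_on {a..b}" unfolding r1_def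
        by (intro integrable_on_divide Nint[OF u' y E.lin(1)])
      have "continuous_on {a..b} (\<lambda>\<tau>. e\<^sup>2 * \<beta> * cl (y1 \<tau>) + e * \<alpha> * cl (y2 \<tau>))" unfolding cl_def by (intro continuous_intros y)
      then show "(\<lambda>\<tau>. r2 (y1 \<tau>) (y2 \<tau>) (u \<tau>)) integrable_on {a..b}" unfolding r2_def
        by (intro integrable_add[OF integrable_continuous_real Nint[OF u' y E.lin(2)]])
    qed (use lip z bnd vb vv UU in auto)
    obtain \<gamma> \<gamma>d where cu: "switching_curve r1 r2 v U {u. admissible_control u} um up 0 \<gamma> \<gamma>d"
      using double_integrator.curve_exists[OF double_integrator] by blast
    have "scaled r1 r2 v um up 0 \<gamma> \<gamma>d E1 g P1 P2 F G e"
    proof (rule scaled.intro)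
      show "switching_curve r1 r2 v {u. \<forall>k. u $ k \<in> {- 1..1}} {u. admissible_control u} um up 0 \<gamma> \<gamma>d" using cu unfolding U_def .
      show "coords2 E1 g P1 P2" by (rule co)
      show "scaled_axioms r1 r2 v E1 g P1 P2 F G e"
      proof (rule scaled_axioms.intro[OF e(1)])
        fix a b :: real and u :: "real^'m" assume ab: "\<bar>a\<bar> \<le> 1" "\<bar>b\<bar> \<le> 1" and u: "\<forall>k. u $ k \<in> {- 1..1}"
        define X where "X = (e\<^sup>2 * a) *\<^sub>R E1 + (e * b) *\<^sub>R g"
        have X: "X = x a b" using ab by (simp add: X_def x_def cl_id)
        have G0u: "G0 *v u = v u *\<^sub>R g"
          unfolding matrix_mult_sum[of G0] col by (simp add: v_def scaleR_sum_left scalar_mult_eq_scaleR mult.commute)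
        have AX: "A *v X = (e * b) *\<^sub>R E1 + (e\<^sup>2 * a * \<beta> + e * b * \<alpha>) *\<^sub>R g"
          unfolding X_def matrix_vector_right_distrib matrix_vector_mult_scaleR AE1 Ag by (simp add: algebra_simps)
        have "F X + G X *v u = A *v X + G0 *v u + N X u" by (simp add: N_def matrix_vector_mult_diff_rdistrib)
        also have "\<dots> = ((e * b) *\<^sub>R E1 + (e\<^sup>2 * a * \<beta> + e * b * \<alpha> + v u) *\<^sub>R g) + N X u" unfolding AX G0u by (simp add: algebra_simps)
        finally have "P1 (F X + G X *v u) = e * b + P1 (N X u)" "P2 (F X + G X *v u) = (e\<^sup>2 * a * \<beta> + e * b * \<alpha> + v u) + P2 (N X u)"
          by (simp_all only: linear_add[OF E.lin(1), of _ "N X u"] linear_add[OF E.lin(2), of _ "N X u"] E.proj)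
        then show "P1 (F ((e\<^sup>2 * a) *\<^sub>R E1 + (e * b) *\<^sub>R g) + G ((e\<^sup>2 * a) *\<^sub>R E1 + (e * b) *\<^sub>R g) *v u) = e * (b + r1 a b u)"
          "P2 (F ((e\<^sup>2 * a) *\<^sub>R E1 + (e * b) *\<^sub>R g) + G ((e\<^sup>2 * a) *\<^sub>R E1 + (e * b) *\<^sub>R g) *v u) = v u + r2 a b u"
          unfolding X_def[symmetric] r1_def r2_def X[symmetric] using e ab by (simp_all add: cl_id algebra_simps)
      qed
    qed
    then show "\<exists>r1 r2 v um up u0 \<gamma> \<gamma>d E1 E2 P1 P2. scaled r1 r2 v um up u0 \<gamma> \<gamma>d E1 E2 P1 P2 F G e" by blast
  qed
qed

section \<open>Independent columns\<close>

lemma coords2_axes: "i \<noteq> j \<Longrightarrow> coords2 (axis i 1) (axis j 1) (\<lambda>x. x $ i) (\<lambda>x::real^2. x $ j)"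
proof (rule coords2.intro)
  assume ij: "i \<noteq> j"
  show "linear (\<lambda>x::real^2. x $ i)" "linear (\<lambda>x::real^2. x $ j)" by (rule linearI; simp)+
  show "x $ i *\<^sub>R axis i 1 + x $ j *\<^sub>R axis j 1 = x" for x :: "real^2"
    using exhaust_2[of i] exhaust_2[of j] ij by (auto simp: vec_eq_iff forall_2 axis_def)
  show "(s *\<^sub>R axis i 1 + y *\<^sub>R axis j 1) $ i = s" "(s *\<^sub>R axis i 1 + y *\<^sub>R axis j 1) $ j = y" for s y :: real
    using ij by (auto simp: axis_def)
qed

text \<open>The valley criterion with the valley point at the left end of every line: a Lipschitz
  function rises, up to its Lipschitz slope, all the way.\<close>

lemma SBV_on_lipschitz:
  fixes T :: "real^2 \<Rightarrow> real"
  assumes lip: "\<And>x z. norm x \<le> r \<Longrightarrow> norm z \<le> r \<Longrightarrow> \<bar>T x - T z\<bar> \<le> K * norm (x - z)" and K: "0 \<le> K" and r: "0 < r"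
    and V: "open V" "V \<subseteq> ball 0 (r / 2)"
  shows "SBV_on V T"
proof -
  have Vr: "norm x \<le> r" "norm x < r / 2" if "x \<in> V" for x using that V(2) r by (auto simp: subset_iff)
  have cV: "compact (closure V)" using V(2) bounded_subset[OF bounded_ball] by (auto simp: compact_closure)
  have Tcb: "continuous_on (cball 0 r) T"
  proof (rule continuous_onI)
    fix x :: "real^2" and d :: real assume x: "x \<in> cball 0 r" and d: "0 < d"
    show "\<exists>e>0. \<forall>x'\<in>cball 0 r. dist x' x < e \<longrightarrow> dist (T x') (T x) \<le> d"
    proof (intro exI[of _ "d / (K + 1)"] conjI ballI impI)
      show "0 < d / (K + 1)" using d K by simp
      fix x' assume x': "x' \<in> cball 0 r" "dist x' x < d / (K + 1)"
      have "\<bar>T x' - T x\<bar> \<le> K * norm (x' - x)" using lip x x' by simp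
      also have "\<dots> \<le> (K + 1) * norm (x' - x)" by (simp add: mult_right_mono)
      also have "\<dots> \<le> (K + 1) * (d / (K + 1))" using x'(2) K by (intro mult_left_mono) (auto simp: dist_norm)
      also have "\<dots> = d" using K by simp
      finally show "dist (T x') (T x) \<le> d" by (simp add: dist_real_def)
    qed
  qed
  have Tc: "continuous_on V T" using Tcb by (rule continuous_on_subset) (use Vr in auto)
  have Tb: "\<bar>T x\<bar> \<le> \<bar>T 0\<bar> + K * r" if "norm x \<le> r" for x
  proof -
    have "\<bar>T x - T 0\<bar> \<le> K * norm (x - 0)" using that r by (intro lip) auto
    also have "\<dots> \<le> K * r" using that K by (intro mult_left_mono) auto
    finally show ?thesis by linarith
  qed
  define h where "h = r / 2"
  have h: "0 < h" using r by (simp add: h_def)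
  define cl where "cl s = max (- h) (min h s)" for s
  have cl: "\<bar>cl s\<bar> \<le> h" "\<bar>cl s - cl s'\<bar> \<le> \<bar>s - s'\<bar>" for s s' using h by (auto simp: cl_def max_def min_def)
  have cl_id: "cl s = s" if "\<bar>s\<bar> \<le> h" for s using that by (auto simp: cl_def)
  have wd: "\<exists>g. integrable lborel g \<and> (\<forall>\<phi>. test_C1 V \<phi> \<longrightarrow>
      (\<integral>x. indicator V x * T x * frechet_derivative \<phi> (at x) (axis i 1) \<partial>lebesgue) = - (\<integral>x. g x * \<phi> x \<partial>lborel))"
    if ij: "i \<noteq> j" for i j :: 2
  proof -
    interpret coords2 "axis i 1" "axis j 1" "\<lambda>x. x $ i" "\<lambda>x. x $ j" by (rule coords2_axes[OF ij])
    define q where "q s y = cl s *\<^sub>R axis i 1 + cl y *\<^sub>R axis j (1::real)" for s y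
    have nq: "norm (s *\<^sub>R axis i 1 + y *\<^sub>R axis j (1::real)) \<le> \<bar>s\<bar> + \<bar>y\<bar>" for s y
      using norm_triangle_ineq[of "s *\<^sub>R axis i 1" "y *\<^sub>R axis j (1::real)"] by (simp add: norm_axis_1)
    have qr: "norm (q s y) \<le> r" for s y using nq[of "cl s" "cl y"] cl(1)[of s] cl(1)[of y] by (simp add: q_def h_def)
    have fl: "\<bar>T (q s y) - T (q s' y')\<bar> \<le> K * (\<bar>s - s'\<bar> + \<bar>y - y'\<bar>)" for s y s' y'
    proof -
      have "q s y - q s' y' = (cl s - cl s') *\<^sub>R axis i 1 + (cl y - cl y') *\<^sub>R axis j 1" by (simp add: q_def algebra_simps)
      then have "norm (q s y - q s' y') \<le> \<bar>s - s'\<bar> + \<bar>y - y'\<bar>" using nq[of "cl s - cl s'" "cl y - cl y'"] cl(2)[of s s'] cl(2)[of y y'] by simp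
      with K have "K * norm (q s y - q s' y') \<le> K * (\<bar>s - s'\<bar> + \<bar>y - y'\<bar>)" by (rule mult_left_mono[rotated])
      then show ?thesis using lip[OF qr qr, of s y s' y'] by linarith
    qed
    have fc: "continuous_on UNIV (\<lambda>p. T (q (fst p) (snd p)))"
    proof (rule continuous_on_compose2[OF Tcb])
      show "continuous_on UNIV (\<lambda>p. q (fst p) (snd p))" unfolding q_def cl_def by (intro continuous_intros)
    qed (use qr in auto)
    obtain g where g: "integrable lborel g"
      "\<And>\<phi> \<phi>'. box_test (- h) h (- h) h \<phi> \<phi>' \<Longrightarrow> (\<integral>p. T (q (fst p) (snd p)) * \<phi>' p \<partial>lborel) = - (\<integral>p. g p * \<phi> p \<partial>lborel)"
    proof (rule valley_weak_derivative[where f = "\<lambda>s y. T (q s y)" and a = "- h" and b = h and c = "- h" and d = h and C = K and \<sigma> = "\<lambda>_. - h" and M = "\<bar>T 0\<bar> + K * r"])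
      show "T (q s y) \<le> T (q s' y) + K * (s' - s)" if "s \<le> s'" for s s' y
        using fl[of s y s' y] that by (simp add: abs_le_iff)
      show "T (q s' y) \<le> T (q s y) + K * (s' - s)" if "s \<le> s'" for s s' y
        using fl[of s y s' y] that by (simp add: abs_le_iff)
      show "\<exists>e>0. \<exists>B. \<forall>s'\<in>{- h..h}. \<bar>s' - s\<bar> < e \<longrightarrow> \<bar>T (q s' y) - T (q s y)\<bar> \<le> B * \<bar>s' - s\<bar>" for s y
        using fl[of _ y s y] by (intro exI[of _ 1] exI[of _ K] conjI ballI impI) (simp_all add: zero_less_one)
    qed (use h K fc Tb qr in auto)
    show ?thesis
    proof (rule weak_derivative_transfer[OF g])
      show "(\<lambda>p. T (q (fst p) (snd p))) \<in> borel_measurable borel" by (rule borel_measurable_continuous_onI[OF fc])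
      fix x assume x: "x \<in> V"
      have n: "\<bar>x $ m\<bar> < h" for m using component_le_norm_cart[of x m] Vr(2)[OF x] by (simp add: h_def)
      show "x $ i \<in> {- h<..<h} \<and> x $ j \<in> {- h<..<h}" using n[of i] n[of j] by (auto simp: abs_less_iff)
      have "q (x $ i) (x $ j) = x" using decomp[of x] n[of i] n[of j] by (simp add: q_def cl_id)
      then show "T x = T (q (fst (x $ i, x $ j)) (snd (x $ i, x $ j)))" by simp
    qed (use V Tc in auto)
  qed
  interpret coords2 "axis 1 1" "axis 2 1" "\<lambda>x. x $ 1" "\<lambda>x. x $ (2::2)" by (rule coords2_axes) simp
  show ?thesis
  proof (rule SBV_on_from_coords[OF V(1) cV Tc, of "\<bar>T 0\<bar> + K * r"])
    show "\<bar>T x\<bar> \<le> \<bar>T 0\<bar> + K * r" if "x \<in> V" for x using Tb Vr(1)[OF that] by blast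
  qed (use wd[of 1 2] wd[of 2 1] in auto)
qed

section \<open>Straight-line steering when two columns are independent\<close>

lemma steers_zero: "steers_to_origin F G 0 0"
  unfolding steers_to_origin_def
  by (intro conjI exI[of _ "\<lambda>_. 0"] exI[of _ "\<lambda>_. 0"] admissible_const) (auto intro: has_integral_null_real)

lemma min_time_nonneg: "0 \<le> min_time F G x"
  unfolding min_time_def by (rule Inf_greatest) (auto simp: steers_to_origin_def)

lemma min_time_le: "steers_to_origin F G x t \<Longrightarrow> min_time F G x \<le> ereal t"
  unfolding min_time_def by (intro Inf_lower) auto

lemma steers_prepend:
  assumes z: "steers_to_origin F G z t2" and u: "admissible_control u" and t1: "0 \<le> t1"
    and y: "continuous_on {0..t1} y" "y 0 = x" "y t1 = z"
    and I: "\<And>s. s \<in> {0..t1} \<Longrightarrow> ((\<lambda>\<tau>. F (y \<tau>) + G (y \<tau>) *v u \<tau>) has_integral (y s - x)) {0..s}"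
  shows "steers_to_origin F G x (t1 + t2)"
proof -
  obtain w y2 where t2: "0 \<le> t2" and w: "admissible_control w" and y2: "continuous_on {0..t2} y2" "y2 0 = z" "y2 t2 = 0"
    and I2: "\<forall>s\<in>{0..t2}. ((\<lambda>\<tau>. F (y2 \<tau>) + G (y2 \<tau>) *v w \<tau>) has_integral (y2 s - z)) {0..s}"
    using z unfolding steers_to_origin_def by blast
  define Y where "Y \<tau> = (if \<tau> \<le> t1 then y \<tau> else y2 (\<tau> + - t1))" for \<tau>
  define U where "U = (\<lambda>\<tau>. if \<tau> \<le> t1 then u \<tau> else w (\<tau> + - t1))"
  have Y2: "Y \<tau> = y2 (\<tau> + - t1)" if "t1 \<le> \<tau>" for \<tau> using that y(3) y2(2) by (cases "\<tau> = t1") (auto simp: Y_def)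
  show ?thesis unfolding steers_to_origin_def
  proof (intro conjI exI[of _ U] exI[of _ Y] ballI)
    show "admissible_control U" unfolding U_def by (rule admissible_join[OF u w])
    show "0 \<le> t1 + t2" using t1 t2 by simp
    show "Y 0 = x" "Y (t1 + t2) = 0" using t1 t2 y(2) y2(3) Y2[of "t1 + t2"] by (auto simp: Y_def)
    have "continuous_on ({0..t1} \<union> {t1..t1 + t2}) Y"
    proof (rule continuous_on_closed_Un)
      show "continuous_on {0..t1} Y" by (rule continuous_on_eq[OF y(1)]) (simp add: Y_def)
      have "continuous_on {t1..t1 + t2} (\<lambda>\<tau>. y2 (\<tau> + - t1))" by (intro continuous_on_compose2[OF y2(1)] continuous_intros) auto
      then show "continuous_on {t1..t1 + t2} Y" by (rule continuous_on_eq) (use Y2 in auto)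
    qed auto
    moreover have "{0..t1} \<union> {t1..t1 + t2} = {0..t1 + t2}" using t1 t2 by auto
    ultimately show "continuous_on {0..t1 + t2} Y" by simp
    have first: "((\<lambda>\<tau>. F (Y \<tau>) + G (Y \<tau>) *v U \<tau>) has_integral (y s - x)) {0..s}" if "s \<in> {0..t1}" for s
      by (rule has_integral_eq[OF _ I[OF that]]) (use that in \<open>auto simp: Y_def U_def\<close>)
    fix s assume s: "s \<in> {0..t1 + t2}"
    show "((\<lambda>\<tau>. F (Y \<tau>) + G (Y \<tau>) *v U \<tau>) has_integral (Y s - x)) {0..s}"
    proof (cases "s \<le> t1")
      case True
      then show ?thesis using first[of s] s by (simp add: Y_def)
    next
      case False
      have "((\<lambda>\<tau>. F (y2 \<tau>) + G (y2 \<tau>) *v w \<tau>) has_integral (y2 (s - t1) - z)) (cbox 0 (s - t1))"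
        using I2 s False by auto
      from has_integral_affinity'[OF this zero_less_one, of "- t1"]
      have "((\<lambda>\<tau>. F (y2 (\<tau> + - t1)) + G (y2 (\<tau> + - t1)) *v w (\<tau> + - t1)) has_integral (y2 (s - t1) - z)) {t1..s}" by simp
      then have "((\<lambda>\<tau>. F (Y \<tau>) + G (Y \<tau>) *v U \<tau>) has_integral (y2 (s - t1) - z)) {t1..s}"
        by (rule has_integral_spike_finite[of "{t1}", rotated 2]) (auto simp: Y_def U_def)
      from has_integral_combine[OF t1 _ first[of t1] this] False t1
      have "((\<lambda>\<tau>. F (Y \<tau>) + G (Y \<tau>) *v U \<tau>) has_integral ((y t1 - x) + (y2 (s - t1) - z))) {0..s}" by simp
      then show ?thesis using False y(3) by (simp add: Y_def)
    qed
  qed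
qed

text \<open>On the ball of radius \<open>r\<close> the columns \<open>k\<close> and \<open>l\<close>
  span the plane quantitatively. The condition \<open>Bc\<close> ensures that every velocity of norm
  at most \<open>c\<close> is produced by an admissible control.\<close>

locale full_control =
  fixes F :: "real^2 \<Rightarrow> real^2" and G :: "real^2 \<Rightarrow> real^'m^2" and k l :: 'm and r c B d0 :: real
  assumes Fc: "continuous_on UNIV F" and Gc: "continuous_on UNIV G" and r: "0 < r" and c: "0 < c" and d0: "0 < d0"
    and det: "norm x \<le> r \<Longrightarrow> d0 \<le> \<bar>G x $ 1 $ k * G x $ 2 $ l - G x $ 2 $ k * G x $ 1 $ l\<bar>"
    and GB: "norm x \<le> r \<Longrightarrow> \<bar>G x $ i $ j\<bar> \<le> B"
    and FB: "norm x \<le> r \<Longrightarrow> \<bar>F x $ i\<bar> \<le> c"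
    and Bc: "4 * B * c \<le> d0"
begin

definition "dG x = G x $ 1 $ k * G x $ 2 $ l - G x $ 2 $ k * G x $ 1 $ l"

text \<open>Cramer's solution of F x + G x u = w using only the columns \<open>k\<close> and
  \<open>l\<close>.\<close>

definition fb :: "real^2 \<Rightarrow> real^2 \<Rightarrow> real^'m" where
  "fb w x = (\<chi> j. if j = k then ((w - F x) $ 1 * G x $ 2 $ l - (w - F x) $ 2 * G x $ 1 $ l) / dG x
     else if j = l then (G x $ 1 $ k * (w - F x) $ 2 - G x $ 2 $ k * (w - F x) $ 1) / dG x else 0)"

lemma dG: "norm x \<le> r \<Longrightarrow> d0 \<le> \<bar>dG x\<bar>" "norm x \<le> r \<Longrightarrow> dG x \<noteq> 0"
  using det[of x] d0 by (auto simp: dG_def)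

lemma kl: "k \<noteq> l"
  using dG(2)[of 0] r by (auto simp: dG_def)

lemma fb_dynamics:
  assumes x: "norm x \<le> r"
  shows "F x + G x *v fb w x = w"
proof -
  have ne: "column k (G x) $ 1 * column l (G x) $ 2 - column k (G x) $ 2 * column l (G x) $ 1 \<noteq> 0"
    using dG(2)[OF x] by (simp add: dG_def column_def)
  have "G x *v fb w x = (\<Sum>j\<in>UNIV. fb w x $ j *\<^sub>R column j (G x))"
    by (simp add: matrix_mult_sum scalar_mult_eq_scaleR)
  also have "\<dots> = (\<Sum>j\<in>{k, l}. fb w x $ j *\<^sub>R column j (G x))"
    by (rule sum.mono_neutral_right) (auto simp: fb_def)
  also have "\<dots> = fb w x $ k *\<^sub>R column k (G x) + fb w x $ l *\<^sub>R column l (G x)" using kl by simp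
  also have "\<dots> = w - F x"
    using coords2.decomp[OF coords2_explicit[OF ne], of "w - F x"] kl by (simp add: fb_def dG_def column_def)
  finally show ?thesis by simp
qed

lemma fb_bound:
  assumes x: "norm x \<le> r" and w: "norm w \<le> c"
  shows "fb w x $ j \<in> {-1..1}"
proof -
  have w': "\<bar>(w - F x) $ i\<bar> \<le> 2 * c" for i using component_le_norm_cart[of w i] FB[OF x, of i] w by simp
  have p: "\<bar>(w - F x) $ i * G x $ m $ n\<bar> \<le> 2 * c * B" for i m n
    unfolding abs_mult using w' GB[OF x] c by (intro mult_mono) auto
  have q: "\<bar>z / dG x\<bar> \<le> 1" if "\<bar>z\<bar> \<le> 4 * B * c" for z
  proof -
    have "\<bar>z\<bar> \<le> \<bar>dG x\<bar>" using that Bc dG(1)[OF x] by linarith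
    then show ?thesis using dG(2)[OF x] by (simp add: abs_divide)
  qed
  have "\<bar>((w - F x) $ 1 * G x $ 2 $ l - (w - F x) $ 2 * G x $ 1 $ l) / dG x\<bar> \<le> 1"
    using p[of 1 2 l] p[of 2 1 l] by (intro q) (simp only: abs_le_iff, argo)
  moreover have "\<bar>(G x $ 1 $ k * (w - F x) $ 2 - G x $ 2 $ k * (w - F x) $ 1) / dG x\<bar> \<le> 1"
    using p[of 2 1 k] p[of 1 2 k] by (intro q) (simp only: abs_le_iff mult.commute[of "G x $ _ $ k"], argo)
  ultimately show ?thesis unfolding mem_Icc_abs by (simp add: fb_def)
qed

text \<open>The feedback moves the state along the segment at speed \<open>c\<close>; the segment
  stays in the ball by convexity.\<close>

lemma min_time_segment:
  assumes x: "norm x \<le> r" and z: "norm z \<le> r" and t: "steers_to_origin F G z t"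
  shows "steers_to_origin F G x (norm (z - x) / c + t)"
proof -
  define t1 where "t1 = norm (z - x) / c"
  \<comment> \<open>For z = x division by zero makes \<open>w\<close> zero, and the travel time is
    zero as well.\<close>
  define w where "w = (c / norm (z - x)) *\<^sub>R (z - x)"
  \<comment> \<open>Clamped time defines the path, and with it the feedback control, continuously on
    the whole line, as admissibility demands.\<close>
  define p where "p \<tau> = max 0 (min t1 \<tau>)" for \<tau>
  define y where "y \<tau> = x + p \<tau> *\<^sub>R w" for \<tau>
  have t1: "0 \<le> t1" using c by (simp add: t1_def)
  have w: "norm w \<le> c" using c by (simp add: w_def)
  have tw: "t1 *\<^sub>R w = z - x" using c by (cases "z = x") (auto simp: t1_def w_def)
  have yr: "norm (y \<tau>) \<le> r" for \<tau>
  proof -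
    have "y \<tau> \<in> closed_segment x z"
    proof (cases "t1 = 0")
      case True
      then show ?thesis by (simp add: y_def p_def)
    next
      case False
      have "p \<tau> *\<^sub>R w = (p \<tau> / t1) *\<^sub>R (z - x)" unfolding tw[symmetric] using False by simp
      moreover have "0 \<le> p \<tau> / t1" "p \<tau> / t1 \<le> 1" using t1 False by (auto simp: p_def)
      ultimately show ?thesis unfolding closed_segment_def y_def by (auto intro!: exI[of _ "p \<tau> / t1"] simp: algebra_simps)
    qed
    moreover have "closed_segment x z \<subseteq> cball 0 r" using x z by (intro closed_segment_subset) auto
    ultimately show ?thesis by auto
  qed
  have yc: "continuous_on UNIV y" unfolding y_def p_def by (intro continuous_intros)
  have u: "admissible_control (\<lambda>\<tau>. fb w (y \<tau>))"
  proof -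
    have Fy: "continuous_on UNIV (\<lambda>\<tau>. F (y \<tau>))" "continuous_on UNIV (\<lambda>\<tau>. G (y \<tau>))"
      by (rule continuous_on_compose2[OF Fc yc], simp) (rule continuous_on_compose2[OF Gc yc], simp)
    have "continuous_on UNIV (\<lambda>\<tau>. fb w (y \<tau>) $ j)" for j
    proof -
      have d: "continuous_on UNIV (\<lambda>\<tau>. dG (y \<tau>))" unfolding dG_def by (intro continuous_intros Fy)
      have ne: "\<forall>\<tau>\<in>UNIV. dG (y \<tau>) \<noteq> 0" using dG(2)[OF yr] by blast
      have c1: "continuous_on UNIV (\<lambda>\<tau>. ((w - F (y \<tau>)) $ 1 * G (y \<tau>) $ 2 $ l - (w - F (y \<tau>)) $ 2 * G (y \<tau>) $ 1 $ l) / dG (y \<tau>))"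
        by (rule continuous_on_divide[OF _ d ne]) (intro continuous_intros Fy)
      have c2: "continuous_on UNIV (\<lambda>\<tau>. (G (y \<tau>) $ 1 $ k * (w - F (y \<tau>)) $ 2 - G (y \<tau>) $ 2 $ k * (w - F (y \<tau>)) $ 1) / dG (y \<tau>))"
        by (rule continuous_on_divide[OF _ d ne]) (intro continuous_intros Fy)
      consider "j = k" | "j \<noteq> k" "j = l" | "j \<noteq> k" "j \<noteq> l" by blast
      then show ?thesis
      proof cases
        case 1
        then show ?thesis using c1 by (simp add: fb_def)
      next
        case 2
        then show ?thesis using c2 by (simp add: fb_def)
      next
        case 3
        then show ?thesis by (simp add: fb_def)
      qed
    qed
    then have "continuous_on UNIV (\<lambda>\<tau>. \<chi> j. fb w (y \<tau>) $ j)" by (rule continuous_on_vec_lambda)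
    then have "(\<lambda>\<tau>. fb w (y \<tau>)) \<in> borel_measurable borel" by (intro borel_measurable_continuous_onI) simp
    then have "(\<lambda>\<tau>. fb w (y \<tau>)) \<in> borel_measurable lebesgue" by (intro measurable_completion) simp
    then show ?thesis unfolding admissible_control_def using fb_bound[OF yr w] by blast
  qed
  have "steers_to_origin F G x (t1 + t)"
  proof (rule steers_prepend[OF t u t1, of y])
    show "continuous_on {0..t1} y" using yc by (rule continuous_on_subset) simp
    show "y 0 = x" "y t1 = z" using t1 tw by (simp_all add: y_def p_def)
    fix s assume s: "s \<in> {0..t1}"
    have "((\<lambda>\<tau>. w) has_integral (s *\<^sub>R w)) {0..s}" using has_integral_const_real[of w 0 s] s by simp
    then show "((\<lambda>\<tau>. F (y \<tau>) + G (y \<tau>) *v fb w (y \<tau>)) has_integral (y s - x)) {0..s}"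
      unfolding fb_dynamics[OF yr] using s by (simp add: y_def p_def)
  qed
  then show ?thesis by (simp add: t1_def)
qed

abbreviation "T x \<equiv> real_of_ereal (min_time F G x)"

lemma min_time_T:
  assumes "norm x \<le> r"
  shows "min_time F G x = ereal (T x)"
proof -
  have "min_time F G x \<le> ereal (norm (0 - x) / c + 0)"
    using r by (intro min_time_le min_time_segment assms steers_zero) simp
  then have "min_time F G x \<noteq> \<infinity>" by auto
  then show ?thesis using min_time_nonneg[of F G x] by (cases "min_time F G x") auto
qed

lemma T_lipschitz:
  assumes "norm x \<le> r" "norm z \<le> r"
  shows "\<bar>T x - T z\<bar> \<le> 1 / c * norm (x - z)"
proof -
  have le: "T x \<le> norm (z - x) / c + T z" if "norm x \<le> r" "norm z \<le> r" for x z
  proof (rule field_le_epsilon)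
    fix d :: real assume "0 < d"
    then have "ereal (T z) < ereal (T z + d)" by simp
    then have "min_time F G z < ereal (T z + d)" by (simp only: min_time_T[OF that(2), symmetric])
    then obtain t where t: "t < T z + d" "steers_to_origin F G z t"
      unfolding min_time_def[of F G z] by (auto simp: Inf_less_iff)
    have "ereal (T x) \<le> ereal (norm (z - x) / c + t)"
      using min_time_le[OF min_time_segment[OF that t(2)]] by (simp only: min_time_T[OF that(1), symmetric])
    then show "T x \<le> norm (z - x) / c + T z + d" using t(1) by simp
  qed
  show ?thesis using le[OF assms] le[OF assms(2,1)] by (simp add: abs_le_iff norm_minus_commute)
qed

definition "Sp = 2 * (c + B * real CARD('m))"

lemma B0: "0 \<le> B" using GB[of 0] r abs_ge_zero order_trans by (metis norm_zero less_imp_le)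

lemma Sp: "0 < Sp" using c B0 by (simp add: Sp_def add_pos_nonneg)

lemma speed:
  assumes x: "norm x \<le> r" and u: "\<And>j. u $ j \<in> {-1..1}"
  shows "norm (F x + G x *v u) \<le> Sp"
proof -
  have "(\<Sum>j\<in>UNIV. \<bar>u $ j\<bar>) \<le> (\<Sum>j\<in>(UNIV::'m set). 1)"
    using u by (intro sum_mono) (auto simp: mem_Icc_abs simp del: atLeastAtMost_iff)
  then have "B * (\<Sum>j\<in>UNIV. \<bar>u $ j\<bar>) \<le> B * real CARD('m)" using B0 by (intro mult_left_mono) auto
  then have "\<bar>(F x + G x *v u) $ i\<bar> \<le> c + B * real CARD('m)" for i
    using abs_component_mult_vec[where S = "G x" and i = i and u = u and B = B, OF GB[OF x]] FB[OF x, of i] by simp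
  from this[of 1] this[of 2] show ?thesis
    using norm_le_l1_cart[of "F x + G x *v u"] by (simp add: UNIV_2 Sp_def)
qed

text \<open>Finite propagation speed. The bound \<open>Sp\<close> holds only in the ball, so the
  trajectory is followed from the last time its norm equals the smaller of \<open>norm x\<close> and
  \<open>r\<close>.\<close>

lemma reach_set_ball: "reach_set F G (r / (4 * Sp)) \<subseteq> ball 0 (r / 2)"
proof
  fix x assume "x \<in> reach_set F G (r / (4 * Sp))"
  moreover have "r / (4 * Sp) < r / (2 * Sp)" using r Sp by (simp add: field_simps)
  ultimately have "min_time F G x < ereal (r / (2 * Sp))"
    unfolding reach_set_def by (auto elim: le_less_trans)
  then obtain t where t: "t < r / (2 * Sp)" "steers_to_origin F G x t"
    unfolding min_time_def by (auto simp: Inf_less_iff)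
  obtain u y where t0: "0 \<le> t" and u: "admissible_control u" and y: "continuous_on {0..t} y" "y 0 = x" "y t = 0"
    and I: "\<forall>s\<in>{0..t}. ((\<lambda>\<tau>. F (y \<tau>) + G (y \<tau>) *v u \<tau>) has_integral (y s - x)) {0..s}"
    using t(2) unfolding steers_to_origin_def by blast
  define \<rho> where "\<rho> = min (norm x) r"
  have yn: "continuous_on {0..t} (\<lambda>s. norm (y s))" by (intro continuous_intros y)
  obtain s where s: "0 \<le> s" "s \<le> t" "norm (y s) = \<rho>" "\<And>q. s \<le> q \<Longrightarrow> q \<le> t \<Longrightarrow> norm (y q) \<le> \<rho>"
    by (rule last_hit[OF yn t0, of \<rho>]) (use y r in \<open>auto simp: \<rho>_def\<close>)
  have "norm (y t - y s) \<le> Sp * measure lborel {s..t}"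
  proof (rule has_integral_bound_real[OF _ _ steers_segment[OF I s(1,2) order_refl], of Sp "{}"])
    fix q assume q: "q \<in> {s..t} - {}"
    have "norm (y q) \<le> r" using s(4)[of q] q by (auto simp: \<rho>_def)
    then show "norm (F (y q) + G (y q) *v u q) \<le> Sp" using u by (intro speed) (auto simp: admissible_control_def)
  qed (use Sp in auto)
  then have "\<rho> \<le> Sp * (t - s)" using y(3) s by simp
  also have "\<dots> \<le> Sp * t" using Sp s by (intro mult_left_mono) auto
  also have "\<dots> < Sp * (r / (2 * Sp))" using t(1) Sp by (intro mult_strict_left_mono) auto
  also have "\<dots> = r / 2" using Sp by simp
  finally show "x \<in> ball 0 (r / 2)" using r by (auto simp: \<rho>_def min_def split: if_splits)
qed

lemma SBV_near_origin: "SBV_loc (interior (reach_set F G (r / (4 * Sp)))) T"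
  unfolding SBV_loc_def
proof (intro allI impI, elim conjE)
  fix V assume V: "open V" "closure V \<subseteq> interior (reach_set F G (r / (4 * Sp)))"
  have "V \<subseteq> ball 0 (r / 2)" using V(2) closure_subset[of V] interior_subset reach_set_ball by blast
  then show "SBV_on V T" using V(1) c r by (intro SBV_on_lipschitz[OF T_lipschitz]) auto
qed

end

lemma independent_columns_SBV:
  fixes G0 :: "real^'m^2" and A :: "real^2^2"
  assumes det: "G0 $ 1 $ k * G0 $ 2 $ l - G0 $ 2 $ k * G0 $ 1 $ l \<noteq> 0" and L: "0 \<le> L"
  shows "\<exists>\<theta>>0. \<forall>F F' G G'. C11_vec F F' L \<and> C11_mat G G' L \<and> F 0 = 0 \<and> G 0 = G0 \<and> matrix (F' 0) = A \<and> G' 0 = (\<lambda>h. 0) \<longrightarrow>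
    SBV_loc (interior (reach_set F G \<theta>)) (\<lambda>x. real_of_ereal (min_time F G x))"
proof -
  define \<delta> where "\<delta> = \<bar>G0 $ 1 $ k * G0 $ 2 $ l - G0 $ 2 $ k * G0 $ 1 $ l\<bar>"
  have \<delta>: "0 < \<delta>" using det by (simp add: \<delta>_def)
  define B where "B = norm G0 + 1"
  have B: "1 \<le> B" by (simp add: B_def)
  have G0B: "\<bar>G0 $ i $ j\<bar> \<le> B - 1" for i j
    using component_le_norm_cart[of "G0 $ i" j] Finite_Cartesian_Product.norm_nth_le[of G0 i] by (simp add: B_def)
  \<comment> \<open>Chosen so that 4 B c is half the determinant at the origin, the half that
    survives on the ball.\<close>
  define c where "c = \<delta> / (8 * B)"
  have c: "0 < c" using \<delta> B by (simp add: c_def)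
  have Bc: "4 * B * c = \<delta> / 2" using B by (simp add: c_def)
  define \<eta> where "\<eta> = min 1 c"
  have \<eta>: "0 < \<eta>" "\<eta> \<le> 1" "\<eta> \<le> c" using c by (auto simp: \<eta>_def)
  obtain K where K: "0 < K" "\<And>x. norm (A *v x) \<le> norm x * K"
    using bounded_linear.pos_bounded[OF matrix_vector_mul_bounded_linear[of A]] by blast
  \<comment> \<open>On this ball the variation of each entry of G and the size of F are at most
    \<eta>.\<close>
  define r where "r = \<eta> / (K + 2 * L + 1)"
  have KL: "0 < K + 2 * L + 1" "1 \<le> K + 2 * L + 1" using K(1) L by auto
  have r: "0 < r" "(K + 2 * L + 1) * r = \<eta>" using \<eta> KL by (auto simp: r_def)
  have r1: "r \<le> 1" using \<eta>(1,2) KL by (simp add: r_def)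
  have rK: "K * r + 2 * L * r \<le> \<eta>" "2 * L * r \<le> \<eta>" using r K(1) mult_pos_pos[OF K(1) r(1)] by (auto simp: algebra_simps)
  define n where "n = real CARD('m)"
  define \<theta> where "\<theta> = r / (4 * (2 * (c + B * n)))"
  have \<theta>: "0 < \<theta>" using r(1) c B by (simp add: \<theta>_def n_def add_pos_nonneg)
  show ?thesis
  proof (intro exI[of _ \<theta>] conjI allI impI \<theta>, elim conjE)
    fix F :: "real^2 \<Rightarrow> real^2" and F' G G'
    assume CF: "C11_vec F F' L" and CG: "C11_mat G G' L" and F0: "F 0 = 0" and G0: "G 0 = G0" and A: "matrix (F' 0) = A" and G'0: "G' 0 = (\<lambda>h. 0)"
    have Lr: "2 * L * r * norm x \<le> 2 * L * r" if "norm x \<le> r" for x :: "real^2"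
      using that r1 L r(1) by (intro mult_left_le) auto
    have dG: "\<bar>G x $ i $ j - G0 $ i $ j\<bar> \<le> \<eta>" if x: "norm x \<le> r" for x i j
      using C11_mat_lipschitz[OF CG G'0 L x, of 0 i j] Lr[OF x] rK r(1) by (simp add: G0)
    interpret full_control F G k l r c B "\<delta> / 2"
    proof
      show "continuous_on UNIV F" "continuous_on UNIV G"
        using CF CG unfolding C11_vec_def C11_mat_def by (meson has_derivative_continuous continuous_at_imp_continuous_on)+
      show "0 < \<delta> / 2" using \<delta> by simp
      show "4 * B * c \<le> \<delta> / 2" using Bc by simp
      fix x :: "real^2" assume x: "norm x \<le> r"
      show GB: "\<bar>G x $ i $ j\<bar> \<le> B" for i j using dG[OF x, of i j] G0B[of i j] \<eta>(2) by linarith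
      have pr: "\<bar>G x $ i $ j * G x $ i' $ j' - G0 $ i $ j * G0 $ i' $ j'\<bar> \<le> 2 * B * \<eta>" for i j i' j'
      proof -
        have "G x $ i $ j * G x $ i' $ j' - G0 $ i $ j * G0 $ i' $ j' =
          G x $ i $ j * (G x $ i' $ j' - G0 $ i' $ j') + G0 $ i' $ j' * (G x $ i $ j - G0 $ i $ j)" by (simp add: algebra_simps)
        moreover have "\<bar>G x $ i $ j * (G x $ i' $ j' - G0 $ i' $ j')\<bar> \<le> B * \<eta>"
          unfolding abs_mult using GB dG[OF x] B by (intro mult_mono) auto
        moreover have "\<bar>G0 $ i' $ j' * (G x $ i $ j - G0 $ i $ j)\<bar> \<le> B * \<eta>"
          unfolding abs_mult using G0B[of i' j'] dG[OF x] B by (intro mult_mono) auto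
        ultimately show ?thesis by linarith
      qed
      \<comment> \<open>Each of the two products in the determinant changes by at most 2 B \<eta>,
        so at least half of the determinant is left.\<close>
      have "B * \<eta> \<le> B * c" using \<eta> B by (intro mult_left_mono) auto
      then have "4 * B * \<eta> \<le> \<delta> / 2" using Bc by simp
      with pr[of 1 k 2 l] pr[of 2 k 1 l]
      show "\<delta> / 2 \<le> \<bar>G x $ 1 $ k * G x $ 2 $ l - G x $ 2 $ k * G x $ 1 $ l\<bar>" unfolding \<delta>_def by argo
      show "\<bar>F x $ i\<bar> \<le> c" for i
      proof -
        have "\<bar>(A *v x) $ i\<bar> \<le> norm x * K" using component_le_norm_cart[of "A *v x" i] K(2)[of x] by linarith
        also have "\<dots> \<le> r * K" using x K(1) by (intro mult_right_mono) auto
        finally have "\<bar>(A *v x) $ i\<bar> \<le> K * r" by (simp add: mult.commute)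
        moreover have "\<bar>F x $ i - (A *v x) $ i\<bar> \<le> 2 * L * r"
          using C11_vec_remainder_lipschitz[OF CF L x, of 0 i] Lr[OF x] r(1) by (simp add: F0 A)
        ultimately show ?thesis using rK(1) \<eta>(3) by linarith
      qed
    qed (use r c in auto)
    show "SBV_loc (interior (reach_set F G \<theta>)) (\<lambda>x. real_of_ereal (min_time F G x))"
      using SBV_near_origin unfolding Sp_def \<theta>_def n_def .
  qed
qed

section \<open>Case distinction on the columns and the uniform time\<close>

lemma bracket_rank_det:
  assumes "rank (bracket_matrix G0 A k) = 2"
  shows "column k G0 $ 1 * (A *v column k G0) $ 2 - column k G0 $ 2 * (A *v column k G0) $ 1 \<noteq> 0"
proof -
  have "inj (\<lambda>h. bracket_matrix G0 A k *v h)" using assms full_rank_injective[of "bracket_matrix G0 A k"] by simp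
  then have "det (bracket_matrix G0 A k) \<noteq> 0"
    by (simp only: invertible_det_nz[symmetric] invertible_left_inverse matrix_left_invertible_injective)
  then show ?thesis by (simp add: det_2 bracket_matrix_def algebra_simps)
qed

lemma parallel_if_det_zero:
  fixes g w :: "real^2"
  assumes "g $ 1 * w $ 2 - g $ 2 * w $ 1 = 0" "g \<noteq> 0"
  shows "\<exists>c. w = c *\<^sub>R g"
proof (cases "g $ 1 = 0")
  case True
  then have "g $ 2 \<noteq> 0" using assms(2) by (auto simp: vec_eq_iff forall_2)
  then show ?thesis using True assms(1) by (intro exI[of _ "w $ 2 / g $ 2"]) (auto simp: vec_eq_iff forall_2)
next
  case False
  then show ?thesis using assms(1) by (intro exI[of _ "w $ 1 / g $ 1"]) (auto simp: vec_eq_iff forall_2 field_simps)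
qed

lemma uniform_SBV_time:
  fixes G0 :: "real^'m^2" and A :: "real^2^2"
  shows "\<exists>\<theta>>0. \<forall>F F' G G'. C11_vec F F' L \<and> C11_mat G G' L \<and> F 0 = 0 \<and> G 0 = G0 \<and> matrix (F' 0) = A \<and>
    (\<forall>k. rank (bracket_matrix G0 A k) = 2) \<and> G' 0 = (\<lambda>h. 0) \<longrightarrow>
    SBV_loc (interior (reach_set F G \<theta>)) (\<lambda>x. real_of_ereal (min_time F G x))"
proof (cases "0 \<le> L \<and> (\<forall>k. rank (bracket_matrix G0 A k) = 2)")
  case False
  \<comment> \<open>In the excluded cases the premises cannot hold: the Lipschitz condition forces L
    to be nonnegative.\<close>
  have "0 \<le> L" if "C11_vec F F' L" for F :: "real^2 \<Rightarrow> real^2" and F'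
  proof -
    have "\<bar>F' (axis 1 1) (axis 1 1) $ 1 - F' 0 (axis 1 1) $ 1\<bar> \<le> L * dist (axis 1 1 :: real^2) 0"
      using that unfolding C11_vec_def by blast
    then have "\<bar>F' (axis 1 1) (axis 1 1) $ 1 - F' 0 (axis 1 1) $ 1\<bar> \<le> L" by (simp add: norm_axis_1)
    then show ?thesis by linarith
  qed
  with False show ?thesis by (intro exI[of _ 1]) auto
next
  case True
  then have L: "0 \<le> L" and rk: "\<And>k. rank (bracket_matrix G0 A k) = 2" by auto
  note dt = bracket_rank_det[OF rk]
  have nz: "column k G0 \<noteq> 0" for k using dt[of k] by auto
  show ?thesis
  proof (cases "\<exists>k l. G0 $ 1 $ k * G0 $ 2 $ l - G0 $ 2 $ k * G0 $ 1 $ l \<noteq> 0")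
    case True
    then obtain k l where "G0 $ 1 $ k * G0 $ 2 $ l - G0 $ 2 $ k * G0 $ 1 $ l \<noteq> 0" by blast
    from independent_columns_SBV[OF this L, of A] show ?thesis by meson
  next
    case False
    \<comment> \<open>An arbitrary index; all columns are nonzero by the rank condition, so any of
      them can serve as the common direction.\<close>
    define k0 where "k0 = (undefined :: 'm)"
    have "\<exists>c. column k G0 = c *\<^sub>R column k0 G0" for k
    proof (rule parallel_if_det_zero[OF _ nz])
      show "column k0 G0 $ 1 * column k G0 $ 2 - column k0 G0 $ 2 * column k G0 $ 1 = 0" using False by (simp add: column_def)
    qed
    then obtain c where c: "\<And>k. column k G0 = c k *\<^sub>R column k0 G0" by metis
    have c0: "c k \<noteq> 0" for k using c[of k] nz[of k] by auto
    obtain e where e: "0 < e" and S: "\<forall>F F' G G'. C11_vec F F' L \<and> C11_mat G G' L \<and> F 0 = 0 \<and> G 0 = G0 \<and> matrix (F' 0) = A \<and> G' 0 = (\<lambda>h. 0) \<longrightarrow>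
      (\<exists>r1 r2 v um up u0 \<gamma> \<gamma>d E1 E2 P1 P2. scaled r1 r2 v um up u0 \<gamma> \<gamma>d E1 E2 P1 P2 F G e)"
      using parallel_columns_scaled[OF c c0 dt L] by blast
    show ?thesis
    proof (intro exI[of _ "e * (1/72000000)"] conjI allI impI)
      show "0 < e * (1/72000000)" using e by simp
      fix F :: "real^2 \<Rightarrow> real^2" and F' G G'
      assume H: "C11_vec F F' L \<and> C11_mat G G' L \<and> F 0 = 0 \<and> G 0 = G0 \<and> matrix (F' 0) = A \<and>
        (\<forall>k. rank (bracket_matrix G0 A k) = 2) \<and> G' 0 = (\<lambda>h. 0)"
      then have "\<exists>r1 r2 v um up u0 \<gamma> \<gamma>d E1 E2 P1 P2. scaled r1 r2 v um up u0 \<gamma> \<gamma>d E1 E2 P1 P2 F G e"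
        by (intro S[rule_format, of F F' G G']) auto
      then show "SBV_loc (interior (reach_set F G (e * (1/72000000)))) (\<lambda>x. real_of_ereal (min_time F G x))"
        by (elim exE) (rule scaled.SBV_near_origin)
    qed
  qed
qed

theorem theorem6p7:
  assumes M: "CARD('m) \<in> {1, 2}"
  shows "\<exists>\<Theta> :: real^'m^2 \<Rightarrow> real^2^2 \<Rightarrow> real \<Rightarrow> real.
           (\<forall>G0 A L. \<Theta> G0 A L > 0) \<and>
           (\<forall>(F :: real^2 \<Rightarrow> real^2) F' (G :: real^2 \<Rightarrow> real^'m^2) G' L.
              C11_vec F F' L \<and> C11_mat G G' L \<and>
              F 0 = 0 \<and>
              (\<forall>k. rank (bracket_matrix (G 0) (matrix (F' 0)) k) = 2) \<and>
              G' 0 = (\<lambda>h. 0)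
              \<longrightarrow> SBV_loc (interior (reach_set F G (\<Theta> (G 0) (matrix (F' 0)) L)))
                     (\<lambda>x. real_of_ereal (min_time F G x)))"
proof -
  define ok where "ok G0 A L \<theta> \<longleftrightarrow> 0 < \<theta> \<and> (\<forall>(F :: real^2 \<Rightarrow> real^2) F' (G :: real^2 \<Rightarrow> real^'m^2) G'.
    C11_vec F F' L \<and> C11_mat G G' L \<and> F 0 = 0 \<and> G 0 = G0 \<and> matrix (F' 0) = A \<and>
    (\<forall>k. rank (bracket_matrix G0 A k) = 2) \<and> G' 0 = (\<lambda>h. 0) \<longrightarrow>
    SBV_loc (interior (reach_set F G \<theta>)) (\<lambda>x. real_of_ereal (min_time F G x)))" for G0 A L \<theta>
  \<comment> \<open>In \<open>ok\<close> the time is fixed before F and G are quantified, so a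
    choice per triple (G0, A, L) expresses the claimed dependence.\<close>
  define \<Theta> where "\<Theta> G0 A L = (SOME \<theta>. ok G0 A L \<theta>)" for G0 A L
  have ok: "ok G0 A L (\<Theta> G0 A L)" for G0 A L
    unfolding \<Theta>_def by (rule someI_ex) (use uniform_SBV_time[of L G0 A] in \<open>simp only: ok_def\<close>)
  show ?thesis
  proof (intro exI[of _ \<Theta>] conjI allI impI)
    show "0 < \<Theta> G0 A L" for G0 A L using ok unfolding ok_def by blast
    fix F :: "real^2 \<Rightarrow> real^2" and F' and G :: "real^2 \<Rightarrow> real^'m^2" and G' L
    assume "C11_vec F F' L \<and> C11_mat G G' L \<and> F 0 = 0 \<and>
      (\<forall>k. rank (bracket_matrix (G 0) (matrix (F' 0)) k) = 2) \<and> G' 0 = (\<lambda>h. 0)"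
    then show "SBV_loc (interior (reach_set F G (\<Theta> (G 0) (matrix (F' 0)) L))) (\<lambda>x. real_of_ereal (min_time F G x))"
      by (intro ok[of "G 0" "matrix (F' 0)" L, unfolded ok_def, THEN conjunct2, rule_format, of F F' G G']) auto
  qed
qed

end
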